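(* Let $\mathfrak M$ be an R-semiregular weight matrix satisfying (a) for every $\mathbf M\in\mathfrak M$ there exist $\mathbf N\in\mathfrak M$ and $C>0$ with $M_{j+k}\le C^{j+k}N_jN_k$ for all $j,k\in\mathbb N$, and (b) for every $\mathbf M\in\mathfrak M$ there exist $\mathbf N\in\mathfrak M$ and $C>0$ such that for all $k\in\mathbb N$, $\max m_jm_{\alpha_1}\cdots m_{\alpha_j}\le C^{k+1}n_k$, the maximum taken over all $j$ and all $\alpha_1,\dots,\alpha_j>0$ with $\alpha_1+\dots+\alpha_j=k$. Let $\Omega\subseteq\mathbb R^n$ be open and $P(x,D)=\sum_{|\alpha|\le m}a_\alpha(x)D^\alpha$ a linear partial differential operator with coefficients $a_\alpha\in\mathcal E^{\{\mathfrak M\}}(\Omega)$. Then: (1) If $\mathfrak L$ is an R-semiregular weight matrix with $\mathfrak M\{\preceq\}\mathfrak L$, then $\mathrm{WF}_{\{\mathfrak L\}}u\subseteq\mathrm{WF}_{\{\mathfrak L\}}Pu\cup\mathrm{Char}\,P$ for all $u\in\mathcal D'(\Omega)$; if $P$ is elliptic, then $\mathrm{WF}_{\{\mathfrak L\}}u=\mathrm{WF}_{\{\mathfrak L\}}Pu$. (2) If $\mathfrak L$ is a B-semiregular weight matrix with $\mathfrak M\{\lhd)\mathfrak L$, then $\mathrm{WF}_{(\mathfrak L)}u\subseteq\mathrm{WF}_{(\mathfrak L)}Pu\cup\mathrm{Char}\,P$ for all $u\in\mathcal D'(\Omega)$; if $P$ is elliptic, then $\mathrm{WF}_{(\mathfrak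 L)}u=\mathrm{WF}_{(\mathfrak L)}Pu$.
   Context: $D^\alpha=(-i)^{|\alpha|}\partial^\alpha$. A weight sequence is $\mathbf M=(M_k)$ with $M_0=1$, $\mu_k:=M_k/M_{k-1}$ satisfying $1\le\mu_1\le\mu_2\le\cdots$, $M_k^{1/k}\to\infty$; $m_k=M_k/k!$, $n_k=N_k/k!$. A weight matrix is a pointwise totally ordered family of weight sequences. R-semiregular: $m_k^{1/k}\to\infty$ for all members and $\forall\mathbf M\,\exists\mathbf N\,\exists C\ge1\,\forall j:M_{j+1}\le C^{j+1}N_j$. B-semiregular: $m_k^{1/k}\to\infty$ for all members and $\forall\mathbf M\,\exists\mathbf N\,\exists C\ge1\,\forall j:N_{j+1}\le C^jM_j$. $\mathfrak M\{\preceq\}\mathfrak L$: for each $\mathbf M\in\mathfrak M$ there is $\mathbf L\in\mathfrak L$ with $M_k^{1/k}/L_k^{1/k}$ bounded. $\mathfrak M\{\lhd)\mathfrak L$: for all $\mathbf M\in\mathfrak M$, $\mathbf L\in\mathfrak L$, $M_k^{1/k}/L_k^{1/k}\to0$. $\mathcal E^{\{\mathfrak M\}}(\Omega)$: $f\in C^\infty(\Omega)$ such that for each relatively compact open $V\subseteq\Omega$ there are $\mathbf M\in\mathfrak M$, $\rho>0$ with $\sup_{x\in V,\alpha}|\partial^\alpha f(x)|/(\rho^{|\alpha|}M_{|\alpha|})<\infty$. Wave front set: $u$ is microlocally of class $\{\mathfrak L\}$ at $(x_0,\xi_0)\in T^*\Omega\setminus\{0\}$ if there exist a neighborhood $V$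 of $x_0$, an open conic neighborhood $\Gamma$ of $\xi_0$, a bounded $(u_N)\subseteq\mathcal E'(\Omega)$ with $u_N|_V=u|_V$, and $\mathbf L\in\mathfrak L$, $Q>0$ with $\sup_{\xi\in\Gamma,N}|\xi|^N|\widehat{u}_N(\xi)|/(Q^NL_N)<\infty$; of class $(\mathfrak L)$ if such $V,\Gamma,(u_N)$ exist with this finite for all $\mathbf L\in\mathfrak L$, $Q>0$. $\mathrm{WF}_{[\mathfrak L]}u$ is the set where $u$ is not microlocally of class $[\mathfrak L]$. $\mathrm{Char}\,P=\{(x,\xi)\in T^*\Omega\setminus\{0\}:P_m(x,\xi)=0\}$, $P_m(x,\xi)=\sum_{|\alpha|=m}a_\alpha(x)\xi^\alpha$; $P$ elliptic means $\mathrm{Char}\,P=\emptyset$. *)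

theory Defs
  imports "HOL-Analysis.Analysis"
begin

definition weight_seq :: "(nat \<Rightarrow> real) \<Rightarrow> bool" where
  "weight_seq M \<longleftrightarrow> M 0 = 1 \<and> (\<forall>k. M k > 0) \<and>
     1 \<le> M 1 / M 0 \<and> (\<forall>k\<ge>1. M k / M (k - 1) \<le> M (k + 1) / M k) \<and>
     filterlim (\<lambda>k. root k (M k)) at_top sequentially"

definition weight_matrix :: "(nat \<Rightarrow> real) set \<Rightarrow> bool" where
  "weight_matrix MM \<longleftrightarrow> MM \<noteq> {} \<and> (\<forall>M\<in>MM. weight_seq M) \<and>
     (\<forall>M\<in>MM. \<forall>N\<in>MM. (\<forall>k. M k \<le> N k) \<or> (\<forall>k. N k \<le> M k))"

definition R_semiregular :: "(nat \<Rightarrow> real) set \<Rightarrow> bool" where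
  "R_semiregular MM \<longleftrightarrow>
     (\<forall>M\<in>MM. filterlim (\<lambda>k. root k (M k / fact k)) at_top sequentially) \<and>
     (\<forall>M\<in>MM. \<exists>N\<in>MM. \<exists>C\<ge>1. \<forall>j. M (j + 1) \<le> C ^ (j + 1) * N j)"

definition B_semiregular :: "(nat \<Rightarrow> real) set \<Rightarrow> bool" where
  "B_semiregular MM \<longleftrightarrow>
     (\<forall>M\<in>MM. filterlim (\<lambda>k. root k (M k / fact k)) at_top sequentially) \<and>
     (\<forall>M\<in>MM. \<exists>N\<in>MM. \<exists>C\<ge>1. \<forall>j. N (j + 1) \<le> C ^ j * M j)"

definition R_preceq :: "(nat \<Rightarrow> real) set \<Rightarrow> (nat \<Rightarrow> real) set \<Rightarrow> bool" where
  "R_preceq MM LL \<longleftrightarrow>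
     (\<forall>M\<in>MM. \<exists>L\<in>LL. \<exists>C. \<forall>k. root k (M k) / root k (L k) \<le> C)"

definition B_lhd :: "(nat \<Rightarrow> real) set \<Rightarrow> (nat \<Rightarrow> real) set \<Rightarrow> bool" where
  "B_lhd MM LL \<longleftrightarrow>
     (\<forall>M\<in>MM. \<forall>L\<in>LL. (\<lambda>k. root k (M k) / root k (L k)) \<longlonglongrightarrow> 0)"

definition mi_abs :: "('n::finite \<Rightarrow> nat) \<Rightarrow> nat" where
  "mi_abs \<alpha> = (\<Sum>i\<in>UNIV. \<alpha> i)"

definition partial :: "'n::finite \<Rightarrow> (real^'n \<Rightarrow> complex) \<Rightarrow> real^'n \<Rightarrow> complex" where
  "partial i f = (\<lambda>x. vector_derivative (\<lambda>t. f (x + t *\<^sub>R axis i 1)) (at 0))"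

fun pdiff_list :: "'n::finite list \<Rightarrow> (real^'n \<Rightarrow> complex) \<Rightarrow> real^'n \<Rightarrow> complex" where
  "pdiff_list [] f = f"
| "pdiff_list (i # is) f = partial i (pdiff_list is f)"

text \<open>The derivative \<open>\<partial>^\<alpha>\<close> (order of differentiation irrelevant for smooth functions).\<close>
definition pdiff :: "('n::finite \<Rightarrow> nat) \<Rightarrow> (real^'n \<Rightarrow> complex) \<Rightarrow> real^'n \<Rightarrow> complex" where
  "pdiff \<alpha> f = pdiff_list (SOME is. \<forall>i. count_list is i = \<alpha> i) f"

definition smooth_on :: "(real^'n::finite) set \<Rightarrow> (real^'n \<Rightarrow> complex) \<Rightarrow> bool" where
  "smooth_on \<Omega> f \<longleftrightarrow>
     (\<forall>is. continuous_on \<Omega> (pdiff_list is f) \<and>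
        (\<forall>x\<in>\<Omega>. \<forall>i. ((\<lambda>t. pdiff_list is f (x + t *\<^sub>R axis i 1))
                      has_vector_derivative pdiff_list (i # is) f x) (at 0)))"

definition tsupport :: "(real^'n::finite \<Rightarrow> complex) \<Rightarrow> (real^'n) set" where
  "tsupport f = closure {x. f x \<noteq> 0}"

definition test_fun :: "(real^'n::finite) set \<Rightarrow> (real^'n \<Rightarrow> complex) \<Rightarrow> bool" where
  "test_fun \<Omega> \<phi> \<longleftrightarrow> smooth_on UNIV \<phi> \<and> compact (tsupport \<phi>) \<and> tsupport \<phi> \<subseteq> \<Omega>"

definition E_roumieu :: "(nat \<Rightarrow> real) set \<Rightarrow> (real^'n::finite) set \<Rightarrow> (real^'n \<Rightarrow> complex) \<Rightarrow> bool" where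
  "E_roumieu MM \<Omega> f \<longleftrightarrow> smooth_on \<Omega> f \<and>
     (\<forall>V. open V \<and> compact (closure V) \<and> closure V \<subseteq> \<Omega> \<longrightarrow>
        (\<exists>M\<in>MM. \<exists>\<rho>>0. \<exists>C. \<forall>x\<in>V. \<forall>\<alpha>.
            norm (pdiff \<alpha> f x) \<le> C * \<rho> ^ mi_abs \<alpha> * M (mi_abs \<alpha>)))"

text \<open>Distributions are represented as functionals on functions \<open>real^'n \<Rightarrow> complex\<close>;
  only their values on test functions of \<Omega> matter.\<close>
definition distribution :: "(real^'n::finite) set \<Rightarrow> ((real^'n \<Rightarrow> complex) \<Rightarrow> complex) \<Rightarrow> bool" where
  "distribution \<Omega> u \<longleftrightarrow>
     (\<forall>\<phi> \<psi> a b. test_fun \<Omega> \<phi> \<longrightarrow> test_fun \<Omega> \<psi> \<longrightarrow>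
        u (\<lambda>x. a * \<phi> x + b * \<psi> x) = a * u \<phi> + b * u \<psi>) \<and>
     (\<forall>K. compact K \<and> K \<subseteq> \<Omega> \<longrightarrow> (\<exists>C k. \<forall>\<phi> B. test_fun \<Omega> \<phi> \<longrightarrow> tsupport \<phi> \<subseteq> K \<longrightarrow>
        (\<forall>\<alpha>. mi_abs \<alpha> \<le> k \<longrightarrow> (\<forall>x. norm (pdiff \<alpha> \<phi> x) \<le> B)) \<longrightarrow> norm (u \<phi>) \<le> C * B))"

definition E_prime :: "(real^'n::finite) set \<Rightarrow> ((real^'n \<Rightarrow> complex) \<Rightarrow> complex) \<Rightarrow> bool" where
  "E_prime \<Omega> v \<longleftrightarrow>
     (\<forall>\<phi> \<psi> a b. smooth_on \<Omega> \<phi> \<longrightarrow> smooth_on \<Omega> \<psi> \<longrightarrow>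
        v (\<lambda>x. a * \<phi> x + b * \<psi> x) = a * v \<phi> + b * v \<psi>) \<and>
     (\<exists>K C k. compact K \<and> K \<subseteq> \<Omega> \<and> (\<forall>\<phi> B. smooth_on \<Omega> \<phi> \<longrightarrow>
        (\<forall>\<alpha>. mi_abs \<alpha> \<le> k \<longrightarrow> (\<forall>x\<in>K. norm (pdiff \<alpha> \<phi> x) \<le> B)) \<longrightarrow> norm (v \<phi>) \<le> C * B))"

definition bounded_E :: "(real^'n::finite) set \<Rightarrow> (real^'n \<Rightarrow> complex) set \<Rightarrow> bool" where
  "bounded_E \<Omega> S \<longleftrightarrow> (\<forall>\<phi>\<in>S. smooth_on \<Omega> \<phi>) \<and>
     (\<forall>K \<alpha>. compact K \<and> K \<subseteq> \<Omega> \<longrightarrow> (\<exists>c. \<forall>\<phi>\<in>S. \<forall>x\<in>K. norm (pdiff \<alpha> \<phi> x) \<le> c))"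

definition bounded_E_prime_seq :: "(real^'n::finite) set \<Rightarrow> (nat \<Rightarrow> (real^'n \<Rightarrow> complex) \<Rightarrow> complex) \<Rightarrow> bool" where
  "bounded_E_prime_seq \<Omega> us \<longleftrightarrow> (\<forall>N. E_prime \<Omega> (us N)) \<and>
     (\<forall>S. bounded_E \<Omega> S \<longrightarrow> (\<exists>c. \<forall>N. \<forall>\<phi>\<in>S. norm (us N \<phi>) \<le> c))"

definition fourier :: "((real^'n::finite \<Rightarrow> complex) \<Rightarrow> complex) \<Rightarrow> real^'n \<Rightarrow> complex" where
  "fourier v \<xi> = v (\<lambda>x. cis (- (x \<bullet> \<xi>)))"

definition open_cone :: "(real^'n::finite) set \<Rightarrow> bool" where
  "open_cone \<Gamma> \<longleftrightarrow> open \<Gamma> \<and> 0 \<notin> \<Gamma> \<and> (\<forall>\<xi>\<in>\<Gamma>. \<forall>t>0. t *\<^sub>R \<xi> \<in> \<Gamma>)"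

definition micro_roumieu :: "(nat \<Rightarrow> real) set \<Rightarrow> (real^'n::finite) set \<Rightarrow>
    ((real^'n \<Rightarrow> complex) \<Rightarrow> complex) \<Rightarrow> real^'n \<Rightarrow> real^'n \<Rightarrow> bool" where
  "micro_roumieu LL \<Omega> u x0 \<xi>0 \<longleftrightarrow>
     (\<exists>V \<Gamma> us. open V \<and> x0 \<in> V \<and> V \<subseteq> \<Omega> \<and> open_cone \<Gamma> \<and> \<xi>0 \<in> \<Gamma> \<and>
        bounded_E_prime_seq \<Omega> us \<and> (\<forall>N \<phi>. test_fun V \<phi> \<longrightarrow> us N \<phi> = u \<phi>) \<and>
        (\<exists>L\<in>LL. \<exists>Q>0. \<exists>C. \<forall>\<xi>\<in>\<Gamma>. \<forall>N.
            norm \<xi> ^ N * norm (fourier (us N) \<xi>) \<le> C * Q ^ N * L N))"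

definition micro_beurling :: "(nat \<Rightarrow> real) set \<Rightarrow> (real^'n::finite) set \<Rightarrow>
    ((real^'n \<Rightarrow> complex) \<Rightarrow> complex) \<Rightarrow> real^'n \<Rightarrow> real^'n \<Rightarrow> bool" where
  "micro_beurling LL \<Omega> u x0 \<xi>0 \<longleftrightarrow>
     (\<exists>V \<Gamma> us. open V \<and> x0 \<in> V \<and> V \<subseteq> \<Omega> \<and> open_cone \<Gamma> \<and> \<xi>0 \<in> \<Gamma> \<and>
        bounded_E_prime_seq \<Omega> us \<and> (\<forall>N \<phi>. test_fun V \<phi> \<longrightarrow> us N \<phi> = u \<phi>) \<and>
        (\<forall>L\<in>LL. \<forall>Q>0. \<exists>C. \<forall>\<xi>\<in>\<Gamma>. \<forall>N.
            norm \<xi> ^ N * norm (fourier (us N) \<xi>) \<le> C * Q ^ N * L N))"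

definition WF_roumieu :: "(nat \<Rightarrow> real) set \<Rightarrow> (real^'n::finite) set \<Rightarrow>
    ((real^'n \<Rightarrow> complex) \<Rightarrow> complex) \<Rightarrow> ((real^'n) \<times> (real^'n)) set" where
  "WF_roumieu LL \<Omega> u = {(x, \<xi>). x \<in> \<Omega> \<and> \<xi> \<noteq> 0 \<and> \<not> micro_roumieu LL \<Omega> u x \<xi>}"

definition WF_beurling :: "(nat \<Rightarrow> real) set \<Rightarrow> (real^'n::finite) set \<Rightarrow>
    ((real^'n \<Rightarrow> complex) \<Rightarrow> complex) \<Rightarrow> ((real^'n) \<times> (real^'n)) set" where
  "WF_beurling LL \<Omega> u = {(x, \<xi>). x \<in> \<Omega> \<and> \<xi> \<noteq> 0 \<and> \<not> micro_beurling LL \<Omega> u x \<xi>}"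

section \<open>Linear differential operators \<open>P(x,D) = \<Sum>_{|\<alpha>|\<le>m} a_\<alpha>(x) D^\<alpha>\<close>, \<open>D^\<alpha> = (-i)^{|\<alpha>|} \<partial>^\<alpha>\<close>\<close>

text \<open>Action on distributions by transposition:
  \<open>\<langle>Pu,\<phi>\<rangle> = \<langle>u, \<Sum>_\<alpha> (-D)^\<alpha>(a_\<alpha> \<phi>)\<rangle>\<close>, and \<open>(-D)^\<alpha> = i^{|\<alpha>|} \<partial>^\<alpha>\<close>.\<close>
definition apply_op :: "(('n::finite \<Rightarrow> nat) \<Rightarrow> real^'n \<Rightarrow> complex) \<Rightarrow> nat \<Rightarrow>
    ((real^'n \<Rightarrow> complex) \<Rightarrow> complex) \<Rightarrow> (real^'n \<Rightarrow> complex) \<Rightarrow> complex" where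
  "apply_op a m u = (\<lambda>\<phi>. u (\<lambda>x. \<Sum>\<alpha>\<in>{\<alpha>. mi_abs \<alpha> \<le> m}.
       \<i> ^ mi_abs \<alpha> * pdiff \<alpha> (\<lambda>y. a \<alpha> y * \<phi> y) x))"

definition principal_symbol :: "(('n::finite \<Rightarrow> nat) \<Rightarrow> real^'n \<Rightarrow> complex) \<Rightarrow> nat \<Rightarrow>
    real^'n \<Rightarrow> real^'n \<Rightarrow> complex" where
  "principal_symbol a m x \<xi> = (\<Sum>\<alpha>\<in>{\<alpha>. mi_abs \<alpha> = m}.
       a \<alpha> x * (\<Prod>i\<in>UNIV. complex_of_real (\<xi> $ i) ^ \<alpha> i))"

definition Char :: "(real^'n::finite) set \<Rightarrow> (('n \<Rightarrow> nat) \<Rightarrow> real^'n \<Rightarrow> complex) \<Rightarrow> nat \<Rightarrow>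
    ((real^'n) \<times> (real^'n)) set" where
  "Char \<Omega> a m = {(x, \<xi>). x \<in> \<Omega> \<and> \<xi> \<noteq> 0 \<and> principal_symbol a m x \<xi> = 0}"

definition elliptic :: "(real^'n::finite) set \<Rightarrow> (('n \<Rightarrow> nat) \<Rightarrow> real^'n \<Rightarrow> complex) \<Rightarrow> nat \<Rightarrow> bool" where
  "elliptic \<Omega> a m \<longleftrightarrow> Char \<Omega> a m = {}"

end

theory Submission
  imports Defs "HOL-Complex_Analysis.Great_Picard"
begin

text \<open>
  Let \<open>\<phi>_r\<close> be cutoffs around \<open>x0\<close> with derivatives up to order \<open>r\<close> bounded by \<open>E^r \<rho>^l l!\<close>, and let
  \<open>\<tau> = |\<xi>|\<close>, \<open>\<theta> = \<xi> / \<tau>\<close>. Applied to \<open>e^{-i x \<xi>} v\<close>, the transpose of \<open>P\<close> gives \<open>\<tau>^m e^{-i x \<xi>} L v\<close>, where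
  \<open>L v = P_m(x, \<theta>) v + O(1 / \<tau>)\<close>. Near a noncharacteristic point put \<open>q = 1 / P_m(x, \<theta>)\<close> and
  \<open>R v = v - L (q v)\<close>. The Neumann series \<open>\<phi>_r = R^\<nu> \<phi>_r + \<Sum>_{k<\<nu>} L (q R^k \<phi>_r)\<close> then expresses the Fourier
  transform of \<open>\<phi>_r u\<close> by pairings of \<open>P u\<close> with \<open>e^{-i x \<xi>} q R^k \<phi>_r\<close> and a remainder of size
  \<open>\<tau>^{-\<nu>} N_\<nu>\<close>. Expanding the amplitudes into Fourier series turns decay of the transforms of the
  sequence \<open>f_\<nu>\<close> belonging to \<open>P u\<close> in a cone into estimates for these pairings.

  Condition (b) makes the weights stable under products and inversion, so that \<open>q\<close> and \<open>R^k \<phi>_r\<close> are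
  controlled; condition (a) separates the up to \<open>m \<nu>\<close> derivatives falling on them, which are paid for
  by powers of \<open>1 / \<tau>\<close> as long as \<open>N_\<nu> \<le> \<tau>^\<nu>\<close>. If \<open>N_\<nu> > \<tau>^\<nu>\<close>, the
  polynomial growth of the transform already suffices. The resulting estimate, with \<open>N\<close> in the matrix of the coefficients,
  does not involve the second matrix; the Roumieu and the Beurling statement both follow from it.
  The same estimate with \<open>L \<phi>_r\<close> in place of the series gives the inclusion for \<open>P u\<close> in terms of \<open>u\<close>.
\<close>

section \<open>Calculus of iterated partial derivatives\<close>

text \<open>Nonzero cutoffs of compact support cannot satisfy factorial bounds at all orders. Each
  order r therefore has its own cutoff, controlled up to r only, and every bound records how many
  derivatives are still available (the index \<open>R\<close> of \<open>bdp\<close>). A Neumann step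
  may lose m derivatives but gains only one certain factor 1 / \<tau>. This suffices because every
  derivative beyond the l requested ones can be charged to a factor 1 / \<tau> of its own. The
  window sums \<open>Wsum\<close> keep this account: the lower end counts certain factors, the upper
  end derivatives spent. The transferred estimate is linear in a free bound A for the given
  transforms and loses a fixed number s of orders; semiregularity of the second matrix pays for s.
  Derivatives are iterated along lists of coordinates, and smoothness does not presuppose symmetry
  of mixed derivatives. Symmetry comes out of the Fourier series, whose coefficients are limits of
  finite sums, so that no multiple integrals enter.\<close>

definition has_dir :: "'n::finite \<Rightarrow> (real^'n \<Rightarrow> complex) \<Rightarrow> complex \<Rightarrow> real^'n \<Rightarrow> bool" where
  "has_dir i f d x \<longleftrightarrow> ((\<lambda>t. f (x + t *\<^sub>R axis i 1)) has_vector_derivative d) (at 0)"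

lemma partial_eqI: "has_dir i f d x \<Longrightarrow> partial i f x = d"
  unfolding has_dir_def partial_def by (rule vector_derivative_at)

lemma has_dir_cong:
  assumes "open U" "x \<in> U" "\<And>y. y \<in> U \<Longrightarrow> f y = g y" "has_dir i g d x"
  shows "has_dir i f d x"
proof -
  let ?S = "(\<lambda>t. x + t *\<^sub>R axis i 1) -` U"
  have "open ?S"
    by (intro open_vimage assms continuous_intros)
  with assms show ?thesis
    unfolding has_dir_def
    by (elim has_vector_derivative_transform_within_open[where S = ?S]) auto
qed

lemma pdiff_list_snoc: "pdiff_list (is @ [i]) f = pdiff_list is (partial i f)"
  by (induction "is") auto

lemma pdiff_list_append: "pdiff_list (is @ js) f = pdiff_list is (pdiff_list js f)"
  by (induction "is") auto

text \<open>The derivative operator is total and depends only on the germ of the function, which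
  makes this available for arbitrary functions.\<close>

lemma pdiff_list_cong:
  assumes U: "open U" and eq: "\<And>x. x \<in> U \<Longrightarrow> f x = g x" and "x \<in> U"
  shows "pdiff_list is f x = pdiff_list is g x"
  using \<open>x \<in> U\<close>
proof (induction "is" arbitrary: x)
  case (Cons i js)
  let ?S = "(\<lambda>t::real. x + t *\<^sub>R axis i 1) -` U"
  have "open ?S" "0 \<in> ?S"
    using Cons.prems by (auto intro!: open_vimage U continuous_intros)
  then have "eventually (\<lambda>t. t \<in> ?S) (nhds 0)"
    by (rule eventually_nhds_in_open)
  then have "eventually (\<lambda>t. t \<in> UNIV \<longrightarrow> pdiff_list js f (x + t *\<^sub>R axis i 1) =
      pdiff_list js g (x + t *\<^sub>R axis i 1)) (nhds 0)"
    by eventually_elim (use Cons.IH in auto)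
  then have "vector_derivative (\<lambda>t. pdiff_list js f (x + t *\<^sub>R axis i 1)) (at 0) =
      vector_derivative (\<lambda>t. pdiff_list js g (x + t *\<^sub>R axis i 1)) (at 0)"
    by (intro vector_derivative_cong_eq) auto
  then show ?case by (simp add: partial_def)
qed (use eq in auto)

lemma smooth_onD:
  assumes "smooth_on U f"
  shows "continuous_on U (pdiff_list is f)"
    and "x \<in> U \<Longrightarrow> has_dir i (pdiff_list is f) (pdiff_list (i # is) f x) x"
  using assms unfolding smooth_on_def has_dir_def by blast+

lemma smooth_on_has_dir: "smooth_on U f \<Longrightarrow> x \<in> U \<Longrightarrow> has_dir i f (partial i f x) x"
  using smooth_onD(2)[of U f x i "[]"] by simp

lemma smooth_on_continuous: "smooth_on U f \<Longrightarrow> continuous_on U f"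
  using smooth_onD(1)[of U f "[]"] by simp

lemma smooth_on_pdiff_list: "smooth_on U f \<Longrightarrow> smooth_on U (pdiff_list js f)"
  unfolding smooth_on_def by (metis pdiff_list_append append_Cons)

lemma smooth_on_partial: "smooth_on U f \<Longrightarrow> smooth_on U (partial i f)"
  using smooth_on_pdiff_list[of U f "[i]"] by simp

lemma smooth_on_subset: "smooth_on U f \<Longrightarrow> V \<subseteq> U \<Longrightarrow> smooth_on V f"
  unfolding smooth_on_def by (meson continuous_on_subset subsetD)

text \<open>Guessing all iterated derivatives at once turns smoothness and the formula for the
  derivatives into one induction along the list. Openness of \<open>U\<close> lets the equality with
  \<open>F\<close> be differentiated.\<close>

lemma smooth_onI_family:
  assumes U: "open U" and f: "\<And>x. x \<in> U \<Longrightarrow> f x = F [] x"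
    and cont: "\<And>is. continuous_on U (F is)"
    and der: "\<And>i is x. x \<in> U \<Longrightarrow> has_dir i (F is) (F (i # is) x) x"
  shows "smooth_on U f" and "x \<in> U \<Longrightarrow> pdiff_list is f x = F is x"
proof -
  have eq: "pdiff_list is f x = F is x" if "x \<in> U" for "is" x
    using that
  proof (induction "is" arbitrary: x)
    case (Cons i js)
    have "has_dir i (pdiff_list js f) (F (i # js) x) x"
      by (rule has_dir_cong[OF U Cons.prems _ der[OF Cons.prems]]) (rule Cons.IH)
    then show ?case by (simp add: partial_eqI)
  qed (use f in simp)
  then show "x \<in> U \<Longrightarrow> pdiff_list is f x = F is x" .
  have "has_dir i (pdiff_list js f) (pdiff_list (i # js) f x) x" if "x \<in> U" for i js x
    unfolding eq[OF that, of "i # js"]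
    by (rule has_dir_cong[OF U that _ der[OF that]]) (rule eq)
  moreover have "continuous_on U (pdiff_list is f)" for "is"
    using cont[of "is"] eq[of _ "is"] by (simp cong: continuous_on_cong)
  ultimately show "smooth_on U f"
    unfolding smooth_on_def has_dir_def by blast
qed

text \<open>The iterated derivatives are built along the list by choosing a member of
  \<open>X\<close> at each step. The derivative has to be correct on \<open>U\<close> only, so
  members may take any values outside.\<close>

lemma smooth_on_coinduct:
  assumes U: "open U" and X: "X f"
    and cont: "\<And>f. X f \<Longrightarrow> continuous_on U f"
    and der: "\<And>f i. X f \<Longrightarrow> \<exists>g. X g \<and> (\<forall>x\<in>U. has_dir i f (g x) x)"
  shows "smooth_on U f"
proof -
  define F where "F = rec_list f (\<lambda>i is h. SOME g. X g \<and> (\<forall>x\<in>U. has_dir i h (g x) x))"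
  have F0: "F [] = f" by (simp add: F_def)
  have FS: "F (i # is) = (SOME g. X g \<and> (\<forall>x\<in>U. has_dir i (F is) (g x) x))" for i "is"
    by (simp add: F_def)
  have XF: "X (F is)" for "is"
  proof (induction "is")
    case (Cons i js)
    then show ?case unfolding FS using someI_ex[OF der[OF Cons, of i]] by blast
  qed (simp add: F0 X)
  have "x \<in> U \<Longrightarrow> has_dir i (F is) (F (i # is) x) x" for i "is" x
    unfolding FS using someI_ex[OF der[OF XF, of i "is"]] by blast
  then show ?thesis
    by (intro smooth_onI_family(1)[OF U, of f F]) (auto simp: F0 intro: cont XF)
qed

lemma has_dir_add: "has_dir i f d x \<Longrightarrow> has_dir i g e x \<Longrightarrow> has_dir i (\<lambda>x. f x + g x) (d + e) x"
  unfolding has_dir_def by (intro derivative_intros)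

lemma has_dir_mult:
  "has_dir i f d x \<Longrightarrow> has_dir i g e x \<Longrightarrow> has_dir i (\<lambda>x. f x * g x) (d * g x + f x * e) x"
  unfolding has_dir_def by (drule (1) has_vector_derivative_mult) (simp add: add.commute)

lemma has_dir_const: "has_dir i (\<lambda>_. c) 0 x"
  unfolding has_dir_def by simp

lemma has_dir_inverse:
  assumes "has_dir i f d x" "f x \<noteq> 0"
  shows "has_dir i (\<lambda>x. inverse (f x)) (- 1 * (d * (inverse (f x) * inverse (f x)))) x"
proof -
  have "(inverse has_field_derivative - (inverse (f x) ^ 2)) (at (f (x + 0 *\<^sub>R axis i 1)))"
    using DERIV_inverse[of "f x"] assms(2) by (simp add: numeral_2_eq_2)
  from field_vector_diff_chain_at[OF assms(1)[unfolded has_dir_def] this]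
  show ?thesis unfolding has_dir_def o_def by (simp add: power2_eq_square)
qed

lemma smooth_on_const: "open U \<Longrightarrow> smooth_on U (\<lambda>_. c)"
  by (rule smooth_on_coinduct[where X = "\<lambda>f. \<exists>c. f = (\<lambda>_. c)"]) (auto intro: has_dir_const)

text \<open>This closure is the invariant class for \<open>smooth_on_coinduct\<close>: derivatives
  of products and inverses are again built from members by sums, products and inverses, so no
  formula for higher derivatives is needed.\<close>

inductive smooth_closure :: "(real^'n::finite) set \<Rightarrow> (real^'n \<Rightarrow> complex) \<Rightarrow> bool" for U where
  base: "smooth_on U f \<Longrightarrow> smooth_closure U f"
| add: "smooth_closure U f \<Longrightarrow> smooth_closure U g \<Longrightarrow> smooth_closure U (\<lambda>x. f x + g x)"
| mult: "smooth_closure U f \<Longrightarrow> smooth_closure U g \<Longrightarrow> smooth_closure U (\<lambda>x. f x * g x)"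
| inv: "smooth_closure U f \<Longrightarrow> (\<And>x. x \<in> U \<Longrightarrow> f x \<noteq> 0) \<Longrightarrow> smooth_closure U (\<lambda>x. inverse (f x))"

lemma smooth_closure_smooth_on:
  assumes U: "open U" and "smooth_closure U f"
  shows "smooth_on U f"
proof (rule smooth_on_coinduct[where X = "smooth_closure U", OF U assms(2)])
  show "continuous_on U f" if "smooth_closure U f" for f
    using that by induction (auto intro: continuous_on_add continuous_on_mult continuous_on_inverse smooth_on_continuous)
  show "\<exists>g. smooth_closure U g \<and> (\<forall>x\<in>U. has_dir i f (g x) x)" if "smooth_closure U f" for f i
    using that
  proof induction
    case (base f)
    then show ?case
      by (intro exI[of _ "partial i f"])
        (auto intro: smooth_closure.base smooth_on_partial smooth_on_has_dir)
  next
    case (add f g)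
    then obtain f' g' where "smooth_closure U f'" "\<forall>x\<in>U. has_dir i f (f' x) x"
      "smooth_closure U g'" "\<forall>x\<in>U. has_dir i g (g' x) x" by blast
    then show ?case
      by (intro exI[of _ "\<lambda>x. f' x + g' x"]) (auto intro: smooth_closure.add has_dir_add)
  next
    case (mult f g)
    then obtain f' g' where "smooth_closure U f'" "\<forall>x\<in>U. has_dir i f (f' x) x"
      "smooth_closure U g'" "\<forall>x\<in>U. has_dir i g (g' x) x" by blast
    with mult.hyps show ?case
      by (intro exI[of _ "\<lambda>x. f' x * g x + f x * g' x"])
        (auto intro: smooth_closure.add smooth_closure.mult has_dir_mult)
  next
    case (inv f)
    then obtain f' where f': "smooth_closure U f'" "\<forall>x\<in>U. has_dir i f (f' x) x" by blast
    have m: "smooth_closure U (\<lambda>_. - 1)"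
      by (intro smooth_closure.base smooth_on_const U)
    have "smooth_closure U (\<lambda>x. inverse (f x))"
      by (intro smooth_closure.inv inv)
    then have "smooth_closure U (\<lambda>x. - 1 * (f' x * (inverse (f x) * inverse (f x))))"
      by (intro smooth_closure.mult m f')
    moreover have "\<forall>x\<in>U. has_dir i (\<lambda>x. inverse (f x)) (- 1 * (f' x * (inverse (f x) * inverse (f x)))) x"
      using f' inv by (blast intro: has_dir_inverse)
    ultimately show ?case by blast
  qed
qed

lemma smooth_on_add: "open U \<Longrightarrow> smooth_on U f \<Longrightarrow> smooth_on U g \<Longrightarrow> smooth_on U (\<lambda>x. f x + g x)"
  by (rule smooth_closure_smooth_on, assumption, rule smooth_closure.add; rule smooth_closure.base)

lemma smooth_on_mult: "open U \<Longrightarrow> smooth_on U f \<Longrightarrow> smooth_on U g \<Longrightarrow> smooth_on U (\<lambda>x. f x * g x)"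
  by (rule smooth_closure_smooth_on, assumption, rule smooth_closure.mult; rule smooth_closure.base)

lemma smooth_on_inverse:
  "open U \<Longrightarrow> smooth_on U f \<Longrightarrow> (\<And>x. x \<in> U \<Longrightarrow> f x \<noteq> 0) \<Longrightarrow> smooth_on U (\<lambda>x. inverse (f x))"
  by (rule smooth_closure_smooth_on, assumption, rule smooth_closure.inv, rule smooth_closure.base)

lemma smooth_on_cmult: "open U \<Longrightarrow> smooth_on U f \<Longrightarrow> smooth_on U (\<lambda>x. c * f x)"
  by (intro smooth_on_mult smooth_on_const)

lemma smooth_on_diff:
  assumes "open U" "smooth_on U f" "smooth_on U g" shows "smooth_on U (\<lambda>x. f x - g x)"
  using smooth_on_add[OF assms(1,2) smooth_on_cmult[OF assms(1,3), of "- 1"]] by simp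

lemma smooth_on_sum:
  "open U \<Longrightarrow> (\<And>a. a \<in> A \<Longrightarrow> smooth_on U (f a)) \<Longrightarrow> smooth_on U (\<lambda>x. \<Sum>a\<in>A. f a x)"
  by (induction A rule: infinite_finite_induct) (auto intro: smooth_on_const smooth_on_add)

lemma pdiff_list_add:
  assumes U: "open U" and f: "smooth_on U f" and g: "smooth_on U g" and "x \<in> U"
  shows "pdiff_list is (\<lambda>x. f x + g x) x = pdiff_list is f x + pdiff_list is g x"
  by (rule smooth_onI_family(2)[OF U, where F = "\<lambda>is x. pdiff_list is f x + pdiff_list is g x"])
    (use assms in \<open>auto intro!: continuous_intros has_dir_add smooth_onD[OF f] smooth_onD[OF g]
      simp del: pdiff_list.simps(2)\<close>)

lemma pdiff_list_cmult:
  assumes U: "open U" and f: "smooth_on U f" and "x \<in> U"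
  shows "pdiff_list is (\<lambda>x. c * f x) x = c * pdiff_list is f x"
proof (rule smooth_onI_family(2)[OF U, where F = "\<lambda>is x. c * pdiff_list is f x"])
  show "has_dir i (\<lambda>x. c * pdiff_list js f x) (c * pdiff_list (i # js) f y) y" if "y \<in> U" for i js y
    using has_dir_mult[OF has_dir_const smooth_onD(2)[OF f that], of i c js] by simp
qed (use assms in \<open>auto intro!: continuous_intros smooth_onD[OF f]\<close>)

lemma pdiff_list_diff:
  assumes U: "open U" and f: "smooth_on U f" and g: "smooth_on U g" and x: "x \<in> U"
  shows "pdiff_list is (\<lambda>x. f x - g x) x = pdiff_list is f x - pdiff_list is g x"
  using pdiff_list_add[OF U f smooth_on_cmult[OF U g, of "- 1"] x]
    pdiff_list_cmult[OF U g x, of _ "- 1"] by simp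

lemma pdiff_list_zero: "pdiff_list is (\<lambda>_. 0) x = 0"
  using pdiff_list_cmult[OF open_UNIV smooth_on_const[OF open_UNIV, of 0], of x "is" 0] by simp

lemma pdiff_list_sum:
  assumes "open U" "\<And>a. a \<in> A \<Longrightarrow> smooth_on U (f a)" "x \<in> U"
  shows "pdiff_list is (\<lambda>x. \<Sum>a\<in>A. f a x) x = (\<Sum>a\<in>A. pdiff_list is (f a) x)"
  using assms
  by (induction A rule: infinite_finite_induct)
    (auto simp: pdiff_list_zero pdiff_list_add smooth_on_sum)

lemma partial_mult:
  assumes "smooth_on U f" "smooth_on U g" "x \<in> U"
  shows "partial i (\<lambda>x. f x * g x) x = partial i f x * g x + f x * partial i g x"
  using assms by (intro partial_eqI has_dir_mult smooth_on_has_dir)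

lemma pdiff_list_vanish:
  assumes "closed K" "\<And>x. x \<notin> K \<Longrightarrow> f x = 0" "x \<notin> K"
  shows "pdiff_list is f x = 0"
  using pdiff_list_cong[of "- K" f "\<lambda>_. 0" x "is"] assms by (auto simp: pdiff_list_zero)

lemma smooth_on_cong:
  assumes "open U" "\<And>x. x \<in> U \<Longrightarrow> f x = g x" "smooth_on U f"
  shows "smooth_on U g"
proof (rule smooth_onI_family(1)[OF assms(1)])
  show "g x = pdiff_list [] f x" if "x \<in> U" for x using assms(2) that by simp
qed (use smooth_onD[OF assms(3)] in \<open>auto simp del: pdiff_list.simps(2)\<close>)

lemma smooth_on_Un:
  assumes "open U" "open V" "smooth_on U f" "smooth_on V f"
  shows "smooth_on (U \<union> V) f"
  using assms unfolding smooth_on_def by (metis UnE continuous_on_open_Un)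

text \<open>The function is smooth on \<open>U\<close> by hypothesis and on the complement of
  \<open>K\<close> because it is zero there; these two open sets cover the space.\<close>

lemma smooth_on_extend:
  assumes "open U" "closed K" "K \<subseteq> U" "\<And>x. x \<notin> K \<Longrightarrow> f x = 0" "smooth_on U f"
  shows "smooth_on UNIV f"
proof -
  have "smooth_on (- K) f"
    by (rule smooth_on_cong[of _ "\<lambda>_. 0"]) (use assms in \<open>auto intro: smooth_on_const\<close>)
  from smooth_on_Un[OF assms(1) _ assms(5) this] assms(2,3)
  have "smooth_on (U \<union> - K) f" by auto
  moreover have "U \<union> - K = UNIV" using assms(3) by auto
  ultimately show ?thesis by simp
qed

lemma tsupport_subset: "closed K \<Longrightarrow> (\<And>x. x \<notin> K \<Longrightarrow> f x = 0) \<Longrightarrow> tsupport f \<subseteq> K"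
  unfolding tsupport_def by (rule closure_minimal) auto

lemma tsupport_outside: "x \<notin> tsupport f \<Longrightarrow> f x = 0"
  using closure_subset[of "{x. f x \<noteq> 0}"] by (auto simp: tsupport_def)

lemma test_funI:
  assumes "open U" "compact K" "K \<subseteq> U" "K \<subseteq> V" "\<And>x. x \<notin> K \<Longrightarrow> f x = 0" "smooth_on U f"
  shows "test_fun V f"
proof -
  have K: "closed K" using assms by (auto intro: compact_imp_closed)
  have sub: "tsupport f \<subseteq> K" by (intro tsupport_subset K assms)
  have "closed (tsupport f)" by (simp add: tsupport_def)
  from compact_Int_closed[OF assms(2) this] have "compact (tsupport f)"
    using sub by (simp add: Int_absorb1)
  moreover have "smooth_on UNIV f" using assms K by (intro smooth_on_extend[of U K])
  ultimately show ?thesis using sub assms by (auto simp: test_fun_def)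
qed

section \<open>Exponentials and their derivatives\<close>

definition ee :: "real^'n::finite \<Rightarrow> real^'n \<Rightarrow> complex" where
  "ee \<eta> x = cis (x \<bullet> \<eta>)"

lemma ee_add: "ee (\<eta> + \<zeta>) x = ee \<eta> x * ee \<zeta> x"
  by (simp add: ee_def inner_add_right cis_mult)

lemma norm_ee [simp]: "norm (ee \<eta> x) = 1"
  by (simp add: ee_def)

lemma fourier_ee: "fourier v \<xi> = v (ee (- \<xi>))"
  by (simp add: fourier_def ee_def[abs_def])

lemma has_dir_ee: "has_dir i (ee \<eta>) (\<i> * of_real (\<eta> $ i) * ee \<eta> x) x"
proof -
  have "((\<lambda>z. exp (\<i> * (of_real (x \<bullet> \<eta>) + z * of_real (\<eta> $ i)))) has_field_derivative
      \<i> * of_real (\<eta> $ i) * exp (\<i> * of_real (x \<bullet> \<eta>))) (at (of_real 0))"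
    by (auto intro!: derivative_eq_intros)
  note has_vector_derivative_real_field[OF this]
  moreover have "(x + t *\<^sub>R axis i 1) \<bullet> \<eta> = x \<bullet> \<eta> + t * \<eta> $ i" for t
    by (simp add: inner_add_left inner_axis inner_commute[of "axis i 1"])
  ultimately show ?thesis unfolding has_dir_def ee_def cis_conv_exp by simp
qed

lemma
  fixes U :: "(real^'n::finite) set"
  shows smooth_on_ee: "open U \<Longrightarrow> smooth_on U (ee \<eta>)"
    and pdiff_list_ee: "pdiff_list is (ee \<eta>) x = (\<Prod>i\<leftarrow>is. \<i> * of_real (\<eta> $ i)) * ee \<eta> x"
proof -
  let ?F = "\<lambda>is x. (\<Prod>i\<leftarrow>is. \<i> * complex_of_real (\<eta> $ i)) * ee \<eta> x"
  have "continuous_on V (ee \<eta>)" for V :: "(real^'n) set"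
    unfolding ee_def cis_conv_exp by (intro continuous_intros)
  then have c: "continuous_on V (?F is)" for V "is"
    by (intro continuous_intros)
  have d: "has_dir i (?F is) (?F (i # is) x) x" for i "is" x
    using has_dir_mult[OF has_dir_const has_dir_ee, of i "\<Prod>i\<leftarrow>is. \<i> * complex_of_real (\<eta> $ i)" \<eta> x]
    by (simp add: mult_ac)
  show "open U \<Longrightarrow> smooth_on U (ee \<eta>)"
    by (rule smooth_onI_family(1)[where F = ?F]) (use c d in simp_all)
  show "pdiff_list is (ee \<eta>) x = ?F is x"
    by (rule smooth_onI_family(2)[OF open_UNIV, where F = ?F]) (use c d in simp_all)
qed

section \<open>Majorants for derivatives at a point and the Leibniz rule\<close>

definition conv :: "(nat \<Rightarrow> real) \<Rightarrow> (nat \<Rightarrow> real) \<Rightarrow> nat \<Rightarrow> real" where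
  "conv A B l = (\<Sum>k\<le>l. real (l choose k) * A k * B (l - k))"

text \<open>Pascal's rule: the two sums collect the terms in which the additional derivative falls
  on the first and on the second factor. The general semiring covers both majorants and families of
  derivatives.\<close>

lemma binomial_convolution_Suc:
  fixes A B :: "nat \<Rightarrow> 'a::comm_semiring_1"
  shows "(\<Sum>k\<le>Suc l. of_nat (Suc l choose k) * A k * B (Suc l - k)) =
    (\<Sum>k\<le>l. of_nat (l choose k) * A (Suc k) * B (l - k)) +
    (\<Sum>k\<le>l. of_nat (l choose k) * A k * B (Suc (l - k)))"
proof -
  have "(\<Sum>k\<le>Suc l. of_nat (l choose k) * A k * B (Suc l - k)) =
     A 0 * B (Suc l) + (\<Sum>k\<le>l. of_nat (l choose Suc k) * A (Suc k) * B (l - k))"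
    by (simp add: sum.atMost_Suc_shift del: sum.atMost_Suc)
  moreover have "(\<Sum>k\<le>Suc l. of_nat (l choose k) * A k * B (Suc l - k)) =
     (\<Sum>k\<le>l. of_nat (l choose k) * A k * B (Suc (l - k)))"
    by (simp add: Suc_diff_le binomial_eq_0 cong: sum.cong_simp)
  ultimately have *: "A 0 * B (Suc l) + (\<Sum>k\<le>l. of_nat (l choose Suc k) * A (Suc k) * B (l - k)) =
     (\<Sum>k\<le>l. of_nat (l choose k) * A k * B (Suc (l - k)))" by simp
  have "(\<Sum>k\<le>Suc l. of_nat (Suc l choose k) * A k * B (Suc l - k)) =
     A 0 * B (Suc l) + (\<Sum>k\<le>l. of_nat (Suc l choose Suc k) * A (Suc k) * B (l - k))"
    by (simp add: sum.atMost_Suc_shift del: sum.atMost_Suc binomial_Suc_Suc)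
  also have "\<dots> = (\<Sum>k\<le>l. of_nat (l choose k) * A (Suc k) * B (l - k)) +
     (A 0 * B (Suc l) + (\<Sum>k\<le>l. of_nat (l choose Suc k) * A (Suc k) * B (l - k)))"
    by (simp add: distrib_right sum.distrib add_ac)
  finally show ?thesis unfolding * .
qed

lemma conv_Suc: "conv A B (Suc l) = conv (\<lambda>k. A (Suc k)) B l + conv A (\<lambda>k. B (Suc k)) l"
  unfolding conv_def by (rule binomial_convolution_Suc)

text \<open>The cap \<open>R\<close> is essential for cutoffs whose good bounds end at a finite
  order; operations that differentiate lower it. The majorant depends on the order alone, not on the
  directions.\<close>

definition bdp :: "real^'n::finite \<Rightarrow> nat \<Rightarrow> (real^'n \<Rightarrow> complex) \<Rightarrow> (nat \<Rightarrow> real) \<Rightarrow> bool" where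
  "bdp x R f A \<longleftrightarrow> (\<forall>is. length is \<le> R \<longrightarrow> norm (pdiff_list is f x) \<le> A (length is))"

lemma bdpD: "bdp x R f A \<Longrightarrow> length is \<le> R \<Longrightarrow> norm (pdiff_list is f x) \<le> A (length is)"
  by (simp add: bdp_def)

lemma bdp_mono: "bdp x R f A \<Longrightarrow> R' \<le> R \<Longrightarrow> (\<And>l. l \<le> R' \<Longrightarrow> A l \<le> B l) \<Longrightarrow> bdp x R' f B"
  unfolding bdp_def by (meson order_trans)

lemma bdp_partial: "bdp x (Suc R) f A \<Longrightarrow> bdp x R (partial i f) (\<lambda>k. A (Suc k))"
  unfolding bdp_def pdiff_list_snoc[symmetric] by (metis Suc_le_mono length_append_singleton)

lemma bdp_add:
  assumes "open U" "smooth_on U f" "smooth_on U g" "x \<in> U" "bdp x R f A" "bdp x R g B"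
  shows "bdp x R (\<lambda>x. f x + g x) (\<lambda>l. A l + B l)"
  using assms unfolding bdp_def by (auto simp: pdiff_list_add intro: norm_triangle_mono)

lemma bdp_cmult:
  assumes "open U" "smooth_on U f" "x \<in> U" "bdp x R f A"
  shows "bdp x R (\<lambda>x. c * f x) (\<lambda>l. norm c * A l)"
  using assms unfolding bdp_def
  by (auto simp: pdiff_list_cmult norm_mult intro!: mult_left_mono)

lemma bdp_sum:
  assumes "open U" "\<And>a. a \<in> I \<Longrightarrow> smooth_on U (f a)" "x \<in> U" "\<And>a. a \<in> I \<Longrightarrow> bdp x R (f a) (A a)"
  shows "bdp x R (\<lambda>x. \<Sum>a\<in>I. f a x) (\<lambda>l. \<Sum>a\<in>I. A a l)"
  using assms unfolding bdp_def by (auto simp: pdiff_list_sum intro!: sum_norm_le)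

text \<open>The induction peels off the innermost derivative, because \<open>partial i f\<close>
  inherits the majorant of f shifted by one; \<open>conv_Suc\<close> then reassembles the two halves
  of the product rule.\<close>

lemma bdp_mult_aux:
  assumes U: "open U" and "x \<in> U"
  shows "smooth_on U f \<Longrightarrow> smooth_on U g \<Longrightarrow> bdp x (length is) f A \<Longrightarrow> bdp x (length is) g B \<Longrightarrow>
    norm (pdiff_list is (\<lambda>x. f x * g x) x) \<le> conv A B (length is)"
proof (induction "is" arbitrary: f g A B rule: rev_induct)
  case Nil
  then show ?case by (auto simp: conv_def bdp_def norm_mult intro!: mult_mono intro: order_trans[OF norm_ge_zero])
next
  case (snoc i js)
  note sm = snoc.prems(1,2) smooth_on_partial[OF snoc.prems(1), of i] smooth_on_partial[OF snoc.prems(2), of i]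
  have b: "bdp x (length js) f A" "bdp x (length js) g B"
    "bdp x (length js) (partial i f) (\<lambda>k. A (Suc k))" "bdp x (length js) (partial i g) (\<lambda>k. B (Suc k))"
    using snoc.prems by (auto intro: bdp_mono[of x "Suc (length js)"] bdp_partial)
  have "pdiff_list (js @ [i]) (\<lambda>x. f x * g x) x =
      pdiff_list js (\<lambda>x. partial i f x * g x + f x * partial i g x) x"
    unfolding pdiff_list_snoc
    by (rule pdiff_list_cong[OF U _ \<open>x \<in> U\<close>]) (rule partial_mult[OF sm(1,2)])
  also have "\<dots> = pdiff_list js (\<lambda>x. partial i f x * g x) x + pdiff_list js (\<lambda>x. f x * partial i g x) x"
    by (intro pdiff_list_add[OF U] smooth_on_mult[OF U] sm \<open>x \<in> U\<close>)
  also have "norm \<dots> \<le> conv (\<lambda>k. A (Suc k)) B (length js) + conv A (\<lambda>k. B (Suc k)) (length js)"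
    by (intro norm_triangle_mono snoc.IH sm b)
  finally show ?case by (simp add: conv_Suc)
qed

lemma bdp_mult:
  assumes "open U" "smooth_on U f" "smooth_on U g" "x \<in> U" "bdp x R f A" "bdp x R g B"
  shows "bdp x R (\<lambda>x. f x * g x) (conv A B)"
  unfolding bdp_def
  using assms by (auto intro!: bdp_mult_aux[OF assms(1,4)] intro: bdp_mono)

text \<open>Removing the term in which all derivatives fall on g leaves strictly lower derivatives
  of g; accordingly the majorant of f is set to 0 at order 0. This yields the recursion for the
  derivatives of 1 / f.\<close>

lemma bdp_mult_diff:
  assumes U: "open U" and "x \<in> U"
  shows "smooth_on U f \<Longrightarrow> smooth_on U g \<Longrightarrow> bdp x (length is) f A \<Longrightarrow> (\<And>js. length js < length is \<Longrightarrow> norm (pdiff_list js g x) \<le> B (length js)) \<Longrightarrow>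
    norm (pdiff_list is (\<lambda>x. f x * g x) x - f x * pdiff_list is g x) \<le> conv (A(0 := 0)) B (length is)"
proof (induction "is" arbitrary: f g A B rule: rev_induct)
  case Nil
  then show ?case by (auto simp: conv_def)
next
  case (snoc i js)
  note sm = snoc.prems(1,2) smooth_on_partial[OF snoc.prems(1), of i] smooth_on_partial[OF snoc.prems(2), of i]
  have b: "bdp x (length js) f A" "bdp x (length js) g B"
    "bdp x (length js) (partial i f) (\<lambda>k. A (Suc k))"
    using snoc.prems
    by (auto intro: bdp_mono[of x "Suc (length js)"] bdp_partial) (auto simp: bdp_def)
  have b': "norm (pdiff_list js' (partial i g) x) \<le> B (Suc (length js'))"
    if "length js' < length js" for js'
    using snoc.prems(4)[of "js' @ [i]"] that by (simp add: pdiff_list_snoc)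
  have "pdiff_list (js @ [i]) (\<lambda>x. f x * g x) x =
      pdiff_list js (\<lambda>x. partial i f x * g x + f x * partial i g x) x"
    unfolding pdiff_list_snoc
    by (rule pdiff_list_cong[OF U _ \<open>x \<in> U\<close>]) (rule partial_mult[OF sm(1,2)])
  also have "\<dots> = pdiff_list js (\<lambda>x. partial i f x * g x) x + pdiff_list js (\<lambda>x. f x * partial i g x) x"
    by (intro pdiff_list_add[OF U] smooth_on_mult[OF U] sm \<open>x \<in> U\<close>)
  finally have "pdiff_list (js @ [i]) (\<lambda>x. f x * g x) x - f x * pdiff_list (js @ [i]) g x =
      pdiff_list js (\<lambda>x. partial i f x * g x) x +
      (pdiff_list js (\<lambda>x. f x * partial i g x) x - f x * pdiff_list js (partial i g) x)"
    by (simp add: pdiff_list_snoc)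
  also have "norm \<dots> \<le> conv (\<lambda>k. A (Suc k)) B (length js) + conv (A(0 := 0)) (\<lambda>k. B (Suc k)) (length js)"
    by (intro norm_triangle_mono snoc.IH bdp_mult_aux[OF U \<open>x \<in> U\<close>] sm b b')
  also have "\<dots> = conv (A(0 := 0)) B (Suc (length js))"
    unfolding conv_Suc by simp
  finally show ?case by (simp only: length_append_singleton)
qed

section \<open>Cutoff functions with controlled derivatives\<close>

text \<open>A function is carried together with all its derivatives, \<open>d k\<close> being the
  k-th derivative of \<open>d 0\<close>, so that constructions can prescribe the derivatives
  explicitly.\<close>

definition dfam :: "(nat \<Rightarrow> real \<Rightarrow> real) \<Rightarrow> bool" where
  "dfam d \<longleftrightarrow> (\<forall>k x. (d k has_real_derivative d (Suc k) x) (at x))"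

lemma dfamD: "dfam d \<Longrightarrow> (d k has_real_derivative d (Suc k) x) (at x)"
  by (simp add: dfam_def)

lemma poly_times_exp_tendsto_0: "((\<lambda>y. poly p y * exp (- y)) \<longlongrightarrow> (0::real)) at_top"
proof -
  have "((\<lambda>y. \<Sum>i\<le>degree p. coeff p i * (y ^ i / exp y)) \<longlongrightarrow> (\<Sum>i\<le>degree p. coeff p i * 0)) at_top"
    by (intro tendsto_intros tendsto_power_div_exp_0)
  also have "(\<lambda>y. \<Sum>i\<le>degree p. coeff p i * (y ^ i / exp y)) = (\<lambda>y. poly p y * exp (- y))"
    by (simp add: poly_altdef sum_distrib_left exp_minus divide_inverse mult_ac)
  finally show ?thesis by simp
qed

text \<open>The function is exp(-1/x) for x > 0. Each derivative is a polynomial in 1/x times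
  exp(-1/x), and the exponential decay beats every polynomial at the origin.\<close>

lemma ex_flat_dfam: "\<exists>h. dfam h \<and> (\<forall>x>0. h 0 x > 0) \<and> (\<forall>x\<le>0. h 0 x = 0)"
proof -
  \<comment> \<open>The derivative of p(1/x) exp(-1/x) is x^(-2) (p - p')(1/x) exp(-1/x); the
    polynomial \<open>[:0, 0, 1:]\<close> is the factor x^(-2) in the variable 1/x.\<close>
  define q :: "nat \<Rightarrow> real poly" where "q = rec_nat 1 (\<lambda>_ p. [:0, 0, 1:] * (p - pderiv p))"
  have q0: "q 0 = 1" and qS: "q (Suc k) = [:0, 0, 1:] * (q k - pderiv (q k))" for k
    by (auto simp: q_def)
  define h where "h k x = (if x > 0 then poly (q k) (inverse x) * exp (- inverse x) else 0)" for k x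
  have "(h k has_real_derivative h (Suc k) x) (at x)" for k x
  proof -
    consider "x > 0" | "x < 0" | "x = 0" by linarith
    then show ?thesis
    proof cases
      case 1
      have "((\<lambda>x. poly (q k) (inverse x) * exp (- inverse x)) has_real_derivative h (Suc k) x) (at x)"
        using 1 by (auto intro!: derivative_eq_intros DERIV_chain2[OF poly_DERIV]
            simp: h_def qS field_simps power2_eq_square)
      then show ?thesis
        by (rule has_field_derivative_transform_within_open[where S = "{0<..}"]) (use 1 in \<open>auto simp: h_def\<close>)
    next
      case 2
      have "((\<lambda>_. 0) has_real_derivative h (Suc k) x) (at x)" using 2 by (simp add: h_def)
      then show ?thesis
        by (rule has_field_derivative_transform_within_open[where S = "{..<0}"]) (use 2 in \<open>auto simp: h_def\<close>)
    next
      case 3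
      \<comment> \<open>The difference quotient at 0 contains one more factor 1/x, which
        \<open>pCons 0\<close> supplies.\<close>
      have "((\<lambda>x. poly (pCons 0 (q k)) (inverse x) * exp (- inverse x)) \<longlongrightarrow> 0) (at_right 0)"
        by (rule filterlim_compose[OF poly_times_exp_tendsto_0 filterlim_inverse_at_top_right])
      then have r: "((\<lambda>y. (h k y - h k 0) / (y - 0)) \<longlongrightarrow> 0) (at_right 0)"
        by (rule Lim_transform_eventually)
          (auto simp: eventually_at_filter h_def divide_inverse mult_ac intro!: always_eventually)
      have l: "((\<lambda>y. (h k y - h k 0) / (y - 0)) \<longlongrightarrow> 0) (at_left 0)"
        by (rule Lim_transform_eventually[OF tendsto_const])
          (auto simp: eventually_at_filter h_def intro!: always_eventually)
      from filterlim_split_at[OF l r] 3 show ?thesis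
        by (simp add: has_field_derivative_iff h_def)
    qed
  qed
  then show ?thesis
    by (intro exI[of _ h]) (auto simp: dfam_def h_def q0)
qed

lemma dfam_mult:
  assumes "dfam f" "dfam g"
  shows "dfam (\<lambda>k x. \<Sum>i\<le>k. of_nat (k choose i) * f i x * g (k - i) x)"
  unfolding dfam_def
proof (intro allI)
  fix k x
  show "((\<lambda>x. \<Sum>i\<le>k. of_nat (k choose i) * f i x * g (k - i) x) has_real_derivative
      (\<Sum>i\<le>Suc k. of_nat (Suc k choose i) * f i x * g (Suc k - i) x)) (at x)"
    unfolding binomial_convolution_Suc[of k "\<lambda>i. f i x" "\<lambda>i. g i x"]
    by (auto intro!: derivative_eq_intros dfamD assms simp: sum.distrib algebra_simps)
qed

lemma dfam_affine:
  assumes "dfam f" shows "dfam (\<lambda>k x. s ^ k * f k (s * x + c))"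
  unfolding dfam_def
proof (intro allI)
  fix k x
  have "((\<lambda>x. f k (s * x + c)) has_real_derivative f (Suc k) (s * x + c) * s) (at x)"
    by (rule DERIV_chain2[OF dfamD[OF assms]]) (auto intro!: derivative_eq_intros)
  then show "((\<lambda>x. s ^ k * f k (s * x + c)) has_real_derivative s ^ Suc k * f (Suc k) (s * x + c)) (at x)"
    by (auto intro!: derivative_eq_intros)
qed

lemma dfam_cmult: "dfam f \<Longrightarrow> dfam (\<lambda>k x. c * f k x)"
  unfolding dfam_def by (auto intro!: derivative_eq_intros)

lemma dfam_zero_on:
  assumes "dfam f" "open S" "\<And>x. x \<in> S \<Longrightarrow> f 0 x = 0"
  shows "x \<in> S \<Longrightarrow> f k x = 0"
proof (induction k arbitrary: x)
  case (Suc k)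
  have "((\<lambda>_. 0) has_real_derivative 0) (at x)" by simp
  then have "(f k has_real_derivative 0) (at x)"
    by (rule has_field_derivative_transform_within_open[OF _ assms(2) Suc.prems]) (simp add: Suc.IH)
  with dfamD[OF assms(1)] show ?case by (rule DERIV_unique)
qed (use assms in auto)

text \<open>Averaging over \<open>[x - a, x + a]\<close>: one derivative of the average costs only the factor
  \<open>1 / a\<close> and no derivative of the averaged function.\<close>

lemma box_average:
  assumes d: "dfam d" and a: "a > 0"
  shows "\<exists>e. dfam e \<and> (\<forall>k x. \<exists>y. \<bar>y - x\<bar> \<le> a \<and> e k x = d k y) \<and>
           (\<forall>k x. e (Suc k) x = (d k (x + a) - d k (x - a)) / (2 * a))"
proof -
  have "isCont (d 0) x" for x using DERIV_isCont dfamD[OF d] by blast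
  then obtain F where F: "\<And>x. (F has_vector_derivative d 0 x) (at x)"
    using einterval_antiderivative[of "-\<infinity>" "\<infinity>" "d 0"] by auto
  \<comment> \<open>Shifting the index makes \<open>E k\<close> an antiderivative of
    \<open>d k\<close> for every k, including k = 0; a single central difference quotient then
    defines the whole averaged family.\<close>
  define E where "E k = (case k of 0 \<Rightarrow> F | Suc j \<Rightarrow> d j)" for k
  have E: "(E k has_real_derivative d k x) (at x)" for k x
    using F dfamD[OF d] by (cases k) (auto simp: E_def has_real_derivative_iff_has_vector_derivative)
  define e where "e k x = (E k (x + a) - E k (x - a)) / (2 * a)" for k x
  have "dfam e"
    unfolding dfam_def
  proof (intro allI)
    fix k x
    have "((\<lambda>x. E k (x + a)) has_real_derivative d k (x + a) * 1) (at x)"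
      by (rule DERIV_chain2[OF E]) (auto intro!: derivative_eq_intros)
    moreover have "((\<lambda>x. E k (x - a)) has_real_derivative d k (x - a) * 1) (at x)"
      by (rule DERIV_chain2[OF E]) (auto intro!: derivative_eq_intros)
    ultimately have "((\<lambda>x. (E k (x + a) - E k (x - a)) / (2 * a)) has_real_derivative
        (d k (x + a) * 1 - d k (x - a) * 1) / (2 * a)) (at x)"
      by (intro DERIV_cdivide DERIV_diff)
    then show "(e k has_real_derivative e (Suc k) x) (at x)"
      by (simp add: e_def[abs_def] E_def)
  qed
  moreover have "\<exists>y. \<bar>y - x\<bar> \<le> a \<and> e k x = d k y" for k x
  proof -
    from MVT2[of "x - a" "x + a" "E k" "d k"] a E obtain z
      where "x - a < z" "z < x + a" "E k (x + a) - E k (x - a) = 2 * a * d k z" by auto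
    then show ?thesis using a by (intro exI[of _ z]) (auto simp: e_def)
  qed
  ultimately show ?thesis by (intro exI[of _ e]) (auto simp: e_def E_def)
qed

text \<open>A nonnegative bump supported in [-1, 1] is averaged over windows of half-width 2. For
  |x| <= 1 the window contains the whole support, so the average is constant there; for |x| >= 3 it
  misses the support. Dividing by the constant gives the plateau.\<close>

lemma ex_plateau_dfam:
  "\<exists>d c. dfam d \<and> (\<forall>x. \<bar>x\<bar> \<le> 1 \<longrightarrow> d 0 x = 1) \<and> (\<forall>x. \<bar>x\<bar> \<ge> 3 \<longrightarrow> d 0 x = 0) \<and> (\<forall>k x. \<bar>d k x\<bar> \<le> c k)"
proof -
  obtain h where h: "dfam h" "\<And>x. x > 0 \<Longrightarrow> h 0 x > 0" "\<And>x. x \<le> 0 \<Longrightarrow> h 0 x = 0"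
    using ex_flat_dfam by blast
  define b where "b k x = (\<Sum>i\<le>k. of_nat (k choose i) * (1 ^ i * h i (1 * x + 1)) *
    ((- 1) ^ (k - i) * h (k - i) (- 1 * x + 1)))" for k x
  have b: "dfam b"
    unfolding b_def[abs_def] by (intro dfam_mult dfam_affine h)
  have b0: "b 0 x = h 0 (x + 1) * h 0 (1 - x)" for x by (simp add: b_def add.commute)
  have b_nonneg: "b 0 x \<ge> 0" for x
    unfolding b0 using h(2,3) by (metis less_eq_real_def linorder_not_less mult_nonneg_nonneg)
  have b_zero: "\<bar>x\<bar> \<ge> 1 \<Longrightarrow> b 0 x = 0" for x
    unfolding b0 using h(3)[of "x + 1"] h(3)[of "1 - x"] by (auto simp: abs_le_iff abs_if split: if_splits)
  obtain e where e: "dfam e" "\<And>k x. \<exists>y. \<bar>y - x\<bar> \<le> 2 \<and> e k x = b k y"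
    "\<And>k x. e (Suc k) x = (b k (x + 2) - b k (x - 2)) / (2 * 2)"
    using box_average[OF b, of 2] by (auto simp del: mult_numeral_left mult_numeral_1)
  have e_nonneg: "e 0 x \<ge> 0" for x using e(2)[of x 0] b_nonneg by auto
  have e_zero: "e 0 x = 0" if "\<bar>x\<bar> \<ge> 3" for x
  proof -
    obtain y where "\<bar>y - x\<bar> \<le> 2" "e 0 x = b 0 y" using e(2)[of x 0] by blast
    then show ?thesis using that b_zero[of y] by linarith
  qed
  \<comment> \<open>The derivative of the average at -2 is (b(0) - b(-4)) / 4 > 0 for the bump b.
    Hence the average is positive just to the right of -2 and, being nondecreasing up to -1, also at
    -1: the normalising constant is not zero.\<close>
  have "e (Suc 0) (- 2) > 0"
    unfolding e(3) using b_zero[of "-4"] b0[of 0] h(2)[of 1] by simp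
  then obtain t where t: "t > 0" "\<And>s. 0 < s \<Longrightarrow> s < t \<Longrightarrow> e 0 (- 2) < e 0 (- 2 + s)"
    using DERIV_pos_inc_right[OF dfamD[OF e(1)], of 0 "- 2"] by blast
  define s where "s = min (t / 2) 1"
  have s: "0 < s" "s < t" "s \<le> 1" using t(1) by (auto simp: s_def)
  have pos: "e 0 (- 2 + s) > 0" using t(2)[OF s(1,2)] e_nonneg[of "- 2"] by linarith
  have "e 0 (- 2 + s) \<le> e 0 (- 1)"
  proof (rule DERIV_nonneg_imp_nondecreasing[of "- 2 + s" "- 1" "e 0"])
    show "\<exists>y. (e 0 has_real_derivative y) (at x) \<and> 0 \<le> y" if "- 2 + s \<le> x" "x \<le> - 1" for x
      using that dfamD[OF e(1), of 0 x] b_zero[of "x - 2"] b_nonneg[of "x + 2"]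
      by (intro exI[of _ "e (Suc 0) x"]) (auto simp: e(3))
  qed (use s in auto)
  with pos have I: "e 0 (- 1) > 0" by linarith
  have const: "e 0 x = e 0 (- 1)" if "\<bar>x\<bar> \<le> 1" for x
  proof (rule has_derivative_zero_unique[of "{-1..1}" "e 0"])
    show "(e 0 has_derivative (\<lambda>h. 0)) (at y within {-1..1})" if "y \<in> {-1..1}" for y
    proof -
      have "e (Suc 0) y = 0"
        unfolding e(3) using b_zero[of "y + 2"] b_zero[of "y - 2"] that by auto
      moreover have "(*) (0::real) = (\<lambda>h. 0)" by auto
      ultimately show ?thesis using dfamD[OF e(1), of 0 y]
        by (auto simp: has_field_derivative_def intro: has_derivative_at_withinI)
    qed
  qed (use that in auto)
  define d where "d k x = (1 / e 0 (- 1)) * e k x" for k x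
  have d: "dfam d" unfolding d_def[abs_def] by (intro dfam_cmult e)
  have d0: "d 0 x = 1" if "\<bar>x\<bar> \<le> 1" for x using const[OF that] I by (simp add: d_def)
  have d1: "d 0 x = 0" if "\<bar>x\<bar> \<ge> 3" for x using e_zero[OF that] by (simp add: d_def)
  have "\<exists>c. \<forall>x. \<bar>d k x\<bar> \<le> c" for k
  proof -
    have "continuous_on {-3..3} (d k)"
      by (intro continuous_at_imp_continuous_on ballI DERIV_isCont[OF dfamD[OF d]])
    then have "bounded (d k ` {-3..3})"
      by (intro compact_imp_bounded compact_continuous_image) auto
    then obtain B where "\<forall>y\<in>d k ` {-3..3}. norm y \<le> B"
      unfolding bounded_iff by blast
    then have B: "\<And>x. x \<in> {-3..3} \<Longrightarrow> \<bar>d k x\<bar> \<le> B" by simp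
    have "\<bar>d k x\<bar> \<le> max B 0" for x
    proof (cases "x \<in> {-3..3}")
      case False
      then have "x \<in> {..<-3} \<union> {3<..}" by auto
      then have "d k x = 0"
        by (rule dfam_zero_on[OF d open_Un[OF open_lessThan open_greaterThan], rotated])
          (auto intro: d1)
      then show ?thesis by simp
    next
      case True
      from B[OF this] show ?thesis by linarith
    qed
    then show ?thesis by blast
  qed
  then obtain c where "\<And>k x. \<bar>d k x\<bar> \<le> c k" by metis
  with d d0 d1 show ?thesis by blast
qed

text \<open>Each averaging pays for one derivative with a factor 1 / a, so q averagings pay for q
  derivatives while only the supremum \<open>c 0\<close> enters; plateau and support move by at most
  q a. The bounds \<open>c k\<close> survive unchanged, which keeps every fixed order bounded
  uniformly in q.\<close>

lemma iterated_box_average: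
  assumes d: "dfam d" "\<And>x. \<bar>x\<bar> \<le> 1 \<Longrightarrow> d 0 x = 1" "\<And>x. \<bar>x\<bar> \<ge> 3 \<Longrightarrow> d 0 x = 0"
    "\<And>k x. \<bar>d k x\<bar> \<le> c k" and a: "a > 0"
  shows "\<exists>e. dfam e \<and> (\<forall>x. \<bar>x\<bar> \<le> 1 - real q * a \<longrightarrow> e 0 x = 1) \<and>
    (\<forall>x. \<bar>x\<bar> \<ge> 3 + real q * a \<longrightarrow> e 0 x = 0) \<and> (\<forall>k x. \<bar>e k x\<bar> \<le> c k) \<and>
    (\<forall>k x. k \<le> q \<longrightarrow> \<bar>e k x\<bar> \<le> c 0 * (1 / a) ^ k)"
proof (induction q)
  case 0
  show ?case using d by (intro exI[of _ d]) auto
next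
  case (Suc q)
  then obtain f where f: "dfam f" "\<And>x. \<bar>x\<bar> \<le> 1 - real q * a \<Longrightarrow> f 0 x = 1"
    "\<And>x. \<bar>x\<bar> \<ge> 3 + real q * a \<Longrightarrow> f 0 x = 0" "\<And>k x. \<bar>f k x\<bar> \<le> c k"
    "\<And>k x. k \<le> q \<Longrightarrow> \<bar>f k x\<bar> \<le> c 0 * (1 / a) ^ k" by blast
  obtain e where e: "dfam e" "\<And>k x. \<exists>y. \<bar>y - x\<bar> \<le> a \<and> e k x = f k y"
    "\<And>k x. e (Suc k) x = (f k (x + a) - f k (x - a)) / (2 * a)"
    using box_average[OF f(1) a] by blast
  have "e 0 x = 1" if "\<bar>x\<bar> \<le> 1 - real (Suc q) * a" for x
  proof -
    obtain y where "\<bar>y - x\<bar> \<le> a" "e 0 x = f 0 y" using e(2)[of x 0] by blast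
    with that f(2)[of y] show ?thesis by (simp add: algebra_simps)
  qed
  moreover have "e 0 x = 0" if "\<bar>x\<bar> \<ge> 3 + real (Suc q) * a" for x
  proof -
    obtain y where "\<bar>y - x\<bar> \<le> a" "e 0 x = f 0 y" using e(2)[of x 0] by blast
    with that f(3)[of y] show ?thesis by (simp add: algebra_simps)
  qed
  moreover have "\<bar>e k x\<bar> \<le> c k" for k x using e(2)[of x k] f(4) by metis
  moreover have "\<bar>e k x\<bar> \<le> c 0 * (1 / a) ^ k" if "k \<le> Suc q" for k x
  proof (cases k)
    case 0
    then show ?thesis using e(2)[of x k] f(4) by (metis mult.right_neutral power_0)
  next
    case (Suc j)
    with that have "j \<le> q" by simp
    have "\<bar>f j (x + a) - f j (x - a)\<bar> \<le> 2 * (c 0 * (1 / a) ^ j)"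
      using f(5)[OF \<open>j \<le> q\<close>, of "x + a"] f(5)[OF \<open>j \<le> q\<close>, of "x - a"] by linarith
    then have "\<bar>f j (x + a) - f j (x - a)\<bar> / (2 * a) \<le> 2 * (c 0 * (1 / a) ^ j) / (2 * a)"
      using a by (intro divide_right_mono) auto
    then show ?thesis using a by (simp add: Suc e(3) abs_divide abs_mult field_simps)
  qed
  ultimately show ?case using e(1) by blast
qed

text \<open>Differentiating a product of one-variable functions raises the index in the coordinate
  concerned only, so the list enters through its counts.\<close>

lemma
  fixes d :: "'n::finite \<Rightarrow> nat \<Rightarrow> real \<Rightarrow> real"
  assumes d: "\<And>j. dfam (d j)"
  shows smooth_on_prod_dfam: "smooth_on UNIV (\<lambda>x::real^'n. complex_of_real (\<Prod>j\<in>UNIV. d j 0 (x $ j)))"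
    and pdiff_list_prod_dfam: "pdiff_list is (\<lambda>x::real^'n. complex_of_real (\<Prod>j\<in>UNIV. d j 0 (x $ j))) x =
        complex_of_real (\<Prod>j\<in>UNIV. d j (count_list is j) (x $ j))"
proof -
  let ?F = "\<lambda>is x. complex_of_real (\<Prod>j\<in>UNIV. d j (count_list is j) ((x::real^'n) $ j))"
  have ct: "continuous_on UNIV (d j k)" for j k
    by (intro continuous_at_imp_continuous_on ballI DERIV_isCont[OF dfamD[OF d]])
  have c: "continuous_on UNIV (?F is)" for "is"
    by (intro continuous_intros continuous_on_compose2[OF ct]) auto
  have D: "has_dir i (?F is) (?F (i # is) x) x" for i "is" x
  proof -
    let ?P = "\<Prod>j\<in>UNIV - {i}. d j (count_list is j) (x $ j)"
    have "((\<lambda>t. d i (count_list is i) (x $ i + t)) has_real_derivative d i (Suc (count_list is i)) (x $ i + 0) * 1) (at 0)"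
      by (rule DERIV_chain2[OF dfamD[OF d]]) (auto intro!: derivative_eq_intros)
    then have "((\<lambda>t. d i (count_list is i) (x $ i + t) * ?P) has_real_derivative
        d i (Suc (count_list is i)) (x $ i) * ?P) (at 0)"
      by (auto intro!: derivative_eq_intros)
    then have "((\<lambda>t. complex_of_real (d i (count_list is i) (x $ i + t) * ?P)) has_vector_derivative
        complex_of_real (d i (Suc (count_list is i)) (x $ i) * ?P)) (at 0)"
      unfolding has_real_derivative_iff_has_vector_derivative
      by (rule bounded_linear.has_vector_derivative[OF bounded_linear_of_real])
    moreover have "(\<Prod>j\<in>UNIV. d j (count_list is j) ((x + t *\<^sub>R axis i 1) $ j)) =
        d i (count_list is i) (x $ i + t) * ?P" for t
      by (subst prod.remove[of UNIV i]) (auto simp: axis_def intro!: prod.cong)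
    moreover have "(\<Prod>j\<in>UNIV. d j (count_list (i # is) j) (x $ j)) =
        d i (Suc (count_list is i)) (x $ i) * ?P"
      by (subst prod.remove[of UNIV i]) (auto intro!: prod.cong)
    ultimately show ?thesis unfolding has_dir_def by simp
  qed
  show "smooth_on UNIV (\<lambda>x::real^'n. complex_of_real (\<Prod>j\<in>UNIV. d j 0 (x $ j)))"
    by (rule smooth_onI_family(1)[where F = ?F]) (use c D in simp_all)
  show "pdiff_list is (\<lambda>x::real^'n. complex_of_real (\<Prod>j\<in>UNIV. d j 0 (x $ j))) x = ?F is x"
    by (rule smooth_onI_family(2)[OF open_UNIV, where F = ?F]) (use c D in simp_all)
qed

lemma power_le_exp_fact: "x \<ge> 0 \<Longrightarrow> x ^ k \<le> exp x * fact k" for x :: real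
proof -
  assume x: "x \<ge> 0"
  have "(\<Sum>n\<in>{k}. inverse (fact n) *\<^sub>R x ^ n) \<le> (\<Sum>n. inverse (fact n) *\<^sub>R x ^ n)"
    by (rule sum_le_suminf) (use x summable_exp_generic[of x] in auto)
  then show ?thesis by (simp add: exp_def field_simps)
qed

lemma sum_count_list_UNIV: "(\<Sum>j\<in>UNIV. count_list is (j::'n::finite)) = length is"
proof (induction "is")
  case (Cons a js)
  have "count_list (a # js) j = count_list js j + (if j = a then 1 else 0)" for j
    by simp
  then show ?case by (simp add: sum.distrib Cons.IH del: count_list.simps)
qed simp

text \<open>With r averagings of width about 1 / r the derivatives of order l <= r grow like a
  constant to the power l times (r + 1)^l, and (r + 1)^l <= e^(r+1) l! trades this for geometric
  growth in r times a factorial. The bounds \<open>C\<close>, valid at all orders and independent of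
  r, later give boundedness of the localised sequence.\<close>

lemma ex_cutoffs:
  fixes x0 :: "real^'n::finite"
  assumes \<delta>: "\<delta> > 0"
  obtains \<phi> C E \<rho> where
    "\<And>r::nat. smooth_on UNIV (\<phi> r)"
    "\<And>r x. (\<And>i. \<bar>x $ i - x0 $ i\<bar> \<le> \<delta>) \<Longrightarrow> \<phi> r x = 1"
    "\<And>r x i. \<bar>x $ i - x0 $ i\<bar> \<ge> 8 * \<delta> \<Longrightarrow> \<phi> r x = 0"
    "\<And>r is x. norm (pdiff_list is (\<phi> r) x) \<le> C (length is)"
    "\<And>r is x. length is \<le> r \<Longrightarrow> norm (pdiff_list is (\<phi> r) x) \<le> E * E ^ r * \<rho> ^ length is * fact (length is)"
    "E \<ge> (1::real)" "\<rho> \<ge> (1::real)"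
proof -
  let ?n = "CARD('n)"
  obtain d c where d: "dfam d" "\<And>x. \<bar>x\<bar> \<le> 1 \<Longrightarrow> d 0 x = 1" "\<And>x. \<bar>x\<bar> \<ge> 3 \<Longrightarrow> d 0 x = 0"
    "\<And>k x. \<bar>d k x\<bar> \<le> c k"
    using ex_plateau_dfam by blast
  have c0: "c k \<ge> 0" for k using d(4)[of k 0] by linarith
  \<comment> \<open>The r averagings together move the edges by r a <= 1/2.\<close>
  define a where "a r = 1 / (2 * (real r + 1))" for r
  have a: "a r > 0" "real r * a r \<le> 1 / 2" for r by (auto simp: a_def field_simps)
  have "\<exists>e. dfam e \<and> (\<forall>x. \<bar>x\<bar> \<le> 1 - real r * a r \<longrightarrow> e 0 x = 1) \<and>
    (\<forall>x. \<bar>x\<bar> \<ge> 3 + real r * a r \<longrightarrow> e 0 x = 0) \<and> (\<forall>k x. \<bar>e k x\<bar> \<le> c k) \<and>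
    (\<forall>k x. k \<le> r \<longrightarrow> \<bar>e k x\<bar> \<le> c 0 * (1 / a r) ^ k)" for r
    by (rule iterated_box_average[OF d a(1)])
  then obtain e where e: "\<And>r. dfam (e r)" "\<And>r x. \<bar>x\<bar> \<le> 1 - real r * a r \<Longrightarrow> e r 0 x = 1"
    "\<And>r x. \<bar>x\<bar> \<ge> 3 + real r * a r \<Longrightarrow> e r 0 x = 0" "\<And>r k x. \<bar>e r k x\<bar> \<le> c k"
    "\<And>r k x. k \<le> r \<Longrightarrow> \<bar>e r k x\<bar> \<le> c 0 * (1 / a r) ^ k" by metis
  \<comment> \<open>After averaging the profile is 1 for |x| <= 1/2 and 0 for |x| >= 4; this scaling
    turns the two radii into \<delta> and 8 \<delta>.\<close>
  define s where "s = 1 / (2 * \<delta>)"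
  have s: "s > 0" using \<delta> by (simp add: s_def)
  define f where "f r j k t = s ^ k * e r k (s * t + (- s * x0 $ j))" for r j k t
  have f: "dfam (f r j)" for r j unfolding f_def[abs_def] by (intro dfam_affine e)
  have f0: "f r j k t = s ^ k * e r k (s * (t - x0 $ j))" for r j k t
    by (simp add: f_def algebra_simps)
  define \<phi> where "\<phi> r x = complex_of_real (\<Prod>j\<in>UNIV. f r j 0 (x $ j))" for r x
  define C where "C l = (1 + (\<Sum>k\<le>l. c k)) ^ ?n * s ^ l" for l
  define E where "E = (1 + c 0) ^ ?n * exp 1"
  define \<rho> where "\<rho> = 1 + 2 * s"
  have p1: "(1 + c 0) ^ ?n \<ge> 1" using c0[of 0] by (intro one_le_power) simp
  have E1: "E \<ge> 1"
    unfolding E_def using mult_mono[of 1 "(1 + c 0) ^ ?n" 1 "exp 1"] p1 by simp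
  have nrm: "norm (pdiff_list is (\<phi> r) x) = (\<Prod>j\<in>UNIV. \<bar>f r j (count_list is j) (x $ j)\<bar>)" for "is" r x
    unfolding \<phi>_def[abs_def] pdiff_list_prod_dfam[of "f r", OF f] norm_of_real abs_prod ..
  have pw: "(\<Prod>j\<in>UNIV. t ^ count_list is (j::'n)) = t ^ length is" for t :: real and "is"
    by (simp add: power_sum[symmetric] sum_count_list_UNIV)
  show ?thesis
  proof
    show "smooth_on UNIV (\<phi> r)" for r
      unfolding \<phi>_def[abs_def] by (intro smooth_on_prod_dfam f)
    show "\<phi> r x = 1" if "\<And>i. \<bar>x $ i - x0 $ i\<bar> \<le> \<delta>" for r x
    proof -
      have "f r j 0 (x $ j) = 1" for j
      proof -
        have "s * \<bar>x $ j - x0 $ j\<bar> \<le> s * \<delta>" using that s by (intro mult_left_mono) auto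
        then have "\<bar>s * (x $ j - x0 $ j)\<bar> \<le> 1 / 2" using s \<delta> by (simp add: abs_mult s_def)
        then show ?thesis unfolding f0 using a(2)[of r] by (simp add: e(2))
      qed
      then show ?thesis by (simp add: \<phi>_def)
    qed
    show "\<phi> r x = 0" if "\<bar>x $ i - x0 $ i\<bar> \<ge> 8 * \<delta>" for r x i
    proof -
      have "s * \<bar>x $ i - x0 $ i\<bar> \<ge> s * (8 * \<delta>)" using that s by (intro mult_left_mono) auto
      then have "\<bar>s * (x $ i - x0 $ i)\<bar> \<ge> 4" using s \<delta> by (simp add: abs_mult s_def)
      then have "f r i 0 (x $ i) = 0" unfolding f0 using a(2)[of r] by (simp add: e(3))
      then have "(\<Prod>j\<in>UNIV. f r j 0 (x $ j)) = 0" by (intro prod_zero) auto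
      then show ?thesis by (simp add: \<phi>_def)
    qed
    show "norm (pdiff_list is (\<phi> r) x) \<le> C (length is)" for r "is" x
    proof -
      have "(\<Prod>j\<in>UNIV. \<bar>f r j (count_list is j) (x $ j)\<bar>) \<le>
          (\<Prod>j\<in>(UNIV::'n set). s ^ count_list is j * (1 + (\<Sum>k\<le>length is. c k)))"
      proof (intro prod_mono conjI)
        fix j :: 'n
        have "c (count_list is j) \<le> (\<Sum>k\<le>length is. c k)"
          by (rule member_le_sum) (auto simp: c0 count_le_length)
        then have "\<bar>e r (count_list is j) (s * (x $ j - x0 $ j))\<bar> \<le> 1 + (\<Sum>k\<le>length is. c k)"
          using e(4)[of r "count_list is j" "s * (x $ j - x0 $ j)"] by linarith
        then show "\<bar>f r j (count_list is j) (x $ j)\<bar> \<le> s ^ count_list is j * (1 + (\<Sum>k\<le>length is. c k))"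
          unfolding f0 abs_mult using s by (intro mult_mono) auto
      qed auto
      then show ?thesis unfolding nrm C_def by (simp add: prod.distrib pw mult.commute)
    qed
    show "norm (pdiff_list is (\<phi> r) x) \<le> E * E ^ r * \<rho> ^ length is * fact (length is)"
      if "length is \<le> r" for r "is" x
    proof -
      have "(\<Prod>j\<in>UNIV. \<bar>f r j (count_list is j) (x $ j)\<bar>) \<le>
          (\<Prod>j\<in>(UNIV::'n set). s ^ count_list is j * ((1 + c 0) * (1 / a r) ^ count_list is j))"
      proof (intro prod_mono conjI)
        fix j :: 'n
        have "count_list is j \<le> r" using that count_le_length[of "is" j] by linarith
        then have "\<bar>e r (count_list is j) (s * (x $ j - x0 $ j))\<bar> \<le> c 0 * (1 / a r) ^ count_list is j"
          by (rule e)
        also have "\<dots> \<le> (1 + c 0) * (1 / a r) ^ count_list is j"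
          using a(1)[of r] by (intro mult_right_mono) auto
        finally show "\<bar>f r j (count_list is j) (x $ j)\<bar> \<le> s ^ count_list is j * ((1 + c 0) * (1 / a r) ^ count_list is j)"
          unfolding f0 abs_mult using s by (intro mult_mono) auto
      qed auto
      also have "\<dots> = (1 + c 0) ^ ?n * (s * (1 / a r)) ^ length is"
        unfolding prod.distrib pw power_mult_distrib by simp
      also have "(s * (1 / a r)) ^ length is = (2 * s) ^ length is * (real r + 1) ^ length is"
        unfolding power_mult_distrib[symmetric] by (rule arg_cong[of _ _ "\<lambda>t. t ^ length is"]) (simp add: a_def)
      also have "\<dots> \<le> \<rho> ^ length is * (exp (real r + 1) * fact (length is))"
        proof (rule mult_mono)
          show "(2 * s) ^ length is \<le> \<rho> ^ length is"
            using s by (intro power_mono) (auto simp: \<rho>_def)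
          show "(real r + 1) ^ length is \<le> exp (real r + 1) * fact (length is)"
            by (rule power_le_exp_fact) simp
        qed (use s in \<open>simp_all add: \<rho>_def\<close>)
      also have "(1 + c 0) ^ ?n * (\<rho> ^ length is * (exp (real r + 1) * fact (length is))) \<le>
          E * E ^ r * \<rho> ^ length is * fact (length is)"
      proof -
        have "exp (real r + 1) = exp 1 * exp 1 ^ r"
          by (simp add: exp_add exp_of_nat_mult[symmetric] mult.commute)
        moreover have "exp 1 ^ r \<le> E ^ r"
          by (intro power_mono) (use mult_right_mono[OF p1, of "exp 1"] in \<open>auto simp: E_def\<close>)
        ultimately have "(1 + c 0) ^ ?n * exp (real r + 1) \<le> E * E ^ r"
          using c0[of 0] by (auto simp: E_def intro!: mult_left_mono)
        then have "((1 + c 0) ^ ?n * exp (real r + 1)) * (\<rho> ^ length is * fact (length is)) \<le>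
            (E * E ^ r) * (\<rho> ^ length is * fact (length is))"
          by (intro mult_right_mono) (use s in \<open>auto simp: \<rho>_def\<close>)
        then show ?thesis by (simp add: mult_ac)
      qed
      finally show ?thesis using c0[of 0] unfolding nrm by (simp add: mult_left_mono)
    qed
    show "E \<ge> 1" by fact
    show "\<rho> \<ge> 1" using s by (simp add: \<rho>_def)
  qed
qed

section \<open>Fourier series of smooth functions\<close>

lemma infsum_diff_finite:
  fixes f :: "'a \<Rightarrow> 'b::banach"
  assumes "f summable_on UNIV" "finite \<Phi>"
  shows "infsum f UNIV - sum f \<Phi> = infsum f (- \<Phi>)"
proof -
  have "f summable_on - \<Phi>" using assms(1) by (rule summable_on_subset_banach) simp
  then have "infsum f (\<Phi> \<union> - \<Phi>) = infsum f \<Phi> + infsum f (- \<Phi>)"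
    using assms(2) by (intro infsum_Un_disjoint) auto
  then show ?thesis using assms(2) by simp
qed

lemma infsum_tail_le:
  fixes f :: "'a \<Rightarrow> 'b::banach"
  assumes D: "D summable_on UNIV" and f: "\<And>k. norm (f k) \<le> D k" and \<Phi>: "finite \<Phi>"
  shows "f summable_on UNIV" and "norm (infsum f UNIV - sum f \<Phi>) \<le> infsum D UNIV - sum D \<Phi>"
proof -
  have "D k \<ge> 0" for k using f[of k] norm_ge_zero order_trans by blast
  then have "(\<lambda>k. norm (D k)) summable_on UNIV" using D by simp
  then have "(\<lambda>k. norm (f k)) summable_on UNIV"
    by (rule Infinite_Sum.abs_summable_on_comparison_test) (use f \<open>\<And>k. D k \<ge> 0\<close> in auto)
  then show s: "f summable_on UNIV" by (rule Infinite_Sum.abs_summable_summable)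
  have "f summable_on - \<Phi>" "D summable_on - \<Phi>"
    using s D by (auto intro: summable_on_subset_banach)
  then have "(f has_sum infsum f (- \<Phi>)) (- \<Phi>)" "(D has_sum infsum D (- \<Phi>)) (- \<Phi>)"
    by simp_all
  from norm_infsum_le[OF this f]
  show "norm (infsum f UNIV - sum f \<Phi>) \<le> infsum D UNIV - sum D \<Phi>"
    unfolding infsum_diff_finite[OF s \<Phi>] infsum_diff_finite[OF D \<Phi>] .
qed

text \<open>Tannery's theorem: a finite set carries all but e/4 of the dominating sum, and on it the
  limit is taken term by term.\<close>

lemma dominated_infsum_LIMSEQ:
  fixes F :: "nat \<Rightarrow> 'a \<Rightarrow> 'b::banach"
  assumes D: "D summable_on UNIV" and F: "\<And>r k. norm (F r k) \<le> D k"
    and lim: "\<And>k. (\<lambda>r. F r k) \<longlonglongrightarrow> G k"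
  shows "(\<lambda>r. infsum (F r) UNIV) \<longlonglongrightarrow> infsum G UNIV"
proof (rule LIMSEQ_I)
  fix e :: real assume e: "e > 0"
  have G: "norm (G k) \<le> D k" for k
    by (rule LIMSEQ_le_const2[OF tendsto_norm[OF lim]]) (use F in auto)
  obtain \<Phi> where \<Phi>: "finite \<Phi>" "dist (sum D \<Phi>) (infsum D UNIV) \<le> e / 4"
    using infsum_finite_approximation[OF D, of "e / 4"] e by auto
  then have tail: "infsum D UNIV - sum D \<Phi> \<le> e / 4" unfolding dist_real_def by linarith
  have "(\<lambda>r. sum (F r) \<Phi>) \<longlonglongrightarrow> sum G \<Phi>" by (intro tendsto_sum lim)
  then obtain R where R: "\<And>r. r \<ge> R \<Longrightarrow> norm (sum (F r) \<Phi> - sum G \<Phi>) < e / 4"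
    using LIMSEQ_D[of _ _ "e / 4"] e by (metis zero_less_divide_iff zero_less_numeral)
  have "norm (infsum (F r) UNIV - infsum G UNIV) < e" if "r \<ge> R" for r
  proof -
    have "norm (infsum (F r) UNIV - infsum G UNIV) = norm ((infsum (F r) UNIV - sum (F r) \<Phi>) +
      (sum (F r) \<Phi> - sum G \<Phi>) - (infsum G UNIV - sum G \<Phi>))" by simp
    also have "\<dots> \<le> norm (infsum (F r) UNIV - sum (F r) \<Phi>) + norm (sum (F r) \<Phi> - sum G \<Phi>) +
      norm (infsum G UNIV - sum G \<Phi>)"
      by (rule order_trans[OF norm_triangle_ineq4 add_right_mono[OF norm_triangle_ineq]])
    finally show ?thesis
      using infsum_tail_le(2)[OF D F[of r] \<Phi>(1)] infsum_tail_le(2)[OF D G \<Phi>(1)] R[OF that] tail e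
      by linarith
  qed
  then show "\<exists>no. \<forall>n\<ge>no. norm (infsum (F n) UNIV - infsum G UNIV) < e" by blast
qed

section \<open>Lattice points and a summable weight on them\<close>

definition kv :: "('n::finite \<Rightarrow> int) \<Rightarrow> real^'n" where
  "kv k = (\<chi> i. of_int (k i))"

definition lbox :: "nat \<Rightarrow> ('n::finite \<Rightarrow> int) set" where
  "lbox r = PiE UNIV (\<lambda>_. {- int r..int r})"

lemma lbox_iff: "k \<in> lbox r \<longleftrightarrow> (\<forall>i. \<bar>k i\<bar> \<le> int r)"
  by (auto simp: lbox_def PiE_iff abs_le_iff minus_le_iff)

lemma finite_lbox [simp]: "finite (lbox r)"
  by (auto simp: lbox_def intro: finite_PiE)

lemma card_lbox: "card (lbox r :: ('n::finite \<Rightarrow> int) set) = (2 * r + 1) ^ CARD('n)"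
proof -
  have "card {- int r..int r} = 2 * r + 1" unfolding card_atLeastAtMost_int by linarith
  then show ?thesis by (simp add: lbox_def card_PiE)
qed

text \<open>A fixed summable majorant on the lattice; the product form makes its sum over a box
  factor into one-dimensional sums.\<close>

definition lattice_weight :: "('n::finite \<Rightarrow> int) \<Rightarrow> real" where
  "lattice_weight k = (\<Prod>j\<in>UNIV. 1 / (1 + \<bar>of_int (k j)\<bar>)\<^sup>2)"

lemma lattice_weight_pos: "lattice_weight k > 0"
  unfolding lattice_weight_def by (intro prod_pos) (auto simp: add_pos_nonneg intro!: zero_less_power)

lemma interval_Suc_int: "{- int (Suc R)..int (Suc R)} = insert (- int (Suc R)) (insert (int (Suc R)) {- int R..int R})"
  by auto

text \<open>The subtracted term 2 / (R + 1) makes the induction close: the two new summands are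
  bounded by a telescoping difference.\<close>

lemma sum_inverse_squares_le:
  "(\<Sum>t\<in>{- int R..int R}. 1 / (1 + \<bar>real_of_int t\<bar>)\<^sup>2) \<le> 4 - 2 / (real R + 1)"
proof (induction R)
  case (Suc R)
  have "(\<Sum>t\<in>{- int (Suc R)..int (Suc R)}. 1 / (1 + \<bar>real_of_int t\<bar>)\<^sup>2) =
      2 / (real R + 2)\<^sup>2 + (\<Sum>t\<in>{- int R..int R}. 1 / (1 + \<bar>real_of_int t\<bar>)\<^sup>2)"
    unfolding interval_Suc_int by (simp add: add_ac)
  also have "2 / (real R + 2)\<^sup>2 \<le> 2 / ((real R + 1) * (real R + 2))"
    unfolding power2_eq_square by (intro divide_left_mono mult_right_mono) auto
  also have "\<dots> = 2 / (real R + 1) - 2 / (real R + 2)" by (simp add: field_simps)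
  finally show ?case using Suc.IH by (simp add: add_ac)
qed simp

lemma sum_lattice_weight_le:
  assumes "finite \<Phi>"
  shows "sum lattice_weight (\<Phi> :: ('n::finite \<Rightarrow> int) set) \<le> 4 ^ CARD('n)"
proof -
  define R where "R = nat (\<Sum>k\<in>\<Phi>. \<Sum>i\<in>UNIV. \<bar>k i\<bar>)"
  have "\<Phi> \<subseteq> lbox R"
  proof
    fix k assume k: "k \<in> \<Phi>"
    have "\<bar>k i\<bar> \<le> (\<Sum>k\<in>\<Phi>. \<Sum>i\<in>UNIV. \<bar>k i\<bar>)" for i
    proof -
      have "\<bar>k i\<bar> \<le> (\<Sum>i\<in>UNIV. \<bar>k i\<bar>)" by (rule member_le_sum) auto
      also have "\<dots> \<le> (\<Sum>k\<in>\<Phi>. \<Sum>i\<in>UNIV. \<bar>k i\<bar>)"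
        using k assms by (intro member_le_sum[of k \<Phi> "\<lambda>k. \<Sum>i\<in>UNIV. \<bar>k i\<bar>"]) (auto intro: sum_nonneg)
      finally show ?thesis .
    qed
    moreover have "(\<Sum>k\<in>\<Phi>. \<Sum>i\<in>UNIV. \<bar>k i\<bar>) \<ge> 0" by (intro sum_nonneg) auto
    ultimately show "k \<in> lbox R" by (simp add: lbox_iff R_def)
  qed
  then have "sum lattice_weight \<Phi> \<le> sum lattice_weight (lbox R :: ('n \<Rightarrow> int) set)"
    by (intro sum_mono2) (auto intro: less_imp_le lattice_weight_pos)
  also have "\<dots> = (\<Prod>j\<in>(UNIV::'n set). \<Sum>t\<in>{- int R..int R}. 1 / (1 + \<bar>real_of_int t\<bar>)\<^sup>2)"
    unfolding lattice_weight_def lbox_def by (rule prod_sum_PiE[symmetric]) auto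
  also have "\<dots> \<le> (\<Prod>j\<in>(UNIV::'n set). 4)"
  proof (intro prod_mono conjI)
    show "(\<Sum>t\<in>{- int R..int R}. 1 / (1 + \<bar>real_of_int t\<bar>)\<^sup>2) \<le> 4"
      using sum_inverse_squares_le[of R] by (rule order_trans) simp
  qed (auto intro: sum_nonneg)
  finally show ?thesis by simp
qed

lemma summable_lattice_weight: "lattice_weight summable_on UNIV"
  by (rule nonneg_bdd_above_summable_on)
    (auto intro!: bdd_aboveI sum_lattice_weight_le less_imp_le[OF lattice_weight_pos])

lemma kv_nth [simp]: "kv k $ i = of_int (k i)"
  by (simp add: kv_def)

text \<open>The largest coordinate k_i dominates the others. Of the L + 2n powers available there,
  with n the dimension, L pay for the power of the norm and 2n for the lattice weight, since 1 +
  |k_j| <= 2 |k_i| for every j.\<close>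

lemma lattice_decay:
  fixes k :: "'n::finite \<Rightarrow> int"
  assumes a: "a \<ge> 0" and \<omega>: "\<omega> > 0" and B: "\<And>i. (\<omega> * \<bar>of_int (k i)\<bar>) ^ (L + 2 * CARD('n)) * a \<le> B"
    and k: "k \<noteq> (\<lambda>_. 0)"
  shows "norm (\<omega> *\<^sub>R kv k) ^ L * a \<le> real CARD('n) ^ L * (2 / \<omega>) ^ (2 * CARD('n)) * B * lattice_weight k"
proof -
  let ?n = "CARD('n)"
  obtain i where i: "\<And>j. \<bar>k j\<bar> \<le> \<bar>k i\<bar>"
  proof -
    have "Max (range (\<lambda>j. \<bar>k j\<bar>)) \<in> range (\<lambda>j. \<bar>k j\<bar>)" by (rule Max_in) auto
    then obtain i where i: "Max (range (\<lambda>j. \<bar>k j\<bar>)) = \<bar>k i\<bar>" by (rule rangeE)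
    have "\<bar>k j\<bar> \<le> \<bar>k i\<bar>" for j unfolding i[symmetric] by (rule Max_ge) auto
    then show ?thesis by (rule that)
  qed
  define t where "t = \<bar>real_of_int (k i)\<bar>"
  have "k i \<noteq> 0"
  proof
    assume "k i = 0"
    then have "\<And>j. k j = 0" using i by force
    then show False using k by auto
  qed
  then have "\<bar>k i\<bar> \<ge> 1" by linarith
  then have t1: "t \<ge> 1" unfolding t_def by linarith
  have tj: "\<bar>real_of_int (k j)\<bar> \<le> t" for j unfolding t_def using i[of j] by linarith
  have "norm (kv k) \<le> (\<Sum>j\<in>UNIV. \<bar>kv k $ j\<bar>)" by (rule norm_le_l1_cart)
  also have "\<dots> \<le> (\<Sum>j\<in>(UNIV::'n set). t)" by (intro sum_mono) (simp add: tj)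
  finally have nk: "norm (\<omega> *\<^sub>R kv k) \<le> real ?n * (\<omega> * t)" using \<omega> by (simp add: mult_left_mono mult.left_commute)
  have "1 / (2 * t) ^ (2 * ?n) = (\<Prod>j\<in>(UNIV::'n set). 1 / (2 * t)\<^sup>2)"
    by (simp add: power_mult power_one_over)
  also have "\<dots> \<le> lattice_weight k"
    unfolding lattice_weight_def
  proof (intro prod_mono conjI)
    fix j
    have "1 + \<bar>real_of_int (k j)\<bar> \<le> 2 * t" using tj[of j] t1 by linarith
    then show "1 / (2 * t)\<^sup>2 \<le> 1 / (1 + \<bar>real_of_int (k j)\<bar>)\<^sup>2"
      using t1 by (intro divide_left_mono power_mono) (auto intro!: mult_pos_pos zero_less_power)
  qed auto
  finally have w: "1 / (2 * t) ^ (2 * ?n) \<le> lattice_weight k" .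
  have B0: "B \<ge> 0" using B[of i] a \<omega> by (smt (verit) mult_nonneg_nonneg zero_le_power abs_ge_zero)
  have "norm (\<omega> *\<^sub>R kv k) ^ L * a \<le> (real ?n * (\<omega> * t)) ^ L * a"
    by (intro mult_right_mono power_mono nk a) auto
  also have "\<dots> = real ?n ^ L * ((\<omega> * t) ^ (L + 2 * ?n) * a) / (\<omega> * t) ^ (2 * ?n)"
    using \<omega> t1 by (simp add: power_mult_distrib power_add)
  also have "\<dots> \<le> real ?n ^ L * B / (\<omega> * t) ^ (2 * ?n)"
    using B[of i] \<omega> t1 by (intro divide_right_mono mult_left_mono) (auto simp: t_def)
  also have "\<dots> = real ?n ^ L * (2 / \<omega>) ^ (2 * ?n) * B * (1 / (2 * t) ^ (2 * ?n))"
    using \<omega> t1 by (simp add: power_mult_distrib power_divide)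
  also have "\<dots> \<le> real ?n ^ L * (2 / \<omega>) ^ (2 * ?n) * B * lattice_weight k"
    using \<omega> B0 by (intro mult_left_mono w) auto
  finally show ?thesis .
qed

section \<open>Roots of unity and the discrete Fourier transform\<close>

lemma norm_cis_diff_one: "norm (cis \<theta> - 1) = 2 * \<bar>sin (\<theta> / 2)\<bar>"
  using dist_exp_i_1[of \<theta>] by (simp add: cis_conv_exp)

text \<open>A crude form of Jordan's inequality is enough: the constant only enters the geometric
  factor 4^l in the decay of the coefficients.\<close>

lemma sin_ge_quarter: assumes "0 \<le> x" "x \<le> pi / 2" shows "sin x \<ge> x / 4"
proof (cases "x \<le> pi / 3")
  case True
  have "sin x - x / 2 \<ge> sin 0 - 0 / 2"
  proof (rule DERIV_nonneg_imp_nondecreasing[of 0 x "\<lambda>x. sin x - x / 2"])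
    fix y assume y: "0 \<le> y" "y \<le> x"
    have "cos (pi / 3) \<le> cos y" using y True by (intro cos_monotone_0_pi_le) auto
    then have "cos y \<ge> 1 / 2" by (simp add: cos_60)
    moreover have "((\<lambda>x. sin x - x / 2) has_real_derivative cos y - 1 / 2) (at y)"
      by (auto intro!: derivative_eq_intros)
    ultimately show "\<exists>z. ((\<lambda>x. sin x - x / 2) has_real_derivative z) (at y) \<and> 0 \<le> z" by force
  qed (use assms in auto)
  with assms show ?thesis by simp
next
  case False
  have "sin (pi / 3) \<le> sin x" using assms False by (intro sin_monotone_2pi_le) auto
  moreover have "sqrt 3 \<ge> 1" by (rule real_le_rsqrt) simp
  ultimately have "sin x \<ge> 1 / 2" unfolding sin_60 by linarith
  with assms pi_less_4 show ?thesis by linarith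
qed

lemma norm_cis_diff_one_ge: assumes "\<bar>\<theta>\<bar> \<le> pi" shows "norm (cis \<theta> - 1) \<ge> \<bar>\<theta>\<bar> / 4"
proof -
  have "\<bar>sin (\<theta> / 2)\<bar> = \<bar>sin \<bar>\<theta> / 2\<bar>\<bar>" by (cases "\<theta> \<ge> 0") auto
  then show ?thesis
    using sin_ge_quarter[of "\<bar>\<theta> / 2\<bar>"] assms unfolding norm_cis_diff_one by simp
qed

text \<open>The geometric sum over a symmetric range, kept multiplied out so that \<theta> may be a
  multiple of 2 \<pi>.\<close>

lemma sum_cis_int:
  "(\<Sum>k\<in>{- int r..int r}. cis (\<theta> * of_int k)) * (cis \<theta> - 1) = cis (\<theta> * (real r + 1)) - cis (- \<theta> * real r)"
proof (induction r)
  case (Suc r)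
  have "(\<Sum>k\<in>{- int (Suc r)..int (Suc r)}. cis (\<theta> * of_int k)) =
      cis (- \<theta> * (real r + 1)) + cis (\<theta> * (real r + 1)) + (\<Sum>k\<in>{- int r..int r}. cis (\<theta> * of_int k))"
    unfolding interval_Suc_int by (simp add: algebra_simps)
  then show ?case
    using Suc.IH by (simp add: distrib_right cis_mult algebra_simps)
qed (simp add: cis_mult)

text \<open>The number 2r + 1 of grid points exceeds |d|, so d = 0 is the only multiple of 2r + 1 in
  the range; for every other d the geometric sum closes up to zero.\<close>

lemma sum_cis_root:
  assumes "\<bar>d\<bar> \<le> 2 * int r"
  shows "(\<Sum>k\<in>{- int r..int r}. cis (2 * pi / (2 * real r + 1) * of_int d * of_int k)) =
    (if d = 0 then 2 * of_nat r + 1 else 0)"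
proof (cases "d = 0")
  case False
  define \<theta> where "\<theta> = 2 * pi / (2 * real r + 1) * of_int d"
  have "\<theta> * (real r + 1) = - \<theta> * real r + \<theta> * (2 * real r + 1)" by (simp add: algebra_simps)
  also have "\<theta> * (2 * real r + 1) = 2 * pi * of_int d" by (simp add: \<theta>_def field_simps)
  finally have "cis (\<theta> * (real r + 1)) = cis (- \<theta> * real r) * cis (2 * pi * of_int d)"
    by (simp only: cis_mult)
  then have "(\<Sum>k\<in>{- int r..int r}. cis (\<theta> * of_int k)) * (cis \<theta> - 1) = 0"
    unfolding sum_cis_int by (simp add: cis_multiple_2pi)
  moreover have "cis \<theta> \<noteq> 1"
  proof
    assume "cis \<theta> = 1"
    then have "cos \<theta> = 1" by (simp add: complex_eq_iff)
    then obtain n :: int where "\<theta> = of_int n * 2 * pi" unfolding cos_one_2pi_int by blast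
    then have "(2 * pi) * real_of_int d = (2 * pi) * (of_int n * (2 * real r + 1))"
      by (simp add: \<theta>_def field_simps)
    then have "real_of_int d = of_int n * (2 * real r + 1)"
      by (subst (asm) mult_cancel_left) simp
    then have "real_of_int d = of_int (n * (2 * int r + 1))" by simp
    then have d: "d = n * (2 * int r + 1)" by (simp only: of_int_eq_iff)
    with False have "\<bar>n\<bar> \<ge> 1" by auto
    then have "\<bar>n\<bar> * (2 * int r + 1) \<ge> 1 * (2 * int r + 1)" by (intro mult_right_mono) auto
    moreover have "\<bar>d\<bar> = \<bar>n\<bar> * (2 * int r + 1)" by (simp add: d abs_mult)
    ultimately have "1 * (2 * int r + 1) \<le> \<bar>d\<bar>" by (simp only:)
    from order_trans[OF this assms] show False by simp
  qed
  ultimately show ?thesis using False by (simp add: \<theta>_def)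
qed (simp add: of_nat_diff nat_add_distrib)

text \<open>The Fourier coefficients of a smooth function are obtained as limits of discrete ones: on the
  grid, inversion is an exact finite identity, and difference quotients give decay uniformly in \<open>r\<close>.\<close>

definition dft :: "real \<Rightarrow> nat \<Rightarrow> (real^'n::finite \<Rightarrow> complex) \<Rightarrow> ('n \<Rightarrow> int) \<Rightarrow> complex" where
  "dft T r f k = (\<Sum>j\<in>lbox r. f ((T / (2 * real r + 1)) *\<^sub>R kv j) *
      ee (- ((2 * pi / T) *\<^sub>R kv k)) ((T / (2 * real r + 1)) *\<^sub>R kv j)) / of_nat ((2 * r + 1) ^ CARD('n))"

lemma inner_kv: "kv j \<bullet> kv k = (\<Sum>i\<in>UNIV. of_int (j i) * of_int (k i))"
  by (simp add: inner_vec_def)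

lemma ee_kv:
  assumes "T > 0"
  shows "ee ((2 * pi / T) *\<^sub>R kv k) ((T / p) *\<^sub>R kv j) = cis (2 * pi / p * (\<Sum>i\<in>UNIV. of_int (j i) * of_int (k i)))"
  unfolding ee_def inner_scaleR_left inner_scaleR_right inner_kv
  by (rule arg_cong[of _ _ cis]) (use assms in \<open>simp add: field_simps\<close>)

lemma cis_sum: "finite A \<Longrightarrow> cis (\<Sum>i\<in>A. f i) = (\<Prod>i\<in>A. cis (f i))"
  by (induction A rule: finite_induct) (auto simp: cis_mult[symmetric])

text \<open>Orthogonality of characters: after exchanging the sums, the inner one factors over the
  coordinates, and \<open>sum_cis_root\<close> leaves equal indices only.\<close>

lemma dft_inversion:
  fixes f :: "real^'n::finite \<Rightarrow> complex"
  assumes T: "T > 0" and j: "j \<in> lbox r"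
  defines "p \<equiv> 2 * real r + 1"
  shows "(\<Sum>k\<in>lbox r. dft T r f k * ee ((2 * pi / T) *\<^sub>R kv k) ((T / p) *\<^sub>R kv j)) = f ((T / p) *\<^sub>R kv j)"
proof -
  let ?P = "of_nat ((2 * r + 1) ^ CARD('n)) :: complex"
  have orth: "(\<Sum>k\<in>lbox r. ee ((2 * pi / T) *\<^sub>R kv k) ((T / p) *\<^sub>R kv j) *
      ee (- ((2 * pi / T) *\<^sub>R kv k)) ((T / p) *\<^sub>R kv j')) = (if j' = j then ?P else 0)"
    if j': "j' \<in> lbox r" for j' :: "'n \<Rightarrow> int"
  proof -
    have "ee ((2 * pi / T) *\<^sub>R kv k) ((T / p) *\<^sub>R kv j) * ee (- ((2 * pi / T) *\<^sub>R kv k)) ((T / p) *\<^sub>R kv j')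
        = (\<Prod>i\<in>UNIV. cis (2 * pi / p * of_int (j i - j' i) * of_int (k i)))" for k
    proof -
      have "ee (- ((2 * pi / T) *\<^sub>R kv k)) ((T / p) *\<^sub>R kv j') =
          cis (- (2 * pi / p * (\<Sum>i\<in>UNIV. of_int (j' i) * of_int (k i))))"
        unfolding ee_def inner_minus_right inner_scaleR_left inner_scaleR_right inner_kv
        by (rule arg_cong[of _ _ cis]) (use T in \<open>simp add: field_simps\<close>)
      then have "ee ((2 * pi / T) *\<^sub>R kv k) ((T / p) *\<^sub>R kv j) * ee (- ((2 * pi / T) *\<^sub>R kv k)) ((T / p) *\<^sub>R kv j')
         = cis (\<Sum>i\<in>UNIV. 2 * pi / p * of_int (j i - j' i) * of_int (k i))"
        unfolding ee_kv[OF T] by (simp add: cis_mult sum_distrib_left sum_subtractf algebra_simps diff_divide_distrib)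
      then show ?thesis by (simp add: cis_sum)
    qed
    then have "(\<Sum>k\<in>lbox r. ee ((2 * pi / T) *\<^sub>R kv k) ((T / p) *\<^sub>R kv j) *
        ee (- ((2 * pi / T) *\<^sub>R kv k)) ((T / p) *\<^sub>R kv j')) =
        (\<Sum>k\<in>lbox r. \<Prod>i\<in>UNIV. cis (2 * pi / p * of_int (j i - j' i) * of_int (k i)))"
      by (intro sum.cong refl) simp
    also have "\<dots> = (\<Prod>i\<in>UNIV. \<Sum>t\<in>{- int r..int r}. cis (2 * pi / p * of_int (j i - j' i) * of_int t))"
      unfolding lbox_def by (rule prod_sum_PiE[symmetric]) auto
    also have "\<dots> = (\<Prod>i\<in>UNIV. if j i - j' i = 0 then 2 * of_nat r + 1 else 0)"
    proof (rule prod.cong)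
      fix i
      have "\<bar>j i\<bar> \<le> int r" "\<bar>j' i\<bar> \<le> int r" using j j' by (auto simp: lbox_iff)
      then show "(\<Sum>t\<in>{- int r..int r}. cis (2 * pi / p * of_int (j i - j' i) * of_int t)) =
          (if j i - j' i = 0 then 2 * of_nat r + 1 else 0)"
        unfolding p_def by (intro sum_cis_root) linarith
    qed simp
    also have "\<dots> = (if j' = j then ?P else 0)"
    proof (cases "j' = j")
      case False
      then obtain i where "j i - j' i \<noteq> 0" by force
      then have "(\<Prod>i\<in>UNIV. if j i - j' i = 0 then 2 * of_nat r + 1 else (0::complex)) = 0"
        by (intro prod_zero) auto
      with False show ?thesis by simp
    qed (simp add: add.commute)
    finally show ?thesis .
  qed
  have "(\<Sum>k\<in>lbox r. dft T r f k * ee ((2 * pi / T) *\<^sub>R kv k) ((T / p) *\<^sub>R kv j)) =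
     (\<Sum>k\<in>lbox r. \<Sum>j'\<in>lbox r. f ((T / p) *\<^sub>R kv j') / ?P *
       (ee ((2 * pi / T) *\<^sub>R kv k) ((T / p) *\<^sub>R kv j) * ee (- ((2 * pi / T) *\<^sub>R kv k)) ((T / p) *\<^sub>R kv j')))"
    unfolding dft_def p_def sum_divide_distrib sum_distrib_right
    by (intro sum.cong refl) (simp add: mult_ac)
  also have "\<dots> = (\<Sum>j'\<in>lbox r. f ((T / p) *\<^sub>R kv j') / ?P *
      (\<Sum>k\<in>lbox r. ee ((2 * pi / T) *\<^sub>R kv k) ((T / p) *\<^sub>R kv j) * ee (- ((2 * pi / T) *\<^sub>R kv k)) ((T / p) *\<^sub>R kv j')))"
    by (subst sum.swap) (simp add: sum_distrib_left)
  also have "\<dots> = (\<Sum>j'\<in>lbox r. if j' = j then f ((T / p) *\<^sub>R kv j') else 0)"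
  proof (rule sum.cong)
    fix j' :: "'n \<Rightarrow> int" assume "j' \<in> lbox r"
    moreover have "?P \<noteq> 0" unfolding of_nat_eq_0_iff by simp
    ultimately show "f ((T / p) *\<^sub>R kv j') / ?P *
      (\<Sum>k\<in>lbox r. ee ((2 * pi / T) *\<^sub>R kv k) ((T / p) *\<^sub>R kv j) * ee (- ((2 * pi / T) *\<^sub>R kv k)) ((T / p) *\<^sub>R kv j'))
      = (if j' = j then f ((T / p) *\<^sub>R kv j') else 0)"
      by (simp only: orth) (simp del: of_nat_power)
  qed simp
  also have "\<dots> = f ((T / p) *\<^sub>R kv j)" using j by simp
  finally show ?thesis .
qed

lemma norm_dft_le:
  fixes f :: "real^'n::finite \<Rightarrow> complex"
  assumes "\<And>x. norm (f x) \<le> B"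
  shows "norm (dft T r f k) \<le> B"
proof -
  let ?P = "real ((2 * r + 1) ^ CARD('n))"
  have "norm (\<Sum>j\<in>lbox r. f ((T / (2 * real r + 1)) *\<^sub>R kv j) *
      ee (- ((2 * pi / T) *\<^sub>R kv k)) ((T / (2 * real r + 1)) *\<^sub>R kv j)) \<le> (\<Sum>j\<in>(lbox r :: ('n \<Rightarrow> int) set). B)"
    by (intro sum_norm_le) (simp add: norm_mult assms)
  also have "\<dots> = ?P * B" by (simp add: card_lbox)
  finally have "norm (\<Sum>j\<in>lbox r. f ((T / (2 * real r + 1)) *\<^sub>R kv j) *
      ee (- ((2 * pi / T) *\<^sub>R kv k)) ((T / (2 * real r + 1)) *\<^sub>R kv j)) / ?P \<le> B"
    by (subst pos_divide_le_eq) (auto simp: mult.commute)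
  then show ?thesis unfolding dft_def norm_divide norm_of_nat .
qed

text \<open>Translation by one grid step reindexes the sum. The margin condition makes f vanish at
  the grid points that enter or leave the box, so no boundary term arises.\<close>

lemma dft_shift:
  fixes f :: "real^'n::finite \<Rightarrow> complex"
  assumes T: "T > 0" and supp: "\<And>x i. s < \<bar>x $ i\<bar> \<Longrightarrow> f x = 0" and s: "s + T / (2 * real r + 1) \<le> T / 2"
  defines "h \<equiv> T / (2 * real r + 1)"
  shows "dft T r (\<lambda>x. f (x + h *\<^sub>R axis i 1)) k = cis (2 * pi * of_int (k i) / (2 * real r + 1)) * dft T r f k"
proof -
  let ?\<eta> = "- ((2 * pi / T) *\<^sub>R kv k)"
  let ?sh = "\<lambda>j :: 'n \<Rightarrow> int. j(i := j i + 1)"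
  have h: "h > 0" using T by (simp add: h_def)
  have hr: "h * (real r + 1) > T / 2" using T by (simp add: h_def field_simps)
  have kvs: "kv (?sh j) = kv j + axis i 1" for j
    by (simp add: vec_eq_iff axis_def)
  have out: "f (h *\<^sub>R kv j) = 0 \<and> f (h *\<^sub>R kv (?sh j)) = 0" if jr: "j \<notin> lbox r" for j
  proof -
    obtain l where "\<bar>j l\<bar> > int r" using jr by (meson lbox_iff not_le)
    then have "\<bar>real_of_int (j l)\<bar> \<ge> real r + 1" by linarith
    then have "h * \<bar>real_of_int (j l)\<bar> \<ge> h * (real r + 1)" using h by (intro mult_left_mono) auto
    then have b: "\<bar>h * real_of_int (j l)\<bar> > T / 2" using hr unfolding abs_mult abs_of_pos[OF h] by linarith
    then have "\<bar>(h *\<^sub>R kv j) $ l\<bar> > s" using s h by (simp add: h_def[symmetric])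
    moreover have "\<bar>(h *\<^sub>R kv (?sh j)) $ l\<bar> > s"
    proof (cases "l = i")
      case True
      have "\<bar>h * real_of_int (j l) + h\<bar> > s" using b s h by (simp add: h_def[symmetric])
      then show ?thesis using True by (simp add: distrib_left)
    qed (use b s h in \<open>simp add: h_def[symmetric]\<close>)
    ultimately show ?thesis using supp by blast
  qed
  define F where "F j = f (h *\<^sub>R kv j) * ee ?\<eta> (h *\<^sub>R kv j)" for j
  have inj: "inj ?sh"
  proof (rule injI)
    fix a b assume eq: "?sh a = ?sh b"
    show "a = b"
    proof
      fix l show "a l = b l" using fun_cong[OF eq, of l] by (cases "l = i") auto
    qed
  qed
  have z: "ee ?\<eta> (h *\<^sub>R axis i 1) = cis (- (2 * pi * of_int (k i) / (2 * real r + 1)))"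
    using T by (simp add: ee_def h_def inner_axis inner_commute[of "axis i 1"] mult.assoc)
  have "f (h *\<^sub>R kv j + h *\<^sub>R axis i 1) * ee ?\<eta> (h *\<^sub>R kv j) =
      cis (2 * pi * of_int (k i) / (2 * real r + 1)) * F (?sh j)" for j
  proof -
    have "ee ?\<eta> (h *\<^sub>R kv (?sh j)) = ee ?\<eta> (h *\<^sub>R kv j) * ee ?\<eta> (h *\<^sub>R axis i 1)"
      unfolding kvs scaleR_add_right ee_def inner_add_left cis_mult ..
    then show ?thesis
      unfolding F_def z by (simp add: kvs scaleR_add_right cis_mult mult_ac)
  qed
  then have "(\<Sum>j\<in>lbox r. f (h *\<^sub>R kv j + h *\<^sub>R axis i 1) * ee ?\<eta> (h *\<^sub>R kv j)) =
      cis (2 * pi * of_int (k i) / (2 * real r + 1)) * (\<Sum>j\<in>lbox r. F (?sh j))"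
    by (simp add: sum_distrib_left)
  also have "(\<Sum>j\<in>lbox r. F (?sh j)) = sum F (?sh ` lbox r)"
    using inj by (subst sum.reindex) (auto simp: inj_on_def inj_def)
  also have "\<dots> = sum F (lbox r)"
  proof (rule sum.mono_neutral_cong)
    show "F j = 0" if j: "j \<in> lbox r - ?sh ` lbox r" for j
    proof -
      have "?sh (j(i := j i - 1)) = j" by auto
      then have "j(i := j i - 1) \<notin> lbox r"
        using j imageI[of "j(i := j i - 1)" "lbox r" ?sh] by auto
      from out[OF this] show ?thesis by (simp add: F_def)
    qed
    show "F j = 0" if "j \<in> ?sh ` lbox r - lbox r" for j using out[of j] that by (auto simp: F_def)
  qed auto
  finally show ?thesis
    unfolding dft_def h_def[symmetric] times_divide_eq_right
    by (simp only: F_def[abs_def] times_divide_eq_right)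
qed

lemma smooth_on_translate:
  assumes "smooth_on UNIV f"
  shows "smooth_on UNIV (\<lambda>x. f (x + v))" and "pdiff_list is (\<lambda>x. f (x + v)) x = pdiff_list is f (x + v)"
proof -
  let ?F = "\<lambda>is x. pdiff_list is f (x + v)"
  have c: "continuous_on UNIV (?F is)" for "is"
    by (rule continuous_on_compose2[OF smooth_onD(1)[OF assms]]) (auto intro!: continuous_intros)
  have d: "has_dir i (?F is) (?F (i # is) x) x" for i "is" x
    using smooth_onD(2)[OF assms, of "x + v" i "is"] unfolding has_dir_def by (simp add: algebra_simps)
  show "smooth_on UNIV (\<lambda>x. f (x + v))" by (rule smooth_onI_family(1)[where F = ?F]) (use c d in simp_all)
  show "pdiff_list is (\<lambda>x. f (x + v)) x = ?F is x"
    by (rule smooth_onI_family(2)[OF open_UNIV, where F = ?F]) (use c d in simp_all)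
qed

lemma has_dir_line:
  assumes "has_dir i f d (x + t *\<^sub>R axis i 1)"
  shows "((\<lambda>s. f (x + s *\<^sub>R axis i 1)) has_vector_derivative d) (at t)"
proof -
  have "((\<lambda>s. s - t) has_vector_derivative 1) (at t)" by (auto intro!: derivative_eq_intros)
  moreover have "((\<lambda>s. f (x + t *\<^sub>R axis i 1 + s *\<^sub>R axis i 1)) has_vector_derivative d) (at ((\<lambda>s. s - t) t))"
    using assms by (simp add: has_dir_def)
  ultimately have "((\<lambda>s. f (x + t *\<^sub>R axis i 1 + s *\<^sub>R axis i 1)) \<circ> (\<lambda>s. s - t) has_vector_derivative 1 *\<^sub>R d) (at t)"
    by (rule vector_diff_chain_at)
  then show ?thesis by (simp add: o_def algebra_simps)
qed

lemma norm_increment_le: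
  assumes "\<And>x. has_dir i f (f' x) x" "\<And>x. norm (f' x) \<le> B" "h \<ge> 0"
  shows "norm (f (x + h *\<^sub>R axis i 1) - f x) \<le> h * B"
proof -
  have "norm (f (x + h *\<^sub>R axis i 1) - f (x + 0 *\<^sub>R axis i 1)) \<le> B * norm (h - 0)"
  proof (rule differentiable_bound[of UNIV "\<lambda>s. f (x + s *\<^sub>R axis i 1)" "\<lambda>t s. s *\<^sub>R f' (x + t *\<^sub>R axis i 1)"])
    show "((\<lambda>s. f (x + s *\<^sub>R axis i 1)) has_derivative (\<lambda>s. s *\<^sub>R f' (x + t *\<^sub>R axis i 1))) (at t within UNIV)" for t
      using has_dir_line[OF assms(1)] by (simp add: has_vector_derivative_def)
    show "onorm (\<lambda>s. s *\<^sub>R f' (x + t *\<^sub>R axis i 1)) \<le> B" for t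
    proof (rule onorm_bound)
      show B: "0 \<le> B" by (rule order_trans[OF norm_ge_zero assms(2)])
      show "norm (s *\<^sub>R f' (x + t *\<^sub>R axis i 1)) \<le> B * norm s" for s
        using mult_left_mono[OF assms(2), of "\<bar>s\<bar>"] by (simp add: mult.commute)
    qed
  qed auto
  then show ?thesis using assms(3) by (simp add: mult.commute)
qed

text \<open>A discrete integration by parts. A difference of step h multiplies the coefficient by
  cis \<theta> - 1, of modulus at least |\<theta>| / 4, and is itself bounded by h times a
  derivative. The factor h cancels, so the estimate is uniform in r. Each difference widens the
  support by one step, hence the margin of l steps.\<close>

lemma dft_decay:
  fixes g :: "real^'n::finite \<Rightarrow> complex"
  assumes T: "T > 0" and k: "k \<in> lbox r"
  shows "smooth_on UNIV g \<Longrightarrow> (\<And>x i. s < \<bar>x $ i\<bar> \<Longrightarrow> g x = 0) \<Longrightarrow>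
    s + real l * (T / (2 * real r + 1)) \<le> T / 2 \<Longrightarrow> (\<And>x. norm (pdiff_list (replicate l i) g x) \<le> B) \<Longrightarrow>
    (2 * pi / T * \<bar>of_int (k i)\<bar>) ^ l * norm (dft T r g k) \<le> 4 ^ l * B"
proof (induction l arbitrary: g s B)
  case 0
  then show ?case using norm_dft_le[of g B T r k] by simp
next
  case (Suc l)
  define h where "h = T / (2 * real r + 1)"
  have h: "h > 0" using T by (simp add: h_def)
  let ?sh = "\<lambda>x. g (x + h *\<^sub>R axis i 1)"
  let ?\<Delta> = "\<lambda>x. ?sh x - g x"
  have sm1: "smooth_on UNIV ?sh" by (rule smooth_on_translate(1)[OF Suc.prems(1)])
  note sm = sm1 smooth_on_diff[OF open_UNIV sm1 Suc.prems(1)]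
  have supp: "?\<Delta> x = 0" if "s + h < \<bar>x $ j\<bar>" for x j
  proof -
    have "\<bar>(x + h *\<^sub>R axis i 1) $ j\<bar> \<ge> \<bar>x $ j\<bar> - h" using h by (auto simp: axis_def)
    then have "s < \<bar>(x + h *\<^sub>R axis i 1) $ j\<bar>" "s < \<bar>x $ j\<bar>" using that h by linarith+
    then show ?thesis using Suc.prems(2) by (metis diff_self)
  qed
  have "norm (pdiff_list (replicate l i) ?\<Delta> x) \<le> h * B" for x
  proof -
    have "pdiff_list (replicate l i) ?\<Delta> x = pdiff_list (replicate l i) ?sh x - pdiff_list (replicate l i) g x"
      by (rule pdiff_list_diff[OF open_UNIV sm(1) Suc.prems(1)]) simp
    also have "pdiff_list (replicate l i) ?sh x = pdiff_list (replicate l i) g (x + h *\<^sub>R axis i 1)"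
      by (rule smooth_on_translate(2)[OF Suc.prems(1)])
    finally show ?thesis
      using norm_increment_le[of i "pdiff_list (replicate l i) g" "pdiff_list (replicate (Suc l) i) g" B h x]
        smooth_onD(2)[OF Suc.prems(1), of _ i "replicate l i"] Suc.prems(4) h by simp
  qed
  then have IH: "(2 * pi / T * \<bar>of_int (k i)\<bar>) ^ l * norm (dft T r ?\<Delta> k) \<le> 4 ^ l * (h * B)"
    using Suc.prems(3) by (intro Suc.IH[OF sm(2), of "s + h"] supp) (auto simp: h_def algebra_simps add_divide_distrib)
  define \<theta> where "\<theta> = 2 * pi * real_of_int (k i) / (2 * real r + 1)"
  have "dft T r ?\<Delta> k = dft T r ?sh k - dft T r g k"
    unfolding dft_def by (simp add: sum_subtractf left_diff_distrib diff_divide_distrib)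
  also have "dft T r ?sh k = cis \<theta> * dft T r g k"
  proof -
    have "s + T / (2 * real r + 1) \<le> T / 2"
      using Suc.prems(3) mult_nonneg_nonneg[of "real l" h] h
      unfolding h_def[symmetric] of_nat_Suc distrib_right by linarith
    from dft_shift[OF T Suc.prems(2) this, where i = i and k = k] show ?thesis by (simp add: h_def \<theta>_def)
  qed
  finally have \<Delta>: "norm (dft T r ?\<Delta> k) = norm (cis \<theta> - 1) * norm (dft T r g k)"
    by (metis left_diff_distrib mult_1 norm_mult)
  have "\<bar>of_int (k i)\<bar> \<le> real r" using k unfolding lbox_iff by (metis of_int_abs of_int_le_iff of_int_of_nat_eq)
  then have "\<bar>\<theta>\<bar> \<le> pi * (2 * real r) / (2 * real r + 1)"
    unfolding \<theta>_def by (simp add: abs_mult divide_right_mono)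
  also have "\<dots> \<le> pi" by (simp add: field_simps)
  finally have "norm (cis \<theta> - 1) \<ge> \<bar>\<theta>\<bar> / 4" by (rule norm_cis_diff_one_ge)
  then have "\<bar>\<theta>\<bar> / 4 * norm (dft T r g k) \<le> norm (cis \<theta> - 1) * norm (dft T r g k)"
    by (rule mult_right_mono) simp
  moreover have "\<bar>\<theta>\<bar> = h * (2 * pi / T * \<bar>of_int (k i)\<bar>)"
    using T by (simp add: \<theta>_def h_def abs_mult)
  moreover have quarter: "x / 4 * N \<le> y \<Longrightarrow> x * N \<le> 4 * y" for x N y :: real by simp
  ultimately have "h * (2 * pi / T * \<bar>of_int (k i)\<bar>) / 4 * norm (dft T r g k) \<le> norm (cis \<theta> - 1) * norm (dft T r g k)"
    by (simp only:)
  then have "h * (2 * pi / T * \<bar>of_int (k i)\<bar>) * norm (dft T r g k) \<le> 4 * norm (dft T r ?\<Delta> k)"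
    unfolding \<Delta> by (rule quarter)
  then have "(2 * pi / T * \<bar>of_int (k i)\<bar>) ^ l * (h * (2 * pi / T * \<bar>of_int (k i)\<bar>) * norm (dft T r g k)) \<le>
      (2 * pi / T * \<bar>of_int (k i)\<bar>) ^ l * (4 * norm (dft T r ?\<Delta> k))"
    using T by (intro mult_left_mono) auto
  with IH have "h * ((2 * pi / T * \<bar>of_int (k i)\<bar>) ^ Suc l * norm (dft T r g k)) \<le> h * (4 ^ Suc l * B)"
    by (simp add: mult_ac)
  then show ?case using h by (simp only: mult_le_cancel_left_pos)
qed

section \<open>Trigonometric series and Fourier coefficients\<close>

lemma LIMSEQ_by_diff:
  fixes y :: "nat \<Rightarrow> 'a::real_normed_vector"
  assumes "(\<lambda>r. a - y r) \<longlonglongrightarrow> 0"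
  shows "y \<longlonglongrightarrow> a"
  using tendsto_diff[OF tendsto_const[of a] assms] by simp

lemma norm_cis_diff_le: "norm (cis a - cis b) \<le> \<bar>a - b\<bar>"
proof -
  have "cis a - cis b = cis b * (cis (a - b) - 1)" by (simp add: right_diff_distrib cis_mult)
  then have "norm (cis a - cis b) = 2 * \<bar>sin ((a - b) / 2)\<bar>" by (simp add: norm_mult norm_cis_diff_one)
  also have "\<dots> \<le> \<bar>a - b\<bar>" using abs_sin_x_le_abs_x[of "(a - b) / 2"] by simp
  finally show ?thesis .
qed

lemma norm_cis_taylor: "norm (cis a - 1 - \<i> * of_real a) \<le> a\<^sup>2"
  using Taylor_exp[of "\<i> * of_real a" 1] by (simp add: cis_conv_exp norm_mult power2_eq_square algebra_simps)

lemma norm_symbol_le: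
  fixes \<eta> :: "real^'n::finite"
  shows "norm (\<Prod>i\<leftarrow>is. \<i> * complex_of_real (\<eta> $ i)) \<le> norm \<eta> ^ length is"
proof (induction "is")
  case (Cons i js)
  have "norm (\<Prod>i\<leftarrow>i # js. \<i> * complex_of_real (\<eta> $ i)) = \<bar>\<eta> $ i\<bar> * norm (\<Prod>i\<leftarrow>js. \<i> * complex_of_real (\<eta> $ i))"
    by (simp add: norm_mult)
  also have "\<dots> \<le> norm \<eta> * norm \<eta> ^ length js"
    by (intro mult_mono Cons.IH component_le_norm_cart) auto
  finally show ?case by simp
qed simp

text \<open>Termwise differentiation by a direct remainder estimate: |cis a - 1 - i a| <= a^2 bounds
  the increment minus its linear part by t^2 times a moment of the coefficients two orders higher,
  and all moments are summable.\<close>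

lemma
  fixes a :: "'k \<Rightarrow> complex" and \<eta> :: "'k \<Rightarrow> real^'n::finite"
  assumes S: "\<And>L. (\<lambda>k. norm (\<eta> k) ^ L * norm (a k)) summable_on UNIV"
  defines "F \<equiv> \<lambda>is x. infsum (\<lambda>k. a k * (\<Prod>i\<leftarrow>is. \<i> * of_real (\<eta> k $ i)) * ee (\<eta> k) x) UNIV"
  shows summable_trig_series: "(\<lambda>k. a k * (\<Prod>i\<leftarrow>is. \<i> * of_real (\<eta> k $ i)) * ee (\<eta> k) x) summable_on UNIV"
    and smooth_on_trig_series: "smooth_on UNIV (F [])"
    and pdiff_list_trig_series: "pdiff_list is (F []) x = F is x"
proof -
  define tm where "tm is x k = a k * (\<Prod>i\<leftarrow>is. \<i> * of_real (\<eta> k $ i)) * ee (\<eta> k) x" for "is" x k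
  define M where "M L = infsum (\<lambda>k. norm (\<eta> k) ^ L * norm (a k)) UNIV" for L
  have M0: "M L \<ge> 0" for L unfolding M_def by (intro infsum_nonneg) auto
  have coeff: "norm (a k * (\<Prod>i\<leftarrow>is. \<i> * of_real (\<eta> k $ i))) \<le> norm (\<eta> k) ^ length is * norm (a k)" for k "is"
    unfolding norm_mult mult.commute[of "norm (a k)"] by (intro mult_right_mono norm_symbol_le) auto
  have "norm (tm is x k) \<le> norm (\<eta> k) ^ length is * norm (a k)" for k "is" x
    using coeff[of k "is"] by (simp add: tm_def norm_mult)
  from infsum_tail_le(1)[OF S this finite.emptyI] have sm: "tm is x summable_on UNIV" for "is" x .
  then show "(\<lambda>k. a k * (\<Prod>i\<leftarrow>is. \<i> * of_real (\<eta> k $ i)) * ee (\<eta> k) x) summable_on UNIV"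
    by (simp add: tm_def[abs_def])
  have F: "F is x = infsum (tm is x) UNIV" for "is" x by (simp add: F_def tm_def[abs_def])
  have hs: "(tm is x has_sum F is x) UNIV" for "is" x using sm by (simp add: F)
  have hs': "((\<lambda>k. - tm is x k) has_sum - F is x) UNIV" for "is" x
    using hs by (simp add: has_sum_uminus)
  have hs'': "((\<lambda>k. - (t * tm is x k)) has_sum - (t * F is x)) UNIV" for "is" x t
    using has_sum_cmult_right[OF hs, of "- t"] by simp
  have bound: "norm s \<le> B * M L" if s: "(f has_sum s) UNIV" and f: "\<And>k. norm (f k) \<le> B * (norm (\<eta> k) ^ L * norm (a k))"
    for f :: "'k \<Rightarrow> complex" and s B L
  proof -
    have "((\<lambda>k. B * (norm (\<eta> k) ^ L * norm (a k))) has_sum (B * M L)) UNIV"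
      unfolding M_def by (intro has_sum_cmult_right has_sum_infsum S)
    from norm_infsum_le[OF s this f] show ?thesis .
  qed
  have cont: "continuous_on UNIV (F is)" for "is"
  proof (rule lipschitz_on_continuous_on[OF lipschitz_onI])
    fix x y
    have "((\<lambda>k. tm is x k + - tm is y k) has_sum (F is x + - F is y)) UNIV"
      by (intro has_sum_add hs hs')
    moreover have "norm (tm is x k + - tm is y k) \<le> norm (x - y) * (norm (\<eta> k) ^ Suc (length is) * norm (a k))" for k
    proof -
      have "norm (ee (\<eta> k) x - ee (\<eta> k) y) \<le> \<bar>x \<bullet> \<eta> k - y \<bullet> \<eta> k\<bar>"
        unfolding ee_def by (rule norm_cis_diff_le)
      also have "\<dots> \<le> norm (x - y) * norm (\<eta> k)"
        unfolding inner_diff_left[symmetric] by (rule Cauchy_Schwarz_ineq2)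
      finally have "norm (a k * (\<Prod>i\<leftarrow>is. \<i> * of_real (\<eta> k $ i))) * norm (ee (\<eta> k) x - ee (\<eta> k) y) \<le>
          norm (\<eta> k) ^ length is * norm (a k) * (norm (x - y) * norm (\<eta> k))"
        by (intro mult_mono coeff) auto
      moreover have "tm is x k + - tm is y k =
          (a k * (\<Prod>i\<leftarrow>is. \<i> * of_real (\<eta> k $ i))) * (ee (\<eta> k) x - ee (\<eta> k) y)"
        unfolding tm_def by (simp add: right_diff_distrib)
      ultimately show ?thesis by (simp only: norm_mult power_Suc mult_ac)
    qed
    ultimately have "norm (F is x + - F is y) \<le> norm (x - y) * M (Suc (length is))" by (rule bound)
    then show "dist (F is x) (F is y) \<le> M (Suc (length is)) * dist x y"
      by (simp add: dist_norm mult.commute)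
  qed (rule M0)
  have der: "has_dir i (F is) (F (i # is) x) x" for i "is" x
    unfolding has_dir_def has_vector_derivative_def
  proof (rule has_derivativeI_sandwich[of 1])
    show "bounded_linear (\<lambda>t. t *\<^sub>R F (i # is) x)" by (rule bounded_linear_scaleR_left)
    show "((\<lambda>t. \<bar>t\<bar> * M (length is + 2)) \<longlongrightarrow> 0) (at 0 within UNIV)"
      by (rule tendsto_eq_intros refl | simp)+
    fix t :: real assume t: "t \<noteq> 0"
    have "((\<lambda>k. tm is (x + t *\<^sub>R axis i 1) k + - tm is x k + - (of_real t * tm (i # is) x k)) has_sum
        (F is (x + t *\<^sub>R axis i 1) + - F is x + - (of_real t * F (i # is) x))) UNIV"
      by (intro has_sum_add hs hs' hs'')
    moreover have "norm (tm is (x + t *\<^sub>R axis i 1) k + - tm is x k + - (of_real t * tm (i # is) x k)) \<le>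
        t\<^sup>2 * (norm (\<eta> k) ^ (length is + 2) * norm (a k))" for k
    proof -
      have e: "ee (\<eta> k) (x + t *\<^sub>R axis i 1) = ee (\<eta> k) x * cis (t * \<eta> k $ i)"
        by (simp add: ee_def inner_add_left inner_axis inner_commute[of "axis i 1"] cis_mult)
      have "tm is (x + t *\<^sub>R axis i 1) k + - tm is x k + - (of_real t * tm (i # is) x k) =
        (a k * (\<Prod>i\<leftarrow>is. \<i> * of_real (\<eta> k $ i))) * ee (\<eta> k) x * (cis (t * \<eta> k $ i) - 1 - \<i> * of_real (t * \<eta> k $ i))"
        unfolding tm_def e by (simp add: algebra_simps)
      then have "norm (tm is (x + t *\<^sub>R axis i 1) k + - tm is x k + - (of_real t * tm (i # is) x k)) =
        norm (a k * (\<Prod>i\<leftarrow>is. \<i> * of_real (\<eta> k $ i))) * norm (cis (t * \<eta> k $ i) - 1 - \<i> * of_real (t * \<eta> k $ i))"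
        by (simp only: norm_mult norm_ee mult_1_right)
      also have "\<dots> \<le> (norm (\<eta> k) ^ length is * norm (a k)) * (t\<^sup>2 * norm (\<eta> k) ^ 2)"
      proof (intro mult_mono coeff)
        have "norm (cis (t * \<eta> k $ i) - 1 - \<i> * of_real (t * \<eta> k $ i)) \<le> (t * \<eta> k $ i)\<^sup>2" by (rule norm_cis_taylor)
        also have "\<dots> = t\<^sup>2 * \<bar>\<eta> k $ i\<bar>\<^sup>2" by (simp add: power_mult_distrib)
        also have "\<dots> \<le> t\<^sup>2 * norm (\<eta> k) ^ 2"
          by (intro mult_left_mono power_mono component_le_norm_cart) auto
        finally show "norm (cis (t * \<eta> k $ i) - 1 - \<i> * of_real (t * \<eta> k $ i)) \<le> t\<^sup>2 * norm (\<eta> k) ^ 2" .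
      qed auto
      finally show ?thesis by (simp add: power_add power2_eq_square mult_ac)
    qed
    ultimately have "norm (F is (x + t *\<^sub>R axis i 1) + - F is x + - (of_real t * F (i # is) x)) \<le> t\<^sup>2 * M (length is + 2)"
      by (rule bound)
    then have "norm (F is (x + t *\<^sub>R axis i 1) + - F is x + - (of_real t * F (i # is) x)) / \<bar>t\<bar> \<le>
        t\<^sup>2 * M (length is + 2) / \<bar>t\<bar>"
      by (rule divide_right_mono) simp
    also have "t\<^sup>2 * M (length is + 2) / \<bar>t\<bar> = \<bar>t\<bar> * M (length is + 2)"
      using t by (simp add: power2_eq_square abs_if)
    finally show "norm (F is (x + t *\<^sub>R axis i 1) - F is (x + 0 *\<^sub>R axis i 1) - (t - 0) *\<^sub>R F (i # is) x) / norm (t - 0)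
        \<le> \<bar>t\<bar> * M (length is + 2)"
      using t by (simp add: scaleR_conv_of_real)
  qed simp
  show "smooth_on UNIV (F [])" by (rule smooth_onI_family(1)[where F = F]) (use cont der in simp_all)
  show "pdiff_list is (F []) x = F is x" by (rule smooth_onI_family(2)[OF open_UNIV, where F = F]) (use cont der in simp_all)
qed

lemma compact_sbox: "compact {x :: real^'n::finite. \<forall>i. \<bar>x $ i - y $ i\<bar> \<le> s}"
proof -
  have "{x :: real^'n. \<forall>i. \<bar>x $ i - y $ i\<bar> \<le> s} = cbox (\<chi> i. y $ i - s) (\<chi> i. y $ i + s)"
    by (auto simp: mem_box_cart abs_le_iff algebra_simps)
  then show ?thesis by (simp add: compact_cbox)
qed

lemma open_sbox: "open {x :: real^'n::finite. \<forall>i. \<bar>x $ i - y $ i\<bar> < s}"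
proof -
  have "{x :: real^'n. \<forall>i. \<bar>x $ i - y $ i\<bar> < s} = box (\<chi> i. y $ i - s) (\<chi> i. y $ i + s)"
    by (auto simp: mem_box_cart abs_less_iff algebra_simps)
  then show ?thesis by (simp add: open_box)
qed

lemma bounded_pdiff_list:
  assumes sm: "smooth_on UNIV g" and K: "compact K" "\<And>x. x \<notin> K \<Longrightarrow> g x = 0"
  obtains B where "\<And>x. norm (pdiff_list is g x) \<le> B"
proof -
  have "bounded (pdiff_list is g ` K)"
    by (intro compact_imp_bounded compact_continuous_image K continuous_on_subset[OF smooth_onD(1)[OF sm]]) auto
  then obtain B where B: "\<forall>y\<in>pdiff_list is g ` K. norm y \<le> B" unfolding bounded_iff by blast
  show ?thesis
  proof (rule that[of "max B 0"])
    fix x show "norm (pdiff_list is g x) \<le> max B 0"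
      using B pdiff_list_vanish[OF compact_imp_closed[OF K(1)] K(2), where x = x]
      by (cases "x \<in> K") (auto intro: max.coboundedI1)
  qed
qed

text \<open>The coefficients are limits of discrete ones along a diagonal subsequence and inherit
  the uniform decay. A point x is approached by grid points, at which inversion is exact, and
  dominated summation passes to the limit. Support in |x_i| <= T/4 leaves room for the widening
  caused by differences on fine grids.\<close>

theorem fourier_series:
  fixes g :: "real^'n::finite \<Rightarrow> complex"
  assumes T: "T > 0" and sm: "smooth_on UNIV g" and supp: "\<And>x i. T / 4 < \<bar>x $ i\<bar> \<Longrightarrow> g x = 0"
  obtains c :: "('n \<Rightarrow> int) \<Rightarrow> complex" where
    "\<And>l i k B. (\<And>x. norm (pdiff_list (replicate l i) g x) \<le> B) \<Longrightarrow>
      (2 * pi / T * \<bar>of_int (k i)\<bar>) ^ l * norm (c k) \<le> 4 ^ l * B"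
    "\<And>L. (\<lambda>k. norm ((2 * pi / T) *\<^sub>R kv k) ^ L * norm (c k)) summable_on UNIV"
    "\<And>is x. (\<And>i. \<bar>x $ i\<bar> < T / 2) \<Longrightarrow>
      ((\<lambda>k. c k * (\<Prod>i\<leftarrow>is. \<i> * of_real (((2 * pi / T) *\<^sub>R kv k) $ i)) * ee ((2 * pi / T) *\<^sub>R kv k) x)
        has_sum pdiff_list is g x) UNIV"
proof -
  let ?n = "CARD('n)"
  define \<omega> where "\<omega> = 2 * pi / T"
  have \<omega>: "\<omega> > 0" using T by (simp add: \<omega>_def)
  have supp': "g x = 0" if "x \<notin> {x. \<forall>i. \<bar>x $ i - 0 $ i\<bar> \<le> T / 4}" for x
    using that supp by (auto simp: not_le)
  have "\<exists>B. \<forall>x. norm (pdiff_list (replicate l i) g x) \<le> B" for l i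
    using bounded_pdiff_list[OF sm compact_sbox supp'] by blast
  then obtain b where b: "\<And>l i x. norm (pdiff_list (replicate l i) g x) \<le> b l i" by metis
  define Bd where "Bd l = (\<Sum>i\<in>UNIV. b l i)" for l
  have b0: "b l i \<ge> 0" for l i using b[of l i 0] norm_ge_zero order_trans by blast
  have Bd: "norm (pdiff_list (replicate l i) g x) \<le> Bd l" for l i x
    unfolding Bd_def using b[of l i x] member_le_sum[of i UNIV "b l"] b0 by force
  have Bd0: "Bd l \<ge> 0" for l unfolding Bd_def by (intro sum_nonneg) (auto simp: b0)
  \<comment> \<open>The offset 4n makes the grid fine enough for differences of order 2n already at
    r = 0, so that the summable majorant holds for every r and not only eventually.\<close>
  define N where "N r = r + 4 * ?n" for r :: nat
  have fit: "T / 4 + real l * (T / (2 * real r + 1)) \<le> T / 2" if "4 * l \<le> 2 * r + 1" for l r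
  proof -
    have "real (4 * l) \<le> real (2 * r + 1)" using that by (simp only: of_nat_le_iff)
    then have "4 * real l \<le> 2 * real r + 1" by simp
    from mult_left_mono[OF this, of T] T show ?thesis by (simp add: field_simps)
  qed
  define a where "a r k = (if k \<in> lbox (N r) then dft T (N r) g k else 0)" for r k
  have a_decay: "(\<omega> * \<bar>of_int (k i)\<bar>) ^ l * norm (a r k) \<le> 4 ^ l * B"
    if l: "4 * l \<le> 2 * N r + 1" and B: "\<And>x. norm (pdiff_list (replicate l i) g x) \<le> B" for l r k i B
  proof (cases "k \<in> lbox (N r)")
    case True
    from dft_decay[OF T True sm supp fit[OF l] B] show ?thesis using True by (simp add: a_def \<omega>_def)
  next
    case False
    have "B \<ge> 0" using B norm_ge_zero order_trans by blast
    then show ?thesis using False by (simp add: a_def)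
  qed
  \<comment> \<open>The summand \<open>Bd 0\<close> covers k = 0, where the lattice weight is 1 and
    decay in the coordinates says nothing.\<close>
  define K where "K L = Bd 0 + real ?n ^ L * (2 / \<omega>) ^ (2 * ?n) * (4 ^ (L + 2 * ?n) * Bd (L + 2 * ?n))" for L
  have lw: "norm (\<omega> *\<^sub>R kv k) ^ L * t \<le> K L * lattice_weight k"
    if t: "t \<ge> 0" and t0: "t \<le> Bd 0" and tl: "\<And>i. (\<omega> * \<bar>of_int (k i)\<bar>) ^ (L + 2 * ?n) * t \<le> 4 ^ (L + 2 * ?n) * Bd (L + 2 * ?n)"
    for k :: "'n \<Rightarrow> int" and L t
  proof (cases "k = (\<lambda>_. 0)")
    case True
    have "kv k = 0" unfolding True by (simp add: vec_eq_iff)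
    moreover have "lattice_weight k = 1" unfolding True by (simp add: lattice_weight_def)
    moreover have "K L \<ge> Bd 0" unfolding K_def using \<omega> Bd0 by simp
    ultimately show ?thesis using t t0 Bd0[of 0] by (cases L) auto
  next
    case False
    have "norm (\<omega> *\<^sub>R kv k) ^ L * t \<le> real ?n ^ L * (2 / \<omega>) ^ (2 * ?n) * (4 ^ (L + 2 * ?n) * Bd (L + 2 * ?n)) * lattice_weight k"
      by (rule lattice_decay[OF t \<omega> tl False])
    also have "\<dots> \<le> K L * lattice_weight k"
      by (intro mult_right_mono less_imp_le[OF lattice_weight_pos]) (simp add: K_def Bd0)
    finally show ?thesis .
  qed
  have aB: "norm (a r k) \<le> Bd 0" for r k
    using norm_dft_le[of g "Bd 0" T "N r" k] Bd[of 0] Bd0 by (auto simp: a_def)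
  have a_lw: "norm (a r k) \<le> K 0 * lattice_weight k" for r k
  proof -
    have "norm (\<omega> *\<^sub>R kv k) ^ 0 * norm (a r k) \<le> K 0 * lattice_weight k"
      by (intro lw aB a_decay Bd) (auto simp: N_def)
    then show ?thesis by simp
  qed
  \<comment> \<open>The coefficients are bounded and the lattice is countable, so a diagonal
    subsequence makes all of them converge.\<close>
  obtain \<sigma> :: "nat \<Rightarrow> nat" where \<sigma>: "strict_mono \<sigma>" "\<And>k. \<exists>l. (\<lambda>r. a (\<sigma> r) k) \<longlonglongrightarrow> l"
    using function_convergent_subsequence[of UNIV a "Bd 0"] aB by (auto simp: countableI_type)
  then obtain c where c: "\<And>k. (\<lambda>r. a (\<sigma> r) k) \<longlonglongrightarrow> c k" by metis
  have \<sigma>_ge: "\<sigma> r \<ge> r" for r using \<sigma>(1) by (rule seq_suble)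
  have c_decay: "(\<omega> * \<bar>of_int (k i)\<bar>) ^ l * norm (c k) \<le> 4 ^ l * B"
    if B: "\<And>x. norm (pdiff_list (replicate l i) g x) \<le> B" for l i k B
  proof (rule LIMSEQ_le_const2)
    show "(\<lambda>r. (\<omega> * \<bar>of_int (k i)\<bar>) ^ l * norm (a (\<sigma> r) k)) \<longlonglongrightarrow> (\<omega> * \<bar>of_int (k i)\<bar>) ^ l * norm (c k)"
      by (intro tendsto_intros c)
    have "(\<omega> * \<bar>of_int (k i)\<bar>) ^ l * norm (a (\<sigma> r) k) \<le> 4 ^ l * B" if "r \<ge> 2 * l" for r
      using that \<sigma>_ge[of r] by (intro a_decay B) (simp add: N_def)
    then show "\<exists>N. \<forall>r\<ge>N. (\<omega> * \<bar>of_int (k i)\<bar>) ^ l * norm (a (\<sigma> r) k) \<le> 4 ^ l * B" by blast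
  qed
  have cB: "norm (c k) \<le> Bd 0" for k
    using c_decay[OF Bd[of 0], where k = k] by simp
  have c_sum: "(\<lambda>k. norm (\<omega> *\<^sub>R kv k) ^ L * norm (c k)) summable_on UNIV" for L
  proof (rule infsum_tail_le(1)[OF _ _ finite.emptyI])
    show "(\<lambda>k. K L * lattice_weight k) summable_on (UNIV :: ('n \<Rightarrow> int) set)"
      by (intro summable_on_cmult_right summable_lattice_weight)
    show "norm (norm (\<omega> *\<^sub>R kv k) ^ L * norm (c k)) \<le> K L * lattice_weight k" for k
      using lw[where k = k and L = L, OF norm_ge_zero cB c_decay[OF Bd]] by simp
  qed
  have point: "infsum (\<lambda>k. c k * ee (\<omega> *\<^sub>R kv k) x) UNIV = g x" if x: "\<And>i. \<bar>x $ i\<bar> < T / 2" for x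
  proof -
    define p where "p r = 2 * real (N (\<sigma> r)) + 1" for r
    have p_pos: "p r > 0" for r by (simp add: p_def add_pos_nonneg)
    have p_ge: "p r \<ge> real r" for r using \<sigma>_ge[of r] by (simp add: p_def N_def)
    \<comment> \<open>The grid point just below x in every coordinate; it lies within T / p of x
      coordinatewise.\<close>
    define j where "j r i = \<lfloor>x $ i * p r / T\<rfloor>" for r i
    define y where "y r = (T / p r) *\<^sub>R kv (j r)" for r
    have p_lim: "filterlim p at_top sequentially"
      by (rule filterlim_at_top_mono[OF filterlim_real_sequentially]) (simp add: p_ge)
    have "(\<lambda>r. y r $ i) \<longlonglongrightarrow> x $ i" for i
    proof (rule LIMSEQ_by_diff)
      have near: "norm (x $ i - y r $ i) \<le> T / p r" for r
      proof -
        have "x $ i - y r $ i = (T / p r) * (x $ i * p r / T - of_int (j r i))"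
          using T p_pos[of r] by (simp add: y_def field_simps)
        moreover have "\<bar>x $ i * p r / T - of_int (j r i)\<bar> \<le> 1" unfolding j_def by linarith
        ultimately show ?thesis
          using T p_pos[of r] mult_left_mono[of "\<bar>x $ i * p r / T - of_int (j r i)\<bar>" 1 "T / p r"]
          by (simp add: abs_mult)
      qed
      have "(\<lambda>r. T / p r) \<longlonglongrightarrow> 0"
        by (rule tendsto_divide_0[OF tendsto_const filterlim_at_top_imp_at_infinity[OF p_lim]])
      then show "(\<lambda>r. x $ i - y r $ i) \<longlonglongrightarrow> 0"
        by (rule Lim_null_comparison[OF always_eventually[OF allI[OF near]]])
    qed
    then have y: "y \<longlonglongrightarrow> x" by (intro vec_tendstoI)
    have ev: "eventually (\<lambda>r. j r \<in> lbox (N (\<sigma> r))) sequentially"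
    proof -
      have "eventually (\<lambda>r. \<bar>j r i\<bar> \<le> int (N (\<sigma> r))) sequentially" for i
      proof -
        \<comment> \<open>The distance of |x_i| from the edge T/2 in units of T. Once p d >= 1/2,
          rounding down cannot leave the index box.\<close>
        define d where "d = 1 / 2 - \<bar>x $ i\<bar> / T"
        have d: "d > 0" using x[of i] T by (simp add: d_def field_simps)
        have "eventually (\<lambda>r. p r \<ge> 1 / (2 * d)) sequentially"
          using p_lim by (simp add: filterlim_at_top)
        then show ?thesis
        proof eventually_elim
          case (elim r)
          then have "p r * d \<ge> 1 / 2" using d by (simp add: field_simps)
          then have "\<bar>x $ i * p r / T\<bar> \<le> p r / 2 - 1 / 2"
          proof -
            have "\<bar>x $ i * p r / T\<bar> = p r * (\<bar>x $ i\<bar> / T)"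
              using p_pos[of r] T by (simp add: abs_mult)
            moreover have "p r * d = p r / 2 - p r * (\<bar>x $ i\<bar> / T)"
              unfolding d_def right_diff_distrib by simp
            moreover have "u = v \<Longrightarrow> w = q - v \<Longrightarrow> 1 / 2 \<le> w \<Longrightarrow> u \<le> q - 1 / 2" for u v w q :: real
              by simp
            ultimately show ?thesis using \<open>p r * d \<ge> 1 / 2\<close> by blast
          qed
          then have "\<bar>x $ i * p r / T\<bar> \<le> real (N (\<sigma> r))"
            by (rule order_trans) (simp add: p_def field_simps)
          then show ?case unfolding j_def by linarith
        qed
      qed
      then show ?thesis unfolding lbox_iff by (intro eventually_all_finite)
    qed
    have cee: "continuous_on UNIV (ee \<eta>)" for \<eta> :: "real^'n"
      by (rule smooth_on_continuous[OF smooth_on_ee[OF open_UNIV]])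
    have "(\<lambda>r. infsum (\<lambda>k. a (\<sigma> r) k * ee (\<omega> *\<^sub>R kv k) (y r)) UNIV) \<longlonglongrightarrow> infsum (\<lambda>k. c k * ee (\<omega> *\<^sub>R kv k) x) UNIV"
    proof (rule dominated_infsum_LIMSEQ)
      show "(\<lambda>k. K 0 * lattice_weight k) summable_on (UNIV :: ('n \<Rightarrow> int) set)"
        by (intro summable_on_cmult_right summable_lattice_weight)
      show "norm (a (\<sigma> r) k * ee (\<omega> *\<^sub>R kv k) (y r)) \<le> K 0 * lattice_weight k" for r k
        using a_lw by (simp add: norm_mult)
      show "(\<lambda>r. a (\<sigma> r) k * ee (\<omega> *\<^sub>R kv k) (y r)) \<longlonglongrightarrow> c k * ee (\<omega> *\<^sub>R kv k) x" for k
        by (intro tendsto_mult c continuous_on_tendsto_compose[OF cee y]) auto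
    qed
    note lim = this
    have ev': "eventually (\<lambda>r. infsum (\<lambda>k. a (\<sigma> r) k * ee (\<omega> *\<^sub>R kv k) (y r)) UNIV = g (y r)) sequentially"
      using ev
    proof eventually_elim
      case (elim r)
      have "infsum (\<lambda>k. a (\<sigma> r) k * ee (\<omega> *\<^sub>R kv k) (y r)) UNIV =
          infsum (\<lambda>k. dft T (N (\<sigma> r)) g k * ee (\<omega> *\<^sub>R kv k) (y r)) (lbox (N (\<sigma> r)))"
        by (rule infsum_cong_neutral) (auto simp: a_def)
      also have "\<dots> = g (y r)"
        using dft_inversion[OF T elim, of g] by (simp add: y_def p_def \<omega>_def)
      finally show ?case .
    qed
    have "(\<lambda>r. g (y r)) \<longlonglongrightarrow> g x"
      by (rule continuous_on_tendsto_compose[OF smooth_on_continuous[OF sm] y]) auto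
    with lim show ?thesis
      unfolding tendsto_cong[OF ev'] by (rule LIMSEQ_unique)
  qed
  show ?thesis
  proof (rule that[of c])
    show "(2 * pi / T * \<bar>of_int (k i)\<bar>) ^ l * norm (c k) \<le> 4 ^ l * B"
      if "\<And>x. norm (pdiff_list (replicate l i) g x) \<le> B" for l i k B
      using c_decay[OF that] by (simp add: \<omega>_def)
    show "(\<lambda>k. norm ((2 * pi / T) *\<^sub>R kv k) ^ L * norm (c k)) summable_on UNIV" for L
      using c_sum[of L] by (simp add: \<omega>_def)
    show "((\<lambda>k. c k * (\<Prod>i\<leftarrow>is. \<i> * of_real (((2 * pi / T) *\<^sub>R kv k) $ i)) * ee ((2 * pi / T) *\<^sub>R kv k) x)
        has_sum pdiff_list is g x) UNIV" if x: "\<And>i. \<bar>x $ i\<bar> < T / 2" for "is" x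
    proof -
      let ?U = "{x :: real^'n. \<forall>i. \<bar>x $ i - 0 $ i\<bar> < T / 2}"
      let ?G = "\<lambda>is x. infsum (\<lambda>k. c k * (\<Prod>i\<leftarrow>is. \<i> * of_real ((\<omega> *\<^sub>R kv k) $ i)) * ee (\<omega> *\<^sub>R kv k) x) UNIV"
      have "pdiff_list is g x = pdiff_list is (?G []) x"
        by (rule pdiff_list_cong[OF open_sbox[of 0 "T / 2"]]) (use x point in auto)
      also have "\<dots> = ?G is x" by (rule pdiff_list_trig_series[OF c_sum])
      finally have "pdiff_list is g x = ?G is x" .
      then show ?thesis
        using has_sum_infsum[OF summable_trig_series[OF c_sum, of "is" x]] by (simp add: \<omega>_def)
    qed
  qed
qed

text \<open>Near x the function agrees with a compactly supported one, whose derivatives are read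
  off its Fourier series; there the list enters through a commutative product of symbols.\<close>

theorem pdiff_list_mset_cong:
  assumes U: "open U" and f: "smooth_on U f" and x: "x \<in> U" and eq: "mset is = mset js"
  shows "pdiff_list is f x = pdiff_list js f (x :: real^'n::finite)"
proof -
  obtain e where e: "e > 0" "cball x e \<subseteq> U" using U x open_contains_cball by blast
  \<comment> \<open>The cube of half-side 8 \<delta> has l1-radius e and therefore stays in the
    ball.\<close>
  define \<delta> where "\<delta> = e / (8 * real CARD('n))"
  have \<delta>: "\<delta> > 0" using e by (simp add: \<delta>_def)
  obtain \<phi> where \<phi>: "smooth_on UNIV \<phi>" "\<And>y. (\<And>i. \<bar>y $ i - x $ i\<bar> \<le> \<delta>) \<Longrightarrow> \<phi> y = 1"
    "\<And>y i. \<bar>y $ i - x $ i\<bar> \<ge> 8 * \<delta> \<Longrightarrow> \<phi> y = (0::complex)"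
  proof (rule ex_cutoffs[OF \<delta>, of x], goal_cases)
    case (1 \<phi> C E \<rho>)
    show ?thesis by (rule that[of "\<phi> 0"]) (simp_all add: 1)
  qed
  let ?K = "{y. \<forall>i. \<bar>y $ i - x $ i\<bar> \<le> 8 * \<delta>}"
  have KU: "?K \<subseteq> U"
  proof
    fix y assume y: "y \<in> ?K"
    have "norm (y - x) \<le> (\<Sum>i\<in>UNIV. \<bar>(y - x) $ i\<bar>)" by (rule norm_le_l1_cart)
    also have "\<dots> \<le> (\<Sum>i\<in>(UNIV::'n set). 8 * \<delta>)" using y by (intro sum_mono) simp
    also have "\<dots> = e" by (simp add: \<delta>_def)
    finally show "y \<in> U" using e by (auto simp: dist_norm norm_minus_commute)
  qed
  let ?g = "\<lambda>y. \<phi> y * f y"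
  have g: "smooth_on UNIV ?g"
  proof (rule smooth_on_extend[OF U compact_imp_closed[OF compact_sbox] KU])
    show "smooth_on U ?g" by (intro smooth_on_mult U f smooth_on_subset[OF \<phi>(1)]) auto
    show "?g y = 0" if "y \<notin> ?K" for y
    proof -
      have "\<exists>i. \<bar>y $ i - x $ i\<bar> \<ge> 8 * \<delta>" using that by (auto simp: not_le intro: less_imp_le)
      then show ?thesis using \<phi>(3)[where y = y] by auto
    qed
  qed
  have near: "pdiff_list ks ?g x = pdiff_list ks f x" for ks
  proof (rule pdiff_list_cong[OF open_sbox[of x \<delta>]])
    show "?g y = f y" if "y \<in> {y. \<forall>i. \<bar>y $ i - x $ i\<bar> < \<delta>}" for y
      using that \<phi>(2)[of y] by (simp add: less_imp_le)
  qed (use \<delta> in auto)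
  define T where "T = 4 * (8 * \<delta> + norm x + 1)"
  have T: "T > 0" unfolding T_def using \<delta> by (intro mult_pos_pos add_pos_nonneg add_nonneg_pos) auto
  have gT: "?g y = 0" if "T / 4 < \<bar>y $ i\<bar>" for y i
  proof -
    have "\<bar>y $ i - x $ i\<bar> \<ge> 8 * \<delta>" using that component_le_norm_cart[of x i] abs_triangle_ineq2[of "y $ i" "x $ i"]
      by (simp add: T_def)
    then show ?thesis by (simp add: \<phi>(3))
  qed
  obtain c where c: "\<And>is y. (\<And>i. \<bar>y $ i\<bar> < T / 2) \<Longrightarrow>
      ((\<lambda>k. c k * (\<Prod>i\<leftarrow>is. \<i> * of_real (((2 * pi / T) *\<^sub>R kv k) $ i)) * ee ((2 * pi / T) *\<^sub>R kv k) y)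
        has_sum pdiff_list is ?g y) UNIV"
  proof (rule fourier_series[OF T g gT])
    fix c :: "('n \<Rightarrow> int) \<Rightarrow> complex"
    assume "\<And>is y. (\<And>i. \<bar>y $ i\<bar> < T / 2) \<Longrightarrow>
      ((\<lambda>k. c k * (\<Prod>i\<leftarrow>is. \<i> * of_real (((2 * pi / T) *\<^sub>R kv k) $ i)) * ee ((2 * pi / T) *\<^sub>R kv k) y)
        has_sum pdiff_list is ?g y) UNIV"
    then show thesis by (rule that)
  qed
  have xT: "\<bar>x $ i\<bar> < T / 2" for i
  proof (rule le_less_trans[OF component_le_norm_cart])
    show "norm x < T / 2" using \<delta> by (simp add: T_def add_nonneg_pos add_pos_pos)
  qed
  have "(\<Prod>i\<leftarrow>is. h i) = (\<Prod>i\<leftarrow>js. h i)" for h :: "'n \<Rightarrow> complex"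
    unfolding prod_mset_prod_list[symmetric] mset_map eq ..
  then have "pdiff_list is ?g x = pdiff_list js ?g x"
    using has_sum_unique[OF c[of x "is", OF xT]] c[of x js, OF xT] by simp
  then show ?thesis by (simp add: near)
qed

section \<open>Compactly supported distributions\<close>

text \<open>The list chosen inside \<open>pdiff\<close>, named so that results on lists apply to it.
  For smooth functions the choice is immaterial by \<open>pdiff_list_mset_cong\<close>.\<close>

definition mlist :: "('n::finite \<Rightarrow> nat) \<Rightarrow> 'n list" where
  "mlist \<alpha> = (SOME is. \<forall>i. count_list is i = \<alpha> i)"

lemma count_list_mlist: "count_list (mlist \<alpha>) i = \<alpha> i" for \<alpha> :: "'n::finite \<Rightarrow> nat"
proof -
  obtain xs where xs: "mset xs = (\<Sum>i\<in>UNIV. replicate_mset (\<alpha> i) i)" using ex_mset by blast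
  have "count_list xs j = \<alpha> j" for j
  proof -
    have "count_list xs j = count (mset xs) j" by (simp add: count_mset)
    also have "\<dots> = (\<Sum>i\<in>UNIV. if i = j then \<alpha> i else 0)"
      unfolding xs count_sum by (intro sum.cong) auto
    finally show ?thesis by simp
  qed
  then have "\<exists>is. \<forall>i. count_list is i = \<alpha> i" by blast
  then have "\<forall>i. count_list (mlist \<alpha>) i = \<alpha> i" unfolding mlist_def by (rule someI_ex)
  then show ?thesis ..
qed

lemma length_mlist: "length (mlist \<alpha>) = mi_abs \<alpha>"
  unfolding mi_abs_def sum_count_list_UNIV[symmetric] count_list_mlist ..

lemma pdiff_mlist: "pdiff \<alpha> f = pdiff_list (mlist \<alpha>) f"
  by (simp add: pdiff_def mlist_def)

lemma mi_abs_count_list: "mi_abs (count_list is) = length is"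
  by (simp add: mi_abs_def sum_count_list_UNIV)

lemma pdiff_list_eq_pdiff:
  assumes "open U" "smooth_on U f" "x \<in> U"
  shows "pdiff_list is f x = pdiff (count_list is) f x"
  unfolding pdiff_mlist
  by (rule pdiff_list_mset_cong[OF assms], rule multiset_eqI) (simp add: count_mset count_list_mlist)

lemma E_prime_linear:
  "E_prime \<Omega> v \<Longrightarrow> smooth_on \<Omega> \<phi> \<Longrightarrow> smooth_on \<Omega> \<psi> \<Longrightarrow>
    v (\<lambda>x. a * \<phi> x + b * \<psi> x) = a * v \<phi> + b * v \<psi>"
  unfolding E_prime_def by blast

lemma E_prime_cmult: "E_prime \<Omega> v \<Longrightarrow> smooth_on \<Omega> \<phi> \<Longrightarrow> v (\<lambda>x. a * \<phi> x) = a * v \<phi>"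
  using E_prime_linear[of \<Omega> v \<phi> \<phi> a 0] by simp

lemma E_prime_add:
  "E_prime \<Omega> v \<Longrightarrow> smooth_on \<Omega> \<phi> \<Longrightarrow> smooth_on \<Omega> \<psi> \<Longrightarrow> v (\<lambda>x. \<phi> x + \<psi> x) = v \<phi> + v \<psi>"
  using E_prime_linear[of \<Omega> v \<phi> \<psi> 1 1] by simp

lemma E_prime_sum:
  assumes "open \<Omega>" "E_prime \<Omega> v" "\<And>a. a \<in> A \<Longrightarrow> smooth_on \<Omega> (f a)"
  shows "v (\<lambda>x. \<Sum>a\<in>A. f a x) = (\<Sum>a\<in>A. v (f a))"
proof -
  have 0: "v (\<lambda>x. 0) = 0"
    using E_prime_cmult[OF assms(2) smooth_on_const[OF assms(1), of 0], of 0] by simp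
  show ?thesis using assms(3)
    by (induction A rule: infinite_finite_induct)
      (auto simp: 0 E_prime_add[OF assms(2)] smooth_on_sum[OF assms(1)])
qed

text \<open>Negating equicontinuity for every seminorm of an exhaustion yields a bounded set of
  functions on which the sequence is unbounded; no Baire argument is needed.\<close>

lemma bounded_E_prime_seq_equicontinuous:
  fixes \<Omega> :: "(real^'n::finite) set"
  assumes \<Omega>: "open \<Omega>" and us: "bounded_E_prime_seq \<Omega> us"
  shows "\<exists>K C k. compact K \<and> K \<subseteq> \<Omega> \<and> C \<ge> 0 \<and> (\<forall>N \<phi> B. smooth_on \<Omega> \<phi> \<longrightarrow> B > 0 \<longrightarrow>
    (\<forall>is x. length is \<le> k \<longrightarrow> x \<in> K \<longrightarrow> norm (pdiff_list is \<phi> x) \<le> B) \<longrightarrow> norm (us N \<phi>) \<le> C * B)"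
proof (rule ccontr)
  assume neg: "\<not> ?thesis"
  obtain X :: "nat \<Rightarrow> (real^'n) set" where X: "\<And>j. compact (X j)" "\<And>j. X j \<subseteq> \<Omega>"
    "\<And>K. compact K \<Longrightarrow> K \<subseteq> \<Omega> \<Longrightarrow> \<exists>N. \<forall>j\<ge>N. K \<subseteq> X j"
  proof (rule open_Union_compact_subsets[OF \<Omega>])
    fix C :: "nat \<Rightarrow> (real^'n) set"
    assume "\<And>n. compact (C n)" "\<And>n. C n \<subseteq> \<Omega>" "\<And>K. compact K \<Longrightarrow> K \<subseteq> \<Omega> \<Longrightarrow> \<exists>N. \<forall>n\<ge>N. K \<subseteq> C n"
    show thesis by (rule that[of C]; fact)
  qed
  have "\<exists>N \<phi> B. smooth_on \<Omega> \<phi> \<and> B > 0 \<and>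
      (\<forall>is x. length is \<le> j \<longrightarrow> x \<in> X j \<longrightarrow> norm (pdiff_list is \<phi> x) \<le> B) \<and> norm (us N \<phi>) > real j * B" for j
  proof -
    have "\<not> (compact (X j) \<and> X j \<subseteq> \<Omega> \<and> real j \<ge> 0 \<and> (\<forall>N \<phi> B. smooth_on \<Omega> \<phi> \<longrightarrow> B > 0 \<longrightarrow>
        (\<forall>is x. length is \<le> j \<longrightarrow> x \<in> X j \<longrightarrow> norm (pdiff_list is \<phi> x) \<le> B) \<longrightarrow> norm (us N \<phi>) \<le> real j * B))"
      using neg by blast
    with X(1,2)[of j] show ?thesis by (simp add: not_le)
  qed
  then obtain n \<phi> B where \<phi>: "\<And>j. smooth_on \<Omega> (\<phi> j)" "\<And>j. B j > 0"
    "\<And>j is x. length is \<le> j \<Longrightarrow> x \<in> X j \<Longrightarrow> norm (pdiff_list is (\<phi> j) x) \<le> B j"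
    "\<And>j. norm (us (n j) (\<phi> j)) > real j * B j" by metis
  \<comment> \<open>After division by \<open>B j\<close> the derivatives of order at most j are
    bounded by 1 on \<open>X j\<close>, while the pairing with the member \<open>n j\<close> still
    exceeds j.\<close>
  define \<psi> where "\<psi> j = (\<lambda>x. of_real (1 / B j) * \<phi> j x)" for j
  have sm: "smooth_on \<Omega> (\<psi> j)" for j unfolding \<psi>_def by (intro smooth_on_cmult \<Omega> \<phi>)
  have "\<exists>c. \<forall>j. \<forall>x\<in>K. norm (pdiff \<alpha> (\<psi> j) x) \<le> c" if K: "compact K" "K \<subseteq> \<Omega>" for K \<alpha>
  proof -
    obtain j0 where j0: "\<And>j. j \<ge> j0 \<Longrightarrow> K \<subseteq> X j" using X(3)[OF K] by blast
    \<comment> \<open>From this index on, \<open>K\<close> lies in \<open>X j\<close> and the order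
      of \<alpha> is at most j, so the normalised bound 1 applies; the finitely many earlier
      functions are bounded by compactness.\<close>
    define m where "m = max j0 (mi_abs \<alpha>)"
    have late: "norm (pdiff \<alpha> (\<psi> j) x) \<le> 1" if "j \<ge> m" "x \<in> K" for j x
    proof -
      have "pdiff \<alpha> (\<psi> j) x = of_real (1 / B j) * pdiff_list (mlist \<alpha>) (\<phi> j) x"
        unfolding \<psi>_def pdiff_mlist by (rule pdiff_list_cmult[OF \<Omega> \<phi>(1)]) (use that K in auto)
      moreover have "norm (pdiff_list (mlist \<alpha>) (\<phi> j) x) \<le> B j"
        using that j0[of j] by (intro \<phi>(3)) (auto simp: m_def length_mlist)
      ultimately show ?thesis using \<phi>(2)[of j] by (simp add: norm_divide)
    qed
    have "\<exists>c. \<forall>x\<in>K. norm (pdiff \<alpha> (\<psi> j) x) \<le> c" for j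
    proof -
      have "bounded (pdiff \<alpha> (\<psi> j) ` K)"
        unfolding pdiff_mlist
        by (intro compact_imp_bounded compact_continuous_image K
            continuous_on_subset[OF smooth_onD(1)[OF sm]])
      then show ?thesis unfolding bounded_iff by blast
    qed
    then obtain c where c: "\<And>j x. x \<in> K \<Longrightarrow> norm (pdiff \<alpha> (\<psi> j) x) \<le> c j" by metis
    have "norm (pdiff \<alpha> (\<psi> j) x) \<le> 1 + (\<Sum>j<m. \<bar>c j\<bar>)" if "x \<in> K" for j x
    proof (cases "j < m")
      case True
      then have "\<bar>c j\<bar> \<le> (\<Sum>j<m. \<bar>c j\<bar>)" by (intro member_le_sum) auto
      with c[OF that, of j] show ?thesis by linarith
    next
      case False
      then have "norm (pdiff \<alpha> (\<psi> j) x) \<le> 1" using that by (intro late) auto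
      moreover have "(\<Sum>j<m. \<bar>c j\<bar>) \<ge> 0" by (intro sum_nonneg) auto
      ultimately show ?thesis by linarith
    qed
    then show ?thesis by blast
  qed
  then have "bounded_E \<Omega> (range \<psi>)" unfolding bounded_E_def using sm by auto
  then obtain c where c: "\<And>N j. norm (us N (\<psi> j)) \<le> c"
    using us unfolding bounded_E_prime_seq_def by (metis rangeI)
  obtain j :: nat where j: "real j > c" using reals_Archimedean2 by blast
  have "E_prime \<Omega> (us (n j))" using us by (simp add: bounded_E_prime_seq_def)
  from E_prime_cmult[OF this \<phi>(1)] have "us (n j) (\<psi> j) = of_real (1 / B j) * us (n j) (\<phi> j)"
    unfolding \<psi>_def .
  then have "norm (us (n j) (\<psi> j)) = norm (us (n j) (\<phi> j)) / B j"
    using \<phi>(2)[of j] by (simp add: norm_divide)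
  also have "\<dots> > real j" using \<phi>(2,4)[of j] by (simp add: field_simps)
  finally show False using c[of "n j" j] j by linarith
qed

lemma bdp_ee: "bdp x R (ee \<eta>) (\<lambda>l. norm \<eta> ^ l)"
  unfolding bdp_def using norm_symbol_le by (auto simp: pdiff_list_ee norm_mult)

text \<open>Equicontinuity gives polynomial growth of the transforms with one exponent for the whole
  sequence.\<close>

lemma norm_fourier_le:
  fixes us :: "nat \<Rightarrow> (real^'n::finite \<Rightarrow> complex) \<Rightarrow> complex"
  assumes "open \<Omega>" and C: "\<And>N \<phi> B. smooth_on \<Omega> \<phi> \<Longrightarrow> B > 0 \<Longrightarrow>
    (\<And>is x. length is \<le> k \<Longrightarrow> x \<in> K \<Longrightarrow> norm (pdiff_list is \<phi> x) \<le> B) \<Longrightarrow> norm (us N \<phi>) \<le> C * B"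
  shows "norm (fourier (us N) \<xi>) \<le> C * (1 + norm \<xi>) ^ k"
  unfolding fourier_ee
proof (rule C)
  show "smooth_on \<Omega> (ee (- \<xi>))" by (rule smooth_on_ee[OF assms(1)])
  show "0 < (1 + norm \<xi>) ^ k" by (intro zero_less_power add_pos_nonneg) auto
  fix "is" :: "'n list" and x :: "real^'n" assume l: "length is \<le> k"
  have "norm (pdiff_list is (ee (- \<xi>)) x) \<le> norm (- \<xi>) ^ length is"
    using bdp_ee[of x k "- \<xi>"] l by (rule bdpD)
  also have "\<dots> \<le> (1 + norm \<xi>) ^ length is" by (intro power_mono) auto
  also have "\<dots> \<le> (1 + norm \<xi>) ^ k" using l by (intro power_increasing) auto
  finally show "norm (pdiff_list is (ee (- \<xi>)) x) \<le> (1 + norm \<xi>) ^ k" .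
qed

text \<open>Expanding \<open>g\<close> into a Fourier series with frequencies \<open>\<eta>\<close>, the pairing of \<open>e^{-i x \<xi>} g\<close> with
  \<open>u_N\<close> becomes a sum of values of the Fourier transform at \<open>\<xi> - \<eta>\<close>. For \<open>|\<eta>| \<le> c |\<xi>|\<close> these are
  controlled by \<open>A\<close>; the remaining frequencies are absorbed by the decay of the coefficients.\<close>

theorem microlocal_pairing:
  fixes \<Omega> K :: "(real^'n::finite) set"
  assumes \<Omega>: "open \<Omega>" and us: "bounded_E_prime_seq \<Omega> us" and K: "compact K" and c: "0 < c" "c < 1"
  shows "\<exists>C \<kappa> s. C \<ge> 0 \<and> \<kappa> \<ge> 1 \<and> (\<forall>N g \<xi> G H A.
    smooth_on UNIV g \<longrightarrow> (\<forall>x. x \<notin> K \<longrightarrow> g x = 0) \<longrightarrow> norm \<xi> \<ge> 1 \<longrightarrow> A \<ge> 0 \<longrightarrow>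
    (\<forall>is x. length is \<le> 2 * CARD('n) \<longrightarrow> norm (pdiff_list is g x) \<le> G) \<longrightarrow>
    (\<forall>is x. length is \<le> N + s \<longrightarrow> norm (pdiff_list is g x) \<le> H) \<longrightarrow>
    (\<forall>\<eta>. norm (\<eta> - \<xi>) \<le> c * norm \<xi> \<longrightarrow> norm \<eta> ^ N * norm (fourier (us N) \<eta>) \<le> A) \<longrightarrow>
    norm \<xi> ^ N * norm (us N (\<lambda>x. ee (- \<xi>) x * g x)) \<le> C * \<kappa> ^ N * (A * G + H))"
proof -
  let ?n = "CARD('n)"
  from bounded_E_prime_seq_equicontinuous[OF \<Omega> us] obtain K' C0 k0 where K': "compact K'" "K' \<subseteq> \<Omega>"
    and C0: "C0 \<ge> 0" and eqc: "\<And>N \<phi> B. smooth_on \<Omega> \<phi> \<Longrightarrow> B > 0 \<Longrightarrow>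
    (\<And>is x. length is \<le> k0 \<Longrightarrow> x \<in> K' \<Longrightarrow> norm (pdiff_list is \<phi> x) \<le> B) \<Longrightarrow> norm (us N \<phi>) \<le> C0 * B"
    by blast
  have fb: "norm (fourier (us N) \<xi>) \<le> C0 * (1 + norm \<xi>) ^ k0" for N \<xi>
    by (rule norm_fourier_le[OF \<Omega> eqc])
  have us_lin: "E_prime \<Omega> (us N)" for N using us by (simp add: bounded_E_prime_seq_def)
  obtain b where b: "b > 0" "\<And>x. x \<in> K \<union> K' \<Longrightarrow> norm x \<le> b"
    using compact_imp_bounded[OF compact_Un[OF K K'(1)]] unfolding bounded_pos by blast
  \<comment> \<open>Both compact sets then lie in |x_i| <= T/4, so the series represents g together
    with its derivatives near \<open>K'\<close>.\<close>
  define T where "T = 4 * b"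
  have T: "T > 0" using b by (simp add: T_def)
  define \<omega> where "\<omega> = 2 * pi / T"
  have \<omega>: "\<omega> > 0" using T by (simp add: \<omega>_def)
  define W where "W = (2 / \<omega>) ^ (2 * ?n)"
  have W: "W > 0" using \<omega> by (simp add: W_def)
  define C1 where "C1 = (1 + W * 4 ^ (2 * ?n)) + C0 * (2 / c + 1) ^ k0 * real ?n ^ k0 * W * 4 ^ (k0 + 2 * ?n)"
  have C1: "C1 \<ge> 0" unfolding C1_def using W C0 c by (intro add_nonneg_nonneg mult_nonneg_nonneg) auto
  \<comment> \<open>The first summand serves |\<eta>| <= c |\<xi>|, where |\<xi> - \<eta>| >= (1 -
    c) |\<xi>|. The second serves the other frequencies, where |\<xi>|^N <= (|\<eta>| / c)^N is
    absorbed by N derivatives of g; each costs 4 from the coefficient bound and n from comparing the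
    norm with a coordinate.\<close>
  define \<kappa> where "\<kappa> = 1 / (1 - c) + 4 * real ?n / c"
  have \<kappa>1: "\<kappa> \<ge> 1 / (1 - c)" and \<kappa>2: "\<kappa> \<ge> 4 * real ?n / c" unfolding \<kappa>_def using c by auto
  have \<kappa>0: "\<kappa> \<ge> 1" using \<kappa>1 c by (smt (verit) le_divide_eq_1_pos)
  have main: "norm \<xi> ^ N * norm (us N (\<lambda>x. ee (- \<xi>) x * g x)) \<le> (4 ^ ?n * C1) * \<kappa> ^ N * (A * G + H)"
    if g: "smooth_on UNIV g" and gK: "\<And>x. x \<notin> K \<Longrightarrow> g x = 0" and \<xi>: "norm \<xi> \<ge> 1" and A: "A \<ge> 0"
      and G: "\<And>is x. length is \<le> 2 * ?n \<Longrightarrow> norm (pdiff_list is g x) \<le> G"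
      and H: "\<And>is x. length is \<le> N + (k0 + 2 * ?n) \<Longrightarrow> norm (pdiff_list is g x) \<le> H"
      and Ab: "\<And>\<eta>. norm (\<eta> - \<xi>) \<le> c * norm \<xi> \<Longrightarrow> norm \<eta> ^ N * norm (fourier (us N) \<eta>) \<le> A"
    for N g \<xi> G H A
  proof -
    let ?v = "us N"
    have G0: "G \<ge> 0" by (rule order_trans[OF norm_ge_zero G[of "[]" 0]]) simp
    have H0: "H \<ge> 0" by (rule order_trans[OF norm_ge_zero H[of "[]" 0]]) simp
    have supp: "g x = 0" if "T / 4 < \<bar>x $ i\<bar>" for x i
    proof (rule gK, rule notI)
      assume "x \<in> K"
      then have "norm x \<le> b" using b by simp
      with that component_le_norm_cart[of x i] show False by (simp add: T_def)
    qed
    obtain a where a: "\<And>l i k B. (\<And>x. norm (pdiff_list (replicate l i) g x) \<le> B) \<Longrightarrow>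
        (2 * pi / T * \<bar>of_int (k i)\<bar>) ^ l * norm (a k) \<le> 4 ^ l * B"
      "\<And>L. (\<lambda>k. norm ((2 * pi / T) *\<^sub>R kv k) ^ L * norm (a k)) summable_on UNIV"
      "\<And>is x. (\<And>i. \<bar>x $ i\<bar> < T / 2) \<Longrightarrow>
      ((\<lambda>k. a k * (\<Prod>i\<leftarrow>is. \<i> * of_real (((2 * pi / T) *\<^sub>R kv k) $ i)) * ee ((2 * pi / T) *\<^sub>R kv k) x)
        has_sum pdiff_list is g x) UNIV"
    proof (rule fourier_series[OF T g supp])
      fix c :: "('n \<Rightarrow> int) \<Rightarrow> complex"
      assume "\<And>l i k B. (\<And>x. norm (pdiff_list (replicate l i) g x) \<le> B) \<Longrightarrow>
          (2 * pi / T * \<bar>of_int (k i)\<bar>) ^ l * norm (c k) \<le> 4 ^ l * B"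
        "\<And>L. (\<lambda>k. norm ((2 * pi / T) *\<^sub>R kv k) ^ L * norm (c k)) summable_on UNIV"
        "\<And>is x. (\<And>i. \<bar>x $ i\<bar> < T / 2) \<Longrightarrow>
        ((\<lambda>k. c k * (\<Prod>i\<leftarrow>is. \<i> * of_real (((2 * pi / T) *\<^sub>R kv k) $ i)) * ee ((2 * pi / T) *\<^sub>R kv k) x)
          has_sum pdiff_list is g x) UNIV"
      then show thesis by (rule that)
    qed
    define \<eta> where "\<eta> k = \<omega> *\<^sub>R kv k" for k :: "'n \<Rightarrow> int"
    note a = a[folded \<omega>_def]
    have a2: "(\<lambda>k. norm (\<eta> k) ^ L * norm (a k)) summable_on UNIV" for L
      using a(2) by (simp add: \<eta>_def)
    \<comment> \<open>Near frequencies require only summable coefficients, hence just the 2n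
      derivatives behind \<open>G\<close>; the higher derivatives behind \<open>H\<close> are
      reserved for the far ones.\<close>
    have aG: "norm (a k) \<le> (1 + W * 4 ^ (2 * ?n)) * G * lattice_weight k" for k
    proof (cases "k = (\<lambda>_. 0)")
      case True
      have "norm (a k) \<le> G" using a(1)[of 0 undefined G k] G[of "[]"] by simp
      also have "G \<le> (1 + W * 4 ^ (2 * ?n)) * G" using W G0 by (simp add: distrib_right)
      finally show ?thesis unfolding True by (simp add: lattice_weight_def)
    next
      case False
      have "norm (\<omega> *\<^sub>R kv k) ^ 0 * norm (a k) \<le> real ?n ^ 0 * (2 / \<omega>) ^ (2 * ?n) * (4 ^ (2 * ?n) * G) * lattice_weight k"
        by (rule lattice_decay[OF norm_ge_zero \<omega> _ False]) (simp, rule a(1), rule G, simp)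
      also have "\<dots> \<le> (1 + W * 4 ^ (2 * ?n)) * G * lattice_weight k"
        unfolding W_def[symmetric] using G0 W lattice_weight_pos[of k]
        by (simp add: distrib_right mult.assoc)
      finally show ?thesis by simp
    qed
    \<comment> \<open>The exponent N + k0 covers |\<xi>|^N together with the polynomial growth of
      the transform; 2n further derivatives make the bound summable.\<close>
    have aH: "norm (\<eta> k) ^ (N + k0) * norm (a k) \<le> real ?n ^ (N + k0) * W * (4 ^ (N + k0 + 2 * ?n) * H) * lattice_weight k"
      if "k \<noteq> (\<lambda>_. 0)" for k
      unfolding \<eta>_def W_def
      by (rule lattice_decay[OF norm_ge_zero \<omega> _ that]) (rule a(1), rule H, simp)
    have termb: "norm \<xi> ^ N * (norm (a k) * norm (fourier ?v (\<xi> - \<eta> k))) \<le> C1 * \<kappa> ^ N * (A * G + H) * lattice_weight k" for k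
    proof (cases "norm (\<eta> k) \<le> c * norm \<xi>")
      case True
      have "norm \<xi> \<le> norm (\<xi> - \<eta> k) + norm (\<eta> k)" using norm_triangle_ineq[of "\<xi> - \<eta> k" "\<eta> k"] by simp
      then have le: "(1 - c) * norm \<xi> \<le> norm (\<xi> - \<eta> k)" using True by (simp add: left_diff_distrib)
      have "((1 - c) * norm \<xi>) ^ N * norm (fourier ?v (\<xi> - \<eta> k)) \<le> norm (\<xi> - \<eta> k) ^ N * norm (fourier ?v (\<xi> - \<eta> k))"
        using le c by (intro mult_right_mono power_mono) auto
      also have "\<dots> \<le> A" by (rule Ab) (use True in simp)
      finally have "(1 - c) ^ N * (norm \<xi> ^ N * norm (fourier ?v (\<xi> - \<eta> k))) \<le> A"
        by (simp add: power_mult_distrib mult.assoc)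
      then have "norm \<xi> ^ N * norm (fourier ?v (\<xi> - \<eta> k)) \<le> (1 / (1 - c)) ^ N * A"
        using c by (simp add: power_divide field_simps)
      also have "\<dots> \<le> \<kappa> ^ N * A" using c \<kappa>1 A by (intro mult_right_mono power_mono) auto
      finally have "norm \<xi> ^ N * norm (fourier ?v (\<xi> - \<eta> k)) \<le> \<kappa> ^ N * A" .
      then have "norm (a k) * (norm \<xi> ^ N * norm (fourier ?v (\<xi> - \<eta> k))) \<le>
          ((1 + W * 4 ^ (2 * ?n)) * G * lattice_weight k) * (\<kappa> ^ N * A)"
        by (rule mult_mono[OF aG]) (use G0 W lattice_weight_pos[of k] in auto)
      also have "\<dots> \<le> (C1 * G * lattice_weight k) * (\<kappa> ^ N * A)"
        using G0 A \<kappa>0 lattice_weight_pos[of k] W C0 c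
        by (intro mult_right_mono) (auto simp: C1_def)
      also have "\<dots> \<le> C1 * \<kappa> ^ N * (A * G + H) * lattice_weight k"
        using C1 H0 \<kappa>0 lattice_weight_pos[of k] by (simp add: algebra_simps)
      finally show ?thesis by (simp add: mult_ac)
    next
      case False
      then have big: "norm \<xi> \<le> norm (\<eta> k) / c" using c by (simp add: field_simps)
      have \<eta>1: "norm (\<eta> k) / c \<ge> 1" using \<xi> big by linarith
      have k: "k \<noteq> (\<lambda>_. 0)"
      proof
        assume "k = (\<lambda>_. 0)"
        then have "\<eta> k = 0" by (simp add: \<eta>_def vec_eq_iff)
        then show False using \<eta>1 by simp
      qed
      have "1 + norm (\<xi> - \<eta> k) \<le> (2 / c + 1) * norm (\<eta> k)"
        using norm_triangle_ineq4[of \<xi> "\<eta> k"] big \<eta>1 by (simp add: distrib_right)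
      then have "(1 + norm (\<xi> - \<eta> k)) ^ k0 \<le> ((2 / c + 1) * norm (\<eta> k)) ^ k0" by (intro power_mono) auto
      then have "C0 * (1 + norm (\<xi> - \<eta> k)) ^ k0 \<le> C0 * ((2 / c + 1) * norm (\<eta> k)) ^ k0" using C0 by (rule mult_left_mono)
      from order_trans[OF fb this]
      have f: "norm (fourier ?v (\<xi> - \<eta> k)) \<le> C0 * ((2 / c + 1) * norm (\<eta> k)) ^ k0" .
      have "norm \<xi> ^ N \<le> (norm (\<eta> k) / c) ^ N" using big by (intro power_mono) auto
      then have "norm \<xi> ^ N * (norm (a k) * norm (fourier ?v (\<xi> - \<eta> k))) \<le>
          (norm (\<eta> k) / c) ^ N * (norm (a k) * (C0 * ((2 / c + 1) * norm (\<eta> k)) ^ k0))"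
        using c by (intro mult_mono f) auto
      also have "\<dots> = (1 / c) ^ N * C0 * (2 / c + 1) ^ k0 * (norm (\<eta> k) ^ (N + k0) * norm (a k))"
        by (simp add: power_mult_distrib power_divide power_add mult_ac)
      also have "\<dots> \<le> (1 / c) ^ N * C0 * (2 / c + 1) ^ k0 *
          (real ?n ^ (N + k0) * W * (4 ^ (N + k0 + 2 * ?n) * H) * lattice_weight k)"
        using c C0 by (intro mult_left_mono aH k) auto
      also have "\<dots> = (4 * real ?n / c) ^ N * (C0 * (2 / c + 1) ^ k0 * real ?n ^ k0 * W * 4 ^ (k0 + 2 * ?n)) * H * lattice_weight k"
        by (simp add: power_mult_distrib power_divide power_add mult_ac)
      also have "\<dots> \<le> \<kappa> ^ N * C1 * (A * G + H) * lattice_weight k"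
      proof (intro mult_right_mono mult_mono)
        show "(4 * real ?n / c) ^ N \<le> \<kappa> ^ N" using \<kappa>2 c by (intro power_mono) auto
        show "C0 * (2 / c + 1) ^ k0 * real ?n ^ k0 * W * 4 ^ (k0 + 2 * ?n) \<le> C1" using W by (simp add: C1_def)
        show "H \<le> A * G + H" using A G0 by simp
      qed (use C1 C0 W c A G0 H0 \<kappa>0 lattice_weight_pos[of k] in \<open>auto intro!: mult_nonneg_nonneg\<close>)
      finally show ?thesis by (simp add: mult_ac)
    qed
    have fin: "norm \<xi> ^ N * (\<Sum>k\<in>\<Phi>. norm (a k) * norm (fourier ?v (\<xi> - \<eta> k))) \<le> (4 ^ ?n * C1) * \<kappa> ^ N * (A * G + H)"
      if "finite \<Phi>" for \<Phi>
    proof -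
      have "norm \<xi> ^ N * (\<Sum>k\<in>\<Phi>. norm (a k) * norm (fourier ?v (\<xi> - \<eta> k))) \<le>
          (\<Sum>k\<in>\<Phi>. C1 * \<kappa> ^ N * (A * G + H) * lattice_weight k)"
        unfolding sum_distrib_left by (intro sum_mono termb)
      also have "\<dots> = C1 * \<kappa> ^ N * (A * G + H) * sum lattice_weight \<Phi>" by (simp add: sum_distrib_left)
      also have "\<dots> \<le> C1 * \<kappa> ^ N * (A * G + H) * 4 ^ ?n"
        using C1 \<kappa>0 A G0 H0 by (intro mult_left_mono sum_lattice_weight_le that) auto
      finally show ?thesis by (simp add: mult_ac)
    qed
    \<comment> \<open>The functional is applied to finite partial sums only. The remainder is small
      on \<open>K'\<close> together with its derivatives up to order \<open>k0\<close>, and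
      equicontinuity bounds its contribution by \<epsilon>.\<close>
    have approx: "\<exists>\<Phi>. finite \<Phi> \<and> norm (?v (\<lambda>x. ee (- \<xi>) x * g x)) \<le>
        \<epsilon> + (\<Sum>k\<in>\<Phi>. norm (a k) * norm (fourier ?v (\<xi> - \<eta> k)))" if \<epsilon>: "\<epsilon> > 0" for \<epsilon>
    proof -
      define E where "E = (\<Sum>l\<le>k0. conv (\<lambda>l. norm (- \<xi>) ^ l) (\<lambda>_. 1) l)"
      have cv0: "conv (\<lambda>l. norm (- \<xi>) ^ l) (\<lambda>_. 1) l \<ge> 0" for l unfolding conv_def by (intro sum_nonneg) auto
      then have E0: "E \<ge> 0" unfolding E_def by (intro sum_nonneg)
      define e where "e = \<epsilon> / (C0 * (E + 1) + 1)"
      have e: "e > 0" unfolding e_def using \<epsilon> C0 E0 by (intro divide_pos_pos add_nonneg_pos mult_nonneg_nonneg) auto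
      define D where "D k = (\<Sum>L\<le>k0. norm (\<eta> k) ^ L * norm (a k))" for k
      have "(\<lambda>k. \<Sum>L\<le>m. norm (\<eta> k) ^ L * norm (a k)) summable_on UNIV" for m
      proof (induction m)
        case 0
        show ?case using a2[of 0] by simp
      next
        case (Suc m)
        show ?case unfolding sum.atMost_Suc by (intro summable_on_add Suc a2)
      qed
      then have D: "D summable_on UNIV" unfolding D_def[abs_def] .
      obtain \<Phi> where \<Phi>: "finite \<Phi>" "dist (sum D \<Phi>) (infsum D UNIV) \<le> e"
        using infsum_finite_approximation[OF D e] by auto
      define r where "r x = g x - (\<Sum>k\<in>\<Phi>. a k * ee (\<eta> k) x)" for x
      have sums: "smooth_on UNIV (\<lambda>x. a k * ee (\<eta> k) x)" for k
        by (intro smooth_on_cmult smooth_on_ee) auto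
      have sr: "smooth_on UNIV r"
        unfolding r_def[abs_def] by (intro smooth_on_diff smooth_on_sum sums g) auto
      have rb: "norm (pdiff_list is r x) \<le> e" if l: "length is \<le> k0" and x: "x \<in> K'" for "is" x
      proof -
        have xT: "\<bar>x $ i\<bar> < T / 2" for i
        proof (rule le_less_trans[OF component_le_norm_cart])
          show "norm x < T / 2" using b(2)[of x] x b(1) by (simp add: T_def)
        qed
        let ?t = "\<lambda>k. a k * (\<Prod>i\<leftarrow>is. \<i> * of_real (\<eta> k $ i)) * ee (\<eta> k) x"
        have "(?t has_sum pdiff_list is g x) UNIV" using a(3)[OF xT, of "is"] by (simp add: \<eta>_def)
        then have inf: "infsum ?t UNIV = pdiff_list is g x" by (rule infsumI)
        have tb: "norm (?t k) \<le> D k" for k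
        proof -
          have "norm (?t k) \<le> norm (a k) * norm (\<eta> k) ^ length is"
            by (simp add: norm_mult mult_left_mono norm_symbol_le)
          also have "\<dots> \<le> D k"
            unfolding D_def mult.commute[of "norm (a k)"]
            by (rule member_le_sum[of "length is" "{..k0}" "\<lambda>L. norm (\<eta> k) ^ L * norm (a k)"]) (use l in auto)
          finally show ?thesis .
        qed
        have sS: "smooth_on UNIV (\<lambda>x. \<Sum>k\<in>\<Phi>. a k * ee (\<eta> k) x)"
          by (rule smooth_on_sum[OF open_UNIV sums])
        have "pdiff_list is (\<lambda>x. \<Sum>k\<in>\<Phi>. a k * ee (\<eta> k) x) x = (\<Sum>k\<in>\<Phi>. pdiff_list is (\<lambda>x. a k * ee (\<eta> k) x) x)"
          by (rule pdiff_list_sum[OF open_UNIV sums]) simp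
        then have "pdiff_list is r x = pdiff_list is g x - (\<Sum>k\<in>\<Phi>. pdiff_list is (\<lambda>x. a k * ee (\<eta> k) x) x)"
          unfolding r_def[abs_def]
          using pdiff_list_diff[OF open_UNIV g sS UNIV_I] by simp
        also have "(\<Sum>k\<in>\<Phi>. pdiff_list is (\<lambda>x. a k * ee (\<eta> k) x) x) = sum ?t \<Phi>"
          by (intro sum.cong refl) (simp add: pdiff_list_cmult[OF open_UNIV smooth_on_ee] pdiff_list_ee)
        finally have "norm (pdiff_list is r x) = norm (infsum ?t UNIV - sum ?t \<Phi>)" by (simp add: inf)
        also have "\<dots> \<le> infsum D UNIV - sum D \<Phi>" by (rule infsum_tail_le(2)[OF D tb \<Phi>(1)])
        also have "\<dots> \<le> e" using \<Phi>(2) unfolding dist_real_def by linarith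
        finally show ?thesis .
      qed
      have s1: "smooth_on UNIV (\<lambda>x. ee (- \<xi>) x * r x)" by (intro smooth_on_mult smooth_on_ee sr) auto
      have "norm (?v (\<lambda>x. ee (- \<xi>) x * r x)) \<le> C0 * ((E + 1) * e)"
      proof (rule eqc)
        show "smooth_on \<Omega> (\<lambda>x. ee (- \<xi>) x * r x)" using s1 by (rule smooth_on_subset) simp
        show "0 < (E + 1) * e" using E0 e by (intro mult_pos_pos) auto
        fix "is" :: "'n list" and x assume l: "length is \<le> k0" and x: "x \<in> K'"
        have "bdp x k0 r (\<lambda>l. e)" unfolding bdp_def using rb x by auto
        from bdp_mult[OF open_UNIV smooth_on_ee[OF open_UNIV] sr UNIV_I bdp_ee this]
        have "norm (pdiff_list is (\<lambda>x. ee (- \<xi>) x * r x) x) \<le> conv (\<lambda>l. norm (- \<xi>) ^ l) (\<lambda>l. e) (length is)"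
          using l by (rule bdpD)
        also have "\<dots> = e * conv (\<lambda>l. norm (- \<xi>) ^ l) (\<lambda>_. 1) (length is)"
          by (simp add: conv_def sum_distrib_left mult_ac)
        also have "conv (\<lambda>l. norm (- \<xi>) ^ l) (\<lambda>_. 1) (length is) \<le> E"
          unfolding E_def by (rule member_le_sum) (use l cv0 in auto)
        also have "e * E \<le> (E + 1) * e" using e by (simp add: algebra_simps)
        finally show "norm (pdiff_list is (\<lambda>x. ee (- \<xi>) x * r x) x) \<le> (E + 1) * e" using e by simp
      qed
      also have "\<dots> \<le> \<epsilon>"
      proof -
        have "C0 * (E + 1) * e \<le> (C0 * (E + 1) + 1) * e" using e by (simp add: algebra_simps)
        also have "\<dots> = \<epsilon>" unfolding e_def using C0 E0 by (simp add: add_nonneg_eq_0_iff)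
        finally show ?thesis by (simp add: mult.assoc)
      qed
      finally have vr: "norm (?v (\<lambda>x. ee (- \<xi>) x * r x)) \<le> \<epsilon>" .
      have split: "(\<lambda>x. ee (- \<xi>) x * g x) = (\<lambda>x. ee (- \<xi>) x * r x + (\<Sum>k\<in>\<Phi>. a k * ee (- (\<xi> - \<eta> k)) x))"
      proof
        fix x
        have "ee (- (\<xi> - \<eta> k)) x = ee (- \<xi>) x * ee (\<eta> k) x" for k
          using ee_add[of "- \<xi>" "\<eta> k" x] by simp
        then show "ee (- \<xi>) x * g x = ee (- \<xi>) x * r x + (\<Sum>k\<in>\<Phi>. a k * ee (- (\<xi> - \<eta> k)) x)"
          unfolding r_def by (simp add: algebra_simps sum_distrib_left)
      qed
      have se: "smooth_on \<Omega> (\<lambda>x. a k * ee (- (\<xi> - \<eta> k)) x)" for k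
        by (intro smooth_on_cmult smooth_on_ee \<Omega>)
      have "?v (\<lambda>x. ee (- \<xi>) x * g x) = ?v (\<lambda>x. ee (- \<xi>) x * r x) + ?v (\<lambda>x. \<Sum>k\<in>\<Phi>. a k * ee (- (\<xi> - \<eta> k)) x)"
        unfolding split
        by (rule E_prime_add[OF us_lin smooth_on_subset[OF s1 subset_UNIV] smooth_on_sum[OF \<Omega> se]])
      also have "?v (\<lambda>x. \<Sum>k\<in>\<Phi>. a k * ee (- (\<xi> - \<eta> k)) x) = (\<Sum>k\<in>\<Phi>. a k * fourier ?v (\<xi> - \<eta> k))"
        unfolding E_prime_sum[OF \<Omega> us_lin se] fourier_ee
        by (intro sum.cong refl E_prime_cmult[OF us_lin] smooth_on_ee \<Omega>)
      finally have "norm (?v (\<lambda>x. ee (- \<xi>) x * g x)) \<le> \<epsilon> + norm (\<Sum>k\<in>\<Phi>. a k * fourier ?v (\<xi> - \<eta> k))"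
        using norm_triangle_le vr by (smt (verit) norm_triangle_ineq)
      also have "norm (\<Sum>k\<in>\<Phi>. a k * fourier ?v (\<xi> - \<eta> k)) \<le> (\<Sum>k\<in>\<Phi>. norm (a k) * norm (fourier ?v (\<xi> - \<eta> k)))"
        by (rule sum_norm_le) (simp add: norm_mult)
      finally show ?thesis using \<Phi>(1) by (intro exI[of _ \<Phi>]) simp
    qed
    show ?thesis
    proof (rule field_le_epsilon)
      fix e :: real assume e: "e > 0"
      have xN: "norm \<xi> ^ N > 0" using \<xi> by (intro zero_less_power) linarith
      from approx[of "e / norm \<xi> ^ N"] e xN obtain \<Phi> where \<Phi>: "finite \<Phi>"
        "norm (?v (\<lambda>x. ee (- \<xi>) x * g x)) \<le> e / norm \<xi> ^ N + (\<Sum>k\<in>\<Phi>. norm (a k) * norm (fourier ?v (\<xi> - \<eta> k)))"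
        by auto
      have "norm \<xi> ^ N * norm (?v (\<lambda>x. ee (- \<xi>) x * g x)) \<le>
          norm \<xi> ^ N * (e / norm \<xi> ^ N + (\<Sum>k\<in>\<Phi>. norm (a k) * norm (fourier ?v (\<xi> - \<eta> k))))"
        using \<Phi>(2) xN by (intro mult_left_mono) auto
      also have "\<dots> = e + norm \<xi> ^ N * (\<Sum>k\<in>\<Phi>. norm (a k) * norm (fourier ?v (\<xi> - \<eta> k)))"
        using xN \<xi> by (auto simp: distrib_left)
      finally show "norm \<xi> ^ N * norm (?v (\<lambda>x. ee (- \<xi>) x * g x)) \<le> (4 ^ ?n * C1) * \<kappa> ^ N * (A * G + H) + e"
        using fin[OF \<Phi>(1)] by linarith
    qed
  qed
  show ?thesis
    by (rule exI[of _ "4 ^ ?n * C1"], rule exI[of _ \<kappa>], rule exI[of _ "k0 + 2 * ?n"])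
      (use main C1 \<kappa>0 in auto)
qed

section \<open>Weight sequences\<close>

lemma weight_seq_pos: "weight_seq M \<Longrightarrow> M k > 0"
  by (simp add: weight_seq_def)

lemma weight_seq_0: "weight_seq M \<Longrightarrow> M 0 = 1"
  by (simp add: weight_seq_def)

lemma weight_seq_ratio_ge_1:
  assumes "weight_seq M" shows "M (Suc k) / M k \<ge> 1"
proof (induction k)
  case 0
  show ?case using assms unfolding weight_seq_def by auto
next
  case (Suc k)
  have "M (Suc k) / M k \<le> M (Suc (Suc k)) / M (Suc k)"
    using assms unfolding weight_seq_def by (auto dest!: spec[of _ "Suc k"])
  with Suc show ?case by linarith
qed

lemma weight_seq_mono: "weight_seq M \<Longrightarrow> j \<le> k \<Longrightarrow> M j \<le> M k"
  by (rule lift_Suc_mono_le[of M]) (use weight_seq_ratio_ge_1[of M] weight_seq_pos[of M] in \<open>auto simp: le_divide_eq\<close>)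

lemma weight_seq_ge_1: "weight_seq M \<Longrightarrow> M k \<ge> 1"
  using weight_seq_mono[of M 0 k] by (simp add: weight_seq_0)

lemma weight_seq_log_convex:
  assumes M: "weight_seq M" shows "M (Suc k) ^ 2 \<le> M k * M (Suc (Suc k))"
proof -
  have "M (Suc k) / M k \<le> M (Suc (Suc k)) / M (Suc k)"
    using M unfolding weight_seq_def by (auto dest!: spec[of _ "Suc k"])
  then show ?thesis
    using weight_seq_pos[OF M, of k] weight_seq_pos[OF M, of "Suc k"]
    by (simp add: field_simps power2_eq_square)
qed

text \<open>Log-convexity, raised to the power k + 1 and combined with the previous case, leaves a
  common power of M_(k+1) to cancel. In terms of roots: M_k^(1/k) increases.\<close>

lemma weight_seq_root_step:
  assumes M: "weight_seq M" shows "M k ^ Suc k \<le> M (Suc k) ^ k"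
proof (induction k)
  case 0
  show ?case using M by (simp add: weight_seq_def)
next
  case (Suc k)
  note pos = weight_seq_pos[OF M, THEN less_imp_le]
  have "M (Suc k) ^ k * M (Suc k) ^ Suc (Suc k) = (M (Suc k) ^ 2) ^ Suc k"
    unfolding power_add[symmetric] power_mult[symmetric] by (simp add: mult_2)
  also have "\<dots> \<le> (M k * M (Suc (Suc k))) ^ Suc k"
    by (intro power_mono weight_seq_log_convex M) simp
  also have "\<dots> = M k ^ Suc k * M (Suc (Suc k)) ^ Suc k" by (rule power_mult_distrib)
  also have "\<dots> \<le> M (Suc k) ^ k * M (Suc (Suc k)) ^ Suc k"
    by (intro mult_right_mono Suc.IH zero_le_power pos)
  finally show ?case using weight_seq_pos[OF M, of "Suc k"] by simp
qed

lemma weight_seq_power_le: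
  assumes M: "weight_seq M" and "j \<le> k" shows "M j ^ k \<le> M k ^ j"
  using assms(2)
proof (induction k rule: dec_induct)
  case base
  show ?case by simp
next
  case (step k)
  note pos = weight_seq_pos[OF M, THEN less_imp_le]
  show ?case
  proof (cases "k = 0")
    case True
    with step show ?thesis using M by (simp add: weight_seq_def)
  next
    case False
    have "(M j ^ Suc k) ^ k = (M j ^ k) ^ Suc k" by (simp only: power_mult[symmetric] mult.commute)
    also have "\<dots> \<le> (M k ^ j) ^ Suc k" by (intro power_mono step.IH zero_le_power pos)
    also have "\<dots> = (M k ^ Suc k) ^ j" by (simp only: power_mult[symmetric] mult.commute)
    also have "\<dots> \<le> (M (Suc k) ^ k) ^ j" by (intro power_mono weight_seq_root_step M zero_le_power pos)
    also have "\<dots> = (M (Suc k) ^ j) ^ k" by (simp only: power_mult[symmetric] mult.commute)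
    finally have "(M j ^ Suc k) ^ k \<le> (M (Suc k) ^ j) ^ k" .
    moreover obtain n where "k = Suc n" using False not0_implies_Suc by blast
    ultimately show ?thesis
      using pos by (auto intro!: power_le_imp_le_base[of "M j ^ Suc k" n "M (Suc k) ^ j"] simp del: power_Suc)
  qed
qed

text \<open>Since M_j^(1/j) increases, a threshold reached at \<nu> is reached at all smaller
  indices. Frequency and weight thus have to be compared at \<nu> only.\<close>

lemma weight_seq_le_power:
  assumes M: "weight_seq M" and "j \<le> \<nu>" "M \<nu> \<le> t ^ \<nu>" "t \<ge> 0"
  shows "M j \<le> t ^ j"
proof (cases \<nu>)
  case 0
  then show ?thesis using assms by (simp add: weight_seq_def)
next
  case (Suc n)
  have "M j ^ Suc n \<le> M \<nu> ^ j" using weight_seq_power_le[OF M assms(2)] Suc by simp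
  also have "\<dots> \<le> (t ^ \<nu>) ^ j"
    using assms weight_seq_pos[OF M, of \<nu>] by (intro power_mono) auto
  also have "\<dots> = (t ^ j) ^ Suc n" unfolding Suc by (simp only: power_mult[symmetric] mult.commute)
  finally show ?thesis by (rule power_le_imp_le_base) (use assms in auto)
qed

text \<open>The total order allows weights obtained in separate steps to be merged into the largest
  of them.\<close>

lemma weight_matrix_upper:
  assumes wm: "weight_matrix MM" and "finite F" "F \<subseteq> MM" "F \<noteq> {}"
  shows "\<exists>N\<in>F. \<forall>M\<in>F. \<forall>k. M k \<le> N k"
  using assms(2,4,3)
proof (induction F rule: finite_ne_induct)
  case (insert M F)
  then obtain N where N: "N \<in> F" "\<forall>M\<in>F. \<forall>k. M k \<le> N k" by auto
  have "(\<forall>k. M k \<le> N k) \<or> (\<forall>k. N k \<le> M k)"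
    using wm insert.prems N(1) unfolding weight_matrix_def insert_subset by (meson subsetD)
  then show ?case
  proof
    assume "\<forall>k. M k \<le> N k"
    then show ?thesis using N by auto
  next
    assume "\<forall>k. N k \<le> M k"
    then show ?thesis using N by (auto intro!: bexI[of _ M] intro: order_trans)
  qed
qed auto

lemma weight_matrixD: "weight_matrix MM \<Longrightarrow> M \<in> MM \<Longrightarrow> weight_seq M"
  by (simp add: weight_matrix_def)

text \<open>The last clause says that S_k / k! is supermultiplicative. It absorbs the binomial
  coefficients of the Leibniz rule, so products and inverses keep the sequence S instead of passing
  to a larger one.\<close>

definition supermult :: "(nat \<Rightarrow> real) \<Rightarrow> bool" where
  "supermult S \<longleftrightarrow> (\<forall>k. S k > 0) \<and> S 0 = 1 \<and> (\<forall>k. S k \<le> S (Suc k)) \<and>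
     (\<forall>a b. real (a + b choose a) * S a * S b \<le> S (a + b))"

text \<open>The sequence \<open>S\<close> is \<open>k!\<close> times the largest product \<open>m_{a_1} \<cdots> m_{a_j}\<close> with
  \<open>a_1 + \<cdots> + a_j = k\<close>; condition (b) says that it stays in the same class.\<close>

lemma ex_supermult:
  assumes M: "weight_seq M" and lim: "filterlim (\<lambda>k. root k (M k / fact k)) at_top sequentially"
    and C: "C > 0" and b: "\<And>as. (\<forall>i\<in>set as. i > 0) \<Longrightarrow>
      M (length as) / fact (length as) * (\<Prod>i\<leftarrow>as. M i / fact i) \<le> C ^ (sum_list as + 1) * (N (sum_list as) / fact (sum_list as))"
  shows "\<exists>S c C'. supermult S \<and> (\<forall>k. M k \<le> S k) \<and> c > 0 \<and> (\<forall>k. fact k \<le> c * S k) \<and> C' \<ge> 1 \<and>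
    (\<forall>k. S k \<le> C' ^ (k + 1) * N k)"
proof -
  define m where "m k = M k / fact k" for k
  have m_pos: "m k > 0" for k using weight_seq_pos[OF M] by (simp add: m_def)
  have m0: "m 0 = 1" using M by (simp add: m_def weight_seq_def)
  have m1: "m 1 \<ge> 1" using M unfolding m_def weight_seq_def by auto
  \<comment> \<open>Beyond \<open>k0\<close> all m_k are at least 1, so the whole sequence has a
    positive lower bound \<open>c1\<close>.\<close>
  obtain k0 where k0: "\<And>k. k \<ge> k0 \<Longrightarrow> root k (m k) \<ge> 1"
    using lim unfolding filterlim_at_top eventually_sequentially m_def[symmetric] by blast
  define c where "c = Min (m ` {..k0})"
  define c1 where "c1 = min c 1"
  have "c > 0" unfolding c_def using m_pos by (subst Min_gr_iff) auto
  then have c1: "c1 > 0" by (simp add: c1_def)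
  have c1m: "c1 \<le> m k" for k
  proof (cases "k \<le> k0")
    case True
    then have "c \<le> m k" unfolding c_def by (intro Min_le) auto
    then show ?thesis by (simp add: c1_def)
  next
    case False
    then have k: "k > 0" "root k (m k) \<ge> 1" using k0[of k] by auto
    then have "root k (m k) ^ k \<ge> 1" by (intro one_le_power)
    then have "m k \<ge> 1" using k m_pos[of k] by (simp add: real_root_pow_pos)
    then show ?thesis by (simp add: c1_def)
  qed
  define A where "A k = {\<Prod>i\<leftarrow>as. m i | as. (\<forall>i\<in>set as. i > 0) \<and> sum_list as = k}" for k
  define s where "s k = Sup (A k)" for k
  have prod_pos: "(\<Prod>i\<leftarrow>as. m i) > 0" for as by (induction as) (auto simp: m_pos)
  have A_le: "x \<le> C ^ (k + 1) * (N k / fact k) / c1" if xA: "x \<in> A k" for x k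
  proof -
    obtain as where as: "x = (\<Prod>i\<leftarrow>as. m i)" "\<forall>i\<in>set as. i > 0" "sum_list as = k"
      using xA unfolding A_def by blast
    \<comment> \<open>The factor m_j of condition (b), j being the number of parts, is bounded below
      by \<open>c1\<close> and can be divided out.\<close>
    have "c1 * x \<le> m (length as) * x"
      using c1m prod_pos[of as] by (intro mult_right_mono) (auto simp: as(1))
    also have "\<dots> \<le> C ^ (k + 1) * (N k / fact k)" using b[OF as(2)] by (simp add: as m_def)
    finally show ?thesis using c1 by (simp add: field_simps)
  qed
  have bdd: "bdd_above (A k)" for k using A_le by (intro bdd_aboveI) blast
  have mA: "m k \<in> A k" for k
  proof (cases "k = 0")
    case True
    then show ?thesis unfolding A_def by (auto intro!: exI[of _ "[]"] simp: m0)
  next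
    case False
    then show ?thesis unfolding A_def by (auto intro!: exI[of _ "[k]"])
  qed
  have ms: "m k \<le> s k" for k unfolding s_def by (rule cSup_upper[OF mA bdd])
  have s_pos: "s k > 0" for k using ms[of k] m_pos[of k] by linarith
  have A_pos: "x > 0" if "x \<in> A k" for x k using that prod_pos unfolding A_def by auto
  have "A 0 = {1}"
  proof
    show "A 0 \<subseteq> {1}"
    proof
      fix x assume "x \<in> A 0"
      then obtain as where as: "x = (\<Prod>i\<leftarrow>as. m i)" "\<forall>i\<in>set as. i > 0" "sum_list as = 0"
        unfolding A_def by blast
      then have "as = []" by (cases as) auto
      with as show "x \<in> {1}" by simp
    qed
    show "{1} \<subseteq> A 0" using mA[of 0] m0 by simp
  qed
  then have s0: "s 0 = 1" by (simp add: s_def)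
  \<comment> \<open>Concatenating two compositions multiplies their products; the supremum is then
    taken in one factor at a time.\<close>
  have s_mult: "s a * s b \<le> s (a + b)" for a b
  proof -
    have xy: "x * y \<le> s (a + b)" if x: "x \<in> A a" and y: "y \<in> A b" for x y
    proof -
      obtain as bs where "x = (\<Prod>i\<leftarrow>as. m i)" "\<forall>i\<in>set as. i > 0" "sum_list as = a"
        "y = (\<Prod>i\<leftarrow>bs. m i)" "\<forall>i\<in>set bs. i > 0" "sum_list bs = b"
        using x y unfolding A_def by blast
      then have "x * y \<in> A (a + b)" unfolding A_def by (auto intro!: exI[of _ "as @ bs"])
      then show ?thesis unfolding s_def by (rule cSup_upper[OF _ bdd])
    qed
    have sb: "s b \<le> s (a + b) / x" if "x \<in> A a" for x
      unfolding s_def[of b] using mA[of b] xy[OF that] A_pos[OF that]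
      by (intro cSup_least) (auto simp: field_simps)
    have "x \<le> s (a + b) / s b" if "x \<in> A a" for x
      using sb[OF that] A_pos[OF that] s_pos[of b] by (simp add: field_simps)
    then have "s a \<le> s (a + b) / s b"
      unfolding s_def[of a] using mA[of a] by (intro cSup_least) auto
    then show ?thesis using s_pos[of b] by (simp add: field_simps)
  qed
  define S where "S k = fact k * s k" for k
  have "S k \<le> S (Suc k)" for k
  proof -
    have "s k * 1 \<le> s k * s 1" using ms[of 1] m1 s_pos[of k] by (intro mult_left_mono) auto
    also have "\<dots> \<le> s (Suc k)" using s_mult[of k 1] by simp
    finally have "fact k * s k \<le> fact (Suc k) * s (Suc k)"
      using s_pos[of k] by (intro mult_mono fact_mono) auto
    then show ?thesis by (simp add: S_def)
  qed
  moreover have "real (a + b choose a) * S a * S b \<le> S (a + b)" for a b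
  proof -
    have "real (a + b choose a) * S a * S b = real (fact a * fact b * (a + b choose a)) * (s a * s b)"
      by (simp add: S_def mult_ac)
    also have "fact a * fact b * (a + b choose a) = fact (a + b)"
      using binomial_fact_lemma[of a "a + b"] by simp
    also have "real (fact (a + b)) * (s a * s b) \<le> S (a + b)"
      unfolding S_def of_nat_fact by (intro mult_left_mono s_mult) auto
    finally show ?thesis .
  qed
  ultimately have S: "supermult S"
    unfolding supermult_def using s_pos by (auto simp: S_def s0)
  have MS: "M k \<le> S k" for k using ms[of k] by (simp add: S_def m_def field_simps)
  have "fact k \<le> 1 / c1 * S k" for k
  proof -
    have "c1 \<le> s k" using c1m[of k] ms[of k] by linarith
    then show ?thesis using c1 by (simp add: S_def field_simps)
  qed
  moreover have "S k \<le> ((1 + C) * (1 + 1 / c1)) ^ (k + 1) * N k" for k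
  proof -
    have le: "s k \<le> C ^ (k + 1) * (N k / fact k) / c1"
      unfolding s_def using mA[of k] A_le by (intro cSup_least) auto
    from mult_left_mono[OF le, of "fact k"]
    have up: "S k \<le> C ^ (k + 1) * (1 / c1) * N k" by (simp add: S_def)
    moreover have "S k > 0" using s_pos by (simp add: S_def)
    ultimately have "0 < C ^ (k + 1) * (1 / c1) * N k" by linarith
    moreover have "C ^ (k + 1) * (1 / c1) > 0" using C c1 by simp
    ultimately have N: "N k > 0" by (simp only: zero_less_mult_pos)
    have "C ^ (k + 1) * (1 / c1) \<le> (1 + C) ^ (k + 1) * (1 + 1 / c1) ^ 1"
      using C c1 by (intro mult_mono power_mono) auto
    also have "\<dots> \<le> (1 + C) ^ (k + 1) * (1 + 1 / c1) ^ (k + 1)"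
      using C c1 by (intro mult_left_mono power_increasing) auto
    also have "\<dots> = ((1 + C) * (1 + 1 / c1)) ^ (k + 1)" by (rule power_mult_distrib[symmetric])
    finally have "C ^ (k + 1) * (1 / c1) * N k \<le> ((1 + C) * (1 + 1 / c1)) ^ (k + 1) * N k"
      using N by (intro mult_right_mono) auto
    with up show ?thesis by linarith
  qed
  moreover have "(1 + C) * (1 + 1 / c1) \<ge> 1 * 1" using C c1 by (intro mult_mono) auto
  ultimately show ?thesis
    using S MS c1 by (intro exI[of _ S] exI[of _ "1 / c1"] exI[of _ "(1 + C) * (1 + 1 / c1)"]) auto
qed

text \<open>Condition (a) splits off a block of at most \<nu> indices, which below the threshold
  costs no more than the matching power of t; p blocks cover all j <= p \<nu>. Every split passes to
  another weight, so the number of blocks has to be fixed beforehand.\<close>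

lemma moderate_growth_below_threshold:
  assumes wm: "weight_matrix MM"
    and a: "\<forall>M\<in>MM. \<exists>N\<in>MM. \<exists>C>0. \<forall>j k. M (j + k) \<le> C ^ (j + k) * N j * N k"
  shows "\<forall>M\<in>MM. \<exists>N\<in>MM. \<exists>C\<ge>1. \<forall>\<nu> j t. t \<ge> 1 \<longrightarrow> N \<nu> \<le> t ^ \<nu> \<longrightarrow> j \<le> p * \<nu> \<longrightarrow> M j \<le> C ^ j * t ^ j"
proof (induction p)
  case 0
  show ?case
  proof
    fix M assume M: "M \<in> MM"
    then have "M 0 = 1" using weight_matrixD[OF wm] by (simp add: weight_seq_def)
    then show "\<exists>N\<in>MM. \<exists>C\<ge>1. \<forall>\<nu> j t. t \<ge> 1 \<longrightarrow> N \<nu> \<le> t ^ \<nu> \<longrightarrow> j \<le> 0 * \<nu> \<longrightarrow> M j \<le> C ^ j * t ^ j"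
      using M by (intro bexI[of _ M] exI[of _ 1]) auto
  qed
next
  case (Suc p)
  show ?case
  proof
    fix M assume M: "M \<in> MM"
    obtain N1 C1 where N1: "N1 \<in> MM" "C1 > 0" "\<And>j k. M (j + k) \<le> C1 ^ (j + k) * N1 j * N1 k"
      using a M by blast
    obtain N2 C2 where N2: "N2 \<in> MM" "C2 \<ge> 1"
      "\<And>\<nu> j t. t \<ge> 1 \<Longrightarrow> N2 \<nu> \<le> t ^ \<nu> \<Longrightarrow> j \<le> p * \<nu> \<Longrightarrow> N1 j \<le> C2 ^ j * t ^ j"
      using Suc N1(1) by blast
    obtain N where N: "N \<in> {N1, N2}" "\<And>k. N1 k \<le> N k" "\<And>k. N2 k \<le> N k"
      using weight_matrix_upper[OF wm, of "{N1, N2}"] N1 N2 by auto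
    define C where "C = (1 + C1) * C2"
    have C1: "C \<ge> 1" using N1 N2 mult_mono[of 1 "1 + C1" 1 C2] by (simp add: C_def)
    have "M j \<le> C ^ j * t ^ j" if t: "t \<ge> 1" and th: "N \<nu> \<le> t ^ \<nu>" and j: "j \<le> Suc p * \<nu>" for \<nu> j t
    proof -
      define i where "i = min j \<nu>"
      have i: "i \<le> \<nu>" "j = i + (j - i)" "j - i \<le> p * \<nu>" using j by (auto simp: i_def)
      have "N1 \<nu> \<le> t ^ \<nu>" "N2 \<nu> \<le> t ^ \<nu>" using th N(2,3)[of \<nu>] by auto
      then have b1: "N1 i \<le> t ^ i" and b2: "N1 (j - i) \<le> C2 ^ (j - i) * t ^ (j - i)"
        using weight_seq_le_power[OF weight_matrixD[OF wm N1(1)] i(1)] t N2(3) i(3) by auto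
      have p1: "N1 k \<ge> 0" for k using weight_seq_pos[OF weight_matrixD[OF wm N1(1)], of k] by simp
      have "M j \<le> C1 ^ j * N1 i * N1 (j - i)" using N1(3)[of i "j - i"] i(2) by simp
      also have "\<dots> \<le> (1 + C1) ^ j * t ^ i * (C2 ^ (j - i) * t ^ (j - i))"
        using N1(2) t p1 b1 b2 by (intro mult_mono power_mono) auto
      also have "C2 ^ (j - i) \<le> C2 ^ j" using N2(2) by (intro power_increasing) auto
      also have "(1 + C1) ^ j * t ^ i * (C2 ^ j * t ^ (j - i)) = C ^ j * t ^ j"
        unfolding C_def power_mult_distrib using i(2) power_add[of t i "j - i"] by (simp add: mult_ac)
      finally show ?thesis using N1(2) t by (simp add: mult_left_mono mult_right_mono)
    qed
    then show "\<exists>N\<in>MM. \<exists>C\<ge>1. \<forall>\<nu> j t. t \<ge> 1 \<longrightarrow> N \<nu> \<le> t ^ \<nu> \<longrightarrow> j \<le> Suc p * \<nu> \<longrightarrow> M j \<le> C ^ j * t ^ j"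
      using N(1) N1(1) N2(1) C1 by blast
  qed
qed

text \<open>Two ways of paying for j derivatives beyond l. The first converts all of them into
  powers of t. The second keeps \<nu> of them as N_\<nu> and converts the other j - \<nu>, which is
  where a factor N_\<nu> t^(-\<nu>) comes from. One N lies above the weights produced by both
  splittings.\<close>

lemma ex_weights:
  assumes wm: "weight_matrix MM" and Rsr: "R_semiregular MM"
    and a: "\<forall>M\<in>MM. \<exists>N\<in>MM. \<exists>C>0. \<forall>j k. M (j + k) \<le> C ^ (j + k) * N j * N k"
    and b: "\<forall>M\<in>MM. \<exists>N\<in>MM. \<exists>C>0. \<forall>k. \<forall>as :: nat list.
                   (\<forall>i\<in>set as. i > 0) \<and> sum_list as = k \<longrightarrow>
                   M (length as) / fact (length as) * (\<Prod>i\<leftarrow>as. M i / fact i)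
                     \<le> C ^ (k + 1) * (N k / fact k)"
    and M: "M \<in> MM"
  shows "\<exists>S N C. supermult S \<and> (\<forall>k. M k \<le> S k) \<and> N \<in> MM \<and> C \<ge> 1 \<and> (\<forall>k. fact k \<le> C * S k) \<and>
    (\<forall>\<nu> l j t. t \<ge> 1 \<longrightarrow> N \<nu> \<le> t ^ \<nu> \<longrightarrow> j \<le> p * \<nu> \<longrightarrow> S (l + j) \<le> C ^ (l + j + 1) * N l * t ^ j) \<and>
    (\<forall>\<nu> l j t. t \<ge> 1 \<longrightarrow> N \<nu> \<le> t ^ \<nu> \<longrightarrow> \<nu> \<le> j \<longrightarrow> j \<le> p * \<nu> \<longrightarrow>
       S (l + j) \<le> C ^ (l + j + 1) * N l * N \<nu> * t ^ (j - \<nu>))"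
proof -
  obtain N0 C0 where N0: "N0 \<in> MM" "C0 > 0" and b0: "\<forall>k. \<forall>as :: nat list.
      (\<forall>i\<in>set as. i > 0) \<and> sum_list as = k \<longrightarrow>
      M (length as) / fact (length as) * (\<Prod>i\<leftarrow>as. M i / fact i) \<le> C0 ^ (k + 1) * (N0 k / fact k)"
    using bspec[OF b M] by (elim bexE exE conjE)
  have b1: "M (length as) / fact (length as) * (\<Prod>i\<leftarrow>as. M i / fact i) \<le>
      C0 ^ (sum_list as + 1) * (N0 (sum_list as) / fact (sum_list as))" if "\<forall>i\<in>set as. i > 0" for as
    using b0[THEN spec, THEN spec, of as "sum_list as"] that by simp
  have "filterlim (\<lambda>k. root k (M k / fact k)) at_top sequentially"
    using Rsr M by (simp add: R_semiregular_def)
  from ex_supermult[OF weight_matrixD[OF wm M] this N0(2) b1] obtain S c D where S: "supermult S" "\<And>k. M k \<le> S k"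
    "c > 0" "\<And>k. fact k \<le> c * S k" "D \<ge> 1" "\<And>k. S k \<le> D ^ (k + 1) * N0 k" by blast
  obtain N1 C1 where N1: "N1 \<in> MM" "C1 > 0" "\<And>j k. N0 (j + k) \<le> C1 ^ (j + k) * N1 j * N1 k"
    using a N0(1) by blast
  obtain N2 C2 where N2: "N2 \<in> MM" "C2 \<ge> 1"
    "\<And>\<nu> j t. t \<ge> 1 \<Longrightarrow> N2 \<nu> \<le> t ^ \<nu> \<Longrightarrow> j \<le> p * \<nu> \<Longrightarrow> N1 j \<le> C2 ^ j * t ^ j"
    using moderate_growth_below_threshold[OF wm a, of p] N1(1) by meson
  obtain N3 C3 where N3: "N3 \<in> MM" "C3 > 0" "\<And>j k. N1 (j + k) \<le> C3 ^ (j + k) * N3 j * N3 k"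
    using a N1(1) by blast
  obtain N4 C4 where N4: "N4 \<in> MM" "C4 \<ge> 1"
    "\<And>\<nu> j t. t \<ge> 1 \<Longrightarrow> N4 \<nu> \<le> t ^ \<nu> \<Longrightarrow> j \<le> p * \<nu> \<Longrightarrow> N3 j \<le> C4 ^ j * t ^ j"
    using moderate_growth_below_threshold[OF wm a, of p] N3(1) by meson
  have "\<exists>N\<in>{N1, N2, N3, N4}. \<forall>M\<in>{N1, N2, N3, N4}. \<forall>k. M k \<le> N k"
    using N1 N2 N3 N4 by (intro weight_matrix_upper[OF wm]) auto
  then obtain N where N: "N \<in> {N1, N2, N3, N4}" "\<And>k. N1 k \<le> N k" "\<And>k. N2 k \<le> N k" "\<And>k. N3 k \<le> N k" "\<And>k. N4 k \<le> N k"
    by auto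
  have NMM: "N \<in> MM" using N(1) N1 N2 N3 N4 by auto
  have pos: "N1 k \<ge> 0" "N3 k \<ge> 0" "N k \<ge> 0" for k
    by (intro less_imp_le weight_seq_pos weight_matrixD[OF wm] N1(1) N3(1) NMM)+
  \<comment> \<open>All factors are at least 1, so every partial product needed below is bounded by
    this one constant.\<close>
  define C where "C = (1 + c) * (D * ((1 + C1) * (C2 * ((1 + C3) * C4))))"
  have ge: "1 \<le> x * y" if "1 \<le> x" "1 \<le> y" for x y :: real using mult_mono[OF that] that by simp
  have C1': "C \<ge> 1" unfolding C_def using S(3,5) N1(2) N2(2) N3(2) N4(2) by (intro ge) auto
  have CD: "D * ((1 + C1) * C2) \<le> C" "D * ((1 + C1) * ((1 + C3) * C4)) \<le> C" "c \<le> C"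
  proof -
    have r: "x \<le> y * x" if "1 \<le> y" "0 \<le> x" for x y :: real using mult_right_mono[OF that] by simp
    have l: "x \<le> x * y" if "1 \<le> y" "0 \<le> x" for x y :: real using mult_left_mono[OF that] by simp
    have "D * ((1 + C1) * C2) \<le> D * ((1 + C1) * (C2 * ((1 + C3) * C4)))"
      using S(5) N1(2) N2(2) N3(2) N4(2) by (intro mult_left_mono l ge) auto
    also have "\<dots> \<le> C" unfolding C_def using S(3,5) N1(2) N2(2) N3(2) N4(2) by (intro r) auto
    finally show "D * ((1 + C1) * C2) \<le> C" .
    have "D * ((1 + C1) * ((1 + C3) * C4)) \<le> D * ((1 + C1) * (C2 * ((1 + C3) * C4)))"
      using S(5) N1(2) N2(2) N3(2) N4(2) by (intro mult_left_mono r) auto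
    also have "\<dots> \<le> C" unfolding C_def using S(3,5) N1(2) N2(2) N3(2) N4(2) by (intro r) auto
    finally show "D * ((1 + C1) * ((1 + C3) * C4)) \<le> C" .
    have "c \<le> 1 + c" by simp
    also have "\<dots> \<le> C" unfolding C_def using S(3,5) N1(2) N2(2) N3(2) N4(2) by (intro l ge) auto
    finally show "c \<le> C" .
  qed
  have SN1: "S (l + j) \<le> (D * (1 + C1)) ^ (l + j + 1) * N1 l * N1 j" for l j
  proof -
    have "S (l + j) \<le> D ^ (l + j + 1) * N0 (l + j)" by (rule S)
    also have "\<dots> \<le> D ^ (l + j + 1) * (C1 ^ (l + j) * N1 l * N1 j)"
      using S(5) by (intro mult_left_mono N1) auto
    also have "\<dots> \<le> D ^ (l + j + 1) * ((1 + C1) ^ (l + j + 1) * N1 l * N1 j)"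
    proof -
      have "C1 ^ (l + j) \<le> (1 + C1) ^ (l + j)" using N1(2) by (intro power_mono) auto
      also have "\<dots> \<le> (1 + C1) ^ (l + j + 1)" using N1(2) by (intro power_increasing) auto
      finally show ?thesis using S(5) pos by (intro mult_left_mono mult_right_mono) auto
    qed
    finally show ?thesis by (simp only: power_mult_distrib mult.assoc)
  qed
  have w2: "S (l + j) \<le> C ^ (l + j + 1) * N l * t ^ j"
    if t: "t \<ge> 1" "N \<nu> \<le> t ^ \<nu>" and j: "j \<le> p * \<nu>" for \<nu> l j t
  proof -
    have "N2 \<nu> \<le> t ^ \<nu>" using t(2) N(3)[of \<nu>] by linarith
    then have "N1 j \<le> C2 ^ j * t ^ j" using N2(3) t j by blast
    also have "\<dots> \<le> C2 ^ (l + j + 1) * t ^ j"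
      using N2(2) t by (intro mult_right_mono power_increasing) auto
    finally have "(D * (1 + C1)) ^ (l + j + 1) * N1 l * N1 j \<le> (D * (1 + C1)) ^ (l + j + 1) * N l * (C2 ^ (l + j + 1) * t ^ j)"
      using S(5) N1(2) N2(2) pos N(2) t by (intro mult_mono) auto
    also have "\<dots> = (D * ((1 + C1) * C2)) ^ (l + j + 1) * (N l * t ^ j)"
      by (simp only: power_mult_distrib mult_ac)
    also have "\<dots> \<le> C ^ (l + j + 1) * (N l * t ^ j)"
      using CD(1) S(5) N1(2) N2(2) t pos by (intro mult_right_mono power_mono) auto
    finally show ?thesis using SN1[of l j] by (simp add: mult.assoc)
  qed
  have w3: "S (l + j) \<le> C ^ (l + j + 1) * N l * N \<nu> * t ^ (j - \<nu>)"
    if t: "t \<ge> 1" "N \<nu> \<le> t ^ \<nu>" and j: "\<nu> \<le> j" "j \<le> p * \<nu>" for \<nu> l j t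
  proof -
    have "N4 \<nu> \<le> t ^ \<nu>" using t(2) N(5)[of \<nu>] by linarith
    moreover have "j - \<nu> \<le> p * \<nu>" using j by simp
    ultimately have "N3 (j - \<nu>) \<le> C4 ^ (j - \<nu>) * t ^ (j - \<nu>)" using N4(3) t by blast
    also have "\<dots> \<le> C4 ^ (l + j + 1) * t ^ (j - \<nu>)"
      using N4(2) t by (intro mult_right_mono power_increasing) auto
    finally have n3: "N3 (j - \<nu>) \<le> C4 ^ (l + j + 1) * t ^ (j - \<nu>)" .
    have "N1 j \<le> C3 ^ j * N3 \<nu> * N3 (j - \<nu>)" using N3(3)[of \<nu> "j - \<nu>"] j by simp
    also have "\<dots> \<le> (1 + C3) ^ (l + j + 1) * N \<nu> * (C4 ^ (l + j + 1) * t ^ (j - \<nu>))"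
    proof (intro mult_mono n3 N)
      have "C3 ^ j \<le> (1 + C3) ^ j" using N3(2) by (intro power_mono) auto
      also have "\<dots> \<le> (1 + C3) ^ (l + j + 1)" using N3(2) by (intro power_increasing) auto
      finally show "C3 ^ j \<le> (1 + C3) ^ (l + j + 1)" .
    qed (use pos N3(2) in auto)
    finally have "(D * (1 + C1)) ^ (l + j + 1) * N1 l * N1 j \<le> (D * (1 + C1)) ^ (l + j + 1) * N l *
        ((1 + C3) ^ (l + j + 1) * N \<nu> * (C4 ^ (l + j + 1) * t ^ (j - \<nu>)))"
      using S(5) N1(2) pos N(2) by (intro mult_mono) auto
    also have "\<dots> = (D * ((1 + C1) * ((1 + C3) * C4))) ^ (l + j + 1) * (N l * N \<nu> * t ^ (j - \<nu>))"
      by (simp only: power_mult_distrib mult_ac)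
    also have "\<dots> \<le> C ^ (l + j + 1) * (N l * N \<nu> * t ^ (j - \<nu>))"
      using CD(2) S(5) N1(2) N3(2) N4(2) t pos by (intro mult_right_mono power_mono) auto
    finally show ?thesis using SN1[of l j] by (simp add: mult.assoc)
  qed
  have "fact k \<le> C * S k" for k
  proof -
    have "S k \<ge> 0" using S(1) unfolding supermult_def by (meson less_imp_le)
    then show ?thesis using S(4)[of k] mult_right_mono[OF CD(3), of "S k"] by linarith
  qed
  with S(1,2) NMM C1' w2 w3 show ?thesis by blast
qed

text \<open>The one-step condition is iterated s times; the accumulated power with exponent k + s +
  1 is rewritten with exponent k + 1 and a larger base.\<close>

lemma R_semiregular_shift:
  assumes wm: "weight_matrix MM" and "R_semiregular MM"
  shows "\<forall>M\<in>MM. \<exists>N\<in>MM. \<exists>C\<ge>1. \<forall>k. M (k + s) \<le> C ^ (k + 1) * N k"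
proof (induction s)
  case 0
  show ?case
    using weight_seq_pos[OF weight_matrixD[OF wm]] by (auto intro!: exI[of _ 1])
next
  case (Suc s)
  show ?case
  proof
    fix M assume "M \<in> MM"
    then obtain N C where N: "N \<in> MM" "C \<ge> 1" "\<And>j. M (j + 1) \<le> C ^ (j + 1) * N j"
      using assms(2) unfolding R_semiregular_def by blast
    then obtain N' C' where N': "N' \<in> MM" "C' \<ge> 1" "\<And>k. N (k + s) \<le> C' ^ (k + 1) * N' k" using Suc by blast
    have p: "N' k \<ge> 0" for k using weight_seq_pos[OF weight_matrixD[OF wm N'(1)], of k] by simp
    have "M (k + Suc s) \<le> (C ^ (s + 1) * C') ^ (k + 1) * N' k" for k
    proof -
      have "M (k + Suc s) \<le> C ^ (k + s + 1) * N (k + s)" using N(3)[of "k + s"] by simp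
      also have "\<dots> \<le> C ^ ((s + 1) * (k + 1)) * (C' ^ (k + 1) * N' k)"
        using N(1,2) N'(2) p weight_seq_pos[OF weight_matrixD[OF wm N(1)], of "k + s"]
        by (intro mult_mono power_increasing N') auto
      finally show ?thesis by (simp only: power_mult power_mult_distrib mult.assoc)
    qed
    moreover have "C ^ (s + 1) * C' \<ge> 1"
      using mult_mono[OF one_le_power[OF N(2), of "s + 1"] N'(2)] N(2) by simp
    ultimately show "\<exists>N\<in>MM. \<exists>C\<ge>1. \<forall>k. M (k + Suc s) \<le> C ^ (k + 1) * N k" using N'(1) by blast
  qed
qed

text \<open>The direction is opposite to the Roumieu case: for the given member another one is found
  whose shift it dominates.\<close>

lemma B_semiregular_shift:
  assumes wm: "weight_matrix LL" and "B_semiregular LL"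
  shows "\<forall>L\<in>LL. \<exists>N\<in>LL. \<exists>C\<ge>1. \<forall>k. N (k + s) \<le> C ^ (k + 1) * L k"
proof (induction s)
  case 0
  show ?case
    using weight_seq_pos[OF weight_matrixD[OF wm]] by (auto intro!: exI[of _ 1])
next
  case (Suc s)
  show ?case
  proof
    fix L assume L: "L \<in> LL"
    then obtain N C where N: "N \<in> LL" "C \<ge> 1" "\<And>k. N (k + s) \<le> C ^ (k + 1) * L k" using Suc by blast
    then obtain N' C' where N': "N' \<in> LL" "C' \<ge> 1" "\<And>j. N' (j + 1) \<le> C' ^ j * N j"
      using assms(2) unfolding B_semiregular_def by blast
    have p: "L k \<ge> 0" for k using weight_seq_pos[OF weight_matrixD[OF wm L], of k] by simp
    have "N' (k + Suc s) \<le> (C' ^ (s + 1) * C) ^ (k + 1) * L k" for k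
    proof -
      have "N' (k + Suc s) \<le> C' ^ (k + s) * N (k + s)" using N'(3)[of "k + s"] by simp
      also have "\<dots> \<le> C' ^ ((s + 1) * (k + 1)) * (C ^ (k + 1) * L k)"
        using N(1,2) N'(2) p weight_seq_pos[OF weight_matrixD[OF wm N(1)], of "k + s"]
        by (intro mult_mono power_increasing N) auto
      finally show ?thesis by (simp only: power_mult power_mult_distrib mult.assoc)
    qed
    moreover have "C' ^ (s + 1) * C \<ge> 1"
      using mult_mono[OF one_le_power[OF N'(2), of "s + 1"] N(2)] N'(2) by simp
    ultimately show "\<exists>N\<in>LL. \<exists>C\<ge>1. \<forall>k. N (k + Suc s) \<le> C ^ (k + 1) * L k" using N'(1) by blast
  qed
qed

lemma root_ratio_le:
  assumes "M > 0" "L > 0" "k > 0" "root k M / root k L \<le> C"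
  shows "M \<le> C ^ k * L"
proof -
  have "root k L > 0" using assms by simp
  then have "root k M \<le> C * root k L" using assms by (simp add: divide_le_eq)
  moreover have "root k M \<ge> 0" using assms by simp
  ultimately have "root k M ^ k \<le> (C * root k L) ^ k" by (intro power_mono)
  then show ?thesis using assms by (simp add: power_mult_distrib real_root_pow_pos)
qed

lemma R_preceqD:
  assumes "R_preceq MM LL" "weight_matrix MM" "weight_matrix LL" "M \<in> MM"
  shows "\<exists>L\<in>LL. \<exists>C\<ge>1. \<forall>k. M k \<le> C ^ k * L k"
proof -
  obtain L C where L: "L \<in> LL" "\<And>k. root k (M k) / root k (L k) \<le> C"
    using assms unfolding R_preceq_def by blast
  have w: "weight_seq M" "weight_seq L" using assms L weight_matrixD by blast+
  have "M k \<le> (max C 1) ^ k * L k" for k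
  proof (cases "k = 0")
    case True
    then show ?thesis using w by (simp add: weight_seq_def)
  next
    case False
    show ?thesis
      by (rule root_ratio_le) (use False w weight_seq_pos L(2)[of k] in \<open>auto intro: max.coboundedI1\<close>)
  qed
  then show ?thesis using L(1) by (intro bexI[of _ L] exI[of _ "max C 1"]) auto
qed

text \<open>The limit gives the bound beyond some index; the finitely many earlier quotients are
  summed into the constant.\<close>

lemma B_lhdD:
  assumes "B_lhd MM LL" "weight_matrix MM" "weight_matrix LL" "M \<in> MM" "L \<in> LL" "e > 0"
  shows "\<exists>C\<ge>0. \<forall>k. M k \<le> C * e ^ k * L k"
proof -
  have w: "weight_seq M" "weight_seq L" using assms weight_matrixD by blast+
  note pos = weight_seq_pos[OF w(1)] weight_seq_pos[OF w(2)]
  have "(\<lambda>k. root k (M k) / root k (L k)) \<longlonglongrightarrow> 0" using assms by (simp add: B_lhd_def)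
  then have "eventually (\<lambda>k. root k (M k) / root k (L k) < e) sequentially"
    using assms(6) by (rule order_tendstoD)
  then obtain K where K: "\<And>k. k \<ge> K \<Longrightarrow> root k (M k) / root k (L k) < e"
    unfolding eventually_sequentially by blast
  define C where "C = 1 + (\<Sum>k\<le>K. M k / (e ^ k * L k))"
  have t0: "M k / (e ^ k * L k) \<ge> 0" for k using pos[of k] assms(6) by simp
  have C1: "C \<ge> 1" unfolding C_def using t0 by (simp add: sum_nonneg)
  have "M k \<le> C * e ^ k * L k" for k
  proof (cases "k \<le> K")
    case True
    then have "M k / (e ^ k * L k) \<le> (\<Sum>k\<le>K. M k / (e ^ k * L k))"
      using t0 by (intro member_le_sum[of k "{..K}" "\<lambda>k. M k / (e ^ k * L k)"]) auto
    then have "M k / (e ^ k * L k) \<le> C" by (simp add: C_def)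
    then show ?thesis using pos[of k] assms(6) by (simp add: field_simps)
  next
    case False
    then have "M k \<le> e ^ k * L k" using K[of k] pos[of k] by (intro root_ratio_le) auto
    also have "\<dots> \<le> C * (e ^ k * L k)" using C1 pos[of k] assms(6) by simp
    finally show ?thesis by (simp add: mult.assoc)
  qed
  then show ?thesis using C1 by (intro exI[of _ C]) auto
qed

section \<open>Differential operators conjugated by exponentials\<close>

lemma bdp_cong:
  assumes "open U" "x \<in> U" "\<And>y. y \<in> U \<Longrightarrow> f y = g y" "bdp x R f A"
  shows "bdp x R g A"
  using assms unfolding bdp_def by (metis pdiff_list_cong)

lemma supermultD:
  assumes "supermult S"
  shows "S k > 0" "S 0 = 1" "S k \<le> S (Suc k)" "real (a + b choose a) * S a * S b \<le> S (a + b)"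
  using assms unfolding supermult_def by auto

lemma supermult_mono: "supermult S \<Longrightarrow> j \<le> k \<Longrightarrow> S j \<le> S k"
  by (rule lift_Suc_mono_le[of S]) (auto dest: supermultD)

text \<open>Enlarging the upper index of the binomial coefficient by j makes supermultiplicativity
  applicable to k and l - k + j.\<close>

lemma supermult_binomial:
  assumes S: "supermult S" and "k \<le> l"
  shows "real (l choose k) * (S k * S (l - k + j)) \<le> S (l + j)"
proof -
  have "real (l choose k) * (S k * S (l - k + j)) \<le> real (l + j choose k) * (S k * S (l - k + j))"
  proof (rule mult_right_mono)
    show "real (l choose k) \<le> real (l + j choose k)" by (simp add: binomial_right_mono)
    show "0 \<le> S k * S (l - k + j)" by (intro mult_nonneg_nonneg less_imp_le supermultD(1)[OF S])
  qed
  also have "\<dots> \<le> S (l + j)"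
    using supermultD(4)[OF S, of k "l - k + j"] assms(2) by (simp add: mult.assoc)
  finally show ?thesis .
qed

lemma pdiff_list_const:
  assumes "is \<noteq> []" shows "pdiff_list is (\<lambda>_. c) x = 0"
proof -
  from assms obtain i js where "is = js @ [i]" by (metis rev_exhaust)
  moreover have "partial i (\<lambda>_. c) = (\<lambda>_. 0)" by (rule ext) (rule partial_eqI[OF has_dir_const])
  ultimately show ?thesis by (simp add: pdiff_list_snoc pdiff_list_zero)
qed

text \<open>Differentiating f (1 / f) = 1 expresses the top derivative of 1 / f by lower ones. With
  t = C / c the resulting sum is geometric, t times the sum of (1 + t)^i over i < l being (1 + t)^l
  - 1, so the induction closes with radius \<rho> (1 + t). The combinatorics of compositions is
  already contained in \<open>S\<close>.\<close>

lemma bdp_inverse: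
  assumes U: "open U" and f: "smooth_on U f" and nz: "\<And>x. x \<in> U \<Longrightarrow> f x \<noteq> 0" and x: "x \<in> U"
    and c: "c > 0" "norm (f x) \<ge> c" and S: "supermult S" and C: "C \<ge> 0" and \<rho>: "\<rho> \<ge> 0"
    and b: "bdp x R f (\<lambda>l. C * \<rho> ^ l * S l)"
  shows "bdp x R (\<lambda>x. inverse (f x)) (\<lambda>l. (1 / c) * (\<rho> * (1 + C / c)) ^ l * S l)"
  unfolding bdp_def
proof (intro allI impI)
  fix "is" :: "'a list" assume "length is \<le> R"
  let ?g = "\<lambda>x. inverse (f x)"
  define t where "t = C / c"
  have t: "t \<ge> 0" using C c by (simp add: t_def)
  let ?A = "\<lambda>l. C * \<rho> ^ l * S l" and ?B = "\<lambda>l. (1 / c) * (\<rho> * (1 + t)) ^ l * S l"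
  have g: "smooth_on U ?g" by (rule smooth_on_inverse[OF U f nz])
  have Spos: "S l > 0" for l by (rule supermultD(1)[OF S])
  show "norm (pdiff_list is ?g x) \<le> (1 / c) * (\<rho> * (1 + C / c)) ^ length is * S (length is)"
    unfolding t_def[symmetric] using \<open>length is \<le> R\<close>
  proof (induction "length is" arbitrary: "is" rule: less_induct)
    case less
    show ?case
    proof (cases "is = []")
      case True
      have "norm (inverse (f x)) \<le> 1 / c"
        unfolding norm_inverse using le_imp_inverse_le[OF c(2) c(1)] by (simp only: inverse_eq_divide)
      then show ?thesis using True supermultD(2)[OF S] by simp
    next
      case False
      define l where "l = length is"
      have "pdiff_list is (\<lambda>x. f x * ?g x) x = pdiff_list is (\<lambda>x. 1) x"
        by (rule pdiff_list_cong[OF U _ x]) (use nz in simp)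
      then have z: "pdiff_list is (\<lambda>x. f x * ?g x) x = 0" using False by (simp add: pdiff_list_const)
      have "norm (pdiff_list is (\<lambda>x. f x * ?g x) x - f x * pdiff_list is ?g x) \<le> conv (?A(0 := 0)) ?B l"
        unfolding l_def
      proof (rule bdp_mult_diff[OF U x f g])
        show "bdp x (length is) f ?A" using b less.prems by (rule bdp_mono) simp
        show "norm (pdiff_list js ?g x) \<le> ?B (length js)" if "length js < length is" for js
          using less.hyps[OF that] that less.prems by simp
      qed
      also have "conv (?A(0 := 0)) ?B l \<le> S l * (\<rho> * (1 + t)) ^ l"
      proof -
        have "conv (?A(0 := 0)) ?B l = (\<Sum>i<l. real (l choose Suc i) * ?A (Suc i) * ?B (l - Suc i))"
          unfolding conv_def sum.atMost_shift by simp
        also have "\<dots> \<le> (\<Sum>i<l. S l * \<rho> ^ l * (t * (1 + t) ^ (l - Suc i)))"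
        proof (rule sum_mono)
          fix i assume i: "i \<in> {..<l}"
          then have l: "l = Suc i + (l - Suc i)" by simp
          have "real (l choose Suc i) * ?A (Suc i) * ?B (l - Suc i) =
              (real (l choose Suc i) * (S (Suc i) * S (l - Suc i + 0))) * ((\<rho> ^ Suc i * \<rho> ^ (l - Suc i)) * (t * (1 + t) ^ (l - Suc i)))"
            by (simp add: power_mult_distrib t_def)
          also have "\<rho> ^ Suc i * \<rho> ^ (l - Suc i) = \<rho> ^ l" using l by (metis power_add)
          also have "(real (l choose Suc i) * (S (Suc i) * S (l - Suc i + 0))) * (\<rho> ^ l * (t * (1 + t) ^ (l - Suc i))) \<le>
              S (l + 0) * (\<rho> ^ l * (t * (1 + t) ^ (l - Suc i)))"
            using t \<rho> i by (intro mult_right_mono supermult_binomial[OF S]) auto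
          finally show "real (l choose Suc i) * ?A (Suc i) * ?B (l - Suc i) \<le> S l * \<rho> ^ l * (t * (1 + t) ^ (l - Suc i))"
            by (simp add: mult.assoc)
        qed
        also have "\<dots> = S l * \<rho> ^ l * (t * (\<Sum>i<l. (1 + t) ^ (l - Suc i)))"
          by (simp only: sum_distrib_left)
        also have "(\<Sum>i<l. (1 + t) ^ (l - Suc i)) = (\<Sum>i<l. (1 + t) ^ i)" by (rule sum.nat_diff_reindex)
        also have "t * (\<Sum>i<l. (1 + t) ^ i) = (1 + t) ^ l - 1" using power_diff_1_eq[of "1 + t" l] by simp
        also have "S l * \<rho> ^ l * ((1 + t) ^ l - 1) \<le> S l * \<rho> ^ l * (1 + t) ^ l"
          using Spos[of l] \<rho> by (intro mult_left_mono) auto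
        also have "\<dots> = S l * (\<rho> * (1 + t)) ^ l" by (simp add: power_mult_distrib)
        finally show ?thesis .
      qed
      finally have "norm (f x) * norm (pdiff_list is ?g x) \<le> S l * (\<rho> * (1 + t)) ^ l"
        by (simp add: z norm_mult l_def)
      moreover have "c * norm (pdiff_list is ?g x) \<le> norm (f x) * norm (pdiff_list is ?g x)"
        by (intro mult_right_mono c) simp
      ultimately show ?thesis using c by (simp add: l_def field_simps)
    qed
  qed
qed

fun Lop :: "real^'n::finite \<Rightarrow> real \<Rightarrow> 'n list \<Rightarrow> (real^'n \<Rightarrow> complex) \<Rightarrow> real^'n \<Rightarrow> complex" where
  "Lop \<theta> \<mu> [] f = f"
| "Lop \<theta> \<mu> (i # is) f = (\<lambda>x. of_real (\<theta> $ i) * Lop \<theta> \<mu> is f x + \<i> * of_real \<mu> * partial i (Lop \<theta> \<mu> is f) x)"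

lemma smooth_on_Lop: "open U \<Longrightarrow> smooth_on U f \<Longrightarrow> smooth_on U (Lop \<theta> \<mu> is f)"
proof (induction "is")
  case (Cons i js)
  then have "smooth_on U (Lop \<theta> \<mu> js f)" by simp
  with Cons.prems(1) show ?case
    unfolding Lop.simps by (intro smooth_on_add smooth_on_cmult smooth_on_partial)
qed simp

lemma Lop_vanish:
  assumes K: "closed K" and f: "\<And>x. x \<notin> K \<Longrightarrow> f x = 0"
  shows "x \<notin> K \<Longrightarrow> Lop \<theta> \<mu> is f x = 0"
proof (induction "is" arbitrary: x)
  case (Cons i js)
  have "pdiff_list [i] (Lop \<theta> \<mu> js f) x = 0"
    by (rule pdiff_list_vanish[OF K Cons.IH Cons.prems])
  with Cons show ?case by simp
qed (use f in simp)

text \<open>With \<open>\<xi> = \<tau> \<theta>\<close> and \<open>\<mu> = 1 / \<tau>\<close>, \<open>Lop\<close> is the operator \<open>i^{|\<alpha>|} \<partial>^\<alpha>\<close> conjugated by \<open>e^{-i x \<xi>}\<close>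
  and divided by \<open>\<tau>^{|\<alpha>|}\<close>.\<close>

lemma pdiff_list_conjugate:
  assumes U: "open U" and f: "smooth_on U f" and \<tau>: "\<tau> * \<mu> = 1" and x: "x \<in> U"
  shows "pdiff_list is (\<lambda>x. ee (- (\<tau> *\<^sub>R \<theta>)) x * f x) x =
    (- \<i>) ^ length is * of_real (\<tau> ^ length is) * (ee (- (\<tau> *\<^sub>R \<theta>)) x * Lop \<theta> \<mu> is f x)"
  using x
proof (induction "is" arbitrary: x)
  case (Cons i js)
  let ?e = "ee (- (\<tau> *\<^sub>R \<theta>))" and ?G = "Lop \<theta> \<mu> js f"
  let ?c = "(- \<i>) ^ length js * complex_of_real (\<tau> ^ length js)"
  have G: "smooth_on U ?G" by (rule smooth_on_Lop[OF U f])
  have "has_dir i (\<lambda>x. ?c * (?e x * ?G x)) (0 * (?e x * ?G x) + ?c *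
      (\<i> * of_real ((- (\<tau> *\<^sub>R \<theta>)) $ i) * ?e x * ?G x + ?e x * partial i ?G x)) x"
    by (intro has_dir_mult has_dir_const has_dir_ee smooth_on_has_dir[OF G Cons.prems])
  then have "has_dir i (pdiff_list js (\<lambda>x. ?e x * f x)) (0 * (?e x * ?G x) + ?c *
      (\<i> * of_real ((- (\<tau> *\<^sub>R \<theta>)) $ i) * ?e x * ?G x + ?e x * partial i ?G x)) x"
    by (rule has_dir_cong[OF U Cons.prems, rotated]) (rule Cons.IH)
  then have "pdiff_list (i # js) (\<lambda>x. ?e x * f x) x = ?c *
      (\<i> * of_real ((- (\<tau> *\<^sub>R \<theta>)) $ i) * ?e x * ?G x + ?e x * partial i ?G x)"
    by (simp add: partial_eqI)
  also have "\<dots> = ?c * ?e x * (- \<i> * of_real \<tau> * of_real (\<theta> $ i) * ?G x + of_real (\<tau> * \<mu>) * partial i ?G x)"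
    unfolding \<tau> by (simp add: algebra_simps)
  also have "\<dots> = (- \<i>) ^ length (i # js) * of_real (\<tau> ^ length (i # js)) * (?e x * Lop \<theta> \<mu> (i # js) f x)"
    by (simp add: algebra_simps)
  finally show ?case .
qed simp

text \<open>Majorant for l derivatives of a function obtained, from one bounded by \<rho>^k S_k, by
  operations that supply a factor \<mu> with each additional derivative. The lower end p counts the
  certain powers of \<mu>, the upper end q the derivatives spent.\<close>

definition Wsum :: "(nat \<Rightarrow> real) \<Rightarrow> real \<Rightarrow> real \<Rightarrow> nat \<Rightarrow> nat \<Rightarrow> nat \<Rightarrow> real" where
  "Wsum S \<rho> \<mu> p q l = (\<Sum>j=p..q. \<mu> ^ j * \<rho> ^ (l + j) * S (l + j))"

context
  fixes S :: "nat \<Rightarrow> real" and \<rho> \<mu> :: real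
  assumes S: "supermult S" and \<rho>: "\<rho> \<ge> 1" and \<mu>: "0 \<le> \<mu>" "\<mu> \<le> 1"
begin

lemma Wterm_nonneg: "\<mu> ^ j * \<rho> ^ (l + j) * S (l + j) \<ge> 0"
  using \<rho> \<mu> supermultD(1)[OF S, of "l + j"] by simp

lemma Wsum_nonneg: "Wsum S \<rho> \<mu> p q l \<ge> 0"
  unfolding Wsum_def by (intro sum_nonneg Wterm_nonneg)

lemma Wsum_mono: "p' \<le> p \<Longrightarrow> q \<le> q' \<Longrightarrow> Wsum S \<rho> \<mu> p q l \<le> Wsum S \<rho> \<mu> p' q' l"
  unfolding Wsum_def by (intro sum_mono2 Wterm_nonneg) auto

text \<open>This is the effect of \<mu> times a derivative: the window moves by one step, with no
  loss at all.\<close>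

lemma Wsum_Suc: "\<mu> * Wsum S \<rho> \<mu> p q (Suc l) = Wsum S \<rho> \<mu> (Suc p) (Suc q) l"
  unfolding Wsum_def sum.shift_bounds_cl_Suc_ivl by (simp add: sum_distrib_left mult_ac)

text \<open>A bare factor \<mu> may be booked as if a derivative had been spent with it, since
  \<rho>^k S_k increases. Lower-order terms thereby fit the same windows.\<close>

lemma Wsum_shift: "\<mu> * Wsum S \<rho> \<mu> p q l \<le> Wsum S \<rho> \<mu> (Suc p) (Suc q) l"
  unfolding Wsum_Suc[symmetric]
  unfolding Wsum_def
proof (intro mult_left_mono sum_mono)
  fix j
  have "\<mu> ^ j * (\<rho> ^ (l + j) * S (l + j)) \<le> \<mu> ^ j * (\<rho> ^ (Suc l + j) * S (Suc l + j))"
    using \<rho> \<mu> supermult_mono[OF S, of "l + j" "Suc l + j"] supermultD(1)[OF S, THEN less_imp_le]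
    by (intro mult_left_mono mult_mono power_increasing) auto
  then show "\<mu> ^ j * \<rho> ^ (l + j) * S (l + j) \<le> \<mu> ^ j * \<rho> ^ (Suc l + j) * S (Suc l + j)"
    by (simp add: mult.assoc)
qed (use \<mu> in auto)

text \<open>The coefficient has radius \<rho> / 2 and the argument radius \<rho>; the ratio produces
  a geometric series with sum at most 2. The radius therefore does not grow under multiplication,
  which an iteration of length \<nu> could not afford.\<close>

lemma conv_Wsum:
  assumes "B \<ge> 0" "A \<ge> 0"
  shows "conv (\<lambda>l. B * (\<rho> / 2) ^ l * S l) (\<lambda>l. A * Wsum S \<rho> \<mu> p q l) l \<le> 2 * B * A * Wsum S \<rho> \<mu> p q l"
proof -
  have "conv (\<lambda>l. B * (\<rho> / 2) ^ l * S l) (\<lambda>l. A * Wsum S \<rho> \<mu> p q l) l \<le>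
      (\<Sum>k\<le>l. (1 / 2) ^ k * (B * A * Wsum S \<rho> \<mu> p q l))"
    unfolding conv_def
  proof (rule sum_mono)
    fix k assume "k \<in> {..l}"
    then have k: "k \<le> l" by simp
    have "real (l choose k) * (B * (\<rho> / 2) ^ k * S k) * (A * Wsum S \<rho> \<mu> p q (l - k)) =
        (\<Sum>j=p..q. (B * A * (1 / 2) ^ k * \<mu> ^ j * \<rho> ^ (l + j)) * (real (l choose k) * (S k * S (l - k + j))))"
      unfolding Wsum_def sum_distrib_left
    proof (rule sum.cong[OF refl])
      fix j
      have "\<rho> ^ (l + j) = \<rho> ^ k * \<rho> ^ (l - k + j)" using k by (simp add: power_add[symmetric])
      then show "real (l choose k) * (B * (\<rho> / 2) ^ k * S k) * (A * (\<mu> ^ j * \<rho> ^ (l - k + j) * S (l - k + j))) =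
        (B * A * (1 / 2) ^ k * \<mu> ^ j * \<rho> ^ (l + j)) * (real (l choose k) * (S k * S (l - k + j)))"
        by (simp add: power_divide)
    qed
    also have "\<dots> \<le> (\<Sum>j=p..q. (B * A * (1 / 2) ^ k * \<mu> ^ j * \<rho> ^ (l + j)) * S (l + j))"
      using assms \<rho> \<mu> k by (intro sum_mono mult_left_mono supermult_binomial[OF S]) auto
    also have "\<dots> = (1 / 2) ^ k * (B * A * Wsum S \<rho> \<mu> p q l)"
      unfolding Wsum_def sum_distrib_left by (intro sum.cong refl) (simp add: mult_ac)
    finally show "real (l choose k) * (B * (\<rho> / 2) ^ k * S k) * (A * Wsum S \<rho> \<mu> p q (l - k)) \<le>
        (1 / 2) ^ k * (B * A * Wsum S \<rho> \<mu> p q l)" .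
  qed
  also have "\<dots> = (\<Sum>k\<le>l. (1 / 2) ^ k) * (B * A * Wsum S \<rho> \<mu> p q l)" by (rule sum_distrib_right[symmetric])
  also have "\<dots> \<le> 2 * (B * A * Wsum S \<rho> \<mu> p q l)"
  proof (rule mult_right_mono)
    have "(\<Sum>k\<le>l. (1 / 2 :: real) ^ k) \<le> 2 - (1 / 2) ^ l" by (induction l) auto
    also have "\<dots> \<le> 2" by simp
    finally show "(\<Sum>k\<le>l. (1 / 2 :: real) ^ k) \<le> 2" .
    show "0 \<le> B * A * Wsum S \<rho> \<mu> p q l" using assms Wsum_nonneg by simp
  qed
  finally show ?thesis by (simp add: mult.assoc)
qed

context
  fixes U :: "(real^'n::finite) set" and x \<theta> :: "real^'n"
  assumes U: "open U" and x: "x \<in> U" and \<theta>: "norm \<theta> \<le> 1"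
begin

lemma bdp_mult_Wsum:
  assumes "smooth_on U b" "smooth_on U f" "B \<ge> 0" "A \<ge> 0"
    "bdp x R b (\<lambda>l. B * (\<rho> / 2) ^ l * S l)" "bdp x R f (\<lambda>l. A * Wsum S \<rho> \<mu> p q l)"
  shows "bdp x R (\<lambda>x. b x * f x) (\<lambda>l. 2 * B * A * Wsum S \<rho> \<mu> p q l)"
  using bdp_mult[OF U assms(1,2) x assms(5,6)] order_refl conv_Wsum[OF assms(3,4)] by (rule bdp_mono)

lemma bdp_partial_Wsum:
  assumes f: "smooth_on U f" and "bdp x (Suc R) f (\<lambda>l. A * Wsum S \<rho> \<mu> p q l)"
  shows "bdp x R (\<lambda>x. \<i> * of_real \<mu> * partial i f x) (\<lambda>l. A * Wsum S \<rho> \<mu> (Suc p) (Suc q) l)"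
proof -
  have "bdp x R (\<lambda>x. \<i> * of_real \<mu> * partial i f x) (\<lambda>l. norm (\<i> * complex_of_real \<mu>) * (A * Wsum S \<rho> \<mu> p q (Suc l)))"
    by (rule bdp_cmult[OF U smooth_on_partial[OF f] x bdp_partial[OF assms(2)]])
  then show ?thesis
    by (rule bdp_mono) (use \<mu> in \<open>auto simp: norm_mult Wsum_Suc[symmetric]\<close>)
qed

text \<open>Two bounds are carried through one induction: for the product of the factors \<theta>_i
  + i \<mu> \<partial>_i, and for this product minus its symbol. In the difference every term
  contains at least one \<mu>, so its window starts one step later.\<close>

lemma bdp_Lop:
  assumes f: "smooth_on U f" and A: "A \<ge> 0"
  shows "bdp x (R + length is) f (\<lambda>l. A * Wsum S \<rho> \<mu> p q l) \<Longrightarrow>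
    bdp x R (Lop \<theta> \<mu> is f) (\<lambda>l. 2 ^ length is * A * Wsum S \<rho> \<mu> p (q + length is) l) \<and>
    bdp x R (\<lambda>x. Lop \<theta> \<mu> is f x - (\<Prod>i\<leftarrow>is. of_real (\<theta> $ i)) * f x)
      (\<lambda>l. 2 ^ length is * A * Wsum S \<rho> \<mu> (Suc p) (q + length is) l)"
proof (induction "is" arbitrary: R)
  case Nil
  then show ?case using A Wsum_nonneg by (auto simp: bdp_def pdiff_list_zero)
next
  case (Cons i js)
  let ?L = "Lop \<theta> \<mu> js f" and ?n = "length js"
  let ?D = "\<lambda>x. ?L x - (\<Prod>i\<leftarrow>js. of_real (\<theta> $ i)) * f x"
  have sL: "smooth_on U ?L" by (rule smooth_on_Lop[OF U f])
  have sD: "smooth_on U ?D" by (intro smooth_on_diff smooth_on_cmult U sL f)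
  have IH: "bdp x (Suc R) ?L (\<lambda>l. 2 ^ ?n * A * Wsum S \<rho> \<mu> p (q + ?n) l)"
    "bdp x (Suc R) ?D (\<lambda>l. 2 ^ ?n * A * Wsum S \<rho> \<mu> (Suc p) (q + ?n) l)"
    using Cons.IH[of "Suc R"] Cons.prems by auto
  have \<theta>i: "norm (complex_of_real (\<theta> $ i)) \<le> 1"
    using component_le_norm_cart[of \<theta> i] \<theta> by simp
  have t: "bdp x R (\<lambda>x. of_real (\<theta> $ i) * g x) (\<lambda>l. 2 ^ ?n * A * Wsum S \<rho> \<mu> p' (Suc (q + ?n)) l)"
    if "smooth_on U g" "bdp x (Suc R) g (\<lambda>l. 2 ^ ?n * A * Wsum S \<rho> \<mu> p' (q + ?n) l)" for g p'
  proof (rule bdp_mono[OF bdp_cmult[OF U that(1) x that(2), of "of_real (\<theta> $ i)"]])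
    fix l
    have "norm (complex_of_real (\<theta> $ i)) * (2 ^ ?n * A * Wsum S \<rho> \<mu> p' (q + ?n) l) \<le> 1 * (2 ^ ?n * A * Wsum S \<rho> \<mu> p' (Suc (q + ?n)) l)"
      using A by (intro mult_mono \<theta>i mult_left_mono Wsum_mono mult_nonneg_nonneg Wsum_nonneg) auto
    then show "norm (complex_of_real (\<theta> $ i)) * (2 ^ ?n * A * Wsum S \<rho> \<mu> p' (q + ?n) l) \<le> 2 ^ ?n * A * Wsum S \<rho> \<mu> p' (Suc (q + ?n)) l"
      by simp
  qed simp
  have d: "bdp x R (\<lambda>x. \<i> * of_real \<mu> * partial i ?L x) (\<lambda>l. 2 ^ ?n * A * Wsum S \<rho> \<mu> (Suc p) (Suc (q + ?n)) l)"
    by (rule bdp_partial_Wsum[OF sL IH(1)])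
  have sd: "smooth_on U (\<lambda>x. \<i> * of_real \<mu> * partial i ?L x)"
    by (intro smooth_on_cmult U smooth_on_partial sL)
  have a1: "bdp x R (\<lambda>x. of_real (\<theta> $ i) * ?L x + \<i> * of_real \<mu> * partial i ?L x)
      (\<lambda>l. 2 ^ ?n * A * Wsum S \<rho> \<mu> p (Suc (q + ?n)) l + 2 ^ ?n * A * Wsum S \<rho> \<mu> (Suc p) (Suc (q + ?n)) l)"
    by (rule bdp_add[OF U smooth_on_cmult[OF U sL] sd x t[OF sL IH(1)] d])
  have a2: "bdp x R (\<lambda>x. of_real (\<theta> $ i) * ?D x + \<i> * of_real \<mu> * partial i ?L x)
      (\<lambda>l. 2 ^ ?n * A * Wsum S \<rho> \<mu> (Suc p) (Suc (q + ?n)) l + 2 ^ ?n * A * Wsum S \<rho> \<mu> (Suc p) (Suc (q + ?n)) l)"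
    by (rule bdp_add[OF U smooth_on_cmult[OF U sD] sd x t[OF sD IH(2)] d])
  have "2 ^ ?n * A * Wsum S \<rho> \<mu> p (Suc (q + ?n)) l + 2 ^ ?n * A * Wsum S \<rho> \<mu> (Suc p) (Suc (q + ?n)) l \<le>
      2 ^ length (i # js) * A * Wsum S \<rho> \<mu> p (q + length (i # js)) l" for l
  proof -
    have "2 ^ ?n * A * Wsum S \<rho> \<mu> (Suc p) (Suc (q + ?n)) l \<le> 2 ^ ?n * A * Wsum S \<rho> \<mu> p (Suc (q + ?n)) l"
      using A by (intro mult_left_mono Wsum_mono) auto
    then show ?thesis by simp
  qed
  from bdp_mono[OF a1 order_refl this]
  have "bdp x R (Lop \<theta> \<mu> (i # js) f) (\<lambda>l. 2 ^ length (i # js) * A * Wsum S \<rho> \<mu> p (q + length (i # js)) l)" by simp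
  moreover have "(\<lambda>x. of_real (\<theta> $ i) * ?D x + \<i> * of_real \<mu> * partial i ?L x) =
      (\<lambda>x. Lop \<theta> \<mu> (i # js) f x - (\<Prod>i\<leftarrow>i # js. of_real (\<theta> $ i)) * f x)"
    by (rule ext) (simp add: algebra_simps)
  then have "bdp x R (\<lambda>x. Lop \<theta> \<mu> (i # js) f x - (\<Prod>i\<leftarrow>i # js. of_real (\<theta> $ i)) * f x)
      (\<lambda>l. 2 ^ length (i # js) * A * Wsum S \<rho> \<mu> (Suc p) (q + length (i # js)) l)"
    using bdp_mono[OF a2 order_refl] by simp
  ultimately show ?case ..
qed

end

end

section \<open>Principal symbol, conjugated transpose and Neumann error\<close>

lemma finite_mi_abs_le: "finite {\<alpha> :: 'n::finite \<Rightarrow> nat. mi_abs \<alpha> \<le> m}"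
proof (rule finite_subset)
  show "{\<alpha> :: 'n \<Rightarrow> nat. mi_abs \<alpha> \<le> m} \<subseteq> PiE UNIV (\<lambda>_. {..m})"
  proof
    fix \<alpha> :: "'n \<Rightarrow> nat" assume "\<alpha> \<in> {\<alpha>. mi_abs \<alpha> \<le> m}"
    then have "\<alpha> i \<le> m" for i
      using member_le_sum[of i UNIV \<alpha>] by (simp add: mi_abs_def)
    then show "\<alpha> \<in> PiE UNIV (\<lambda>_. {..m})" by auto
  qed
qed (intro finite_PiE; simp)

lemma prod_list_mlist: "(\<Prod>i\<leftarrow>mlist \<alpha>. h i) = (\<Prod>i\<in>UNIV. h i ^ \<alpha> i)"
  for h :: "'n::finite \<Rightarrow> 'a::comm_monoid_mult"
proof -
  have "(\<Prod>i\<leftarrow>is. h i) = (\<Prod>i\<in>UNIV. h i ^ count_list is i)" for "is"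
  proof (induction "is")
    case (Cons j js)
    have "h i ^ count_list (j # js) i = (if i = j then h j else 1) * h i ^ count_list js i" for i
      by simp
    then have "(\<Prod>i\<in>UNIV. h i ^ count_list (j # js) i) = h j * (\<Prod>i\<in>UNIV. h i ^ count_list js i)"
      by (simp only: prod.distrib) simp
    then show ?case by (simp only: list.map prod_list.Cons Cons.IH)
  qed simp
  then show ?thesis by (simp add: count_list_mlist)
qed

lemma principal_symbol_mlist:
  "principal_symbol a m x \<theta> = (\<Sum>\<alpha>\<in>{\<alpha>. mi_abs \<alpha> = m}. a \<alpha> x * (\<Prod>i\<leftarrow>mlist \<alpha>. of_real (\<theta> $ i)))"
  by (simp add: principal_symbol_def prod_list_mlist)

text \<open>The transpose of the operator, written with lists of derivatives; on distributions the
  operator acts by composition with it.\<close>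

definition tP :: "(('n::finite \<Rightarrow> nat) \<Rightarrow> real^'n \<Rightarrow> complex) \<Rightarrow> nat \<Rightarrow> (real^'n \<Rightarrow> complex) \<Rightarrow> real^'n \<Rightarrow> complex" where
  "tP a m \<phi> = (\<lambda>x. \<Sum>\<alpha>\<in>{\<alpha>. mi_abs \<alpha> \<le> m}. \<i> ^ mi_abs \<alpha> * pdiff_list (mlist \<alpha>) (\<lambda>y. a \<alpha> y * \<phi> y) x)"

lemma apply_op_tP: "apply_op a m u \<phi> = u (tP a m \<phi>)"
  by (simp add: apply_op_def tP_def pdiff_mlist)

text \<open>The conjugated transpose divided by \<tau>^m. A term of order |\<alpha>| keeps \<mu>^(m
  - |\<alpha>|), so only the terms of order m survive as \<mu> tends to 0.\<close>

definition Lsum :: "(('n::finite \<Rightarrow> nat) \<Rightarrow> real^'n \<Rightarrow> complex) \<Rightarrow> nat \<Rightarrow> real^'n \<Rightarrow> real \<Rightarrow> (real^'n \<Rightarrow> complex) \<Rightarrow> real^'n \<Rightarrow> complex" where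
  "Lsum a m \<theta> \<mu> v = (\<lambda>x. \<Sum>\<alpha>\<in>{\<alpha>. mi_abs \<alpha> \<le> m}. of_real (\<mu> ^ (m - mi_abs \<alpha>)) * Lop \<theta> \<mu> (mlist \<alpha>) (\<lambda>y. a \<alpha> y * v y) x)"

lemma smooth_on_Lsum:
  assumes "open U" "\<And>\<alpha>. mi_abs \<alpha> \<le> m \<Longrightarrow> smooth_on U (a \<alpha>)" "smooth_on U v"
  shows "smooth_on U (Lsum a m \<theta> \<mu> v)"
  unfolding Lsum_def
  by (rule smooth_on_sum[OF assms(1)])
    (rule smooth_on_cmult[OF assms(1) smooth_on_Lop[OF assms(1) smooth_on_mult[OF assms(1) assms(2) assms(3)]]], simp)

lemma Lsum_vanish:
  assumes "closed K" "\<And>x. x \<notin> K \<Longrightarrow> v x = 0" "x \<notin> K"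
  shows "Lsum a m \<theta> \<mu> v x = 0"
proof -
  have "Lop \<theta> \<mu> (mlist \<alpha>) (\<lambda>y. a \<alpha> y * v y) x = 0" for \<alpha>
    by (rule Lop_vanish[OF assms(1) _ assms(3)]) (simp add: assms(2))
  then show ?thesis by (simp add: Lsum_def)
qed

lemma smooth_on_tP:
  assumes "open U" "\<And>\<alpha>. mi_abs \<alpha> \<le> m \<Longrightarrow> smooth_on U (a \<alpha>)" "smooth_on U v"
  shows "smooth_on U (tP a m v)"
  unfolding tP_def
  by (rule smooth_on_sum[OF assms(1)])
    (rule smooth_on_cmult[OF assms(1) smooth_on_pdiff_list[OF smooth_on_mult[OF assms(1) assms(2) assms(3)]]], simp)

lemma tP_vanish:
  assumes "closed K" "\<And>x. x \<notin> K \<Longrightarrow> v x = 0" "x \<notin> K"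
  shows "tP a m v x = 0"
proof -
  have "pdiff_list (mlist \<alpha>) (\<lambda>y. a \<alpha> y * v y) x = 0" for \<alpha>
    by (rule pdiff_list_vanish[OF assms(1) _ assms(3)]) (simp add: assms(2))
  then show ?thesis by (simp add: tP_def)
qed

text \<open>Off \<open>K\<close> both sides vanish, so the identity holds on the whole space.
  Distributions are applied to functions on the whole space, and an equality on \<open>U\<close>
  alone could not be inserted there.\<close>

lemma tP_conjugate:
  assumes U: "open U" and a: "\<And>\<alpha>. mi_abs \<alpha> \<le> m \<Longrightarrow> smooth_on U (a \<alpha>)" and v: "smooth_on U v"
    and K: "closed K" "K \<subseteq> U" "\<And>x. x \<notin> K \<Longrightarrow> v x = 0" and \<tau>: "\<tau> * \<mu> = 1"
  shows "tP a m (\<lambda>x. ee (- (\<tau> *\<^sub>R \<theta>)) x * v x) x = of_real (\<tau> ^ m) * (ee (- (\<tau> *\<^sub>R \<theta>)) x * Lsum a m \<theta> \<mu> v x)"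
proof (cases "x \<in> U")
  case True
  let ?e = "ee (- (\<tau> *\<^sub>R \<theta>))"
  have "\<i> ^ mi_abs \<alpha> * pdiff_list (mlist \<alpha>) (\<lambda>y. a \<alpha> y * (?e y * v y)) x =
      of_real (\<tau> ^ m) * (?e x * (of_real (\<mu> ^ (m - mi_abs \<alpha>)) * Lop \<theta> \<mu> (mlist \<alpha>) (\<lambda>y. a \<alpha> y * v y) x))"
    if \<alpha>: "mi_abs \<alpha> \<le> m" for \<alpha>
  proof -
    have "(\<lambda>y. a \<alpha> y * (?e y * v y)) = (\<lambda>y. ?e y * (a \<alpha> y * v y))" by (simp add: mult_ac)
    then have "\<i> ^ mi_abs \<alpha> * pdiff_list (mlist \<alpha>) (\<lambda>y. a \<alpha> y * (?e y * v y)) x =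
        (\<i> ^ mi_abs \<alpha> * (- \<i>) ^ mi_abs \<alpha>) * of_real (\<tau> ^ mi_abs \<alpha>) * (?e x * Lop \<theta> \<mu> (mlist \<alpha>) (\<lambda>y. a \<alpha> y * v y) x)"
      using pdiff_list_conjugate[OF U smooth_on_mult[OF U a[OF \<alpha>] v] \<tau> True, of "mlist \<alpha>" \<theta>]
      by (simp add: length_mlist)
    also have "\<i> ^ mi_abs \<alpha> * (- \<i>) ^ mi_abs \<alpha> = (1::complex)" unfolding power_mult_distrib[symmetric] by simp
    also have "\<tau> ^ mi_abs \<alpha> = \<tau> ^ m * \<mu> ^ (m - mi_abs \<alpha>)"
    proof -
      have "\<tau> ^ m = \<tau> ^ mi_abs \<alpha> * \<tau> ^ (m - mi_abs \<alpha>)" using \<alpha> by (simp add: power_add[symmetric])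
      then have "\<tau> ^ m * \<mu> ^ (m - mi_abs \<alpha>) = \<tau> ^ mi_abs \<alpha> * (\<tau> * \<mu>) ^ (m - mi_abs \<alpha>)"
        by (simp add: power_mult_distrib)
      then show ?thesis by (simp add: \<tau>)
    qed
    finally show ?thesis by simp
  qed
  then show ?thesis unfolding tP_def Lsum_def sum_distrib_left by (intro sum.cong refl) simp
next
  case False
  then have x: "x \<notin> K" using K by blast
  have "tP a m (\<lambda>x. ee (- (\<tau> *\<^sub>R \<theta>)) x * v x) x = 0" by (rule tP_vanish[OF K(1) _ x]) (simp add: K(3))
  moreover have "Lsum a m \<theta> \<mu> v x = 0" by (rule Lsum_vanish[OF K(1) K(3) x])
  ultimately show ?thesis by simp
qed

definition Rop :: "(('n::finite \<Rightarrow> nat) \<Rightarrow> real^'n \<Rightarrow> complex) \<Rightarrow> nat \<Rightarrow> (real^'n \<Rightarrow> complex) \<Rightarrow> real^'n \<Rightarrow> real \<Rightarrow>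
    (real^'n \<Rightarrow> complex) \<Rightarrow> real^'n \<Rightarrow> complex" where
  "Rop a m q \<theta> \<mu> v = (\<lambda>x. v x - Lsum a m \<theta> \<mu> (\<lambda>y. q y * v y) x)"

lemma smooth_on_Rop:
  assumes "open U" "\<And>\<alpha>. mi_abs \<alpha> \<le> m \<Longrightarrow> smooth_on U (a \<alpha>)" "smooth_on U q" "smooth_on U v"
  shows "smooth_on U (Rop a m q \<theta> \<mu> v)"
  unfolding Rop_def
  by (rule smooth_on_diff[OF assms(1) assms(4) smooth_on_Lsum[OF assms(1,2) smooth_on_mult[OF assms(1,3,4)]]])

lemma Rop_vanish:
  assumes "closed K" "\<And>x. x \<notin> K \<Longrightarrow> v x = 0" "x \<notin> K"
  shows "Rop a m q \<theta> \<mu> v x = 0"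
proof -
  have "Lsum a m \<theta> \<mu> (\<lambda>y. q y * v y) x = 0" by (rule Lsum_vanish[OF assms(1) _ assms(3)]) (simp add: assms(2))
  then show ?thesis by (simp add: Rop_def assms)
qed

context
  fixes S :: "nat \<Rightarrow> real" and \<rho> \<mu> :: real
    and U :: "(real^'n::finite) set" and x \<theta> :: "real^'n"
  assumes S: "supermult S" and \<rho>: "\<rho> \<ge> 1" and \<mu>: "0 \<le> \<mu>" "\<mu> \<le> 1"
    and U: "open U" and x: "x \<in> U" and \<theta>: "norm \<theta> \<le> 1"
begin

lemma Wsum_power_shift: "\<mu> ^ d * Wsum S \<rho> \<mu> p q l \<le> Wsum S \<rho> \<mu> (p + d) (q + d) l"
proof (induction d arbitrary: p q)
  case (Suc d)
  have "\<mu> ^ Suc d * Wsum S \<rho> \<mu> p q l = \<mu> ^ d * (\<mu> * Wsum S \<rho> \<mu> p q l)" by simp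
  also have "\<dots> \<le> \<mu> ^ d * Wsum S \<rho> \<mu> (Suc p) (Suc q) l"
    using \<mu> by (intro mult_left_mono Wsum_shift[OF S \<rho> \<mu>]) auto
  also have "\<dots> \<le> Wsum S \<rho> \<mu> (Suc p + d) (Suc q + d) l" by (rule Suc.IH)
  finally show ?case by simp
qed simp

lemma bdp_Lsum:
  assumes a: "\<And>\<alpha>. mi_abs \<alpha> \<le> m \<Longrightarrow> smooth_on U (a \<alpha>)" and v: "smooth_on U v"
    and B: "B \<ge> 0" and A: "A \<ge> 0"
    and ba: "\<And>\<alpha> R. mi_abs \<alpha> \<le> m \<Longrightarrow> bdp x R (a \<alpha>) (\<lambda>l. B * (\<rho> / 2) ^ l * S l)"
    and bv: "bdp x (R + m) v (\<lambda>l. A * Wsum S \<rho> \<mu> 0 0 l)"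
  shows "bdp x R (Lsum a m \<theta> \<mu> v)
    (\<lambda>l. real (card {\<alpha> :: 'n \<Rightarrow> nat. mi_abs \<alpha> \<le> m}) * 2 ^ m * (2 * B) * A * Wsum S \<rho> \<mu> 0 m l)"
proof -
  let ?I = "{\<alpha> :: 'n \<Rightarrow> nat. mi_abs \<alpha> \<le> m}"
  have "bdp x R (Lsum a m \<theta> \<mu> v) (\<lambda>l. \<Sum>\<alpha>\<in>?I. 2 ^ m * (2 * B) * A * Wsum S \<rho> \<mu> 0 m l)"
    unfolding Lsum_def
  proof (rule bdp_sum[OF U _ x])
    fix \<alpha> assume "\<alpha> \<in> ?I"
    then have \<alpha>: "mi_abs \<alpha> \<le> m" by simp
    have sv: "smooth_on U (\<lambda>y. a \<alpha> y * v y)" by (rule smooth_on_mult[OF U a[OF \<alpha>] v])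
    have sL: "smooth_on U (Lop \<theta> \<mu> (mlist \<alpha>) (\<lambda>y. a \<alpha> y * v y))" by (rule smooth_on_Lop[OF U sv])
    then show "smooth_on U (\<lambda>x. of_real (\<mu> ^ (m - mi_abs \<alpha>)) * Lop \<theta> \<mu> (mlist \<alpha>) (\<lambda>y. a \<alpha> y * v y) x)"
      by (rule smooth_on_cmult[OF U])
    have "bdp x (R + m) (\<lambda>y. a \<alpha> y * v y) (\<lambda>l. 2 * B * A * Wsum S \<rho> \<mu> 0 0 l)"
      by (rule bdp_mult_Wsum[OF S \<rho> \<mu> U x \<theta> a[OF \<alpha>] v B A ba[OF \<alpha>] bv])
    then have "bdp x (R + length (mlist \<alpha>)) (\<lambda>y. a \<alpha> y * v y) (\<lambda>l. 2 * B * A * Wsum S \<rho> \<mu> 0 0 l)"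
      by (rule bdp_mono) (use \<alpha> in \<open>auto simp: length_mlist\<close>)
    with bdp_Lop[OF S \<rho> \<mu> U x \<theta> sv, of "2 * B * A" R "mlist \<alpha>" 0 0] A B
    have bL: "bdp x R (Lop \<theta> \<mu> (mlist \<alpha>) (\<lambda>y. a \<alpha> y * v y)) (\<lambda>l. 2 ^ mi_abs \<alpha> * (2 * B * A) * Wsum S \<rho> \<mu> 0 (mi_abs \<alpha>) l)"
      by (simp add: length_mlist)
    show "bdp x R (\<lambda>x. of_real (\<mu> ^ (m - mi_abs \<alpha>)) * Lop \<theta> \<mu> (mlist \<alpha>) (\<lambda>y. a \<alpha> y * v y) x)
        (\<lambda>l. 2 ^ m * (2 * B) * A * Wsum S \<rho> \<mu> 0 m l)"
    proof (rule bdp_mono[OF bdp_cmult[OF U sL x bL]])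
      fix l
      have "\<mu> ^ (m - mi_abs \<alpha>) * (2 ^ mi_abs \<alpha> * (2 * B * A) * Wsum S \<rho> \<mu> 0 (mi_abs \<alpha>) l) \<le>
          1 * (2 ^ m * (2 * B * A) * Wsum S \<rho> \<mu> 0 m l)"
        using \<alpha> \<mu> A B by (intro mult_mono Wsum_mono[OF S \<rho> \<mu>] power_le_one power_increasing mult_nonneg_nonneg Wsum_nonneg[OF S \<rho> \<mu>]) auto
      then show "norm (complex_of_real (\<mu> ^ (m - mi_abs \<alpha>))) * (2 ^ mi_abs \<alpha> * (2 * B * A) * Wsum S \<rho> \<mu> 0 (mi_abs \<alpha>) l) \<le>
          2 ^ m * (2 * B) * A * Wsum S \<rho> \<mu> 0 m l"
        using \<mu> by (simp add: norm_power mult.assoc)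
    qed simp
  qed
  then show ?thesis by (simp add: mult.assoc)
qed

text \<open>The principal part cancels because the symbol times q is 1: the error is minus the sum
  of the terms \<open>?t\<close>. For order m the symbol has been subtracted, for lower order a
  factor \<mu>^(m - |\<alpha>|) is present; either way the window starts at p + 1. The bounds
  concern the products of the coefficients with q, so each step contains a single
  multiplication.\<close>

lemma bdp_Rop:
  assumes a: "\<And>\<alpha>. mi_abs \<alpha> \<le> m \<Longrightarrow> smooth_on U (a \<alpha>)" and q: "smooth_on U q" and v: "smooth_on U v"
    and inv: "\<And>y. y \<in> U \<Longrightarrow> principal_symbol a m y \<theta> * q y = 1"
    and B: "B \<ge> 0" and A: "A \<ge> 0"
    and ba: "\<And>\<alpha> R. mi_abs \<alpha> \<le> m \<Longrightarrow> bdp x R (\<lambda>y. a \<alpha> y * q y) (\<lambda>l. B * (\<rho> / 2) ^ l * S l)"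
    and bv: "bdp x (R + m) v (\<lambda>l. A * Wsum S \<rho> \<mu> p k l)"
  shows "bdp x R (Rop a m q \<theta> \<mu> v)
    (\<lambda>l. real (card {\<alpha> :: 'n \<Rightarrow> nat. mi_abs \<alpha> \<le> m}) * 2 ^ m * (2 * B) * A * Wsum S \<rho> \<mu> (Suc p) (k + m) l)"
proof -
  let ?I = "{\<alpha> :: 'n \<Rightarrow> nat. mi_abs \<alpha> \<le> m}"
  let ?L = "\<lambda>\<alpha>. Lop \<theta> \<mu> (mlist \<alpha>) (\<lambda>y. a \<alpha> y * (q y * v y))"
  let ?t = "\<lambda>\<alpha> y. if mi_abs \<alpha> = m then ?L \<alpha> y - (\<Prod>i\<leftarrow>mlist \<alpha>. of_real (\<theta> $ i)) * (a \<alpha> y * (q y * v y))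
    else of_real (\<mu> ^ (m - mi_abs \<alpha>)) * ?L \<alpha> y"
  have sv: "smooth_on U (\<lambda>y. a \<alpha> y * (q y * v y))" if "mi_abs \<alpha> \<le> m" for \<alpha>
    by (intro smooth_on_mult U a that q v)
  have sL: "smooth_on U (?L \<alpha>)" if "mi_abs \<alpha> \<le> m" for \<alpha> by (rule smooth_on_Lop[OF U sv[OF that]])
  have st: "smooth_on U (?t \<alpha>)" if "\<alpha> \<in> ?I" for \<alpha>
  proof -
    have \<alpha>: "mi_abs \<alpha> \<le> m" using that by simp
    have "smooth_on U (\<lambda>y. ?L \<alpha> y - (\<Prod>i\<leftarrow>mlist \<alpha>. of_real (\<theta> $ i)) * (a \<alpha> y * (q y * v y)))"
      by (intro smooth_on_diff smooth_on_cmult U sL[OF \<alpha>] sv[OF \<alpha>])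
    moreover have "smooth_on U (\<lambda>y. of_real (\<mu> ^ (m - mi_abs \<alpha>)) * ?L \<alpha> y)"
      by (intro smooth_on_cmult U sL[OF \<alpha>])
    ultimately show ?thesis by (cases "mi_abs \<alpha> = m") simp_all
  qed
  have bt: "bdp x R (?t \<alpha>) (\<lambda>l. 2 ^ m * (2 * B) * A * Wsum S \<rho> \<mu> (Suc p) (k + m) l)" if "\<alpha> \<in> ?I" for \<alpha>
  proof -
    have \<alpha>: "mi_abs \<alpha> \<le> m" using that by simp
    have "bdp x (R + m) (\<lambda>y. (a \<alpha> y * q y) * v y) (\<lambda>l. 2 * B * A * Wsum S \<rho> \<mu> p k l)"
      by (rule bdp_mult_Wsum[OF S \<rho> \<mu> U x \<theta> smooth_on_mult[OF U a[OF \<alpha>] q] v B A ba[OF \<alpha>] bv])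
    then have "bdp x (R + length (mlist \<alpha>)) (\<lambda>y. a \<alpha> y * (q y * v y)) (\<lambda>l. 2 * B * A * Wsum S \<rho> \<mu> p k l)"
      unfolding mult.assoc by (rule bdp_mono) (use \<alpha> in \<open>auto simp: length_mlist\<close>)
    with bdp_Lop[OF S \<rho> \<mu> U x \<theta> sv[OF \<alpha>], of "2 * B * A" R "mlist \<alpha>" p k] A B
    have bL: "bdp x R (?L \<alpha>) (\<lambda>l. 2 ^ mi_abs \<alpha> * (2 * B * A) * Wsum S \<rho> \<mu> p (k + mi_abs \<alpha>) l)"
      "bdp x R (\<lambda>y. ?L \<alpha> y - (\<Prod>i\<leftarrow>mlist \<alpha>. of_real (\<theta> $ i)) * (a \<alpha> y * (q y * v y)))
        (\<lambda>l. 2 ^ mi_abs \<alpha> * (2 * B * A) * Wsum S \<rho> \<mu> (Suc p) (k + mi_abs \<alpha>) l)"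
      by (simp_all add: length_mlist)
    show ?thesis
    proof (cases "mi_abs \<alpha> = m")
      case True
      then show ?thesis using bL(2) by (simp add: mult.assoc)
    next
      case False
      have "bdp x R (\<lambda>y. of_real (\<mu> ^ (m - mi_abs \<alpha>)) * ?L \<alpha> y) (\<lambda>l. 2 ^ m * (2 * B) * A * Wsum S \<rho> \<mu> (Suc p) (k + m) l)"
      proof (rule bdp_mono[OF bdp_cmult[OF U sL[OF \<alpha>] x bL(1)]])
        fix l
        have "\<mu> ^ (m - mi_abs \<alpha>) * Wsum S \<rho> \<mu> p (k + mi_abs \<alpha>) l \<le>
            Wsum S \<rho> \<mu> (p + (m - mi_abs \<alpha>)) (k + mi_abs \<alpha> + (m - mi_abs \<alpha>)) l"
          by (rule Wsum_power_shift)
        also have "\<dots> \<le> Wsum S \<rho> \<mu> (Suc p) (k + m) l"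
          using \<alpha> False by (intro Wsum_mono[OF S \<rho> \<mu>]) auto
        finally have "(2 ^ mi_abs \<alpha> * (2 * B * A)) * (\<mu> ^ (m - mi_abs \<alpha>) * Wsum S \<rho> \<mu> p (k + mi_abs \<alpha>) l) \<le>
            (2 ^ m * (2 * B * A)) * Wsum S \<rho> \<mu> (Suc p) (k + m) l"
          using \<alpha> A B \<mu> by (intro mult_mono mult_right_mono power_increasing mult_nonneg_nonneg Wsum_nonneg[OF S \<rho> \<mu>]) auto
        then show "norm (complex_of_real (\<mu> ^ (m - mi_abs \<alpha>))) * (2 ^ mi_abs \<alpha> * (2 * B * A) * Wsum S \<rho> \<mu> p (k + mi_abs \<alpha>) l) \<le>
            2 ^ m * (2 * B) * A * Wsum S \<rho> \<mu> (Suc p) (k + m) l"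
          using \<mu> by (simp add: norm_power mult_ac)
      qed simp
      with False show ?thesis by simp
    qed
  qed
  have "bdp x R (\<lambda>y. \<Sum>\<alpha>\<in>?I. ?t \<alpha> y) (\<lambda>l. \<Sum>\<alpha>\<in>?I. 2 ^ m * (2 * B) * A * Wsum S \<rho> \<mu> (Suc p) (k + m) l)"
    by (rule bdp_sum[OF U st x bt])
  from bdp_cmult[OF U smooth_on_sum[OF U st] x this, of "- 1"]
  have b: "bdp x R (\<lambda>y. - 1 * (\<Sum>\<alpha>\<in>?I. ?t \<alpha> y))
      (\<lambda>l. real (card ?I) * 2 ^ m * (2 * B) * A * Wsum S \<rho> \<mu> (Suc p) (k + m) l)"
    by (simp add: mult.assoc)
  show ?thesis
  proof (rule bdp_cong[OF U x _ b])
    fix y assume y: "y \<in> U"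
    have "(\<Sum>\<alpha>\<in>?I. ?t \<alpha> y) = (\<Sum>\<alpha>\<in>?I. of_real (\<mu> ^ (m - mi_abs \<alpha>)) * ?L \<alpha> y -
        (if mi_abs \<alpha> = m then (\<Prod>i\<leftarrow>mlist \<alpha>. of_real (\<theta> $ i)) * (a \<alpha> y * (q y * v y)) else 0))"
      by (intro sum.cong refl) auto
    also have "\<dots> = Lsum a m \<theta> \<mu> (\<lambda>y. q y * v y) y -
        (\<Sum>\<alpha>\<in>?I. if mi_abs \<alpha> = m then (\<Prod>i\<leftarrow>mlist \<alpha>. of_real (\<theta> $ i)) * (a \<alpha> y * (q y * v y)) else 0)"
      by (simp add: sum_subtractf Lsum_def)
    also have "(\<Sum>\<alpha>\<in>?I. if mi_abs \<alpha> = m then (\<Prod>i\<leftarrow>mlist \<alpha>. of_real (\<theta> $ i)) * (a \<alpha> y * (q y * v y)) else 0) =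
        (\<Sum>\<alpha>\<in>{\<alpha>. mi_abs \<alpha> = m}. (\<Prod>i\<leftarrow>mlist \<alpha>. of_real (\<theta> $ i)) * (a \<alpha> y * (q y * v y)))"
      by (rule sum.mono_neutral_cong_right[OF finite_mi_abs_le]) auto
    also have "\<dots> = (principal_symbol a m y \<theta> * q y) * v y"
      unfolding principal_symbol_mlist sum_distrib_right by (intro sum.cong refl) (simp add: mult_ac)
    also have "\<dots> = v y" by (simp add: inv[OF y])
    finally show "- 1 * (\<Sum>\<alpha>\<in>?I. ?t \<alpha> y) = Rop a m q \<theta> \<mu> v y" by (simp add: Rop_def)
  qed
qed

text \<open>After k steps the window runs from k to m k: at least k powers of \<mu> gained, at most
  m k derivatives lost. The constant enters merely as a k-th power because the radius \<rho> stays
  the same.\<close>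

lemma bdp_Rop_iterate:
  assumes a: "\<And>\<alpha>. mi_abs \<alpha> \<le> m \<Longrightarrow> smooth_on U (a \<alpha>)" and q: "smooth_on U q" and v: "smooth_on U v"
    and inv: "\<And>y. y \<in> U \<Longrightarrow> principal_symbol a m y \<theta> * q y = 1"
    and B: "B \<ge> 0" and A: "A \<ge> 0"
    and ba: "\<And>\<alpha> R. mi_abs \<alpha> \<le> m \<Longrightarrow> bdp x R (\<lambda>y. a \<alpha> y * q y) (\<lambda>l. B * (\<rho> / 2) ^ l * S l)"
  shows "bdp x (R + m * k) v (\<lambda>l. A * Wsum S \<rho> \<mu> 0 0 l) \<Longrightarrow>
    smooth_on U ((Rop a m q \<theta> \<mu> ^^ k) v) \<and> bdp x R ((Rop a m q \<theta> \<mu> ^^ k) v)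
    (\<lambda>l. (real (card {\<alpha> :: 'n \<Rightarrow> nat. mi_abs \<alpha> \<le> m}) * 2 ^ m * (2 * B)) ^ k * A * Wsum S \<rho> \<mu> k (m * k) l)"
proof (induction k arbitrary: R)
  case 0
  then show ?case using v by simp
next
  case (Suc k)
  let ?c = "real (card {\<alpha> :: 'n \<Rightarrow> nat. mi_abs \<alpha> \<le> m}) * 2 ^ m * (2 * B)"
  have IH: "smooth_on U ((Rop a m q \<theta> \<mu> ^^ k) v)" "bdp x (R + m) ((Rop a m q \<theta> \<mu> ^^ k) v) (\<lambda>l. ?c ^ k * A * Wsum S \<rho> \<mu> k (m * k) l)"
    using Suc.IH[of "R + m"] Suc.prems by (auto simp: add_ac)
  have s: "smooth_on U ((Rop a m q \<theta> \<mu> ^^ Suc k) v)"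
    using smooth_on_Rop[OF U a q IH(1)] by simp
  have c: "?c ^ k * A \<ge> 0" using A B by simp
  have "bdp x R (Rop a m q \<theta> \<mu> ((Rop a m q \<theta> \<mu> ^^ k) v)) (\<lambda>l. ?c * (?c ^ k * A) * Wsum S \<rho> \<mu> (Suc k) (m * k + m) l)"
    by (rule bdp_Rop[OF a q IH(1) inv B c ba IH(2)])
  with s show ?case by (simp add: mult_ac add.commute)
qed

end

section \<open>Cutting off distributions\<close>

lemma distribution_linear:
  "distribution \<Omega> u \<Longrightarrow> test_fun \<Omega> \<phi> \<Longrightarrow> test_fun \<Omega> \<psi> \<Longrightarrow> u (\<lambda>x. a * \<phi> x + b * \<psi> x) = a * u \<phi> + b * u \<psi>"
  unfolding distribution_def by blast

lemma distribution_cmult: "distribution \<Omega> u \<Longrightarrow> test_fun \<Omega> \<phi> \<Longrightarrow> u (\<lambda>x. a * \<phi> x) = a * u \<phi>"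
  using distribution_linear[of \<Omega> u \<phi> \<phi> a 0] by simp

lemma distribution_add:
  "distribution \<Omega> u \<Longrightarrow> test_fun \<Omega> \<phi> \<Longrightarrow> test_fun \<Omega> \<psi> \<Longrightarrow> u (\<lambda>x. \<phi> x + \<psi> x) = u \<phi> + u \<psi>"
  using distribution_linear[of \<Omega> u \<phi> \<psi> 1 1] by simp

text \<open>The seminorm estimate in the form used later: derivatives along lists, on
  \<open>K\<close> only, for functions smooth on \<Omega> and zero off \<open>K\<close>. A point of
  \<open>K\<close> forces B to be nonnegative, which permits replacing the constant by its maximum
  with 0.\<close>

lemma distribution_order:
  assumes \<Omega>: "open \<Omega>" and u: "distribution \<Omega> u" and K: "compact K" "K \<subseteq> \<Omega>" "K \<noteq> {}"
  shows "\<exists>C\<ge>0. \<exists>k. \<forall>\<phi> B. smooth_on \<Omega> \<phi> \<longrightarrow> (\<forall>x. x \<notin> K \<longrightarrow> \<phi> x = 0) \<longrightarrow>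
    (\<forall>is x. length is \<le> k \<longrightarrow> x \<in> K \<longrightarrow> norm (pdiff_list is \<phi> x) \<le> B) \<longrightarrow> norm (u \<phi>) \<le> C * B"
proof -
  obtain C k where C: "\<And>\<phi> B. test_fun \<Omega> \<phi> \<Longrightarrow> tsupport \<phi> \<subseteq> K \<Longrightarrow>
    (\<And>\<alpha> x. mi_abs \<alpha> \<le> k \<Longrightarrow> norm (pdiff \<alpha> \<phi> x) \<le> B) \<Longrightarrow> norm (u \<phi>) \<le> C * B"
    using u K unfolding distribution_def by metis
  have "norm (u \<phi>) \<le> max C 0 * B" if s: "smooth_on \<Omega> \<phi>" and v: "\<And>x. x \<notin> K \<Longrightarrow> \<phi> x = 0"
    and B: "\<And>is x. length is \<le> k \<Longrightarrow> x \<in> K \<Longrightarrow> norm (pdiff_list is \<phi> x) \<le> B" for \<phi> B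
  proof -
    obtain x0 where x0: "x0 \<in> K" using K by blast
    have B0: "B \<ge> 0" by (rule order_trans[OF norm_ge_zero B[of "[]" x0]]) (use x0 in auto)
    have cK: "closed K" using K by (simp add: compact_imp_closed)
    have "norm (pdiff \<alpha> \<phi> x) \<le> B" if "mi_abs \<alpha> \<le> k" for \<alpha> x
    proof (cases "x \<in> K")
      case True
      then show ?thesis using B[of "mlist \<alpha>" x] that by (simp add: pdiff_mlist length_mlist)
    next
      case False
      have "pdiff_list (mlist \<alpha>) \<phi> x = 0" by (rule pdiff_list_vanish[OF cK v False])
      then show ?thesis using B0 by (simp add: pdiff_mlist)
    qed
    then have "norm (u \<phi>) \<le> C * B"
      by (intro C test_funI[OF \<Omega> K(1,2,2) v s] tsupport_subset[OF cK v])
    also have "\<dots> \<le> max C 0 * B" using B0 by (intro mult_right_mono) auto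
    finally show ?thesis .
  qed
  then show ?thesis by (intro exI[of _ "max C 0"] conjI exI[of _ k]) auto
qed

lemma finite_short_lists: "finite {is :: 'n::finite list. length is \<le> k}"
  using finite_lists_length_le[of "UNIV :: 'n set" k] by simp

lemma conv_mono_const:
  assumes "\<And>l. A l \<ge> 0" "l \<le> k" shows "conv A (\<lambda>_. B) l \<le> (\<Sum>l\<le>k. conv A (\<lambda>_. 1) l) * max B 0"
proof -
  have n: "conv A (\<lambda>_. 1) l \<ge> 0" for l unfolding conv_def using assms(1) by (intro sum_nonneg) auto
  have "conv A (\<lambda>_. B) l = conv A (\<lambda>_. 1) l * B" by (simp add: conv_def sum_distrib_right)
  also have "\<dots> \<le> conv A (\<lambda>_. 1) l * max B 0" using n by (intro mult_left_mono) auto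
  also have "\<dots> \<le> (\<Sum>l\<le>k. conv A (\<lambda>_. 1) l) * max B 0"
    using assms(2) n by (intro mult_right_mono member_le_sum) auto
  finally show ?thesis .
qed

text \<open>The derivatives of the cutoffs are bounded order by order independently of r, so the
  Leibniz rule gives one seminorm and one constant for the whole sequence.\<close>

lemma cutoff_sequence:
  fixes \<Omega> :: "(real^'n::finite) set"
  assumes \<Omega>: "open \<Omega>" and u: "distribution \<Omega> u" and K: "compact K" "K \<subseteq> \<Omega>" "K \<noteq> {}"
    and \<phi>: "\<And>r::nat. smooth_on UNIV (\<phi> r)" "\<And>r x. x \<notin> K \<Longrightarrow> \<phi> r x = 0"
    and C: "\<And>r is x. norm (pdiff_list is (\<phi> r) x) \<le> C (length is)"
  shows "bounded_E_prime_seq \<Omega> (\<lambda>r \<psi>. u (\<lambda>x. \<phi> r x * \<psi> x))"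
proof -
  obtain D k where D: "D \<ge> 0" "\<And>\<phi> B. smooth_on \<Omega> \<phi> \<Longrightarrow> (\<And>x. x \<notin> K \<Longrightarrow> \<phi> x = 0) \<Longrightarrow>
    (\<And>is x. length is \<le> k \<Longrightarrow> x \<in> K \<Longrightarrow> norm (pdiff_list is \<phi> x) \<le> B) \<Longrightarrow> norm (u \<phi>) \<le> D * B"
    using distribution_order[OF \<Omega> u K] by metis
  have C0: "C l \<ge> 0" for l
    using order_trans[OF norm_ge_zero C[of "replicate l undefined" 0 undefined]] by simp
  define E where "E = (\<Sum>l\<le>k. conv C (\<lambda>_. 1) l)"
  have E0: "E \<ge> 0" unfolding E_def conv_def using C0 by (intro sum_nonneg) auto
  have sm: "smooth_on \<Omega> (\<lambda>x. \<phi> r x * \<psi> x)" if "smooth_on \<Omega> \<psi>" for r \<psi>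
    by (rule smooth_on_mult[OF \<Omega> smooth_on_subset[OF \<phi>(1) subset_UNIV] that])
  have bound: "norm (u (\<lambda>x. \<phi> r x * \<psi> x)) \<le> D * (E * max B 0)"
    if \<psi>: "smooth_on \<Omega> \<psi>" and B: "\<And>is x. length is \<le> k \<Longrightarrow> x \<in> K \<Longrightarrow> norm (pdiff_list is \<psi> x) \<le> B" for r \<psi> B
  proof (rule D(2)[OF sm[OF \<psi>]])
    show "\<phi> r x * \<psi> x = 0" if "x \<notin> K" for x using \<phi>(2)[OF that] by simp
    fix "is" :: "'n list" and x assume l: "length is \<le> k" and x: "x \<in> K"
    have "bdp x k (\<phi> r) C" unfolding bdp_def using C by blast
    moreover have "bdp x k \<psi> (\<lambda>_. B)" unfolding bdp_def using B x by blast
    ultimately have "bdp x k (\<lambda>x. \<phi> r x * \<psi> x) (conv C (\<lambda>_. B))"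
      using x K by (intro bdp_mult[OF \<Omega> smooth_on_subset[OF \<phi>(1) subset_UNIV] \<psi>]) auto
    from bdpD[OF this l] show "norm (pdiff_list is (\<lambda>x. \<phi> r x * \<psi> x) x) \<le> E * max B 0"
      unfolding E_def by (rule order_trans) (rule conv_mono_const[OF C0 l])
  qed
  have tf: "test_fun \<Omega> (\<lambda>x. \<phi> r x * \<psi> x)" if "smooth_on \<Omega> \<psi>" for r \<psi>
    by (rule test_funI[OF \<Omega> K(1,2,2) _ sm[OF that]]) (simp add: \<phi>(2))
  have E': "E_prime \<Omega> (\<lambda>\<psi>. u (\<lambda>x. \<phi> r x * \<psi> x))" for r
    unfolding E_prime_def
  proof (intro conjI allI impI)
    fix f g :: "real^'n \<Rightarrow> complex" and a b assume fg: "smooth_on \<Omega> f" "smooth_on \<Omega> g"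
    have "(\<lambda>x. \<phi> r x * (a * f x + b * g x)) = (\<lambda>x. a * (\<phi> r x * f x) + b * (\<phi> r x * g x))"
      by (simp add: algebra_simps)
    then show "u (\<lambda>x. \<phi> r x * (a * f x + b * g x)) = a * u (\<lambda>x. \<phi> r x * f x) + b * u (\<lambda>x. \<phi> r x * g x)"
      using distribution_linear[OF u tf[OF fg(1)] tf[OF fg(2)]] by simp
  next
    obtain x0 where x0: "x0 \<in> K" using K by blast
    have "norm (u (\<lambda>x. \<phi> r x * f x)) \<le> (D * E) * B"
      if f: "smooth_on \<Omega> f" and B: "\<And>\<alpha> x. mi_abs \<alpha> \<le> k \<Longrightarrow> x \<in> K \<Longrightarrow> norm (pdiff \<alpha> f x) \<le> B" for f B
    proof -
      \<comment> \<open>\<open>E_prime\<close> speaks of multi-indices; symmetry of mixed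
        derivatives extends the bound to all lists.\<close>
      have "norm (pdiff_list is f x) \<le> B" if "length is \<le> k" "x \<in> K" for "is" x
        using pdiff_list_eq_pdiff[OF \<Omega> f, of x "is"] B[of "count_list is" x] that K by (auto simp: mi_abs_count_list)
      moreover from this have "B \<ge> 0" using x0 order_trans[OF norm_ge_zero] by (metis bot_nat_0.extremum list.size(3))
      ultimately show ?thesis using bound[OF f, of B r] by (simp add: max_def mult.assoc)
    qed
    then show "\<exists>K C k. compact K \<and> K \<subseteq> \<Omega> \<and> (\<forall>f B. smooth_on \<Omega> f \<longrightarrow>
        (\<forall>\<alpha>. mi_abs \<alpha> \<le> k \<longrightarrow> (\<forall>x\<in>K. norm (pdiff \<alpha> f x) \<le> B)) \<longrightarrow> norm (u (\<lambda>x. \<phi> r x * f x)) \<le> C * B)"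
      using K by (intro exI[of _ K] exI[of _ "D * E"] exI[of _ k]) auto
  qed
  have "\<exists>c. \<forall>r. \<forall>\<psi>\<in>X. norm (u (\<lambda>x. \<phi> r x * \<psi> x)) \<le> c" if X: "bounded_E \<Omega> X" for X
  proof -
    have "\<exists>c. \<forall>\<psi>\<in>X. \<forall>x\<in>K. norm (pdiff \<alpha> \<psi> x) \<le> c" for \<alpha>
      using X K unfolding bounded_E_def by blast
    then obtain c where c: "\<And>\<alpha> \<psi> x. \<psi> \<in> X \<Longrightarrow> x \<in> K \<Longrightarrow> norm (pdiff \<alpha> \<psi> x) \<le> c \<alpha>" by metis
    define B where "B = (\<Sum>is\<in>{is :: 'n list. length is \<le> k}. \<bar>c (count_list is)\<bar>)"
    have "norm (u (\<lambda>x. \<phi> r x * \<psi> x)) \<le> D * (E * max B 0)" if \<psi>: "\<psi> \<in> X" for r \<psi>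
    proof (rule bound)
      show s: "smooth_on \<Omega> \<psi>" using X \<psi> by (simp add: bounded_E_def)
      fix "is" :: "'n list" and x assume l: "length is \<le> k" and x: "x \<in> K"
      have "norm (pdiff_list is \<psi> x) \<le> c (count_list is)"
        using c[OF \<psi> x, of "count_list is"] pdiff_list_eq_pdiff[OF \<Omega> s, of x "is"] x K by auto
      also have "\<dots> \<le> \<bar>c (count_list is)\<bar>" by simp
      also have "\<dots> \<le> B"
        unfolding B_def using l by (intro member_le_sum[of "is" _ "\<lambda>is. \<bar>c (count_list is)\<bar>"] finite_short_lists) auto
      finally show "norm (pdiff_list is \<psi> x) \<le> B" .
    qed
    then show ?thesis by blast
  qed
  with E' show ?thesis unfolding bounded_E_prime_seq_def by blast
qed

lemma test_fun_tP:
  assumes \<Omega>: "open \<Omega>" and a: "\<And>\<alpha>. mi_abs \<alpha> \<le> m \<Longrightarrow> smooth_on \<Omega> (a \<alpha>)" and \<phi>: "test_fun \<Omega> \<phi>"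
  shows "test_fun \<Omega> (tP a m \<phi>)"
proof (rule test_funI[OF \<Omega>])
  show K: "compact (tsupport \<phi>)" "tsupport \<phi> \<subseteq> \<Omega>" "tsupport \<phi> \<subseteq> \<Omega>" using \<phi> by (auto simp: test_fun_def)
  have "smooth_on \<Omega> \<phi>" using \<phi> smooth_on_subset by (auto simp: test_fun_def)
  from smooth_on_tP[OF \<Omega> a this] show "smooth_on \<Omega> (tP a m \<phi>)" .
  show "tP a m \<phi> x = 0" if "x \<notin> tsupport \<phi>" for x
    by (rule tP_vanish[OF compact_imp_closed[OF K(1)] tsupport_outside that])
qed

text \<open>The order of continuity rises by m, since the transpose differentiates up to m times.
  Linearity is checked as an equality of functions on the whole space: on \<Omega> by the rules for
  derivatives, elsewhere because everything vanishes off the supports.\<close>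

lemma distribution_apply_op:
  fixes \<Omega> :: "(real^'n::finite) set"
  assumes \<Omega>: "open \<Omega>" and u: "distribution \<Omega> u" and a: "\<And>\<alpha>. mi_abs \<alpha> \<le> m \<Longrightarrow> smooth_on \<Omega> (a \<alpha>)"
  shows "distribution \<Omega> (apply_op a m u)"
proof -
  let ?I = "{\<alpha> :: 'n \<Rightarrow> nat. mi_abs \<alpha> \<le> m}"
  have sm: "smooth_on \<Omega> \<phi>" if "test_fun \<Omega> \<phi>" for \<phi>
    using that smooth_on_subset by (auto simp: test_fun_def)
  have lin: "apply_op a m u (\<lambda>x. c * \<phi> x + d * \<psi> x) = c * apply_op a m u \<phi> + d * apply_op a m u \<psi>"
    if \<phi>: "test_fun \<Omega> \<phi>" and \<psi>: "test_fun \<Omega> \<psi>" for \<phi> \<psi> c d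
  proof -
    have "tP a m (\<lambda>x. c * \<phi> x + d * \<psi> x) x = c * tP a m \<phi> x + d * tP a m \<psi> x" for x
    proof (cases "x \<in> \<Omega>")
      case True
      have "pdiff_list (mlist \<alpha>) (\<lambda>y. a \<alpha> y * (c * \<phi> y + d * \<psi> y)) x =
          c * pdiff_list (mlist \<alpha>) (\<lambda>y. a \<alpha> y * \<phi> y) x + d * pdiff_list (mlist \<alpha>) (\<lambda>y. a \<alpha> y * \<psi> y) x"
        if "\<alpha> \<in> ?I" for \<alpha>
      proof -
        have s: "smooth_on \<Omega> (\<lambda>y. a \<alpha> y * \<phi> y)" "smooth_on \<Omega> (\<lambda>y. a \<alpha> y * \<psi> y)"
          using that sm \<phi> \<psi> by (auto intro!: smooth_on_mult \<Omega> a)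
        have "(\<lambda>y. a \<alpha> y * (c * \<phi> y + d * \<psi> y)) = (\<lambda>y. c * (a \<alpha> y * \<phi> y) + d * (a \<alpha> y * \<psi> y))"
          by (simp add: algebra_simps)
        then show ?thesis
          using pdiff_list_add[OF \<Omega> smooth_on_cmult[OF \<Omega> s(1)] smooth_on_cmult[OF \<Omega> s(2)] True]
            pdiff_list_cmult[OF \<Omega> s(1) True] pdiff_list_cmult[OF \<Omega> s(2) True] by simp
      qed
      then show ?thesis
        unfolding tP_def sum_distrib_left sum.distrib[symmetric] by (intro sum.cong refl) (simp add: algebra_simps)
    next
      case False
      have K: "closed (tsupport \<phi> \<union> tsupport \<psi>)" "tsupport \<phi> \<union> tsupport \<psi> \<subseteq> \<Omega>"
        using \<phi> \<psi> by (auto simp: test_fun_def intro: compact_imp_closed)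
      have z: "\<phi> y = 0" "\<psi> y = 0" if "y \<notin> tsupport \<phi> \<union> tsupport \<psi>" for y
        using that by (auto intro: tsupport_outside)
      have x: "x \<notin> tsupport \<phi> \<union> tsupport \<psi>" using False K by blast
      have "tP a m (\<lambda>x. c * \<phi> x + d * \<psi> x) x = 0" by (rule tP_vanish[OF K(1) _ x]) (simp add: z)
      moreover have "tP a m \<phi> x = 0" by (rule tP_vanish[OF K(1) z(1) x])
      moreover have "tP a m \<psi> x = 0" by (rule tP_vanish[OF K(1) z(2) x])
      ultimately show ?thesis by simp
    qed
    then have "tP a m (\<lambda>x. c * \<phi> x + d * \<psi> x) = (\<lambda>x. c * tP a m \<phi> x + d * tP a m \<psi> x)" by blast
    then show ?thesis unfolding apply_op_tP
      using distribution_linear[OF u test_fun_tP[OF \<Omega> a \<phi>] test_fun_tP[OF \<Omega> a \<psi>]] by simp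
  qed
  have cont: "\<exists>C k. \<forall>\<phi> B. test_fun \<Omega> \<phi> \<longrightarrow> tsupport \<phi> \<subseteq> K \<longrightarrow>
        (\<forall>\<alpha>. mi_abs \<alpha> \<le> k \<longrightarrow> (\<forall>x. norm (pdiff \<alpha> \<phi> x) \<le> B)) \<longrightarrow> norm (apply_op a m u \<phi>) \<le> C * B"
    if K: "compact K" "K \<subseteq> \<Omega>" for K
  proof (cases "K = {}")
    case True
    have "apply_op a m u \<phi> = 0" if "test_fun \<Omega> \<phi>" "tsupport \<phi> \<subseteq> K" for \<phi>
    proof -
      have "\<phi> x = 0" for x using that True tsupport_outside[of x \<phi>] by auto
      then have "\<phi> = (\<lambda>x. 0 * \<phi> x + 0 * \<phi> x)" by (simp add: fun_eq_iff)
      then have "apply_op a m u \<phi> = apply_op a m u (\<lambda>x. 0 * \<phi> x + 0 * \<phi> x)" by (rule arg_cong)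
      then show ?thesis unfolding lin[OF that(1) that(1)] by simp
    qed
    then show ?thesis by (intro exI[of _ 0]) auto
  next
    case False
    obtain D k where D: "D \<ge> 0" "\<And>\<phi> B. smooth_on \<Omega> \<phi> \<Longrightarrow> (\<And>x. x \<notin> K \<Longrightarrow> \<phi> x = 0) \<Longrightarrow>
      (\<And>is x. length is \<le> k \<Longrightarrow> x \<in> K \<Longrightarrow> norm (pdiff_list is \<phi> x) \<le> B) \<Longrightarrow> norm (u \<phi>) \<le> D * B"
      using distribution_order[OF \<Omega> u K False] by metis
    have "\<exists>c. \<forall>x\<in>K. norm (pdiff_list is (a \<alpha>) x) \<le> c" if \<alpha>: "mi_abs \<alpha> \<le> m" for "is" \<alpha>
    proof -
      have "continuous_on K (pdiff_list is (a \<alpha>))"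
        by (rule continuous_on_subset[OF smooth_onD(1)[OF a[OF \<alpha>]] K(2)])
      then have "bounded (pdiff_list is (a \<alpha>) ` K)"
        by (rule compact_imp_bounded[OF compact_continuous_image[OF _ K(1)]])
      then show ?thesis unfolding bounded_iff by blast
    qed
    then have "\<forall>is \<alpha>. \<exists>c. mi_abs \<alpha> \<le> m \<longrightarrow> (\<forall>x\<in>K. norm (pdiff_list is (a \<alpha>) x) \<le> c)" by blast
    then obtain c where "\<forall>is \<alpha>. mi_abs \<alpha> \<le> m \<longrightarrow> (\<forall>x\<in>K. norm (pdiff_list is (a \<alpha>) x) \<le> c is \<alpha>)" by metis
    then have c: "norm (pdiff_list is (a \<alpha>) x) \<le> c is \<alpha>" if "\<alpha> \<in> ?I" "x \<in> K" for "is" \<alpha> x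
      using that by blast
    define M where "M = (\<Sum>is\<in>{is :: 'n list. length is \<le> k + m}. \<Sum>\<alpha>\<in>?I. \<bar>c is \<alpha>\<bar>)"
    have M0: "M \<ge> 0" unfolding M_def by (intro sum_nonneg) auto
    have M: "norm (pdiff_list is (a \<alpha>) x) \<le> M" if "\<alpha> \<in> ?I" "x \<in> K" "length is \<le> k + m" for "is" \<alpha> x
    proof -
      have "norm (pdiff_list is (a \<alpha>) x) \<le> \<bar>c is \<alpha>\<bar>" using c[OF that(1,2), of "is"] by linarith
      also have "\<dots> \<le> (\<Sum>\<alpha>\<in>?I. \<bar>c is \<alpha>\<bar>)"
        using that(1) by (intro member_le_sum[of \<alpha> ?I "\<lambda>\<alpha>. \<bar>c is \<alpha>\<bar>"] finite_mi_abs_le) auto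
      also have "\<dots> \<le> M"
        unfolding M_def using that(3)
        by (intro member_le_sum[of "is" _ "\<lambda>is. \<Sum>\<alpha>\<in>?I. \<bar>c is \<alpha>\<bar>"] finite_short_lists) (auto intro: sum_nonneg)
      finally show ?thesis .
    qed
    define E where "E = (\<Sum>l\<le>k + m. conv (\<lambda>_. M) (\<lambda>_. 1) l)"
    have E0: "E \<ge> 0" unfolding E_def conv_def using M0 by (intro sum_nonneg) auto
    obtain x0 where x0: "x0 \<in> K" using False by blast
    have "norm (apply_op a m u \<phi>) \<le> (D * (real (card ?I) * E)) * B"
      if \<phi>: "test_fun \<Omega> \<phi>" "tsupport \<phi> \<subseteq> K" and B: "\<And>\<alpha> x. mi_abs \<alpha> \<le> k + m \<Longrightarrow> norm (pdiff \<alpha> \<phi> x) \<le> B" for \<phi> B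
    proof -
      have B0: "B \<ge> 0" by (rule order_trans[OF norm_ge_zero B[of "\<lambda>_. 0" x0]]) (simp add: mi_abs_def)
      have z: "\<phi> x = 0" if "x \<notin> K" for x using that \<phi>(2) tsupport_outside by blast
      have "norm (u (tP a m \<phi>)) \<le> D * (real (card ?I) * (E * B))"
      proof (rule D(2))
        show "smooth_on \<Omega> (tP a m \<phi>)" by (rule smooth_on_tP[OF \<Omega> a sm[OF \<phi>(1)]])
        show "tP a m \<phi> x = 0" if "x \<notin> K" for x
          by (rule tP_vanish[OF compact_imp_closed[OF K(1)] z that])
        fix "is" :: "'n list" and x assume l: "length is \<le> k" and x: "x \<in> K"
        then have xO: "x \<in> \<Omega>" using K by blast
        have s: "smooth_on \<Omega> (\<lambda>y. a \<alpha> y * \<phi> y)" if "\<alpha> \<in> ?I" for \<alpha>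
          using that by (intro smooth_on_mult \<Omega> a sm \<phi>) auto
        have "pdiff_list is (tP a m \<phi>) x = (\<Sum>\<alpha>\<in>?I. \<i> ^ mi_abs \<alpha> * pdiff_list (is @ mlist \<alpha>) (\<lambda>y. a \<alpha> y * \<phi> y) x)"
        proof -
          have "pdiff_list is (tP a m \<phi>) x = (\<Sum>\<alpha>\<in>?I. pdiff_list is (\<lambda>x. \<i> ^ mi_abs \<alpha> * pdiff_list (mlist \<alpha>) (\<lambda>y. a \<alpha> y * \<phi> y) x) x)"
            unfolding tP_def by (rule pdiff_list_sum[OF \<Omega> smooth_on_cmult[OF \<Omega> smooth_on_pdiff_list[OF s]] xO])
          also have "\<dots> = (\<Sum>\<alpha>\<in>?I. \<i> ^ mi_abs \<alpha> * pdiff_list (is @ mlist \<alpha>) (\<lambda>y. a \<alpha> y * \<phi> y) x)"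
            unfolding pdiff_list_append
            by (intro sum.cong refl pdiff_list_cmult[OF \<Omega> smooth_on_pdiff_list[OF s] xO])
          finally show ?thesis .
        qed
        also have "norm \<dots> \<le> (\<Sum>\<alpha>\<in>?I. E * B)"
        proof (rule sum_norm_le)
          fix \<alpha> assume \<alpha>: "\<alpha> \<in> ?I"
          have bb: "norm (pdiff_list js \<phi> x) \<le> B" if "length js \<le> k + m" for js
            using pdiff_list_eq_pdiff[OF \<Omega> sm[OF \<phi>(1)] xO, of js] B[of "count_list js" x] that
            by (simp add: mi_abs_count_list)
          have "bdp x (k + m) (a \<alpha>) (\<lambda>_. M)" "bdp x (k + m) \<phi> (\<lambda>_. B)"
            unfolding bdp_def using M[OF \<alpha> x] bb by auto
          then have "bdp x (k + m) (\<lambda>y. a \<alpha> y * \<phi> y) (conv (\<lambda>_. M) (\<lambda>_. B))"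
            using \<alpha> by (intro bdp_mult[OF \<Omega> a sm[OF \<phi>(1)] xO]) auto
          moreover have l': "length (is @ mlist \<alpha>) \<le> k + m" using l \<alpha> by (simp add: length_mlist)
          ultimately have "norm (pdiff_list (is @ mlist \<alpha>) (\<lambda>y. a \<alpha> y * \<phi> y) x) \<le> conv (\<lambda>_. M) (\<lambda>_. B) (length (is @ mlist \<alpha>))"
            by (rule bdpD)
          also have "\<dots> \<le> E * max B 0" unfolding E_def by (rule conv_mono_const[OF M0 l'])
          finally show "norm (\<i> ^ mi_abs \<alpha> * pdiff_list (is @ mlist \<alpha>) (\<lambda>y. a \<alpha> y * \<phi> y) x) \<le> E * B"
            using B0 by (simp add: norm_mult norm_power max_def)
        qed
        finally show "norm (pdiff_list is (tP a m \<phi>) x) \<le> real (card ?I) * (E * B)" by simp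
      qed
      then show ?thesis by (simp add: apply_op_tP mult.assoc)
    qed
    then show ?thesis by (intro exI[of _ "D * (real (card ?I) * E)"] exI[of _ "k + m"]) auto
  qed
  show ?thesis unfolding distribution_def using lin cont by blast
qed

section \<open>Transfer of microlocal regularity\<close>

text \<open>The powers of t cancel, so each term of the window is at most \<open>b\<close> times a
  geometric factor in \<nu>, and the at most m \<nu> + 1 terms cost 2^(m \<nu>). The factor
  \<open>b\<close> is left free: it is N_l for the terms of the expansion and N_l N_\<nu> t^(-\<nu>)
  for its remainder.\<close>

lemma Wsum_le_threshold:
  assumes S: "supermult S" and N: "b \<ge> 0" and C: "C \<ge> 1" and \<rho>: "\<rho> \<ge> 1" and t: "t \<ge> 1"
    and w: "\<And>j. p \<le> j \<Longrightarrow> j \<le> q \<Longrightarrow> S (l + j) \<le> C ^ (l + j + 1) * b * t ^ j"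
    and l: "l \<le> \<nu> + s" and q: "q \<le> m * \<nu>"
  shows "Wsum S \<rho> (1 / t) p q l \<le> C * (\<rho> * C) ^ s * (2 ^ m * (\<rho> * C) ^ (m + 1)) ^ \<nu> * b"
proof -
  have rc: "\<rho> * C \<ge> 1" using mult_mono[OF \<rho> C] \<rho> by simp
  have "Wsum S \<rho> (1 / t) p q l \<le> (\<Sum>j=p..q. C * (\<rho> * C) ^ (\<nu> + s + m * \<nu>) * b)"
    unfolding Wsum_def
  proof (rule sum_mono)
    fix j assume "j \<in> {p..q}"
    then have pq: "p \<le> j" "j \<le> q" and j: "j \<le> m * \<nu>" using q by simp_all
    have "(1 / t) ^ j * \<rho> ^ (l + j) * S (l + j) \<le> (1 / t) ^ j * \<rho> ^ (l + j) * (C ^ (l + j + 1) * b * t ^ j)"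
      using t \<rho> by (intro mult_left_mono w pq) auto
    also have "\<dots> = C * (\<rho> * C) ^ (l + j) * b"
      using t by (simp add: power_mult_distrib power_divide)
    also have "\<dots> \<le> C * (\<rho> * C) ^ (\<nu> + s + m * \<nu>) * b"
      using rc C l j N by (intro mult_right_mono mult_left_mono power_increasing) auto
    finally show "(1 / t) ^ j * \<rho> ^ (l + j) * S (l + j) \<le> C * (\<rho> * C) ^ (\<nu> + s + m * \<nu>) * b" .
  qed
  also have "\<dots> = real (card {p..q}) * (C * (\<rho> * C) ^ (\<nu> + s + m * \<nu>) * b)" by simp
  also have "\<dots> \<le> 2 ^ (m * \<nu>) * (C * (\<rho> * C) ^ (\<nu> + s + m * \<nu>) * b)"
  proof (rule mult_right_mono)
    have "card {p..q} \<le> Suc q" by simp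
    also have "Suc q \<le> 2 ^ q" using less_exp[of q] by (simp add: Suc_le_eq)
    also have "\<dots> \<le> 2 ^ (m * \<nu>)" using q by (intro power_increasing) auto
    finally have "real (card {p..q}) \<le> real (2 ^ (m * \<nu>))" by (simp only: of_nat_le_iff)
    then show "real (card {p..q}) \<le> 2 ^ (m * \<nu>)" by simp
    show "0 \<le> C * (\<rho> * C) ^ (\<nu> + s + m * \<nu>) * b" using C rc N by simp
  qed
  also have "\<dots> = C * (\<rho> * C) ^ s * (2 ^ m * (\<rho> * C) ^ (m + 1)) ^ \<nu> * b"
  proof -
    have "(\<rho> * C) ^ (\<nu> + s + m * \<nu>) = (\<rho> * C) ^ s * ((\<rho> * C) ^ (m + 1)) ^ \<nu>"
      unfolding power_mult[symmetric] power_add[symmetric] by (simp add: algebra_simps)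
    then show ?thesis unfolding power_mult_distrib[of "2 ^ m"] power_mult[of 2 m \<nu>] by (simp only: mult_ac)
  qed
  finally show ?thesis .
qed

text \<open>The estimate \<open>main\<close> requires |\<xi>| >= 1 and N_\<nu> <= |\<xi>|^\<nu>, and
  it loses |\<xi>|^k0. Using it at \<nu> = n + s for the order n absorbs the loss; for small \<xi>
  and above the threshold the polynomial growth of the transforms takes over. R-semiregularity
  finally replaces the shifted weight by M_n.\<close>

lemma transfer_conclusion:
  fixes \<Omega> :: "(real^'n::finite) set"
  assumes wm: "weight_matrix MM" and Rsr: "R_semiregular MM" and \<Omega>: "open \<Omega>"
    and ws: "bounded_E_prime_seq \<Omega> ws" and N: "N \<in> MM" and C3: "C3 \<ge> 0" and \<kappa>3: "\<kappa>3 \<ge> 1"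
    and main: "\<And>\<nu> \<xi> A. \<nu> \<ge> 1 \<Longrightarrow> \<xi> \<in> \<Gamma>' \<Longrightarrow> A \<ge> 0 \<Longrightarrow> norm \<xi> \<ge> 1 \<Longrightarrow> N \<nu> \<le> norm \<xi> ^ \<nu> \<Longrightarrow>
      (\<And>\<eta>. \<eta> \<in> \<Gamma> \<Longrightarrow> norm \<eta> ^ \<nu> * norm (fourier (fs \<nu>) \<eta>) \<le> A) \<Longrightarrow>
      norm \<xi> ^ \<nu> * norm (fourier (ws \<nu>) \<xi>) \<le> C3 * \<kappa>3 ^ \<nu> * norm \<xi> ^ k0 * (N (\<nu> + s2) + A)"
  shows "\<exists>M C \<kappa> s. M \<in> MM \<and> C \<ge> 0 \<and> \<kappa> \<ge> 1 \<and> (\<forall>n \<xi> A. \<xi> \<in> \<Gamma>' \<longrightarrow> A \<ge> 0 \<longrightarrow>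
    (\<forall>\<eta>\<in>\<Gamma>. norm \<eta> ^ (n + s) * norm (fourier (fs (n + s)) \<eta>) \<le> A) \<longrightarrow>
    norm \<xi> ^ n * norm (fourier (ws (n + s)) \<xi>) \<le> C * \<kappa> ^ n * (M n + A))"
proof -
  from bounded_E_prime_seq_equicontinuous[OF \<Omega> ws] obtain K C1 k1 where C1: "C1 \<ge> 0"
    and eqc: "\<And>N \<phi> B. smooth_on \<Omega> \<phi> \<Longrightarrow> B > 0 \<Longrightarrow>
    (\<And>is x. length is \<le> k1 \<Longrightarrow> x \<in> K \<Longrightarrow> norm (pdiff_list is \<phi> x) \<le> B) \<Longrightarrow> norm (ws N \<phi>) \<le> C1 * B"
    by blast
  have fb: "norm (fourier (ws r) \<xi>) \<le> C1 * (1 + norm \<xi>) ^ k1" for r \<xi>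
    by (rule norm_fourier_le[OF \<Omega> eqc])
  \<comment> \<open>Here \<open>k0\<close> absorbs the loss in \<open>main\<close>,
    \<open>k1\<close> the growth of the transforms, and the additional 1 guarantees \<nu> >=
    1.\<close>
  define s where "s = k0 + k1 + 1"
  obtain M C5 where M: "M \<in> MM" "C5 \<ge> 1" "\<And>k. N (k + (s + s2)) \<le> C5 ^ (k + 1) * M k"
    using R_semiregular_shift[OF wm Rsr, of "s + s2"] N by blast
  have wN: "weight_seq N" "weight_seq M" using wm N M(1) weight_matrixD by blast+
  define D where "D = C1 * 2 ^ k1 + C3 * \<kappa>3 ^ s"
  have D: "D \<ge> 0" "C1 * 2 ^ k1 \<le> D" "C3 * \<kappa>3 ^ s \<le> D" using C1 C3 \<kappa>3 by (auto simp: D_def)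
  have est: "norm \<xi> ^ n * norm (fourier (ws (n + s)) \<xi>) \<le> D * C5 * (\<kappa>3 * C5) ^ n * (M n + A)"
    if \<xi>: "\<xi> \<in> \<Gamma>'" and A: "A \<ge> 0"
      and h: "\<And>\<eta>. \<eta> \<in> \<Gamma> \<Longrightarrow> norm \<eta> ^ (n + s) * norm (fourier (fs (n + s)) \<eta>) \<le> A" for n \<xi> A
  proof -
    let ?t = "norm \<xi>" and ?\<nu> = "n + s" and ?F = "norm (fourier (ws (n + s)) \<xi>)"
    have N1: "N (?\<nu> + s2) \<ge> 1" "M n \<ge> 0" using weight_seq_ge_1[OF wN(1)] weight_seq_pos[OF wN(2), of n] by auto
    have key: "?t ^ n * ?F \<le> D * \<kappa>3 ^ n * (N (?\<nu> + s2) + A)"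
    proof (cases "?t \<ge> 1")
      case False
      have "?t ^ n * ?F \<le> 1 * (C1 * 2 ^ k1)"
      proof (intro mult_mono)
        show "?t ^ n \<le> 1" using False by (intro power_le_one) auto
        have "(1 + ?t) ^ k1 \<le> 2 ^ k1" using False by (intro power_mono) auto
        then have "C1 * (1 + ?t) ^ k1 \<le> C1 * 2 ^ k1" using C1 by (rule mult_left_mono)
        with fb[of ?\<nu> \<xi>] show "?F \<le> C1 * 2 ^ k1" by linarith
      qed auto
      also have "\<dots> \<le> D * \<kappa>3 ^ n * (N (?\<nu> + s2) + A)"
      proof -
        have "D * 1 * 1 \<le> D * \<kappa>3 ^ n * (N (?\<nu> + s2) + A)"
          using D(1) \<kappa>3 N1 A by (intro mult_mono) auto
        with D(2) show ?thesis by simp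
      qed
      finally show ?thesis .
    next
      case t: True
      show ?thesis
      proof (cases "N ?\<nu> \<le> ?t ^ ?\<nu>")
        case False
        have "(1 + ?t) ^ k1 \<le> (2 * ?t) ^ k1" using t by (intro power_mono) auto
        then have "C1 * (1 + ?t) ^ k1 \<le> C1 * (2 * ?t) ^ k1" using C1 by (rule mult_left_mono)
        with fb[of ?\<nu> \<xi>] have "?F \<le> C1 * (2 * ?t) ^ k1" by linarith
        then have "?t ^ n * ?F \<le> ?t ^ n * (C1 * (2 * ?t) ^ k1)" by (intro mult_left_mono) auto
        also have "\<dots> = C1 * 2 ^ k1 * ?t ^ (n + k1)" by (simp add: power_mult_distrib power_add)
        also have "\<dots> \<le> D * (1 * N (?\<nu> + s2))"
        proof -
          have "?t ^ (n + k1) \<le> ?t ^ ?\<nu>" using t by (intro power_increasing) (auto simp: s_def)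
          also have "\<dots> \<le> N ?\<nu>" using False by simp
          also have "\<dots> \<le> N (?\<nu> + s2)" by (intro weight_seq_mono wN) simp
          finally show ?thesis using D C1 by (intro mult_mono) auto
        qed
        also have "\<dots> \<le> D * (\<kappa>3 ^ n * (N (?\<nu> + s2) + A))"
          using D(1) \<kappa>3 N1 A by (intro mult_left_mono mult_mono) auto
        finally show ?thesis by (simp add: mult.assoc)
      next
        case True
        have "?t ^ k0 * (?t ^ n * ?F) \<le> ?t ^ ?\<nu> * ?F"
          unfolding mult.assoc[symmetric] power_add[symmetric]
          using t by (intro mult_right_mono power_increasing) (auto simp: s_def)
        also have "\<dots> \<le> C3 * \<kappa>3 ^ ?\<nu> * ?t ^ k0 * (N (?\<nu> + s2) + A)"
          by (rule main) (use \<xi> A t True h in \<open>auto simp: s_def\<close>)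
        also have "\<dots> = ?t ^ k0 * (C3 * \<kappa>3 ^ ?\<nu> * (N (?\<nu> + s2) + A))" by (simp add: mult_ac)
        finally have "?t ^ n * ?F \<le> C3 * \<kappa>3 ^ ?\<nu> * (N (?\<nu> + s2) + A)"
          by (rule mult_left_le_imp_le) (use t in \<open>auto intro!: zero_less_power\<close>)
        also have "\<dots> = (C3 * \<kappa>3 ^ s) * \<kappa>3 ^ n * (N (?\<nu> + s2) + A)" by (simp add: power_add mult_ac)
        also have "\<dots> \<le> D * \<kappa>3 ^ n * (N (?\<nu> + s2) + A)"
          using D(3) \<kappa>3 N1 A by (intro mult_right_mono) auto
        finally show ?thesis .
      qed
    qed
    also have "\<dots> \<le> D * \<kappa>3 ^ n * (C5 ^ (n + 1) * (M n + A))"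
    proof -
      have "N (?\<nu> + s2) \<le> C5 ^ (n + 1) * M n" using M(3)[of n] by (simp add: add.assoc)
      moreover have "1 * A \<le> C5 ^ (n + 1) * A" using M(2) A by (intro mult_right_mono one_le_power) auto
      ultimately have "N (?\<nu> + s2) + A \<le> C5 ^ (n + 1) * (M n + A)" by (simp add: distrib_left)
      then show ?thesis using D(1) \<kappa>3 by (intro mult_left_mono) auto
    qed
    also have "\<dots> = D * C5 * (\<kappa>3 * C5) ^ n * (M n + A)" by (simp add: power_mult_distrib)
    finally show ?thesis .
  qed
  have "\<kappa>3 * C5 \<ge> 1" using mult_mono[OF \<kappa>3 M(2)] \<kappa>3 by simp
  moreover have "D * C5 \<ge> 0" using D M(2) by simp
  ultimately show ?thesis
    using est M(1) by (intro exI[of _ M] exI[of _ "D * C5"] exI[of _ "\<kappa>3 * C5"] exI[of _ s]) blast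
qed

text \<open>The free bound A stands for whatever decay the transforms of the given sequence have at
  order n + s. The new neighbourhood, cone, sequence and constants are chosen before n, \<xi> and A,
  so one choice serves every weight and every radius, as the Beurling class demands.\<close>

definition transfers :: "(nat \<Rightarrow> real) set \<Rightarrow> (real^'n::finite) set \<Rightarrow> ((real^'n \<Rightarrow> complex) \<Rightarrow> complex) \<Rightarrow>
    ((real^'n \<Rightarrow> complex) \<Rightarrow> complex) \<Rightarrow> real^'n \<Rightarrow> real^'n \<Rightarrow> bool" where
  "transfers MM \<Omega> f u x0 \<xi>0 \<longleftrightarrow> (\<forall>V \<Gamma> fs. open V \<longrightarrow> x0 \<in> V \<longrightarrow> V \<subseteq> \<Omega> \<longrightarrow> open_cone \<Gamma> \<longrightarrow> \<xi>0 \<in> \<Gamma> \<longrightarrow>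
     bounded_E_prime_seq \<Omega> fs \<longrightarrow> (\<forall>N \<phi>. test_fun V \<phi> \<longrightarrow> fs N \<phi> = f \<phi>) \<longrightarrow>
     (\<exists>V' \<Gamma>' us M C \<kappa> s. open V' \<and> x0 \<in> V' \<and> V' \<subseteq> \<Omega> \<and> open_cone \<Gamma>' \<and> \<xi>0 \<in> \<Gamma>' \<and>
       bounded_E_prime_seq \<Omega> us \<and> (\<forall>N \<phi>. test_fun V' \<phi> \<longrightarrow> us N \<phi> = u \<phi>) \<and>
       M \<in> MM \<and> C \<ge> 0 \<and> \<kappa> \<ge> 1 \<and> (\<forall>n \<xi> A. \<xi> \<in> \<Gamma>' \<longrightarrow> A \<ge> 0 \<longrightarrow>
         (\<forall>\<eta>\<in>\<Gamma>. norm \<eta> ^ (n + s) * norm (fourier (fs (n + s)) \<eta>) \<le> A) \<longrightarrow>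
         norm \<xi> ^ n * norm (fourier (us n) \<xi>) \<le> C * \<kappa> ^ n * (M n + A))))"

text \<open>Two members of the second matrix enter, one dominating M and one dominating the shift of
  L by s; the larger of them serves both purposes.\<close>

lemma transfers_micro_roumieu:
  assumes tr: "transfers MM \<Omega> f u x0 \<xi>0" and wm: "weight_matrix MM" and wl: "weight_matrix LL"
    and Rsr: "R_semiregular LL" and pre: "R_preceq MM LL" and mf: "micro_roumieu LL \<Omega> f x0 \<xi>0"
  shows "micro_roumieu LL \<Omega> u x0 \<xi>0"
proof -
  obtain V \<Gamma> fs L Q C0 where fs: "open V" "x0 \<in> V" "V \<subseteq> \<Omega>" "open_cone \<Gamma>" "\<xi>0 \<in> \<Gamma>"
    "bounded_E_prime_seq \<Omega> fs" "\<forall>N \<phi>. test_fun V \<phi> \<longrightarrow> fs N \<phi> = f \<phi>"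
    and L: "L \<in> LL" "Q > 0" "\<And>\<xi> N. \<xi> \<in> \<Gamma> \<Longrightarrow> norm \<xi> ^ N * norm (fourier (fs N) \<xi>) \<le> C0 * Q ^ N * L N"
    using mf unfolding micro_roumieu_def by blast
  obtain V' \<Gamma>' us M C \<kappa> s where us: "open V'" "x0 \<in> V'" "V' \<subseteq> \<Omega>" "open_cone \<Gamma>'" "\<xi>0 \<in> \<Gamma>'"
    "bounded_E_prime_seq \<Omega> us" "\<forall>N \<phi>. test_fun V' \<phi> \<longrightarrow> us N \<phi> = u \<phi>"
    and M: "M \<in> MM" "C \<ge> 0" "\<kappa> \<ge> 1" and est: "\<forall>n \<xi> A. \<xi> \<in> \<Gamma>' \<longrightarrow> A \<ge> 0 \<longrightarrow>
         (\<forall>\<eta>\<in>\<Gamma>. norm \<eta> ^ (n + s) * norm (fourier (fs (n + s)) \<eta>) \<le> A) \<longrightarrow>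
         norm \<xi> ^ n * norm (fourier (us n) \<xi>) \<le> C * \<kappa> ^ n * (M n + A)"
    using tr[unfolded transfers_def, THEN spec, THEN spec, THEN spec, THEN mp, THEN mp, THEN mp, THEN mp, THEN mp, THEN mp,
      THEN mp, OF fs] by (elim exE conjE)
  obtain L1 C1 where L1: "L1 \<in> LL" "C1 \<ge> 1" "\<And>k. M k \<le> C1 ^ k * L1 k"
    using R_preceqD[OF pre wm wl M(1)] by blast
  obtain L2 C2 where L2: "L2 \<in> LL" "C2 \<ge> 1" "\<And>k. L (k + s) \<le> C2 ^ (k + 1) * L2 k"
    using R_semiregular_shift[OF wl Rsr, of s] L(1) by blast
  obtain L' where L': "L' \<in> {L1, L2}" "\<And>k. L1 k \<le> L' k" "\<And>k. L2 k \<le> L' k"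
    using weight_matrix_upper[OF wl, of "{L1, L2}"] L1 L2 by auto
  have L'L: "L' \<in> LL" using L'(1) L1 L2 by auto
  define C' where "C' = 1 + \<bar>C0\<bar> * Q ^ s * C2"
  define Q' where "Q' = \<kappa> * (C1 + Q * C2)"
  have pos: "L k > 0" "L' k > 0" for k
    using weight_seq_pos[OF weight_matrixD[OF wl L(1)]] weight_seq_pos[OF weight_matrixD[OF wl L'L]] by auto
  have "norm \<xi> ^ n * norm (fourier (us n) \<xi>) \<le> (C * C') * Q' ^ n * L' n" if \<xi>: "\<xi> \<in> \<Gamma>'" for \<xi> n
  proof -
    let ?A = "\<bar>C0\<bar> * Q ^ (n + s) * L (n + s)"
    have "norm \<eta> ^ (n + s) * norm (fourier (fs (n + s)) \<eta>) \<le> ?A" if "\<eta> \<in> \<Gamma>" for \<eta>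
    proof (rule order_trans[OF L(3)[OF that]])
      show "C0 * Q ^ (n + s) * L (n + s) \<le> ?A"
        using L(2) pos(1)[of "n + s"] by (intro mult_right_mono) auto
    qed
    moreover have "?A \<ge> 0" using L(2) pos(1)[of "n + s"] by simp
    ultimately have "norm \<xi> ^ n * norm (fourier (us n) \<xi>) \<le> C * \<kappa> ^ n * (M n + ?A)"
      using est \<xi> by blast
    also have "\<dots> \<le> C * \<kappa> ^ n * ((C1 + Q * C2) ^ n * L' n + (\<bar>C0\<bar> * Q ^ s * C2) * (C1 + Q * C2) ^ n * L' n)"
    proof (intro mult_left_mono add_mono)
      have "M n \<le> C1 ^ n * L' n" using L1(2) L1(3)[of n] L'(2)[of n] by (smt (verit) mult_left_mono zero_le_power)
      also have "\<dots> \<le> (C1 + Q * C2) ^ n * L' n"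
        using L1(2) L2(2) L(2) pos(2)[of n] by (intro mult_right_mono power_mono) auto
      finally show "M n \<le> (C1 + Q * C2) ^ n * L' n" .
      have "L (n + s) \<le> C2 ^ (n + 1) * L' n" using L2(2) L2(3)[of n] L'(3)[of n] by (smt (verit) mult_left_mono zero_le_power)
      then have "?A \<le> \<bar>C0\<bar> * Q ^ (n + s) * (C2 ^ (n + 1) * L' n)" using L(2) by (intro mult_left_mono) auto
      also have "\<dots> = (\<bar>C0\<bar> * Q ^ s * C2) * (Q * C2) ^ n * L' n" by (simp add: power_add power_mult_distrib mult_ac)
      also have "\<dots> \<le> (\<bar>C0\<bar> * Q ^ s * C2) * (C1 + Q * C2) ^ n * L' n"
        using L1(2) L2(2) L(2) pos(2)[of n] by (intro mult_right_mono mult_left_mono power_mono) auto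
      finally show "?A \<le> (\<bar>C0\<bar> * Q ^ s * C2) * (C1 + Q * C2) ^ n * L' n" .
    qed (use M in auto)
    also have "\<dots> = (C * C') * Q' ^ n * L' n"
      unfolding C'_def Q'_def power_mult_distrib by (simp add: algebra_simps)
    finally show ?thesis .
  qed
  moreover have "Q' > 0" unfolding Q'_def using M(3) L1(2) L2(2) L(2) by (intro mult_pos_pos add_pos_pos) auto
  ultimately show ?thesis
    unfolding micro_roumieu_def
    by (intro exI[of _ V'] exI[of _ \<Gamma>'] exI[of _ us] conjI us bexI[of _ L', OF _ L'L] exI[of _ Q'] exI[of _ "C * C'"]) blast+
qed

text \<open>The sequence and the cone are fixed before L and Q. For given L and Q the decay of f is
  used with a member whose shift L dominates and with radius q = Q / (\<kappa> C2), so that the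
  factors \<kappa> and C2 lost on the way bring the radius back to Q.\<close>

lemma transfers_micro_beurling:
  assumes tr: "transfers MM \<Omega> f u x0 \<xi>0" and wm: "weight_matrix MM" and wl: "weight_matrix LL"
    and Bsr: "B_semiregular LL" and pre: "B_lhd MM LL" and mf: "micro_beurling LL \<Omega> f x0 \<xi>0"
  shows "micro_beurling LL \<Omega> u x0 \<xi>0"
proof -
  obtain V \<Gamma> fs where fs: "open V" "x0 \<in> V" "V \<subseteq> \<Omega>" "open_cone \<Gamma>" "\<xi>0 \<in> \<Gamma>"
    "bounded_E_prime_seq \<Omega> fs" "\<forall>N \<phi>. test_fun V \<phi> \<longrightarrow> fs N \<phi> = f \<phi>"
    and F: "\<forall>L\<in>LL. \<forall>Q>0. \<exists>C. \<forall>\<xi>\<in>\<Gamma>. \<forall>N. norm \<xi> ^ N * norm (fourier (fs N) \<xi>) \<le> C * Q ^ N * L N"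
    using mf unfolding micro_beurling_def by blast
  obtain V' \<Gamma>' us M C \<kappa> s where us: "open V'" "x0 \<in> V'" "V' \<subseteq> \<Omega>" "open_cone \<Gamma>'" "\<xi>0 \<in> \<Gamma>'"
    "bounded_E_prime_seq \<Omega> us" "\<forall>N \<phi>. test_fun V' \<phi> \<longrightarrow> us N \<phi> = u \<phi>"
    and M: "M \<in> MM" "C \<ge> 0" "\<kappa> \<ge> 1" and est: "\<forall>n \<xi> A. \<xi> \<in> \<Gamma>' \<longrightarrow> A \<ge> 0 \<longrightarrow>
         (\<forall>\<eta>\<in>\<Gamma>. norm \<eta> ^ (n + s) * norm (fourier (fs (n + s)) \<eta>) \<le> A) \<longrightarrow>
         norm \<xi> ^ n * norm (fourier (us n) \<xi>) \<le> C * \<kappa> ^ n * (M n + A)"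
    using tr[unfolded transfers_def, THEN spec, THEN spec, THEN spec, THEN mp, THEN mp, THEN mp, THEN mp, THEN mp, THEN mp,
      THEN mp, OF fs] by (elim exE conjE)
  have "\<exists>D. \<forall>\<xi>\<in>\<Gamma>'. \<forall>n. norm \<xi> ^ n * norm (fourier (us n) \<xi>) \<le> D * Q ^ n * L n" if L: "L \<in> LL" and Q: "Q > 0" for L Q
  proof -
    obtain L2 C2 where L2: "L2 \<in> LL" "C2 \<ge> 1" "\<And>k. L2 (k + s) \<le> C2 ^ (k + 1) * L k"
      using B_semiregular_shift[OF wl Bsr, of s] L by blast
    define q where "q = Q / (\<kappa> * C2)"
    have q: "q > 0" using Q M(3) L2(2) by (simp add: q_def)
    obtain C0 where C0: "\<And>\<xi> N. \<xi> \<in> \<Gamma> \<Longrightarrow> norm \<xi> ^ N * norm (fourier (fs N) \<xi>) \<le> C0 * q ^ N * L2 N"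
      using F L2(1) q by blast
    obtain C1 where C1: "C1 \<ge> 0" "\<And>k. M k \<le> C1 * (Q / \<kappa>) ^ k * L k"
      using B_lhdD[OF pre wm wl M(1) L, of "Q / \<kappa>"] Q M(3) by auto
    have pos: "L k > 0" "L2 k > 0" for k
      using weight_seq_pos[OF weight_matrixD[OF wl L]] weight_seq_pos[OF weight_matrixD[OF wl L2(1)]] by auto
    have "norm \<xi> ^ n * norm (fourier (us n) \<xi>) \<le> (C * (C1 + \<bar>C0\<bar> * q ^ s * C2)) * Q ^ n * L n" if \<xi>: "\<xi> \<in> \<Gamma>'" for \<xi> n
    proof -
      let ?A = "\<bar>C0\<bar> * q ^ (n + s) * L2 (n + s)"
      have "norm \<eta> ^ (n + s) * norm (fourier (fs (n + s)) \<eta>) \<le> ?A" if "\<eta> \<in> \<Gamma>" for \<eta>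
      proof (rule order_trans[OF C0[OF that]])
        show "C0 * q ^ (n + s) * L2 (n + s) \<le> ?A"
          using q pos(2)[of "n + s"] by (intro mult_right_mono) auto
      qed
      moreover have "?A \<ge> 0" using q pos(2)[of "n + s"] by simp
      ultimately have "norm \<xi> ^ n * norm (fourier (us n) \<xi>) \<le> C * \<kappa> ^ n * (M n + ?A)"
        using est \<xi> by blast
      also have "\<dots> \<le> C * \<kappa> ^ n * (C1 * (Q / \<kappa>) ^ n * L n + (\<bar>C0\<bar> * q ^ s * C2) * (Q / \<kappa>) ^ n * L n)"
      proof (intro mult_left_mono add_mono C1)
        have "?A \<le> \<bar>C0\<bar> * q ^ (n + s) * (C2 ^ (n + 1) * L n)" using q by (intro mult_left_mono L2) auto
        also have "\<dots> = (\<bar>C0\<bar> * q ^ s * C2) * (q * C2) ^ n * L n" by (simp add: power_add power_mult_distrib mult_ac)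
        also have "q * C2 = Q / \<kappa>" using L2(2) by (simp add: q_def)
        finally show "?A \<le> (\<bar>C0\<bar> * q ^ s * C2) * (Q / \<kappa>) ^ n * L n" .
      qed (use M in auto)
      also have "\<dots> = C * (C1 + \<bar>C0\<bar> * q ^ s * C2) * (\<kappa> ^ n * (Q / \<kappa>) ^ n) * L n" by (simp add: algebra_simps)
      also have "\<kappa> ^ n * (Q / \<kappa>) ^ n = Q ^ n" using M(3) by (simp add: power_divide)
      finally show ?thesis .
    qed
    then show ?thesis by blast
  qed
  then show ?thesis
    unfolding micro_beurling_def
    by (intro exI[of _ V'] exI[of _ \<Gamma>'] exI[of _ us] conjI us) blast+
qed

text \<open>Homogeneity reduces the claim to directions \<open>sgn \<xi>\<close>: an aperture of at
  most r/2 around \<open>sgn \<xi>0\<close> together with a relative perturbation c <= r/2 stays in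
  a ball of radius r inside \<Gamma>.\<close>

lemma cone_shrink:
  fixes \<Gamma> :: "(real^'n::finite) set"
  assumes \<Gamma>: "open_cone \<Gamma>" and \<xi>0: "\<xi>0 \<in> \<Gamma>" and e: "e > 0"
  shows "\<exists>\<Gamma>' c. open_cone \<Gamma>' \<and> \<xi>0 \<in> \<Gamma>' \<and> 0 < c \<and> c < 1 \<and>
    (\<forall>\<xi>\<in>\<Gamma>'. \<forall>\<eta>. norm (\<eta> - \<xi>) \<le> c * norm \<xi> \<longrightarrow> \<eta> \<in> \<Gamma>) \<and> (\<forall>\<xi>\<in>\<Gamma>'. norm (sgn \<xi> - sgn \<xi>0) < e)"
proof -
  have n0: "\<xi>0 \<noteq> 0" using \<Gamma> \<xi>0 by (auto simp: open_cone_def)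
  have "sgn \<xi>0 = inverse (norm \<xi>0) *\<^sub>R \<xi>0" by (simp add: sgn_div_norm)
  then have "sgn \<xi>0 \<in> \<Gamma>" using \<Gamma> \<xi>0 n0 by (simp add: open_cone_def)
  moreover have "open \<Gamma>" using \<Gamma> by (simp add: open_cone_def)
  ultimately obtain r where r: "r > 0" "ball (sgn \<xi>0) r \<subseteq> \<Gamma>"
    by (meson open_contains_ball)
  define c where "c = min (r / 2) (1 / 2)"
  define \<epsilon> where "\<epsilon> = min (r / 2) e"
  have \<epsilon>: "\<epsilon> > 0" "\<epsilon> \<le> r / 2" "\<epsilon> \<le> e" using r e by (auto simp: \<epsilon>_def)
  have c: "c > 0" "c < 1" "c \<le> r / 2" using r by (auto simp: c_def)
  define \<Gamma>' where "\<Gamma>' = - {0} \<inter> sgn -` ball (sgn \<xi>0) \<epsilon>"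
  have mem: "\<xi> \<in> \<Gamma>' \<longleftrightarrow> \<xi> \<noteq> 0 \<and> norm (sgn \<xi> - sgn \<xi>0) < \<epsilon>" for \<xi>
    by (auto simp: \<Gamma>'_def dist_norm norm_minus_commute)
  have "open \<Gamma>'"
    unfolding \<Gamma>'_def by (intro continuous_open_preimage continuous_on_sgn continuous_on_id) auto
  moreover have "sgn (t *\<^sub>R \<xi>) = sgn \<xi>" if "t > 0" for t :: real and \<xi> :: "real^'n"
    using that by (simp add: sgn_scaleR)
  ultimately have "open_cone \<Gamma>'" by (auto simp: open_cone_def mem)
  moreover have "\<xi>0 \<in> \<Gamma>'" using n0 \<epsilon> by (simp add: mem)
  moreover have "\<eta> \<in> \<Gamma>" if \<xi>: "\<xi> \<in> \<Gamma>'" and \<eta>: "norm (\<eta> - \<xi>) \<le> c * norm \<xi>" for \<xi> \<eta>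
  proof -
    have nz: "norm \<xi> > 0" using \<xi> by (simp add: mem)
    let ?h = "inverse (norm \<xi>) *\<^sub>R \<eta>"
    have "?h - sgn \<xi> = inverse (norm \<xi>) *\<^sub>R (\<eta> - \<xi>)" by (simp add: sgn_div_norm scaleR_diff_right)
    then have "norm (?h - sgn \<xi>) = norm (\<eta> - \<xi>) / norm \<xi>" using nz by (simp add: divide_inverse mult.commute)
    also have "\<dots> \<le> c" using \<eta> nz by (simp add: divide_le_eq)
    finally have "norm (?h - sgn \<xi>) \<le> c" .
    moreover have "norm (sgn \<xi> - sgn \<xi>0) < \<epsilon>" using \<xi> by (simp add: mem)
    moreover have "norm (?h - sgn \<xi>0) \<le> norm (?h - sgn \<xi>) + norm (sgn \<xi> - sgn \<xi>0)"
      using norm_triangle_ineq[of "?h - sgn \<xi>" "sgn \<xi> - sgn \<xi>0"] by simp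
    ultimately have "norm (?h - sgn \<xi>0) < r" using c(3) \<epsilon>(2) by linarith
    then have "?h \<in> \<Gamma>" using r(2) by (auto simp: dist_norm norm_minus_commute)
    then have "norm \<xi> *\<^sub>R ?h \<in> \<Gamma>" using \<Gamma> nz unfolding open_cone_def by blast
    then show ?thesis using nz by simp
  qed
  moreover have "norm (sgn \<xi> - sgn \<xi>0) < e" if "\<xi> \<in> \<Gamma>'" for \<xi> using that \<epsilon>(3) by (simp add: mem)
  ultimately show ?thesis using c by blast
qed

lemma principal_symbol_scale:
  "principal_symbol a m x (t *\<^sub>R \<theta>) = of_real (t ^ m) * principal_symbol a m x (\<theta> :: real^'n::finite)"
proof -
  have "(\<Prod>i\<in>UNIV. complex_of_real ((t *\<^sub>R \<theta>) $ i) ^ \<alpha> i) = of_real (t ^ m) * (\<Prod>i\<in>UNIV. complex_of_real (\<theta> $ i) ^ \<alpha> i)"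
    if "mi_abs \<alpha> = m" for \<alpha> :: "'n \<Rightarrow> nat"
  proof -
    have "(\<Prod>i\<in>UNIV. complex_of_real ((t *\<^sub>R \<theta>) $ i) ^ \<alpha> i) = (\<Prod>i\<in>UNIV. of_real t ^ \<alpha> i) * (\<Prod>i\<in>UNIV. complex_of_real (\<theta> $ i) ^ \<alpha> i)"
      by (simp add: power_mult_distrib prod.distrib)
    also have "(\<Prod>i\<in>UNIV. complex_of_real t ^ \<alpha> i) = of_real t ^ (\<Sum>i\<in>UNIV. \<alpha> i)" by (rule power_sum[symmetric])
    also have "(\<Sum>i\<in>UNIV. \<alpha> i) = m" using that by (simp add: mi_abs_def)
    finally show ?thesis by simp
  qed
  then show ?thesis
    unfolding principal_symbol_def sum_distrib_left by (intro sum.cong refl) simp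
qed

text \<open>Joint continuity in x and \<theta> at a point where the symbol does not vanish; half of
  its modulus there serves as the bound.\<close>

lemma symbol_lower_bound:
  fixes \<Omega> :: "(real^'n::finite) set"
  assumes \<Omega>: "open \<Omega>" and a: "\<And>\<alpha>. mi_abs \<alpha> \<le> m \<Longrightarrow> continuous_on \<Omega> (a \<alpha>)" and x0: "x0 \<in> \<Omega>"
    and nz: "principal_symbol a m x0 \<theta>0 \<noteq> 0"
  shows "\<exists>d>0. \<exists>c>0. \<forall>x \<theta>. norm (x - x0) < d \<longrightarrow> norm (\<theta> - \<theta>0) < d \<longrightarrow> norm (principal_symbol a m x \<theta>) \<ge> c"
proof -
  let ?P = "\<lambda>z. principal_symbol a m (fst z) (snd z)"
  have "continuous_on (\<Omega> \<times> UNIV) (\<lambda>z. a \<alpha> (fst z) * (\<Prod>i\<in>UNIV. complex_of_real (snd z $ i) ^ \<alpha> i))"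
    if "\<alpha> \<in> {\<alpha>. mi_abs \<alpha> = m}" for \<alpha>
    using that by (intro continuous_intros continuous_on_compose2[OF a]) auto
  then have "continuous_on (\<Omega> \<times> UNIV) ?P"
    unfolding principal_symbol_def by (intro continuous_on_sum)
  moreover have "open (\<Omega> \<times> (UNIV :: (real^'n) set))" by (intro open_Times \<Omega>) simp
  ultimately have "isCont ?P (x0, \<theta>0)" using x0 by (simp add: continuous_on_eq_continuous_at)
  then have "isCont (\<lambda>z. norm (?P z)) (x0, \<theta>0)" by (rule continuous_norm)
  then obtain d where d: "d > 0" "\<And>z. dist z (x0, \<theta>0) < d \<Longrightarrow> dist (norm (?P z)) (norm (?P (x0, \<theta>0))) < norm (?P (x0, \<theta>0)) / 2"
    unfolding continuous_at_eps_delta using nz by (metis fst_conv snd_conv half_gt_zero zero_less_norm_iff)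
  have "norm (principal_symbol a m x \<theta>) \<ge> norm (?P (x0, \<theta>0)) / 2" if "norm (x - x0) < d / 2" "norm (\<theta> - \<theta>0) < d / 2" for x \<theta>
  proof -
    have "dist (x, \<theta>) (x0, \<theta>0) \<le> dist x x0 + dist \<theta> \<theta>0"
      unfolding dist_Pair_Pair by (rule sqrt_sum_squares_le_sum) auto
    also have "\<dots> < d" using that by (simp add: dist_norm)
    finally have "dist (norm (?P (x, \<theta>))) (norm (?P (x0, \<theta>0))) < norm (?P (x0, \<theta>0)) / 2" by (rule d)
    then show ?thesis unfolding dist_real_def fst_conv snd_conv by linarith
  qed
  then show ?thesis
    using d(1) nz by (intro exI[of _ "d / 2"] conjI exI[of _ "norm (?P (x0, \<theta>0)) / 2"]) auto
qed

text \<open>There are finitely many coefficients, and the total order of the matrix provides one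
  weight for all of them.\<close>

lemma coeff_bounds:
  fixes \<Omega> U :: "(real^'n::finite) set" and a :: "('n \<Rightarrow> nat) \<Rightarrow> real^'n \<Rightarrow> complex"
  assumes wm: "weight_matrix MM" and \<Omega>: "open \<Omega>" and U: "open U" "compact (closure U)" "closure U \<subseteq> \<Omega>"
    and a: "\<forall>\<alpha>. mi_abs \<alpha> \<le> m \<longrightarrow> E_roumieu MM \<Omega> (a \<alpha>)"
  shows "\<exists>M\<in>MM. \<exists>C\<ge>0. \<exists>\<rho>\<ge>1. \<forall>\<alpha> x is. mi_abs \<alpha> \<le> m \<longrightarrow> x \<in> U \<longrightarrow>
    norm (pdiff_list is (a \<alpha>) x) \<le> C * \<rho> ^ length is * M (length is)"
proof -
  let ?I = "{\<alpha> :: 'n \<Rightarrow> nat. mi_abs \<alpha> \<le> m}"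
  have "\<forall>\<alpha>. \<exists>M \<rho> C. mi_abs \<alpha> \<le> m \<longrightarrow> M \<in> MM \<and> \<rho> > 0 \<and>
      (\<forall>x\<in>U. \<forall>\<beta>. norm (pdiff \<beta> (a \<alpha>) x) \<le> C * \<rho> ^ mi_abs \<beta> * M (mi_abs \<beta>))"
    using a U unfolding E_roumieu_def by meson
  then obtain M \<rho> C where h: "\<forall>\<alpha>. mi_abs \<alpha> \<le> m \<longrightarrow> M \<alpha> \<in> MM \<and> \<rho> \<alpha> > 0 \<and>
      (\<forall>x\<in>U. \<forall>\<beta>. norm (pdiff \<beta> (a \<alpha>) x) \<le> C \<alpha> * \<rho> \<alpha> ^ mi_abs \<beta> * M \<alpha> (mi_abs \<beta>))"
    by metis
  have "(\<lambda>_. 0) \<in> ?I" by (simp add: mi_abs_def)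
  then have "M ` ?I \<noteq> {}" by blast
  moreover have "M ` ?I \<subseteq> MM" using h by blast
  ultimately obtain M' where M': "M' \<in> M ` ?I" "\<forall>N\<in>M ` ?I. \<forall>k. N k \<le> M' k"
    using weight_matrix_upper[OF wm finite_imageI[OF finite_mi_abs_le[of m]]] by blast
  have M'M: "M' \<in> MM" using M'(1) h by blast
  define C' where "C' = (\<Sum>\<alpha>\<in>?I. \<bar>C \<alpha>\<bar>)"
  define \<rho>' where "\<rho>' = 1 + (\<Sum>\<alpha>\<in>?I. \<bar>\<rho> \<alpha>\<bar>)"
  have C0: "C' \<ge> 0" "\<rho>' \<ge> 1" unfolding C'_def \<rho>'_def by (auto intro: sum_nonneg)
  have "norm (pdiff_list is (a \<alpha>) x) \<le> C' * \<rho>' ^ length is * M' (length is)"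
    if \<alpha>: "mi_abs \<alpha> \<le> m" and x: "x \<in> U" for \<alpha> x "is"
  proof -
    have xO: "x \<in> \<Omega>" using x U closure_subset by blast
    have "smooth_on \<Omega> (a \<alpha>)" using a \<alpha> by (simp add: E_roumieu_def)
    then have "norm (pdiff_list is (a \<alpha>) x) = norm (pdiff (count_list is) (a \<alpha>) x)"
      using pdiff_list_eq_pdiff[OF \<Omega> _ xO] by simp
    also have "\<dots> \<le> C \<alpha> * \<rho> \<alpha> ^ length is * M \<alpha> (length is)"
      using h \<alpha> x by (metis mi_abs_count_list)
    also have "\<dots> \<le> C' * \<rho>' ^ length is * M' (length is)"
    proof -
      have MM: "M \<alpha> \<in> MM" "\<rho> \<alpha> > 0" using h \<alpha> by auto
      have "C \<alpha> \<le> \<bar>C \<alpha>\<bar>" by simp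
      also have "\<dots> \<le> C'" unfolding C'_def
        using \<alpha> by (intro member_le_sum[of \<alpha> ?I "\<lambda>\<alpha>. \<bar>C \<alpha>\<bar>"] finite_mi_abs_le) auto
      finally have "C \<alpha> \<le> C'" .
      moreover have "\<bar>\<rho> \<alpha>\<bar> \<le> (\<Sum>\<alpha>\<in>?I. \<bar>\<rho> \<alpha>\<bar>)"
        using \<alpha> by (intro member_le_sum[of \<alpha> ?I "\<lambda>\<alpha>. \<bar>\<rho> \<alpha>\<bar>"] finite_mi_abs_le) auto
      then have "\<rho> \<alpha> \<le> \<rho>'" unfolding \<rho>'_def by linarith
      moreover have "M \<alpha> (length is) \<le> M' (length is)" using M'(2) \<alpha> by blast
      moreover have "M \<alpha> (length is) > 0" by (rule weight_seq_pos[OF weight_matrixD[OF wm MM(1)]])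
      ultimately show ?thesis using MM(2) C0 by (intro mult_mono power_mono) auto
    qed
    finally show ?thesis .
  qed
  with M'M C0 show ?thesis by blast
qed

lemma conv_power_le:
  assumes "t \<ge> 1" "l \<le> k" "Y \<ge> 0"
  shows "conv (\<lambda>l. t ^ l) (\<lambda>_. Y) l \<le> 2 ^ k * t ^ k * Y"
proof -
  have "conv (\<lambda>l. t ^ l) (\<lambda>_. Y) l \<le> (\<Sum>j\<le>l. real (l choose j) * (t ^ k * Y))"
    unfolding conv_def mult.assoc
    using assms by (intro sum_mono mult_left_mono mult_right_mono power_increasing) auto
  also have "\<dots> = real (\<Sum>j\<le>l. l choose j) * (t ^ k * Y)" by (simp add: sum_distrib_right)
  also have "(\<Sum>j\<le>l. l choose j) = 2 ^ l" by (rule choose_row_sum)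
  also have "real (2 ^ l) * (t ^ k * Y) \<le> 2 ^ k * (t ^ k * Y)"
    using assms by (intro mult_right_mono) (auto intro: power_increasing)
  finally show ?thesis by (simp add: mult.assoc)
qed

lemma sbox_subset_ball:
  fixes x0 :: "real^'n::finite"
  assumes "r * real CARD('n) < d" "\<And>i. \<bar>y $ i - x0 $ i\<bar> \<le> r"
  shows "norm (y - x0) < d"
proof -
  have "norm (y - x0) \<le> (\<Sum>i\<in>UNIV. \<bar>(y - x0) $ i\<bar>)" by (rule norm_le_l1_cart)
  also have "\<dots> \<le> (\<Sum>i\<in>(UNIV::'n set). r)" using assms(2) by (intro sum_mono) simp
  finally show ?thesis using assms(1) by (simp add: mult.commute)
qed

lemma distribution_sum:
  assumes \<Omega>: "open \<Omega>" and u: "distribution \<Omega> u" and K: "compact K" "K \<subseteq> \<Omega>"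
    and f: "\<And>k. k \<in> A \<Longrightarrow> smooth_on \<Omega> (f k)" "\<And>k x. k \<in> A \<Longrightarrow> x \<notin> K \<Longrightarrow> f k x = 0"
  shows "u (\<lambda>x. \<Sum>k\<in>A. f k x) = (\<Sum>k\<in>A. u (f k))"
  using f
proof (induction A rule: infinite_finite_induct)
  have "test_fun \<Omega> (\<lambda>_. 0)"
    by (rule test_funI[OF \<Omega> compact_empty]) (auto intro: smooth_on_const \<Omega>)
  from distribution_cmult[OF u this, of 0] have z: "u (\<lambda>_. 0) = 0" by simp
  { case (infinite A) then show ?case using z by simp }
  { case empty then show ?case using z by simp }
next
  case (insert k A)
  have "test_fun \<Omega> (f k)" by (rule test_funI[OF \<Omega> K(1,2,2)]) (use insert.prems in auto)
  moreover have "test_fun \<Omega> (\<lambda>x. \<Sum>k\<in>A. f k x)"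
    by (rule test_funI[OF \<Omega> K(1,2,2)]) (use insert.prems in \<open>auto intro!: smooth_on_sum \<Omega> sum.neutral\<close>)
  ultimately have "u (\<lambda>x. f k x + (\<Sum>k\<in>A. f k x)) = u (f k) + u (\<lambda>x. \<Sum>k\<in>A. f k x)"
    by (rule distribution_add[OF u])
  then show ?case using insert by simp
qed

lemma bounded_E_prime_seq_reindex:
  "bounded_E_prime_seq \<Omega> ws \<Longrightarrow> bounded_E_prime_seq \<Omega> (\<lambda>n. ws (h n))"
  unfolding bounded_E_prime_seq_def by blast

section \<open>The microlocal parametrix\<close>

lemma mult_ge1: "1 \<le> x \<Longrightarrow> 1 \<le> y \<Longrightarrow> 1 \<le> x * y" for x y :: real
  using mult_mono[of 1 x 1 y] by simp

lemma norm_scaleR_sgn: "norm \<xi> *\<^sub>R sgn \<xi> = \<xi>" for \<xi> :: "'b::real_normed_vector"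
  by (cases "\<xi> = 0") (simp_all add: sgn_div_norm)

text \<open>Names the constants of \<open>microlocal_pairing\<close>, so that they can be fixed once
  and handed to the estimates.\<close>

definition pairing_bound :: "(nat \<Rightarrow> (real^'n::finite \<Rightarrow> complex) \<Rightarrow> complex) \<Rightarrow> (real^'n) set \<Rightarrow> real \<Rightarrow> real \<Rightarrow> real \<Rightarrow> nat \<Rightarrow> bool" where
  "pairing_bound us K c C \<kappa> s \<longleftrightarrow> C \<ge> 0 \<and> \<kappa> \<ge> 1 \<and> (\<forall>N g \<xi> G H A.
    smooth_on UNIV g \<longrightarrow> (\<forall>x. x \<notin> K \<longrightarrow> g x = 0) \<longrightarrow> norm \<xi> \<ge> 1 \<longrightarrow> A \<ge> 0 \<longrightarrow>
    (\<forall>is x. length is \<le> 2 * CARD('n) \<longrightarrow> norm (pdiff_list is g x) \<le> G) \<longrightarrow>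
    (\<forall>is x. length is \<le> N + s \<longrightarrow> norm (pdiff_list is g x) \<le> H) \<longrightarrow>
    (\<forall>\<eta>. norm (\<eta> - \<xi>) \<le> c * norm \<xi> \<longrightarrow> norm \<eta> ^ N * norm (fourier (us N) \<eta>) \<le> A) \<longrightarrow>
    norm \<xi> ^ N * norm (us N (\<lambda>x. ee (- \<xi>) x * g x)) \<le> C * \<kappa> ^ N * (A * G + H))"

lemma pairing_boundD:
  fixes us :: "nat \<Rightarrow> (real^'n::finite \<Rightarrow> complex) \<Rightarrow> complex"
  assumes "pairing_bound us K c C \<kappa> s" "smooth_on UNIV g" "\<And>x. x \<notin> K \<Longrightarrow> g x = 0" "norm \<xi> \<ge> 1" "A \<ge> 0"
    "\<And>is x. length is \<le> 2 * CARD('n) \<Longrightarrow> norm (pdiff_list is g x) \<le> G"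
    "\<And>is x. length is \<le> N + s \<Longrightarrow> norm (pdiff_list is g x) \<le> H"
    "\<And>\<eta>. norm (\<eta> - \<xi>) \<le> c * norm \<xi> \<Longrightarrow> norm \<eta> ^ N * norm (fourier (us N) \<eta>) \<le> A"
  shows "norm \<xi> ^ N * norm (us N (\<lambda>x. ee (- \<xi>) x * g x)) \<le> C * \<kappa> ^ N * (A * G + H)"
  using assms unfolding pairing_bound_def by blast

text \<open>Three nested cubes around \<open>x0\<close>: the cutoffs are 1 for half-side \<delta>
  and vanish beyond half-side 8 \<delta>, and the coefficients are controlled for half-side 9
  \<delta>. The assumptions \<open>w2\<close> and \<open>w3\<close> are the two ways of paying for
  derivatives below the threshold.\<close>

locale cutoff_setting =
  fixes \<Omega> :: "(real^'n::finite) set" and a :: "('n \<Rightarrow> nat) \<Rightarrow> real^'n \<Rightarrow> complex" and m :: nat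
    and x0 :: "real^'n" and \<delta> :: real and S N :: "nat \<Rightarrow> real" and C Ca \<rho>a :: real
    and \<phi> :: "nat \<Rightarrow> real^'n \<Rightarrow> complex" and C\<phi> :: "nat \<Rightarrow> real" and E \<rho>\<phi> :: real
  assumes \<Omega>: "open \<Omega>" and \<delta>: "\<delta> > 0" and box: "{x. \<forall>i. \<bar>x $ i - x0 $ i\<bar> \<le> 9 * \<delta>} \<subseteq> \<Omega>"
    and sa: "mi_abs \<alpha> \<le> m \<Longrightarrow> smooth_on \<Omega> (a \<alpha>)"
    and S: "supermult S" and wN: "weight_seq N" and C: "C \<ge> 1" and fS: "fact k \<le> C * S k"
    and w2: "t \<ge> 1 \<Longrightarrow> N \<nu> \<le> t ^ \<nu> \<Longrightarrow> j \<le> m * \<nu> \<Longrightarrow> S (l + j) \<le> C ^ (l + j + 1) * N l * t ^ j"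
    and w3: "t \<ge> 1 \<Longrightarrow> N \<nu> \<le> t ^ \<nu> \<Longrightarrow> \<nu> \<le> j \<Longrightarrow> j \<le> m * \<nu> \<Longrightarrow>
      S (l + j) \<le> C ^ (l + j + 1) * N l * N \<nu> * t ^ (j - \<nu>)"
    and Ca: "Ca \<ge> 0" and \<rho>a: "\<rho>a \<ge> 1"
    and ca: "mi_abs \<alpha> \<le> m \<Longrightarrow> (\<And>i. \<bar>x $ i - x0 $ i\<bar> < 9 * \<delta>) \<Longrightarrow>
         norm (pdiff_list is (a \<alpha>) x) \<le> Ca * \<rho>a ^ length is * S (length is)"
    and \<phi>: "smooth_on UNIV (\<phi> r)" and \<phi>1: "(\<And>i. \<bar>x $ i - x0 $ i\<bar> \<le> \<delta>) \<Longrightarrow> \<phi> r x = 1"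
    and \<phi>0: "\<bar>x $ i - x0 $ i\<bar> \<ge> 8 * \<delta> \<Longrightarrow> \<phi> r x = 0"
    and C\<phi>: "norm (pdiff_list is (\<phi> r) x) \<le> C\<phi> (length is)"
    and d\<phi>: "length is \<le> r \<Longrightarrow> norm (pdiff_list is (\<phi> r) x) \<le> E * E ^ r * \<rho>\<phi> ^ length is * fact (length is)"
    and E: "E \<ge> 1" and \<rho>\<phi>: "\<rho>\<phi> \<ge> 1"
begin

definition U where "U = {x. \<forall>i. \<bar>x $ i - x0 $ i\<bar> < 9 * \<delta>}"
definition K where "K = {x. \<forall>i. \<bar>x $ i - x0 $ i\<bar> \<le> 8 * \<delta>}"

lemma U: "open U" "U \<subseteq> \<Omega>" and K: "compact K" "closed K" "K \<subseteq> U" "K \<subseteq> \<Omega>" "K \<noteq> {}"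
proof -
  show "open U" unfolding U_def by (rule open_sbox)
  show UO: "U \<subseteq> \<Omega>"
  proof
    fix x assume "x \<in> U"
    then have "\<bar>x $ i - x0 $ i\<bar> \<le> 9 * \<delta>" for i by (auto simp: U_def intro: less_imp_le)
    then show "x \<in> \<Omega>" using box by blast
  qed
  show "compact K" unfolding K_def by (rule compact_sbox)
  then show "closed K" by (rule compact_imp_closed)
  show KU: "K \<subseteq> U"
  proof
    fix x assume "x \<in> K"
    have "\<bar>x $ i - x0 $ i\<bar> < 9 * \<delta>" for i
    proof -
      have "\<bar>x $ i - x0 $ i\<bar> \<le> 8 * \<delta>" using \<open>x \<in> K\<close> unfolding K_def by blast
      then show ?thesis using \<delta> by linarith
    qed
    then show "x \<in> U" unfolding U_def by blast
  qed
  show "K \<subseteq> \<Omega>" using UO KU by blast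
  have "x0 \<in> K" using \<delta> by (simp add: K_def)
  then show "K \<noteq> {}" by blast
qed

lemma phi_outside: "x \<notin> K \<Longrightarrow> \<phi> r x = 0"
proof -
  assume "x \<notin> K"
  then obtain i where "\<not> \<bar>x $ i - x0 $ i\<bar> \<le> 8 * \<delta>" unfolding K_def by blast
  then show ?thesis by (intro \<phi>0[of x i]) simp
qed

lemma sU: "mi_abs \<alpha> \<le> m \<Longrightarrow> smooth_on U (a \<alpha>)"
  by (rule smooth_on_subset[OF sa U(2)])

lemma N_pos: "N k \<ge> 0" using weight_seq_pos[OF wN, of k] by simp

lemma S_nonneg: "S k \<ge> 0" using supermultD(1)[OF S, of k] by simp

lemma bdp_coeff:
  assumes "mi_abs \<alpha> \<le> m" "x \<in> U" "\<rho>a \<le> \<rho>"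
  shows "bdp x R (a \<alpha>) (\<lambda>l. Ca * \<rho> ^ l * S l)"
  unfolding bdp_def
proof (intro allI impI)
  fix "is" :: "'n list"
  have "norm (pdiff_list is (a \<alpha>) x) \<le> Ca * \<rho>a ^ length is * S (length is)"
    using assms by (intro ca) (auto simp: U_def)
  also have "\<dots> \<le> Ca * \<rho> ^ length is * S (length is)"
    using Ca \<rho>a assms S_nonneg by (intro mult_right_mono mult_left_mono power_mono) auto
  finally show "norm (pdiff_list is (a \<alpha>) x) \<le> Ca * \<rho> ^ length is * S (length is)" .
qed

text \<open>A window reduced to j = 0 is the start of the iteration, with no power of \<mu> gained
  yet; \<open>fS\<close> passes from factorials to S.\<close>

lemma bdp_phi:
  assumes "\<rho>\<phi> \<le> \<rho>"
  shows "bdp x r (\<phi> r) (\<lambda>l. E * E ^ r * C * Wsum S \<rho> \<mu> 0 0 l)"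
  unfolding bdp_def
proof (intro allI impI)
  fix "is" :: "'n list" assume l: "length is \<le> r"
  have "norm (pdiff_list is (\<phi> r) x) \<le> E * E ^ r * (\<rho>\<phi> ^ length is * fact (length is))"
    using d\<phi>[OF l, of x] by (simp add: mult.assoc)
  also have "\<dots> \<le> E * E ^ r * (\<rho> ^ length is * (C * S (length is)))"
    using E \<rho>\<phi> assms by (intro mult_left_mono mult_mono power_mono fS) auto
  finally show "norm (pdiff_list is (\<phi> r) x) \<le> E * E ^ r * C * Wsum S \<rho> \<mu> 0 0 (length is)"
    by (simp add: Wsum_def mult_ac)
qed

text \<open>Amplitudes are estimated on \<open>U\<close>, where coefficients and q are smooth, but
  pairings need functions on the whole space; vanishing off \<open>K\<close> bridges the
  two.\<close>

lemma extend:
  assumes "smooth_on U g" "\<And>x. x \<notin> K \<Longrightarrow> g x = 0"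
  shows "smooth_on UNIV g" "K \<subseteq> V \<Longrightarrow> test_fun V g"
    "Y \<ge> 0 \<Longrightarrow> (\<And>x. x \<in> U \<Longrightarrow> norm (pdiff_list is g x) \<le> Y) \<Longrightarrow> norm (pdiff_list is g x) \<le> Y"
proof -
  show "smooth_on UNIV g" by (rule smooth_on_extend[OF U(1) K(2,3) assms(2,1)])
  show "test_fun V g" if "K \<subseteq> V" by (rule test_funI[OF U(1) K(1,3) that assms(2,1)])
  show "norm (pdiff_list is g x) \<le> Y" if "Y \<ge> 0" "\<And>x. x \<in> U \<Longrightarrow> norm (pdiff_list is g x) \<le> Y"
  proof (cases "x \<in> U")
    case False
    then have "x \<notin> K" using K(3) by blast
    from pdiff_list_vanish[OF K(2) assms(2) this] that(1) show ?thesis by simp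
  qed (use that in blast)
qed

text \<open>The single majorant X N_l supplies both bounds of \<open>pairing_bound\<close>: order
  2n, with n the dimension, gives \<open>G\<close> and order \<nu> + s2 gives \<open>H\<close>. The
  product on the right merges the two resulting summands.\<close>

lemma pairing_estimate:
  assumes pb: "pairing_bound fs K c C2 \<kappa>2 s2" and g: "smooth_on U g" "\<And>x. x \<notin> K \<Longrightarrow> g x = 0"
    and b: "\<And>x. x \<in> U \<Longrightarrow> bdp x (\<nu> + (s2 + 2 * CARD('n) + k)) g (\<lambda>l. X * N l)" and X: "X \<ge> 0"
    and \<xi>: "norm \<xi> \<ge> 1" and A: "A \<ge> 0"
    and h: "\<And>\<eta>. norm (\<eta> - \<xi>) \<le> c * norm \<xi> \<Longrightarrow> norm \<eta> ^ \<nu> * norm (fourier (fs \<nu>) \<eta>) \<le> A"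
  shows "norm \<xi> ^ \<nu> * norm (fs \<nu> (\<lambda>x. ee (- \<xi>) x * g x)) \<le>
    C2 * \<kappa>2 ^ \<nu> * (X * (N (2 * CARD('n)) + 1) * (N (\<nu> + s2) + A))"
proof -
  let ?n = "2 * CARD('n)"
  have bnd: "norm (pdiff_list is g x) \<le> X * N l0" if "length is \<le> l0" "l0 \<le> \<nu> + (s2 + ?n + k)" for "is" x l0
  proof (rule extend(3)[OF g])
    show "0 \<le> X * N l0" using X N_pos by simp
    fix y assume "y \<in> U"
    from bdpD[OF b[OF this], of "is"] that have "norm (pdiff_list is g y) \<le> X * N (length is)" by simp
    also have "\<dots> \<le> X * N l0" using X that(1) by (intro mult_left_mono weight_seq_mono wN) auto
    finally show "norm (pdiff_list is g y) \<le> X * N l0" .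
  qed
  have "norm \<xi> ^ \<nu> * norm (fs \<nu> (\<lambda>x. ee (- \<xi>) x * g x)) \<le> C2 * \<kappa>2 ^ \<nu> * (A * (X * N ?n) + X * N (\<nu> + s2))"
    by (rule pairing_boundD[OF pb extend(1)[OF g] g(2) \<xi> A bnd bnd h]) auto
  also have "\<dots> \<le> C2 * \<kappa>2 ^ \<nu> * (X * (N ?n + 1) * (N (\<nu> + s2) + A))"
  proof (rule mult_left_mono)
    have "0 \<le> X * A" "0 \<le> X * N ?n * N (\<nu> + s2)" using X A N_pos by auto
    then show "A * (X * N ?n) + X * N (\<nu> + s2) \<le> X * (N ?n + 1) * (N (\<nu> + s2) + A)"
      by (simp add: algebra_simps)
    show "0 \<le> C2 * \<kappa>2 ^ \<nu>" using pb by (simp add: pairing_bound_def)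
  qed
  finally show ?thesis .
qed

text \<open>Moving the exponential through the transpose turns the transform of the localised P u
  into |\<xi>|^m times a pairing of u with the amplitude \<open>Lsum\<close> of the cutoff. The
  amplitude consumes m derivatives, which explains the summand m in the index of the cutoff.\<close>

lemma operator_estimate:
  assumes u: "distribution \<Omega> u" and KV: "K \<subseteq> V" and fsu: "\<forall>r \<psi>. test_fun V \<psi> \<longrightarrow> fs r \<psi> = u \<psi>"
    and pb: "pairing_bound fs K c C2 \<kappa>2 s2"
  shows "\<exists>C3 \<kappa>3. C3 \<ge> 0 \<and> \<kappa>3 \<ge> 1 \<and> (\<forall>\<nu> \<xi> A. \<nu> \<ge> 1 \<longrightarrow> norm \<xi> \<ge> 1 \<longrightarrow> N \<nu> \<le> norm \<xi> ^ \<nu> \<longrightarrow> A \<ge> 0 \<longrightarrow>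
    (\<forall>\<eta>. norm (\<eta> - \<xi>) \<le> c * norm \<xi> \<longrightarrow> norm \<eta> ^ \<nu> * norm (fourier (fs \<nu>) \<eta>) \<le> A) \<longrightarrow>
    norm \<xi> ^ \<nu> * norm (apply_op a m u (\<lambda>x. \<phi> (\<nu> + (s2 + 2 * CARD('n)) + m) x * ee (- \<xi>) x)) \<le>
      C3 * \<kappa>3 ^ \<nu> * norm \<xi> ^ m * (N (\<nu> + s2) + A))"
proof -
  let ?n = "2 * CARD('n)"
  define \<rho> where "\<rho> = max (2 * \<rho>a) \<rho>\<phi>"
  have \<rho>: "\<rho> \<ge> 1" "\<rho>a \<le> \<rho> / 2" "\<rho>\<phi> \<le> \<rho>" using \<rho>a by (auto simp: \<rho>_def)
  have rc: "\<rho> * C \<ge> 1" by (rule mult_ge1[OF \<rho>(1) C])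
  define sd where "sd = s2 + ?n"
  define cL where "cL = real (card {\<alpha> :: 'n \<Rightarrow> nat. mi_abs \<alpha> \<le> m}) * 2 ^ m * (2 * Ca)"
  define D where "D = C * (\<rho> * C) ^ sd"
  define \<kappa>0 where "\<kappa>0 = 2 ^ m * (\<rho> * C) ^ (m + 1)"
  have \<kappa>0: "\<kappa>0 \<ge> 1" unfolding \<kappa>0_def by (intro mult_ge1 one_le_power rc) simp
  have c0: "cL \<ge> 0" "D \<ge> 0" using Ca C \<rho>(1) by (auto simp: cL_def D_def)
  have C2: "C2 \<ge> 0" "\<kappa>2 \<ge> 1" using pb by (auto simp: pairing_bound_def)
  define C3 where "C3 = C2 * (cL * (E * E ^ (sd + m) * C) * D * (N ?n + 1))"
  define \<kappa>3 where "\<kappa>3 = \<kappa>2 * (E * \<kappa>0)"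
  have C3: "C3 \<ge> 0" unfolding C3_def using C2 c0 E C N_pos by simp
  have \<kappa>3: "\<kappa>3 \<ge> 1"
    unfolding \<kappa>3_def by (intro mult_ge1 C2(2) E \<kappa>0)
  have "norm \<xi> ^ \<nu> * norm (apply_op a m u (\<lambda>x. \<phi> (\<nu> + sd + m) x * ee (- \<xi>) x)) \<le>
      C3 * \<kappa>3 ^ \<nu> * norm \<xi> ^ m * (N (\<nu> + s2) + A)"
    if \<nu>: "\<nu> \<ge> 1" and \<xi>: "norm \<xi> \<ge> 1" and th: "N \<nu> \<le> norm \<xi> ^ \<nu>" and A: "A \<ge> 0"
      and h: "\<And>\<eta>. norm (\<eta> - \<xi>) \<le> c * norm \<xi> \<Longrightarrow> norm \<eta> ^ \<nu> * norm (fourier (fs \<nu>) \<eta>) \<le> A" for \<nu> \<xi> A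
  proof -
    define t where "t = norm \<xi>"
    define \<theta> where "\<theta> = sgn \<xi>"
    define r where "r = \<nu> + sd + m"
    define \<mu> where "\<mu> = 1 / t"
    have t: "t \<ge> 1" using \<xi> by (simp add: t_def)
    have \<mu>: "0 \<le> \<mu>" "\<mu> \<le> 1" "t * \<mu> = 1" using t by (auto simp: \<mu>_def)
    have \<theta>: "norm \<theta> \<le> 1" "t *\<^sub>R \<theta> = \<xi>" using norm_scaleR_sgn[of \<xi>] \<xi> by (auto simp: \<theta>_def t_def norm_sgn)
    define g where "g = Lsum a m \<theta> \<mu> (\<phi> r)"
    define X where "X = cL * (E * E ^ r * C) * (D * \<kappa>0 ^ \<nu>)"
    have X: "X \<ge> 0" unfolding X_def using c0 E C \<kappa>0 by simp
    have s\<phi>: "smooth_on U (\<phi> r)" by (rule smooth_on_subset[OF \<phi>]) simp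
    have g: "smooth_on U g" unfolding g_def by (rule smooth_on_Lsum[OF U(1) sU s\<phi>])
    have gK: "g x = 0" if "x \<notin> K" for x unfolding g_def by (rule Lsum_vanish[OF K(2) phi_outside that])
    have gb: "bdp x (\<nu> + (s2 + ?n + 0)) g (\<lambda>l. X * N l)" if x: "x \<in> U" for x
    proof -
      have "bdp x (\<nu> + sd + m) (\<phi> r) (\<lambda>l. E * E ^ r * C * Wsum S \<rho> \<mu> 0 0 l)"
        using bdp_phi[OF \<rho>(3), of x r \<mu>] by (simp add: r_def)
      then have "bdp x (\<nu> + sd) g (\<lambda>l. cL * (E * E ^ r * C) * Wsum S \<rho> \<mu> 0 m l)"
        unfolding g_def cL_def using E C
        by (intro bdp_Lsum[OF S \<rho>(1) \<mu>(1,2) U(1) x \<theta>(1) sU s\<phi> Ca _ bdp_coeff[OF _ x \<rho>(2)]]) auto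
      then show ?thesis
      proof (rule bdp_mono)
        fix l assume l: "l \<le> \<nu> + (s2 + ?n + 0)"
        have "Wsum S \<rho> \<mu> 0 m l \<le> D * \<kappa>0 ^ \<nu> * N l"
          unfolding D_def \<kappa>0_def \<mu>_def
        proof (rule Wsum_le_threshold[OF S N_pos C \<rho>(1) t])
          \<comment> \<open>Here \<nu> >= 1 enters: the window up to m has to stay below m
            \<nu>.\<close>
          have mm: "m \<le> m * \<nu>" using \<nu> by simp
          show "S (l + j) \<le> C ^ (l + j + 1) * N l * t ^ j" if "0 \<le> j" "j \<le> m" for j
            using th order_trans[OF that(2) mm] by (intro w2[of t \<nu>] t) (auto simp: t_def)
          show "m \<le> m * \<nu>" by fact
        qed (use l in \<open>simp add: sd_def\<close>)
        then have "cL * (E * E ^ r * C) * Wsum S \<rho> \<mu> 0 m l \<le> cL * (E * E ^ r * C) * (D * \<kappa>0 ^ \<nu> * N l)"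
          using c0 E C by (intro mult_left_mono) auto
        then show "cL * (E * E ^ r * C) * Wsum S \<rho> \<mu> 0 m l \<le> X * N l" by (simp add: X_def mult.assoc)
      qed (simp add: sd_def)
    qed
    have est: "t ^ \<nu> * norm (fs \<nu> (\<lambda>x. ee (- \<xi>) x * g x)) \<le> C2 * \<kappa>2 ^ \<nu> * (X * (N ?n + 1) * (N (\<nu> + s2) + A))"
      unfolding t_def by (rule pairing_estimate[OF pb g gK gb X \<xi> A h])
    have seg: "smooth_on U (\<lambda>x. ee (- \<xi>) x * g x)" by (intro smooth_on_mult smooth_on_ee U g)
    have egK: "ee (- \<xi>) x * g x = 0" if "x \<notin> K" for x using gK[OF that] by simp
    have "apply_op a m u (\<lambda>x. \<phi> r x * ee (- \<xi>) x) = u (tP a m (\<lambda>x. ee (- (t *\<^sub>R \<theta>)) x * \<phi> r x))"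
      unfolding apply_op_tP \<theta>(2) by (simp add: mult.commute)
    also have "tP a m (\<lambda>x. ee (- (t *\<^sub>R \<theta>)) x * \<phi> r x) = (\<lambda>x. of_real (t ^ m) * (ee (- \<xi>) x * g x))"
      unfolding g_def \<theta>(2)[symmetric]
      by (rule ext) (rule tP_conjugate[OF U(1) sU s\<phi> K(2,3) phi_outside \<mu>(3)])
    also have "u \<dots> = of_real (t ^ m) * u (\<lambda>x. ee (- \<xi>) x * g x)"
      by (rule distribution_cmult[OF u extend(2)[OF seg egK K(4)]])
    also have "u (\<lambda>x. ee (- \<xi>) x * g x) = fs \<nu> (\<lambda>x. ee (- \<xi>) x * g x)"
      by (rule fsu[rule_format, symmetric]) (rule extend(2)[OF seg egK KV])
    finally have "norm (apply_op a m u (\<lambda>x. \<phi> r x * ee (- \<xi>) x)) = t ^ m * norm (fs \<nu> (\<lambda>x. ee (- \<xi>) x * g x))"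
      using t by (simp add: norm_mult norm_power)
    then have "t ^ \<nu> * norm (apply_op a m u (\<lambda>x. \<phi> r x * ee (- \<xi>) x)) =
        t ^ m * (t ^ \<nu> * norm (fs \<nu> (\<lambda>x. ee (- \<xi>) x * g x)))" by simp
    also have "\<dots> \<le> t ^ m * (C2 * \<kappa>2 ^ \<nu> * (X * (N ?n + 1) * (N (\<nu> + s2) + A)))"
      using t by (intro mult_left_mono est) auto
    also have "\<dots> = C3 * \<kappa>3 ^ \<nu> * t ^ m * (N (\<nu> + s2) + A)"
      unfolding C3_def \<kappa>3_def X_def r_def power_mult_distrib power_add by (simp only: mult_ac)
    finally show ?thesis unfolding t_def r_def .
  qed
  then show ?thesis using C3 \<kappa>3 unfolding sd_def by blast
qed

text \<open>For fixed \<theta> the symbol is a combination of the coefficients with factors of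
  modulus at most 1. So \<open>bdp_inverse\<close> applies with the number of multi-indices times
  \<open>Ca\<close> as constant, which is the origin of \<rho>1. Multiplication by a coefficient
  then doubles the radius.\<close>

lemma parametrix_bounds:
  fixes \<theta> :: "real^'n"
  assumes q_def: "q = (\<lambda>y. inverse (principal_symbol a m y \<theta>))"
    and \<rho>1_def: "\<rho>1 = \<rho>a * (1 + real (card {\<alpha> :: 'n \<Rightarrow> nat. mi_abs \<alpha> \<le> m}) * Ca / c0)"
    and \<theta>: "norm \<theta> \<le> 1" and c0: "c0 > 0" "\<And>y. y \<in> U \<Longrightarrow> norm (principal_symbol a m y \<theta>) \<ge> c0"
  shows "smooth_on U q"
    and "x \<in> U \<Longrightarrow> bdp x R q (\<lambda>l. 1 / c0 * \<rho>1 ^ l * S l)"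
    and "x \<in> U \<Longrightarrow> mi_abs \<alpha> \<le> m \<Longrightarrow> bdp x R (\<lambda>y. a \<alpha> y * q y) (\<lambda>l. 2 * Ca / c0 * (2 * \<rho>1) ^ l * S l)"
proof -
  let ?P = "\<lambda>y. principal_symbol a m y \<theta>"
  let ?I = "{\<alpha> :: 'n \<Rightarrow> nat. mi_abs \<alpha> = m}" and ?J = "{\<alpha> :: 'n \<Rightarrow> nat. mi_abs \<alpha> \<le> m}"
  let ?w = "\<lambda>\<alpha>. \<Prod>i\<leftarrow>mlist \<alpha>. complex_of_real (\<theta> $ i)"
  have P: "?P = (\<lambda>y. \<Sum>\<alpha>\<in>?I. ?w \<alpha> * a \<alpha> y)" by (simp add: principal_symbol_mlist mult.commute)
  have sP: "smooth_on U ?P"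
    unfolding P by (rule smooth_on_sum[OF U(1)], rule smooth_on_cmult[OF U(1) sU]) simp
  have nz: "?P y \<noteq> 0" if "y \<in> U" for y using c0(2)[OF that] c0(1) by auto
  show sq: "smooth_on U q" unfolding q_def by (rule smooth_on_inverse[OF U(1) sP nz])
  have w: "norm (?w \<alpha>) \<le> 1" for \<alpha>
  proof -
    have "norm (\<Prod>i\<leftarrow>is. complex_of_real (\<theta> $ i)) \<le> 1" for "is" :: "'n list"
    proof (induction "is")
      case (Cons i "is")
      have "\<bar>\<theta> $ i\<bar> \<le> 1" using component_le_norm_cart[of \<theta> i] \<theta> by linarith
      with Cons show ?case using mult_mono[of "\<bar>\<theta> $ i\<bar>" 1] by (simp add: norm_mult)
    qed simp
    then show ?thesis .
  qed
  have bP: "bdp x R ?P (\<lambda>l. real (card ?J) * Ca * \<rho>a ^ l * S l)" if x: "x \<in> U" for x R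
  proof -
    have "bdp x R ?P (\<lambda>l. \<Sum>\<alpha>\<in>?I. norm (?w \<alpha>) * (Ca * \<rho>a ^ l * S l))"
      unfolding P
      by (rule bdp_sum[OF U(1) _ x]; (rule smooth_on_cmult[OF U(1) sU] bdp_cmult[OF U(1) sU x bdp_coeff[OF _ x]])) auto
    then show ?thesis
    proof (rule bdp_mono[OF _ order_refl])
      fix l
      have nn: "0 \<le> Ca * \<rho>a ^ l * S l" using Ca \<rho>a S_nonneg by simp
      have "(\<Sum>\<alpha>\<in>?I. norm (?w \<alpha>) * (Ca * \<rho>a ^ l * S l)) \<le> (\<Sum>\<alpha>\<in>?I. 1 * (Ca * \<rho>a ^ l * S l))"
        by (intro sum_mono mult_right_mono w nn)
      also have "\<dots> = real (card ?I) * (Ca * \<rho>a ^ l * S l)" by simp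
      also have "\<dots> \<le> real (card ?J) * (Ca * \<rho>a ^ l * S l)"
        by (intro mult_right_mono nn of_nat_mono card_mono finite_mi_abs_le) auto
      finally show "(\<Sum>\<alpha>\<in>?I. norm (?w \<alpha>) * (Ca * \<rho>a ^ l * S l)) \<le> real (card ?J) * Ca * \<rho>a ^ l * S l"
        by (simp add: mult.assoc)
    qed
  qed
  have Cp: "real (card ?J) * Ca \<ge> 0" using Ca by simp
  have \<rho>a0: "\<rho>a \<ge> 0" using \<rho>a by simp
  have bq: "bdp x R q (\<lambda>l. 1 / c0 * \<rho>1 ^ l * S l)" if x: "x \<in> U" for x R
    unfolding q_def \<rho>1_def by (rule bdp_inverse[OF U(1) sP nz x c0(1) c0(2)[OF x] S Cp \<rho>a0 bP[OF x]])
  then show "x \<in> U \<Longrightarrow> bdp x R q (\<lambda>l. 1 / c0 * \<rho>1 ^ l * S l)" .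
  have \<rho>1: "\<rho>a \<le> \<rho>1"
    unfolding \<rho>1_def using mult_left_mono[of 1 "1 + real (card ?J) * Ca / c0" \<rho>a] \<rho>a0 Cp c0(1) by simp
  assume x: "x \<in> U" and \<alpha>: "mi_abs \<alpha> \<le> m"
  have "bdp x R (a \<alpha>) (\<lambda>l. Ca * (2 * \<rho>1) ^ l * S l)"
    by (rule bdp_coeff[OF \<alpha> x]) (use \<rho>1 \<rho>a in linarith)
  then have "bdp x R (a \<alpha>) (\<lambda>l. Ca * Wsum S (2 * \<rho>1) 0 0 0 l)" by (simp add: Wsum_def mult.assoc)
  moreover have "bdp x R q (\<lambda>l. 1 / c0 * (2 * \<rho>1 / 2) ^ l * S l)" using bq[OF x] by simp
  moreover have "1 \<le> 2 * \<rho>1" using \<rho>1 \<rho>a by linarith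
  ultimately have "bdp x R (\<lambda>y. q y * a \<alpha> y) (\<lambda>l. 2 * (1 / c0) * Ca * Wsum S (2 * \<rho>1) 0 0 0 l)"
    using c0(1) Ca by (intro bdp_mult_Wsum[OF S _ _ _ U(1) x \<theta> sq sU[OF \<alpha>]]) auto
  then show "bdp x R (\<lambda>y. a \<alpha> y * q y) (\<lambda>l. 2 * Ca / c0 * (2 * \<rho>1) ^ l * S l)"
    by (simp add: Wsum_def mult_ac)
qed

text \<open>Telescoping: \<open>v k - v (Suc k)\<close> is \<open>Lsum\<close> applied to \<open>q v k\<close>, and \<open>e Lsum (q v k)\<close> is up to the factor
  \<open>\<mu>^m\<close> the transpose of the operator applied to \<open>e q v k\<close>.\<close>

lemma parametrix_expansion:
  fixes \<theta> :: "real^'n" and \<mu> t :: real and q h :: "real^'n \<Rightarrow> complex"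
  assumes u: "distribution \<Omega> u" and KV: "K \<subseteq> V" and sq: "smooth_on U q" and \<mu>: "t * \<mu> = 1"
    and fsu: "\<And>\<psi>. test_fun V \<psi> \<Longrightarrow> f \<psi> = apply_op a m u \<psi>" and \<chi>: "smooth_on U h" "\<And>x. x \<notin> K \<Longrightarrow> h x = 0"
    and v_def: "v = (\<lambda>k. (Rop a m q \<theta> \<mu> ^^ k) h)" and e_def: "e = ee (- (t *\<^sub>R \<theta>))"
  shows "smooth_on U (v k)" "x \<notin> K \<Longrightarrow> v k x = 0"
    "u (\<lambda>x. h x * e x) = u (\<lambda>x. e x * v \<nu> x) + (\<Sum>k<\<nu>. of_real (\<mu> ^ m) * f (\<lambda>x. e x * (q x * v k x)))"
proof -
  show sv: "smooth_on U (v k)" for k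
    unfolding v_def by (induction k) (simp_all add: \<chi>(1) smooth_on_Rop[OF U(1) sU sq])
  have vK: "v k x = 0" if "x \<notin> K" for k x
    using that
  proof (induction k arbitrary: x)
    case 0 then show ?case by (simp add: v_def \<chi>(2))
  next
    case (Suc k)
    have "Rop a m q \<theta> \<mu> (v k) x = 0" by (rule Rop_vanish[OF K(2) Suc.IH Suc.prems])
    then show ?case by (simp add: v_def)
  qed
  then show "x \<notin> K \<Longrightarrow> v k x = 0" .
  define w where "w = (\<lambda>k x. e x * (q x * v k x))"
  have se: "smooth_on U e" unfolding e_def by (intro smooth_on_ee U)
  have sqv: "smooth_on U (\<lambda>x. q x * v k x)" for k by (intro smooth_on_mult U sq sv)
  have qvK: "q x * v k x = 0" if "x \<notin> K" for k x using vK[OF that] by simp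
  have sw: "smooth_on U (w k)" and wK: "x \<notin> K \<Longrightarrow> w k x = 0" for k x
    unfolding w_def using qvK by (auto intro!: smooth_on_mult U se sqv)
  have stw: "smooth_on U (tP a m (w k))" and twK: "x \<notin> K \<Longrightarrow> tP a m (w k) x = 0" for k x
    by (auto intro!: smooth_on_tP[OF U(1) sU sw] tP_vanish[OF K(2) wK])
  have step: "e x * v k x - e x * v (Suc k) x = of_real (\<mu> ^ m) * tP a m (w k) x" for k x
  proof -
    have "tP a m (w k) x = of_real (t ^ m) * (e x * Lsum a m \<theta> \<mu> (\<lambda>x. q x * v k x) x)"
      unfolding w_def e_def by (rule tP_conjugate[OF U(1) sU sqv K(2,3) qvK \<mu>])
    moreover have "complex_of_real (\<mu> ^ m) * of_real (t ^ m) = 1"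
      unfolding of_real_mult[symmetric] power_mult_distrib[symmetric] by (simp add: \<mu> mult.commute[of \<mu>])
    ultimately have "of_real (\<mu> ^ m) * tP a m (w k) x = e x * Lsum a m \<theta> \<mu> (\<lambda>x. q x * v k x) x"
      by (simp only: mult.assoc[symmetric] mult_1)
    moreover have "v (Suc k) x = v k x - Lsum a m \<theta> \<mu> (\<lambda>x. q x * v k x) x"
      by (simp add: v_def Rop_def)
    ultimately show ?thesis by (simp only: right_diff_distrib diff_diff_eq2 add_diff_cancel_left')
  qed
  have sev: "smooth_on U (\<lambda>x. e x * v \<nu> x)" by (intro smooth_on_mult U se sv)
  have evK: "e x * v \<nu> x = 0" if "x \<notin> K" for x using vK[OF that] by simp
  let ?g = "\<lambda>k x. of_real (\<mu> ^ m) * tP a m (w k) x"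
  have sg: "smooth_on U (?g k)" and gK: "x \<notin> K \<Longrightarrow> ?g k x = 0" for k x
    by (auto intro!: smooth_on_cmult U stw simp: twK)
  have "(\<lambda>x. h x * e x) = (\<lambda>x. e x * v \<nu> x + (\<Sum>k<\<nu>. ?g k x))"
  proof
    fix x
    have "(\<Sum>k<\<nu>. ?g k x) = (\<Sum>k<\<nu>. e x * v k x - e x * v (Suc k) x)" by (simp only: step)
    also have "\<dots> = e x * v 0 x - e x * v \<nu> x" by (rule sum_lessThan_telescope')
    finally show "h x * e x = e x * v \<nu> x + (\<Sum>k<\<nu>. ?g k x)" by (simp add: v_def mult.commute)
  qed
  then have "u (\<lambda>x. h x * e x) = u (\<lambda>x. e x * v \<nu> x + (\<Sum>k<\<nu>. ?g k x))" by (rule arg_cong)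
  also have "\<dots> = u (\<lambda>x. e x * v \<nu> x) + u (\<lambda>x. \<Sum>k<\<nu>. ?g k x)"
  proof (rule distribution_add[OF u extend(2)[OF sev evK K(4)] extend(2)[OF _ _ K(4)]])
    show "smooth_on U (\<lambda>x. \<Sum>k<\<nu>. ?g k x)" by (intro smooth_on_sum U sg)
    show "(\<Sum>k<\<nu>. ?g k x) = 0" if "x \<notin> K" for x by (rule sum.neutral) (simp add: twK[OF that])
  qed
  also have "u (\<lambda>x. \<Sum>k<\<nu>. ?g k x) = (\<Sum>k<\<nu>. u (?g k))"
    by (rule distribution_sum[OF \<Omega> u K(1,4)])
      (rule smooth_on_subset[OF extend(1)[OF sg gK]], auto simp: twK)
  also have "\<dots> = (\<Sum>k<\<nu>. of_real (\<mu> ^ m) * f (w k))"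
  proof (rule sum.cong[OF refl])
    fix k
    have "u (?g k) = of_real (\<mu> ^ m) * u (tP a m (w k))"
      by (rule distribution_cmult[OF u extend(2)[OF stw twK K(4)]])
    also have "u (tP a m (w k)) = f (w k)"
      unfolding apply_op_tP[symmetric] by (rule fsu[symmetric], rule extend(2)[OF sw wK KV])
    finally show "u (?g k) = of_real (\<mu> ^ m) * f (w k)" .
  qed
  finally show "u (\<lambda>x. h x * e x) = u (\<lambda>x. e x * v \<nu> x) + (\<Sum>k<\<nu>. of_real (\<mu> ^ m) * f (\<lambda>x. e x * (q x * v k x)))"
    unfolding w_def .
qed

text \<open>The \<nu> terms of the expansion are pairings with P u and fall under the microlocal
  estimate. The remainder is bounded by the finite order \<open>k0\<close> of u on \<open>K\<close>,
  because its amplitude carries \<nu> certain powers of 1 / |\<xi>|. Up to m \<nu> derivatives are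
  spent on the way, hence the summand m \<nu> in the index of the cutoff.\<close>

lemma elliptic_estimate:
  fixes \<Gamma>' :: "(real^'n) set"
  assumes u: "distribution \<Omega> u" and KV: "K \<subseteq> V" and fsu: "\<forall>r \<psi>. test_fun V \<psi> \<longrightarrow> fs r \<psi> = apply_op a m u \<psi>"
    and pb: "pairing_bound fs K c C2 \<kappa>2 s2"
    and c0: "c0 > 0" "\<forall>x\<in>U. \<forall>\<xi>\<in>\<Gamma>'. norm (principal_symbol a m x (sgn \<xi>)) \<ge> c0"
  shows "\<exists>C3 \<kappa>3 k0. C3 \<ge> 0 \<and> \<kappa>3 \<ge> 1 \<and> (\<forall>\<nu> \<xi> A. \<xi> \<in> \<Gamma>' \<longrightarrow> norm \<xi> \<ge> 1 \<longrightarrow> N \<nu> \<le> norm \<xi> ^ \<nu> \<longrightarrow> A \<ge> 0 \<longrightarrow>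
    (\<forall>\<eta>. norm (\<eta> - \<xi>) \<le> c * norm \<xi> \<longrightarrow> norm \<eta> ^ \<nu> * norm (fourier (fs \<nu>) \<eta>) \<le> A) \<longrightarrow>
    norm \<xi> ^ \<nu> * norm (u (\<lambda>x. \<phi> (\<nu> + (s2 + 2 * CARD('n) + k0) + m * \<nu>) x * ee (- \<xi>) x)) \<le>
      C3 * \<kappa>3 ^ \<nu> * norm \<xi> ^ k0 * (N (\<nu> + s2) + A))"
proof -
  let ?n = "2 * CARD('n)"
  let ?J = "{\<alpha> :: 'n \<Rightarrow> nat. mi_abs \<alpha> \<le> m}"
  obtain Cu k0 where Cu: "Cu \<ge> 0" and du: "\<And>\<psi> B. smooth_on \<Omega> \<psi> \<Longrightarrow> (\<And>x. x \<notin> K \<Longrightarrow> \<psi> x = 0) \<Longrightarrow>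
    (\<And>is x. length is \<le> k0 \<Longrightarrow> x \<in> K \<Longrightarrow> norm (pdiff_list is \<psi> x) \<le> B) \<Longrightarrow> norm (u \<psi>) \<le> Cu * B"
    using distribution_order[OF \<Omega> u K(1,4,5)] by (elim exE conjE) blast
  define \<rho>1 where "\<rho>1 = \<rho>a * (1 + real (card ?J) * Ca / c0)"
  have "real (card ?J) * Ca / c0 \<ge> 0" using Ca c0(1) by simp
  then have \<rho>1: "\<rho>1 \<ge> 1" unfolding \<rho>1_def by (intro mult_ge1 \<rho>a) simp
  \<comment> \<open>The factor 4 brings 2 \<rho>1, the radius of a coefficient times q, down to at
    most \<rho> / 2, as multiplication inside the windows requires.\<close>
  define \<rho> where "\<rho> = max (4 * \<rho>1) \<rho>\<phi>"
  have \<rho>: "\<rho> \<ge> 1" "2 * \<rho>1 \<le> \<rho> / 2" "\<rho>\<phi> \<le> \<rho>" "\<rho>1 \<le> \<rho> / 2" using \<rho>1 by (auto simp: \<rho>_def)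
  have rc: "\<rho> * C \<ge> 1" by (rule mult_ge1[OF \<rho>(1) C])
  define sd where "sd = s2 + ?n + k0"
  define cR where "cR = real (card ?J) * 2 ^ m * (2 * (2 * Ca / c0))"
  define D where "D = C * (\<rho> * C) ^ sd"
  define \<kappa>0 where "\<kappa>0 = 2 ^ m * (\<rho> * C) ^ (m + 1)"
  have \<kappa>0: "\<kappa>0 \<ge> 1" unfolding \<kappa>0_def by (intro mult_ge1 one_le_power rc) simp
  have c1: "cR \<ge> 0" "D \<ge> 0" using Ca c0 C \<rho>(1) by (auto simp: cR_def D_def)
  have C2: "C2 \<ge> 0" "\<kappa>2 \<ge> 1" using pb by (auto simp: pairing_bound_def)
  define C4 where "C4 = Cu * 2 ^ k0 * N k0 + C2 * (2 / c0) * (N ?n + 1)"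
  define Z where "Z = (\<lambda>\<nu>. (1 + cR) ^ \<nu> * (E * E ^ (\<nu> + sd + m * \<nu>) * C) * (D * \<kappa>0 ^ \<nu>))"
  define C3 where "C3 = E * E ^ sd * C * D * C4"
  define \<kappa>3 where "\<kappa>3 = (1 + cR) * (E * E ^ m) * \<kappa>0 * (2 * \<kappa>2)"
  have C4: "C4 \<ge> 0" unfolding C4_def using Cu C2 c0 N_pos by simp
  have C3: "C3 \<ge> 0" unfolding C3_def using C4 c1 E C by simp
  have \<kappa>3: "\<kappa>3 \<ge> 1" unfolding \<kappa>3_def using c1 C2 by (intro mult_ge1 E \<kappa>0 one_le_power) auto
  have Z: "Z \<nu> \<ge> 0" for \<nu> unfolding Z_def using c1 \<kappa>0 E C by simp
  have "norm \<xi> ^ \<nu> * norm (u (\<lambda>x. \<phi> (\<nu> + sd + m * \<nu>) x * ee (- \<xi>) x)) \<le>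
      C3 * \<kappa>3 ^ \<nu> * norm \<xi> ^ k0 * (N (\<nu> + s2) + A)"
    if \<Gamma>: "\<xi> \<in> \<Gamma>'" and \<xi>: "norm \<xi> \<ge> 1" and th: "N \<nu> \<le> norm \<xi> ^ \<nu>" and A: "A \<ge> 0"
      and h: "\<And>\<eta>. norm (\<eta> - \<xi>) \<le> c * norm \<xi> \<Longrightarrow> norm \<eta> ^ \<nu> * norm (fourier (fs \<nu>) \<eta>) \<le> A" for \<nu> \<xi> A
  proof -
    define t where "t = norm \<xi>"
    define \<theta> where "\<theta> = sgn \<xi>"
    define r where "r = \<nu> + sd + m * \<nu>"
    define \<mu> where "\<mu> = 1 / t"
    have t: "t \<ge> 1" using \<xi> by (simp add: t_def)
    have tht: "N \<nu> \<le> t ^ \<nu>" using th by (simp add: t_def)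
    have \<mu>: "0 \<le> \<mu>" "\<mu> \<le> 1" "t * \<mu> = 1" using t by (auto simp: \<mu>_def)
    have \<theta>: "norm \<theta> \<le> 1" "t *\<^sub>R \<theta> = \<xi>" using norm_scaleR_sgn[of \<xi>] \<xi> by (auto simp: \<theta>_def t_def norm_sgn)
    define q where "q = (\<lambda>y. inverse (principal_symbol a m y \<theta>))"
    define v where "v = (\<lambda>k. (Rop a m q \<theta> \<mu> ^^ k) (\<phi> r))"
    define e where "e = ee (- \<xi>)"
    have c0\<theta>: "norm (principal_symbol a m y \<theta>) \<ge> c0" if "y \<in> U" for y
      unfolding \<theta>_def by (rule c0(2)[rule_format, OF that \<Gamma>])
    have qf: "smooth_on U q" "x \<in> U \<Longrightarrow> bdp x R q (\<lambda>l. 1 / c0 * \<rho>1 ^ l * S l)"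
      "x \<in> U \<Longrightarrow> mi_abs \<alpha> \<le> m \<Longrightarrow> bdp x R (\<lambda>y. a \<alpha> y * q y) (\<lambda>l. 2 * Ca / c0 * (2 * \<rho>1) ^ l * S l)" for x \<alpha> R
      using parametrix_bounds[OF q_def \<rho>1_def \<theta>(1) c0(1)] c0\<theta> by blast+
    have s\<phi>: "smooth_on U (\<phi> r)" by (rule smooth_on_subset[OF \<phi>]) simp
    have e: "e = ee (- (t *\<^sub>R \<theta>))" by (simp add: e_def \<theta>(2))
    have ex: "smooth_on U (v k)" "x \<notin> K \<Longrightarrow> v k x = 0"
      "u (\<lambda>x. \<phi> r x * e x) = u (\<lambda>x. e x * v \<nu> x) + (\<Sum>k<\<nu>. of_real (\<mu> ^ m) * fs \<nu> (\<lambda>x. e x * (q x * v k x)))" for k x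
      using parametrix_expansion[OF u KV qf(1) \<mu>(3) _ s\<phi> _ v_def e, of "fs \<nu>"] fsu phi_outside by blast+
    define Av where "Av = E * E ^ r * C"
    have Av: "Av \<ge> 0" unfolding Av_def using E C by simp
    have inv: "principal_symbol a m y \<theta> * q y = 1" if "y \<in> U" for y
    proof -
      have "principal_symbol a m y \<theta> \<noteq> 0" using c0\<theta>[OF that] c0(1) by auto
      then show ?thesis by (simp add: q_def)
    qed
    have ba: "bdp x R (\<lambda>y. a \<alpha> y * q y) (\<lambda>l. 2 * Ca / c0 * (\<rho> / 2) ^ l * S l)" if "x \<in> U" "mi_abs \<alpha> \<le> m" for \<alpha> R x
      using qf(3)[OF that]
    proof (rule bdp_mono[OF _ order_refl])
      fix l show "2 * Ca / c0 * (2 * \<rho>1) ^ l * S l \<le> 2 * Ca / c0 * (\<rho> / 2) ^ l * S l"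
        using \<rho> \<rho>1 Ca c0(1) S_nonneg by (intro mult_right_mono mult_left_mono power_mono) auto
    qed
    have bq: "bdp x R q (\<lambda>l. 1 / c0 * (\<rho> / 2) ^ l * S l)" if "x \<in> U" for R x
      using qf(2)[OF that]
    proof (rule bdp_mono[OF _ order_refl])
      fix l show "1 / c0 * \<rho>1 ^ l * S l \<le> 1 / c0 * (\<rho> / 2) ^ l * S l"
        using \<rho> \<rho>1 c0(1) S_nonneg by (intro mult_right_mono mult_left_mono power_mono) auto
    qed
    have bv: "bdp x (\<nu> + sd) (v k) (\<lambda>l. (1 + cR) ^ \<nu> * Av * Wsum S \<rho> \<mu> k (m * k) l)" if x: "x \<in> U" and k: "k \<le> \<nu>" for x k
    proof -
      have mk: "m * k \<le> m * \<nu>" using k by simp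
      have "bdp x (\<nu> + sd + m * k) (\<phi> r) (\<lambda>l. Av * Wsum S \<rho> \<mu> 0 0 l)"
        unfolding Av_def
        by (rule bdp_mono[OF bdp_phi[OF \<rho>(3)] _ order_refl]) (use mk in \<open>simp add: r_def\<close>)
      then have "bdp x (\<nu> + sd) (v k) (\<lambda>l. cR ^ k * Av * Wsum S \<rho> \<mu> k (m * k) l)"
        using bdp_Rop_iterate[OF S \<rho>(1) \<mu>(1,2) U(1) x \<theta>(1) sU qf(1) s\<phi> inv _ Av ba[OF x], of "\<nu> + sd" k] Ca c0(1)
        unfolding v_def cR_def by auto
      then show ?thesis
      proof (rule bdp_mono[OF _ order_refl])
        fix l
        \<comment> \<open>\<open>cR\<close> may be smaller than 1; the base 1 + cR makes the bound
          increase with k.\<close>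
        have "cR ^ k \<le> (1 + cR) ^ k" using c1 by (intro power_mono) auto
        also have "\<dots> \<le> (1 + cR) ^ \<nu>" using c1 k by (intro power_increasing) auto
        finally show "cR ^ k * Av * Wsum S \<rho> \<mu> k (m * k) l \<le> (1 + cR) ^ \<nu> * Av * Wsum S \<rho> \<mu> k (m * k) l"
          using Av by (intro mult_right_mono Wsum_nonneg[OF S \<rho>(1) \<mu>(1,2)]) auto
      qed
    qed
    define X where "X = 2 / c0 * Z \<nu>"
    have X: "X \<ge> 0" unfolding X_def using Z c0(1) by simp
    have each: "t ^ \<nu> * norm (fs \<nu> (\<lambda>x. e x * (q x * v k x))) \<le> C2 * \<kappa>2 ^ \<nu> * (X * (N ?n + 1) * (N (\<nu> + s2) + A))"
      if k: "k < \<nu>" for k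
      unfolding t_def e_def
    proof (rule pairing_estimate[OF pb _ _ _ X \<xi> A h])
      show "smooth_on U (\<lambda>x. q x * v k x)" by (intro smooth_on_mult U qf(1) ex(1))
      show "q x * v k x = 0" if "x \<notin> K" for x using ex(2)[OF that] by simp
      fix x assume x: "x \<in> U"
      have "bdp x (\<nu> + sd) (\<lambda>x. q x * v k x) (\<lambda>l. 2 * (1 / c0) * ((1 + cR) ^ \<nu> * Av) * Wsum S \<rho> \<mu> k (m * k) l)"
        using c0(1) c1 Av bv[OF x less_imp_le[OF k]] bq[OF x]
        by (intro bdp_mult_Wsum[OF S \<rho>(1) \<mu>(1,2) U(1) x \<theta>(1) qf(1) ex(1)]) auto
      then show "bdp x (\<nu> + (s2 + ?n + k0)) (\<lambda>x. q x * v k x) (\<lambda>l. X * N l)"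
      proof (rule bdp_mono)
        fix l assume l: "l \<le> \<nu> + (s2 + ?n + k0)"
        have mk: "m * k \<le> m * \<nu>" using k by simp
        have "Wsum S \<rho> \<mu> k (m * k) l \<le> D * \<kappa>0 ^ \<nu> * N l"
          unfolding D_def \<kappa>0_def \<mu>_def
        proof (rule Wsum_le_threshold[OF S N_pos C \<rho>(1) t])
          show "S (l + j) \<le> C ^ (l + j + 1) * N l * t ^ j" if "k \<le> j" "j \<le> m * k" for j
            by (rule w2[OF t tht order_trans[OF that(2) mk]])
          show "m * k \<le> m * \<nu>" by fact
        qed (use l in \<open>simp add: sd_def\<close>)
        then have "2 * (1 / c0) * ((1 + cR) ^ \<nu> * Av) * Wsum S \<rho> \<mu> k (m * k) l \<le>
            2 * (1 / c0) * ((1 + cR) ^ \<nu> * Av) * (D * \<kappa>0 ^ \<nu> * N l)"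
          using c0(1) c1 Av by (intro mult_left_mono) auto
        then show "2 * (1 / c0) * ((1 + cR) ^ \<nu> * Av) * Wsum S \<rho> \<mu> k (m * k) l \<le> X * N l"
          by (simp add: X_def Z_def Av_def r_def mult_ac)
      qed (simp add: sd_def)
    qed
    have rest: "t ^ \<nu> * norm (u (\<lambda>x. e x * v \<nu> x)) \<le> Cu * 2 ^ k0 * t ^ k0 * (Z \<nu> * N k0 * N \<nu>)"
    proof -
      \<comment> \<open>Bound for the last iterate. Its factor (1/t)^\<nu> will cancel t^\<nu> and
        leave N_\<nu>, which is the whole gain of the expansion.\<close>
      define Y where "Y = (1 + cR) ^ \<nu> * Av * (D * \<kappa>0 ^ \<nu> * (N k0 * N \<nu> * (1 / t) ^ \<nu>))"
      have Y: "Y \<ge> 0" unfolding Y_def using c1 Av \<kappa>0 N_pos t by simp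
      have vb: "bdp x k0 (v \<nu>) (\<lambda>_. Y)" if x: "x \<in> U" for x
        using bv[OF x order_refl]
      proof (rule bdp_mono)
        show "k0 \<le> \<nu> + sd" by (simp add: sd_def)
        fix l assume l: "l \<le> k0"
        have "Wsum S \<rho> \<mu> \<nu> (m * \<nu>) l \<le> D * \<kappa>0 ^ \<nu> * (N l * N \<nu> * (1 / t) ^ \<nu>)"
          unfolding D_def \<kappa>0_def \<mu>_def
        proof (rule Wsum_le_threshold[OF S _ C \<rho>(1) t])
          show "0 \<le> N l * N \<nu> * (1 / t) ^ \<nu>" using N_pos t by simp
          show "S (l + j) \<le> C ^ (l + j + 1) * (N l * N \<nu> * (1 / t) ^ \<nu>) * t ^ j" if j: "\<nu> \<le> j" "j \<le> m * \<nu>" for j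
          proof -
            \<comment> \<open>This puts \<open>w3\<close> into the form in which N_\<nu> t^(-\<nu>)
              belongs to the free factor of \<open>Wsum_le_threshold\<close>.\<close>
            have "t ^ (j - \<nu>) = (1 / t) ^ \<nu> * t ^ j" using t j(1) by (simp add: power_diff power_divide)
            with w3[OF t tht j, of l] show ?thesis by (simp add: mult.assoc)
          qed
        qed (use l in \<open>simp_all add: sd_def\<close>)
        also have "\<dots> \<le> D * \<kappa>0 ^ \<nu> * (N k0 * N \<nu> * (1 / t) ^ \<nu>)"
          using c1 \<kappa>0 N_pos t by (intro mult_left_mono mult_right_mono weight_seq_mono[OF wN l]) auto
        finally show "(1 + cR) ^ \<nu> * Av * Wsum S \<rho> \<mu> \<nu> (m * \<nu>) l \<le> Y"
          unfolding Y_def using c1 Av by (intro mult_left_mono) auto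
      qed
      have sev: "smooth_on U (\<lambda>x. e x * v \<nu> x)" unfolding e_def by (intro smooth_on_mult smooth_on_ee U ex(1))
      have evK: "e x * v \<nu> x = 0" if "x \<notin> K" for x using ex(2)[OF that] by simp
      have "norm (u (\<lambda>x. e x * v \<nu> x)) \<le> Cu * (2 ^ k0 * t ^ k0 * Y)"
      proof (rule du[OF smooth_on_subset[OF extend(1)[OF sev evK] subset_UNIV] evK])
        fix "is" :: "'n list" and x assume l: "length is \<le> k0" and "x \<in> K"
        then have x: "x \<in> U" using K(3) by blast
        have "bdp x k0 e (\<lambda>l. t ^ l)" using bdp_ee[of x k0 "- \<xi>"] by (simp add: e_def t_def)
        from bdpD[OF bdp_mult[OF U(1) _ ex(1) x this vb[OF x]] l]
        have "norm (pdiff_list is (\<lambda>x. e x * v \<nu> x) x) \<le> conv (\<lambda>l. t ^ l) (\<lambda>_. Y) (length is)"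
          unfolding e_def by (simp add: smooth_on_ee U)
        also have "\<dots> \<le> 2 ^ k0 * t ^ k0 * Y" by (rule conv_power_le[OF t l Y])
        finally show "norm (pdiff_list is (\<lambda>x. e x * v \<nu> x) x) \<le> 2 ^ k0 * t ^ k0 * Y" .
      qed
      then have "t ^ \<nu> * norm (u (\<lambda>x. e x * v \<nu> x)) \<le> t ^ \<nu> * (Cu * (2 ^ k0 * t ^ k0 * Y))"
        using t by (intro mult_left_mono) auto
      also have "\<dots> = Cu * 2 ^ k0 * t ^ k0 * (Z \<nu> * N k0 * N \<nu>) * (t ^ \<nu> * (1 / t) ^ \<nu>)"
        unfolding Y_def Z_def Av_def r_def by (simp only: mult_ac)
      also have "t ^ \<nu> * (1 / t) ^ \<nu> = 1" using t by (simp add: power_divide)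
      finally show ?thesis by simp
    qed
    define T where "T = C2 * \<kappa>2 ^ \<nu> * (X * (N ?n + 1) * (N (\<nu> + s2) + A))"
    have T: "T \<ge> 0" unfolding T_def using C2 X N_pos A by simp
    have NA: "N \<nu> \<le> N (\<nu> + s2) + A" using weight_seq_mono[OF wN, of \<nu> "\<nu> + s2"] A by simp
    have "norm (u (\<lambda>x. \<phi> r x * e x)) \<le> norm (u (\<lambda>x. e x * v \<nu> x)) + norm (\<Sum>k<\<nu>. of_real (\<mu> ^ m) * fs \<nu> (\<lambda>x. e x * (q x * v k x)))"
      unfolding ex(3) by (rule norm_triangle_ineq)
    also have "\<dots> \<le> norm (u (\<lambda>x. e x * v \<nu> x)) + (\<Sum>k<\<nu>. norm (fs \<nu> (\<lambda>x. e x * (q x * v k x))))"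
    proof (rule add_left_mono, rule sum_norm_le)
      fix k
      have "\<mu> ^ m \<le> 1" using \<mu> by (intro power_le_one) auto
      then show "norm (of_real (\<mu> ^ m) * fs \<nu> (\<lambda>x. e x * (q x * v k x))) \<le> norm (fs \<nu> (\<lambda>x. e x * (q x * v k x)))"
        using \<mu>(1) by (simp add: norm_mult norm_power mult_left_le_one_le)
    qed
    finally have "t ^ \<nu> * norm (u (\<lambda>x. \<phi> r x * e x)) \<le>
        t ^ \<nu> * (norm (u (\<lambda>x. e x * v \<nu> x)) + (\<Sum>k<\<nu>. norm (fs \<nu> (\<lambda>x. e x * (q x * v k x)))))"
      using t by (intro mult_left_mono) auto
    also have "\<dots> = t ^ \<nu> * norm (u (\<lambda>x. e x * v \<nu> x)) + (\<Sum>k<\<nu>. t ^ \<nu> * norm (fs \<nu> (\<lambda>x. e x * (q x * v k x))))"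
      by (simp only: distrib_left sum_distrib_left)
    also have "\<dots> \<le> Cu * 2 ^ k0 * t ^ k0 * (Z \<nu> * N k0 * N \<nu>) + (\<Sum>k<\<nu>. T)"
      unfolding T_def by (intro add_mono rest sum_mono each) simp
    also have "\<dots> \<le> (2 * \<kappa>2) ^ \<nu> * (Cu * 2 ^ k0 * t ^ k0 * (Z \<nu> * N k0 * (N (\<nu> + s2) + A))) + 2 ^ \<nu> * (t ^ k0 * T)"
    proof (rule add_mono)
      have "Cu * 2 ^ k0 * t ^ k0 * (Z \<nu> * N k0 * N \<nu>) \<le> Cu * 2 ^ k0 * t ^ k0 * (Z \<nu> * N k0 * (N (\<nu> + s2) + A))"
        using Cu t Z N_pos by (intro mult_left_mono NA) auto
      also have "\<dots> \<le> (2 * \<kappa>2) ^ \<nu> * \<dots>"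
      proof -
        have "1 \<le> (2 * \<kappa>2) ^ \<nu>" using C2(2) by (intro one_le_power) simp
        moreover have "0 \<le> Cu * 2 ^ k0 * t ^ k0 * (Z \<nu> * N k0 * (N (\<nu> + s2) + A))"
          using Cu t Z N_pos A by (intro mult_nonneg_nonneg add_nonneg_nonneg) auto
        ultimately show ?thesis using mult_right_mono[of 1 "(2 * \<kappa>2) ^ \<nu>"] by simp
      qed
      finally show "Cu * 2 ^ k0 * t ^ k0 * (Z \<nu> * N k0 * N \<nu>) \<le>
        (2 * \<kappa>2) ^ \<nu> * (Cu * 2 ^ k0 * t ^ k0 * (Z \<nu> * N k0 * (N (\<nu> + s2) + A)))" .
      \<comment> \<open>The number of terms in the expansion is absorbed into a geometric
        factor.\<close>
      have "real \<nu> \<le> 2 ^ \<nu>" using of_nat_less_two_power[of \<nu>, where 'a = real] by simp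
      moreover have "T \<le> t ^ k0 * T" using mult_right_mono[OF one_le_power[OF t, of k0] T] by simp
      ultimately have "real \<nu> * T \<le> 2 ^ \<nu> * (t ^ k0 * T)" using T by (intro mult_mono) auto
      then show "(\<Sum>k<\<nu>. T) \<le> 2 ^ \<nu> * (t ^ k0 * T)" by simp
    qed
    also have "\<dots> = (2 * \<kappa>2) ^ \<nu> * Z \<nu> * C4 * t ^ k0 * (N (\<nu> + s2) + A)"
      unfolding T_def X_def C4_def by (simp add: algebra_simps power_mult_distrib)
    also have "\<dots> = C3 * \<kappa>3 ^ \<nu> * t ^ k0 * (N (\<nu> + s2) + A)"
      unfolding C3_def \<kappa>3_def Z_def power_mult_distrib power_add power_mult[symmetric] mult.commute[of \<nu> m]
      by (simp only: mult_ac)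
    finally show ?thesis unfolding t_def r_def e_def .
  qed
  then show ?thesis using C3 \<kappa>3 unfolding sd_def by blast
qed

text \<open>The localising sequence multiplies w by cutoffs whose order \<open>r \<nu>\<close> is
  adapted to \<nu>. All of them are 1 near \<open>x0\<close>, so each member agrees with w there;
  the sequence delivered is the one shifted by s.\<close>

lemma micro_conclusion:
  assumes wm: "weight_matrix MM" and Rsr: "R_semiregular MM" and NM: "N \<in> MM" and w: "distribution \<Omega> w"
    and \<Gamma>': "open_cone \<Gamma>'" "\<xi>0 \<in> \<Gamma>'" and C3: "C3 \<ge> 0" and \<kappa>3: "\<kappa>3 \<ge> 1"
    and shrink: "\<forall>\<xi>\<in>\<Gamma>'. \<forall>\<eta>. norm (\<eta> - \<xi>) \<le> c * norm \<xi> \<longrightarrow> \<eta> \<in> \<Gamma>"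
    and main: "\<And>\<nu> \<xi> A. \<nu> \<ge> 1 \<Longrightarrow> \<xi> \<in> \<Gamma>' \<Longrightarrow> norm \<xi> \<ge> 1 \<Longrightarrow> N \<nu> \<le> norm \<xi> ^ \<nu> \<Longrightarrow> A \<ge> 0 \<Longrightarrow>
      (\<forall>\<eta>. norm (\<eta> - \<xi>) \<le> c * norm \<xi> \<longrightarrow> norm \<eta> ^ \<nu> * norm (fourier (fs \<nu>) \<eta>) \<le> A) \<Longrightarrow>
      norm \<xi> ^ \<nu> * norm (w (\<lambda>x. \<phi> (r \<nu>) x * ee (- \<xi>) x)) \<le> C3 * \<kappa>3 ^ \<nu> * norm \<xi> ^ k0 * (N (\<nu> + s2) + A)"
  shows "\<exists>V' \<Gamma>' us M C \<kappa> s. open V' \<and> x0 \<in> V' \<and> V' \<subseteq> \<Omega> \<and> open_cone \<Gamma>' \<and> \<xi>0 \<in> \<Gamma>' \<and>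
       bounded_E_prime_seq \<Omega> us \<and> (\<forall>N \<phi>. test_fun V' \<phi> \<longrightarrow> us N \<phi> = w \<phi>) \<and>
       M \<in> MM \<and> C \<ge> 0 \<and> \<kappa> \<ge> 1 \<and> (\<forall>n \<xi> A. \<xi> \<in> \<Gamma>' \<longrightarrow> A \<ge> 0 \<longrightarrow>
         (\<forall>\<eta>\<in>\<Gamma>. norm \<eta> ^ (n + s) * norm (fourier (fs (n + s)) \<eta>) \<le> A) \<longrightarrow>
         norm \<xi> ^ n * norm (fourier (us n) \<xi>) \<le> C * \<kappa> ^ n * (M n + A))"
proof -
  define ws where "ws = (\<lambda>\<nu> \<psi>. w (\<lambda>x. \<phi> (r \<nu>) x * \<psi> x))"
  have ws: "bounded_E_prime_seq \<Omega> ws"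
    unfolding ws_def by (rule cutoff_sequence[OF \<Omega> w K(1,4,5) \<phi> phi_outside C\<phi>])
  have "\<exists>M C \<kappa> s. M \<in> MM \<and> C \<ge> 0 \<and> \<kappa> \<ge> 1 \<and> (\<forall>n \<xi> A. \<xi> \<in> \<Gamma>' \<longrightarrow> A \<ge> 0 \<longrightarrow>
    (\<forall>\<eta>\<in>\<Gamma>. norm \<eta> ^ (n + s) * norm (fourier (fs (n + s)) \<eta>) \<le> A) \<longrightarrow>
    norm \<xi> ^ n * norm (fourier (ws (n + s)) \<xi>) \<le> C * \<kappa> ^ n * (M n + A))"
  proof (rule transfer_conclusion[OF wm Rsr \<Omega> ws NM C3 \<kappa>3])
    fix \<nu> \<xi> A
    assume h: "\<nu> \<ge> 1" "\<xi> \<in> \<Gamma>'" "A \<ge> (0::real)" "norm \<xi> \<ge> 1" "N \<nu> \<le> norm \<xi> ^ \<nu>"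
      and F: "\<And>\<eta>. \<eta> \<in> \<Gamma> \<Longrightarrow> norm \<eta> ^ \<nu> * norm (fourier (fs \<nu>) \<eta>) \<le> A"
    have "\<forall>\<eta>. norm (\<eta> - \<xi>) \<le> c * norm \<xi> \<longrightarrow> norm \<eta> ^ \<nu> * norm (fourier (fs \<nu>) \<eta>) \<le> A"
      using shrink h(2) F by blast
    from main[OF h(1,2,4,5,3) this]
    show "norm \<xi> ^ \<nu> * norm (fourier (ws \<nu>) \<xi>) \<le> C3 * \<kappa>3 ^ \<nu> * norm \<xi> ^ k0 * (N (\<nu> + s2) + A)"
      by (simp add: fourier_ee ws_def)
  qed
  then obtain M C' \<kappa> s where M: "M \<in> MM" "C' \<ge> 0" "\<kappa> \<ge> 1" and est: "\<forall>n \<xi> A. \<xi> \<in> \<Gamma>' \<longrightarrow> A \<ge> 0 \<longrightarrow>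
    (\<forall>\<eta>\<in>\<Gamma>. norm \<eta> ^ (n + s) * norm (fourier (fs (n + s)) \<eta>) \<le> A) \<longrightarrow>
    norm \<xi> ^ n * norm (fourier (ws (n + s)) \<xi>) \<le> C' * \<kappa> ^ n * (M n + A)"
    by (elim exE conjE) (rule that)
  define V' where "V' = {x. \<forall>i. \<bar>x $ i - x0 $ i\<bar> < \<delta>}"
  have V': "open V'" "x0 \<in> V'" "V' \<subseteq> \<Omega>"
  proof -
    show "open V'" unfolding V'_def by (rule open_sbox)
    show "x0 \<in> V'" using \<delta> by (simp add: V'_def)
    show "V' \<subseteq> \<Omega>"
    proof
      fix x assume "x \<in> V'"
      have "\<bar>x $ i - x0 $ i\<bar> \<le> 9 * \<delta>" for i
      proof -
        have "\<bar>x $ i - x0 $ i\<bar> < \<delta>" using \<open>x \<in> V'\<close> unfolding V'_def by blast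
        then show ?thesis using \<delta> by linarith
      qed
      then show "x \<in> \<Omega>" using box by blast
    qed
  qed
  have eq: "ws n \<psi> = w \<psi>" if "test_fun V' \<psi>" for n \<psi>
  proof -
    have "\<phi> (r n) x * \<psi> x = \<psi> x" for x
    proof (cases "x \<in> V'")
      case True
      have "\<phi> (r n) x = 1"
      proof (rule \<phi>1)
        fix i show "\<bar>x $ i - x0 $ i\<bar> \<le> \<delta>" using True unfolding V'_def by (simp add: less_imp_le)
      qed
      then show ?thesis by simp
    next
      case False
      then have "x \<notin> tsupport \<psi>" using that by (auto simp: test_fun_def)
      then show ?thesis by (simp add: tsupport_outside)
    qed
    then have "(\<lambda>x. \<phi> (r n) x * \<psi> x) = \<psi>" by (rule ext)
    then show ?thesis by (simp only: ws_def)
  qed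
  have "bounded_E_prime_seq \<Omega> (\<lambda>n. ws (n + s))" by (rule bounded_E_prime_seq_reindex[OF ws])
  with V' \<Gamma>' M est eq show ?thesis
    by (intro exI[of _ V'] exI[of _ \<Gamma>'] exI[of _ "\<lambda>n. ws (n + s)"] exI[of _ M] exI[of _ C'] exI[of _ \<kappa>] exI[of _ s] conjI)
      simp_all
qed

end

text \<open>The data are fitted into a given ball: coefficient bounds come from a relatively compact
  cube, the sequences S and N from conditions (a) and (b) with p = m, and the cutoffs from the scale
  \<delta>.\<close>

lemma ex_cutoff_setting:
  fixes \<Omega> :: "(real^'n::finite) set" and a :: "('n \<Rightarrow> nat) \<Rightarrow> real^'n \<Rightarrow> complex"
  assumes wm: "weight_matrix MM" and Rsr: "R_semiregular MM"
    and cond_a: "\<forall>M\<in>MM. \<exists>N\<in>MM. \<exists>C>0. \<forall>j k. M (j + k) \<le> C ^ (j + k) * N j * N k"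
    and cond_b: "\<forall>M\<in>MM. \<exists>N\<in>MM. \<exists>C>0. \<forall>k. \<forall>as :: nat list.
                   (\<forall>i\<in>set as. i > 0) \<and> sum_list as = k \<longrightarrow>
                   M (length as) / fact (length as) * (\<Prod>i\<leftarrow>as. M i / fact i)
                     \<le> C ^ (k + 1) * (N k / fact k)"
    and \<Omega>: "open \<Omega>" and coeff: "\<forall>\<alpha>. mi_abs \<alpha> \<le> m \<longrightarrow> E_roumieu MM \<Omega> (a \<alpha>)"
    and d: "d > 0" "ball x0 d \<subseteq> \<Omega>"
  shows "\<exists>\<delta> S N C Ca \<rho>a \<phi> C\<phi> E \<rho>\<phi>. cutoff_setting \<Omega> a m x0 \<delta> S N C Ca \<rho>a \<phi> C\<phi> E \<rho>\<phi> \<and>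
    N \<in> MM \<and> 9 * \<delta> * real CARD('n) < d"
proof -
  \<comment> \<open>The cube of half-side 9 \<delta> then has l1-radius 9 d / 10 < d.\<close>
  define \<delta> where "\<delta> = d / (10 * real CARD('n))"
  have n: "real CARD('n) > 0" by simp
  have \<delta>: "\<delta> > 0" using d n by (simp add: \<delta>_def)
  have \<delta>d: "9 * \<delta> * real CARD('n) < d" using d n by (simp add: \<delta>_def field_simps)
  define U where "U = {x. \<forall>i. \<bar>x $ i - x0 $ i\<bar> < 9 * \<delta>}"
  define B where "B = {x. \<forall>i. \<bar>x $ i - x0 $ i\<bar> \<le> 9 * \<delta>}"
  have B: "compact B" unfolding B_def by (rule compact_sbox)
  have B\<Omega>: "B \<subseteq> \<Omega>"
  proof
    fix x assume "x \<in> B"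
    then have "norm (x - x0) < d" unfolding B_def by (intro sbox_subset_ball[OF \<delta>d]) blast
    then have "x \<in> ball x0 d" by (simp add: dist_norm norm_minus_commute)
    then show "x \<in> \<Omega>" using d(2) by blast
  qed
  have "U \<subseteq> B" unfolding U_def B_def by (blast intro: less_imp_le)
  then have cU: "closure U \<subseteq> B" by (rule closure_minimal[OF _ compact_imp_closed[OF B]])
  have oU: "open U" unfolding U_def by (rule open_sbox)
  have "compact (B \<inter> closure U)" by (rule compact_Int_closed[OF B closed_closure])
  then have "compact (closure U)" using cU by (simp add: Int_absorb1)
  from coeff_bounds[OF wm \<Omega> oU this subset_trans[OF cU B\<Omega>] coeff]
  obtain M Ca \<rho>a where M: "M \<in> MM" and Ca: "Ca \<ge> 0" "\<rho>a \<ge> 1" and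
    ca: "\<forall>\<alpha> x is. mi_abs \<alpha> \<le> m \<longrightarrow> x \<in> U \<longrightarrow>
      norm (pdiff_list is (a \<alpha>) x) \<le> Ca * \<rho>a ^ length is * M (length is)"
    by (elim bexE exE conjE) (rule that)
  obtain S N C where S: "supermult S" "\<forall>k. M k \<le> S k" and N: "N \<in> MM" and C: "C \<ge> 1" "\<forall>k. fact k \<le> C * S k"
    and w2: "\<forall>\<nu> l j t. t \<ge> 1 \<longrightarrow> N \<nu> \<le> t ^ \<nu> \<longrightarrow> j \<le> m * \<nu> \<longrightarrow> S (l + j) \<le> C ^ (l + j + 1) * N l * t ^ j"
    and w3: "\<forall>\<nu> l j t. t \<ge> 1 \<longrightarrow> N \<nu> \<le> t ^ \<nu> \<longrightarrow> \<nu> \<le> j \<longrightarrow> j \<le> m * \<nu> \<longrightarrow>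
       S (l + j) \<le> C ^ (l + j + 1) * N l * N \<nu> * t ^ (j - \<nu>)"
    using ex_weights[OF wm Rsr cond_a cond_b M, of m] by (elim exE conjE) (rule that)
  obtain \<phi> :: "nat \<Rightarrow> real^'n \<Rightarrow> complex" and C\<phi> E \<rho>\<phi> where \<phi>:
    "\<And>r::nat. smooth_on UNIV (\<phi> r)"
    "\<And>r x. (\<And>i. \<bar>x $ i - x0 $ i\<bar> \<le> \<delta>) \<Longrightarrow> \<phi> r x = 1"
    "\<And>r x i. \<bar>x $ i - x0 $ i\<bar> \<ge> 8 * \<delta> \<Longrightarrow> \<phi> r x = 0"
    "\<And>r is x. norm (pdiff_list is (\<phi> r) x) \<le> C\<phi> (length is)"
    "\<And>r is x. length is \<le> r \<Longrightarrow> norm (pdiff_list is (\<phi> r) x) \<le> E * E ^ r * \<rho>\<phi> ^ length is * fact (length is)"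
    "E \<ge> (1::real)" "\<rho>\<phi> \<ge> (1::real)"
  proof (rule ex_cutoffs[OF \<delta>, of x0], goal_cases)
    case (1 \<phi> C\<phi> E \<rho>\<phi>)
    show ?case by (rule that[of \<phi> C\<phi> E \<rho>\<phi>]) (fact 1)+
  qed
  have "cutoff_setting \<Omega> a m x0 \<delta> S N C Ca \<rho>a \<phi> C\<phi> E \<rho>\<phi>"
  proof (unfold_locales, goal_cases)
    case 1 show ?case by (rule \<Omega>) next
    case 2 show ?case by (rule \<delta>) next
    case 3 show ?case using B\<Omega> by (simp add: B_def) next
    case (4 \<alpha>) then show ?case using coeff by (simp add: E_roumieu_def) next
    case 5 show ?case by (rule S(1)) next
    case 6 show ?case by (rule weight_matrixD[OF wm N]) next
    case 7 show ?case by (rule C(1)) next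
    case (8 k) show ?case using C(2) by blast next
    case (9 t \<nu> j l) then show ?case using w2 by blast next
    case (10 t \<nu> j l) then show ?case using w3 by blast next
    case 11 show ?case by (rule Ca(1)) next
    case 12 show ?case by (rule Ca(2)) next
    case (13 \<alpha> x "is")
    have "norm (pdiff_list is (a \<alpha>) x) \<le> Ca * \<rho>a ^ length is * M (length is)"
      using ca 13 by (simp add: U_def)
    also have "\<dots> \<le> Ca * \<rho>a ^ length is * S (length is)"
      using Ca S(2) by (intro mult_left_mono) auto
    finally show ?case .
  next
    case (14 r) show ?case by (rule \<phi>(1)) next
    case (15 x r) then show ?case by (rule \<phi>(2)) next
    case (16 x i r) then show ?case by (rule \<phi>(3)) next
    case 17 show ?case by (rule \<phi>(4)) next
    case 18 then show ?case by (rule \<phi>(5)) next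
    case 19 show ?case by (rule \<phi>(6)) next
    case 20 show ?case by (rule \<phi>(7))
  qed
  with N \<delta>d show ?thesis by blast
qed

section \<open>Transfer of regularity between u and P u in both directions\<close>

context
  fixes MM :: "(nat \<Rightarrow> real) set" and \<Omega> :: "(real^'n::finite) set"
    and a :: "('n \<Rightarrow> nat) \<Rightarrow> real^'n \<Rightarrow> complex" and m :: nat
  assumes wm: "weight_matrix MM" and Rsr: "R_semiregular MM"
    and cond_a: "\<forall>M\<in>MM. \<exists>N\<in>MM. \<exists>C>0. \<forall>j k. M (j + k) \<le> C ^ (j + k) * N j * N k"
    and cond_b: "\<forall>M\<in>MM. \<exists>N\<in>MM. \<exists>C>0. \<forall>k. \<forall>as :: nat list.
                   (\<forall>i\<in>set as. i > 0) \<and> sum_list as = k \<longrightarrow>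
                   M (length as) / fact (length as) * (\<Prod>i\<leftarrow>as. M i / fact i)
                     \<le> C ^ (k + 1) * (N k / fact k)"
    and \<Omega>: "open \<Omega>" and coeff: "\<forall>\<alpha>. mi_abs \<alpha> \<le> m \<longrightarrow> E_roumieu MM \<Omega> (a \<alpha>)"
begin

lemma smooth_coeff: "mi_abs \<alpha> \<le> m \<Longrightarrow> smooth_on \<Omega> (a \<alpha>)"
  using coeff by (simp add: E_roumieu_def)

text \<open>The ball for the cutoffs is taken inside the set where the given sequence agrees with u,
  so that pairings with functions supported in \<open>K\<close> can be read in either.\<close>

lemma transfers_apply_op:
  assumes u: "distribution \<Omega> u"
  shows "transfers MM \<Omega> u (apply_op a m u) x0 \<xi>0"
  unfolding transfers_def
proof (intro allI impI, goal_cases)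
  case (1 V \<Gamma> fs)
  obtain d where d: "d > 0" "ball x0 d \<subseteq> V" using 1(1,2) by (meson open_contains_ball)
  obtain \<Gamma>' c where \<Gamma>': "open_cone \<Gamma>'" "\<xi>0 \<in> \<Gamma>'" and c: "0 < c" "c < 1"
    and shrink: "\<forall>\<xi>\<in>\<Gamma>'. \<forall>\<eta>. norm (\<eta> - \<xi>) \<le> c * norm \<xi> \<longrightarrow> \<eta> \<in> \<Gamma>"
    using cone_shrink[OF 1(4,5) zero_less_one] by (elim exE conjE) (rule that)
  obtain \<delta> S N C Ca \<rho>a \<phi> C\<phi> E \<rho>\<phi> where cs: "cutoff_setting \<Omega> a m x0 \<delta> S N C Ca \<rho>a \<phi> C\<phi> E \<rho>\<phi>"
    and N: "N \<in> MM" and \<delta>d: "9 * \<delta> * real CARD('n) < d"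
    using ex_cutoff_setting[OF wm Rsr cond_a cond_b \<Omega> coeff d(1) subset_trans[OF d(2) 1(3)]]
    by (elim exE conjE) (rule that)
  interpret cutoff_setting \<Omega> a m x0 \<delta> S N C Ca \<rho>a \<phi> C\<phi> E \<rho>\<phi> by (rule cs)
  have KV: "K \<subseteq> V"
  proof
    fix x assume "x \<in> K"
    then have "x \<in> U" using K(3) by blast
    then have "\<bar>x $ i - x0 $ i\<bar> \<le> 9 * \<delta>" for i unfolding U_def by (blast intro: less_imp_le)
    from sbox_subset_ball[OF \<delta>d this] have "x \<in> ball x0 d" by (simp add: dist_norm norm_minus_commute)
    then show "x \<in> V" using d(2) by blast
  qed
  have "\<exists>C \<kappa> s. pairing_bound fs K c C \<kappa> s"
    unfolding pairing_bound_def by (rule microlocal_pairing[OF \<Omega> 1(6) K(1) c])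
  then obtain C2 \<kappa>2 s2 where pb: "pairing_bound fs K c C2 \<kappa>2 s2" by blast
  from operator_estimate[OF u KV 1(7) pb]
  obtain C3 \<kappa>3 where C3: "C3 \<ge> 0" "\<kappa>3 \<ge> 1" and est: "\<forall>\<nu> \<xi> A. \<nu> \<ge> 1 \<longrightarrow> norm \<xi> \<ge> 1 \<longrightarrow> N \<nu> \<le> norm \<xi> ^ \<nu> \<longrightarrow> A \<ge> 0 \<longrightarrow>
    (\<forall>\<eta>. norm (\<eta> - \<xi>) \<le> c * norm \<xi> \<longrightarrow> norm \<eta> ^ \<nu> * norm (fourier (fs \<nu>) \<eta>) \<le> A) \<longrightarrow>
    norm \<xi> ^ \<nu> * norm (apply_op a m u (\<lambda>x. \<phi> (\<nu> + (s2 + 2 * CARD('n)) + m) x * ee (- \<xi>) x)) \<le>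
      C3 * \<kappa>3 ^ \<nu> * norm \<xi> ^ m * (N (\<nu> + s2) + A)"
    by (elim exE conjE) (rule that)
  have "distribution \<Omega> (apply_op a m u)" by (rule distribution_apply_op[OF \<Omega> u smooth_coeff])
  from micro_conclusion[OF wm Rsr N this \<Gamma>' C3 shrink, of fs "\<lambda>\<nu>. \<nu> + (s2 + 2 * CARD('n)) + m" m s2] est
  show ?case by blast
qed

text \<open>The symbol is nonzero at one covector; homogeneity moves this to the unit direction and
  continuity spreads it over a neighbourhood times a cone. Both are shrunk to this range before the
  cutoffs are chosen.\<close>

lemma transfers_apply_op_elliptic:
  assumes u: "distribution \<Omega> u" and nz: "principal_symbol a m x0 \<xi>0 \<noteq> 0"
  shows "transfers MM \<Omega> (apply_op a m u) u x0 \<xi>0"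
  unfolding transfers_def
proof (intro allI impI, goal_cases)
  case (1 V \<Gamma> fs)
  have "principal_symbol a m x0 (norm \<xi>0 *\<^sub>R sgn \<xi>0) \<noteq> 0" unfolding norm_scaleR_sgn by (rule nz)
  then have nz': "principal_symbol a m x0 (sgn \<xi>0) \<noteq> 0" unfolding principal_symbol_scale by simp
  have x0: "x0 \<in> \<Omega>" using 1(2,3) by blast
  have ca: "continuous_on \<Omega> (a \<alpha>)" if "mi_abs \<alpha> \<le> m" for \<alpha>
    using smooth_coeff[OF that, unfolded smooth_on_def, THEN spec, of "[]"] by simp
  obtain d1 c0 where d1: "d1 > 0" and c0: "c0 > 0"
    and lb: "\<forall>x \<theta>. norm (x - x0) < d1 \<longrightarrow> norm (\<theta> - sgn \<xi>0) < d1 \<longrightarrow> norm (principal_symbol a m x \<theta>) \<ge> c0"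
  proof -
    have "\<exists>d>0. \<exists>c>0. \<forall>x \<theta>. norm (x - x0) < d \<longrightarrow> norm (\<theta> - sgn \<xi>0) < d \<longrightarrow> norm (principal_symbol a m x \<theta>) \<ge> c"
      by (rule symbol_lower_bound[OF \<Omega> ca x0 nz'])
    then show thesis by (elim exE conjE) (rule that)
  qed
  obtain d2 where d2: "d2 > 0" "ball x0 d2 \<subseteq> V" using 1(1,2) by (meson open_contains_ball)
  define d where "d = min d1 d2"
  have d: "d > 0" "ball x0 d \<subseteq> V" "d \<le> d1" using d1 d2 by (auto simp: d_def)
  obtain \<Gamma>' c where \<Gamma>': "open_cone \<Gamma>'" "\<xi>0 \<in> \<Gamma>'" and c: "0 < c" "c < 1"
    and shrink: "\<forall>\<xi>\<in>\<Gamma>'. \<forall>\<eta>. norm (\<eta> - \<xi>) \<le> c * norm \<xi> \<longrightarrow> \<eta> \<in> \<Gamma>"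
    and near: "\<forall>\<xi>\<in>\<Gamma>'. norm (sgn \<xi> - sgn \<xi>0) < d1"
    using cone_shrink[OF 1(4,5) d1] by (elim exE conjE) (rule that)
  obtain \<delta> S N C Ca \<rho>a \<phi> C\<phi> E \<rho>\<phi> where cs: "cutoff_setting \<Omega> a m x0 \<delta> S N C Ca \<rho>a \<phi> C\<phi> E \<rho>\<phi>"
    and N: "N \<in> MM" and \<delta>d: "9 * \<delta> * real CARD('n) < d"
    using ex_cutoff_setting[OF wm Rsr cond_a cond_b \<Omega> coeff d(1) subset_trans[OF d(2) 1(3)]]
    by (elim exE conjE) (rule that)
  interpret cutoff_setting \<Omega> a m x0 \<delta> S N C Ca \<rho>a \<phi> C\<phi> E \<rho>\<phi> by (rule cs)
  have Ud: "norm (x - x0) < d" if "x \<in> U" for x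
  proof -
    have "\<bar>x $ i - x0 $ i\<bar> \<le> 9 * \<delta>" for i using that unfolding U_def by (blast intro: less_imp_le)
    then show ?thesis by (rule sbox_subset_ball[OF \<delta>d])
  qed
  have KV: "K \<subseteq> V"
  proof
    fix x assume "x \<in> K"
    then have "norm (x - x0) < d" using K(3) Ud by blast
    then have "x \<in> ball x0 d" by (simp add: dist_norm norm_minus_commute)
    then show "x \<in> V" using d(2) by blast
  qed
  have "\<exists>C \<kappa> s. pairing_bound fs K c C \<kappa> s"
    unfolding pairing_bound_def by (rule microlocal_pairing[OF \<Omega> 1(6) K(1) c])
  then obtain C2 \<kappa>2 s2 where pb: "pairing_bound fs K c C2 \<kappa>2 s2" by blast
  have sym: "\<forall>x\<in>U. \<forall>\<xi>\<in>\<Gamma>'. norm (principal_symbol a m x (sgn \<xi>)) \<ge> c0"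
  proof (intro ballI)
    fix x \<xi> assume "x \<in> U" "\<xi> \<in> \<Gamma>'"
    with lb[THEN spec, THEN spec, of x "sgn \<xi>"] less_le_trans[OF Ud[of x] d(3)] near
    show "norm (principal_symbol a m x (sgn \<xi>)) \<ge> c0" by blast
  qed
  from elliptic_estimate[OF u KV 1(7) pb c0 sym]
  obtain C3 \<kappa>3 k0 where C3: "C3 \<ge> 0" "\<kappa>3 \<ge> 1" and est: "\<forall>\<nu> \<xi> A. \<xi> \<in> \<Gamma>' \<longrightarrow> norm \<xi> \<ge> 1 \<longrightarrow> N \<nu> \<le> norm \<xi> ^ \<nu> \<longrightarrow> A \<ge> 0 \<longrightarrow>
    (\<forall>\<eta>. norm (\<eta> - \<xi>) \<le> c * norm \<xi> \<longrightarrow> norm \<eta> ^ \<nu> * norm (fourier (fs \<nu>) \<eta>) \<le> A) \<longrightarrow>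
    norm \<xi> ^ \<nu> * norm (u (\<lambda>x. \<phi> (\<nu> + (s2 + 2 * CARD('n) + k0) + m * \<nu>) x * ee (- \<xi>) x)) \<le>
      C3 * \<kappa>3 ^ \<nu> * norm \<xi> ^ k0 * (N (\<nu> + s2) + A)"
    by (elim exE conjE) (rule that, assumption+)
  from micro_conclusion[OF wm Rsr N u \<Gamma>' C3 shrink, of fs "\<lambda>\<nu>. \<nu> + (s2 + 2 * CARD('n) + k0) + m * \<nu>" k0 s2] est
  show ?case by blast
qed

end

theorem theorem7p1:
  fixes MM :: "(nat \<Rightarrow> real) set"
    and \<Omega> :: "(real^'n::finite) set"
    and a :: "('n \<Rightarrow> nat) \<Rightarrow> real^'n \<Rightarrow> complex"
    and m :: nat
  assumes wm: "weight_matrix MM" and Rsr: "R_semiregular MM"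
    and cond_a: "\<forall>M\<in>MM. \<exists>N\<in>MM. \<exists>C>0. \<forall>j k. M (j + k) \<le> C ^ (j + k) * N j * N k"
    and cond_b: "\<forall>M\<in>MM. \<exists>N\<in>MM. \<exists>C>0. \<forall>k. \<forall>as :: nat list.
                   (\<forall>i\<in>set as. i > 0) \<and> sum_list as = k \<longrightarrow>
                   M (length as) / fact (length as) * (\<Prod>i\<leftarrow>as. M i / fact i)
                     \<le> C ^ (k + 1) * (N k / fact k)"
    and \<Omega>: "open \<Omega>"
    and coeff: "\<forall>\<alpha>. mi_abs \<alpha> \<le> m \<longrightarrow> E_roumieu MM \<Omega> (a \<alpha>)"
  shows
    "(\<forall>LL. weight_matrix LL \<and> R_semiregular LL \<and> R_preceq MM LL \<longrightarrow>
        (\<forall>u. distribution \<Omega> u \<longrightarrow>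
           WF_roumieu LL \<Omega> u \<subseteq> WF_roumieu LL \<Omega> (apply_op a m u) \<union> Char \<Omega> a m \<and>
           (elliptic \<Omega> a m \<longrightarrow> WF_roumieu LL \<Omega> u = WF_roumieu LL \<Omega> (apply_op a m u))))
     \<and>
     (\<forall>LL. weight_matrix LL \<and> B_semiregular LL \<and> B_lhd MM LL \<longrightarrow>
        (\<forall>u. distribution \<Omega> u \<longrightarrow>
           WF_beurling LL \<Omega> u \<subseteq> WF_beurling LL \<Omega> (apply_op a m u) \<union> Char \<Omega> a m \<and>
           (elliptic \<Omega> a m \<longrightarrow> WF_beurling LL \<Omega> u = WF_beurling LL \<Omega> (apply_op a m u))))"
proof (intro conjI allI impI; elim conjE)
  fix LL u
  assume LL: "weight_matrix LL" "R_semiregular LL" "R_preceq MM LL" and u: "distribution \<Omega> u"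
  have 1: "micro_roumieu LL \<Omega> u x0 \<xi>0"
    if "principal_symbol a m x0 \<xi>0 \<noteq> 0" "micro_roumieu LL \<Omega> (apply_op a m u) x0 \<xi>0" for x0 \<xi>0
    by (rule transfers_micro_roumieu[OF transfers_apply_op_elliptic[OF wm Rsr cond_a cond_b \<Omega> coeff u that(1)] wm LL that(2)])
  \<comment> \<open>Applying P does not enlarge the wave front set; under ellipticity this combines
    with the first implication to equality.\<close>
  have 2: "micro_roumieu LL \<Omega> (apply_op a m u) x0 \<xi>0" if "micro_roumieu LL \<Omega> u x0 \<xi>0" for x0 \<xi>0
    by (rule transfers_micro_roumieu[OF transfers_apply_op[OF wm Rsr cond_a cond_b \<Omega> coeff u] wm LL that])
  show *: "WF_roumieu LL \<Omega> u \<subseteq> WF_roumieu LL \<Omega> (apply_op a m u) \<union> Char \<Omega> a m"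
    using 1 by (auto simp: WF_roumieu_def Char_def)
  show "WF_roumieu LL \<Omega> u = WF_roumieu LL \<Omega> (apply_op a m u)" if "elliptic \<Omega> a m"
  proof
    show "WF_roumieu LL \<Omega> u \<subseteq> WF_roumieu LL \<Omega> (apply_op a m u)" using * that by (simp add: elliptic_def)
    show "WF_roumieu LL \<Omega> (apply_op a m u) \<subseteq> WF_roumieu LL \<Omega> u" using 2 by (auto simp: WF_roumieu_def)
  qed
next
  fix LL u
  assume LL: "weight_matrix LL" "B_semiregular LL" "B_lhd MM LL" and u: "distribution \<Omega> u"
  have 1: "micro_beurling LL \<Omega> u x0 \<xi>0"
    if "principal_symbol a m x0 \<xi>0 \<noteq> 0" "micro_beurling LL \<Omega> (apply_op a m u) x0 \<xi>0" for x0 \<xi>0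
    by (rule transfers_micro_beurling[OF transfers_apply_op_elliptic[OF wm Rsr cond_a cond_b \<Omega> coeff u that(1)] wm LL that(2)])
  have 2: "micro_beurling LL \<Omega> (apply_op a m u) x0 \<xi>0" if "micro_beurling LL \<Omega> u x0 \<xi>0" for x0 \<xi>0
    by (rule transfers_micro_beurling[OF transfers_apply_op[OF wm Rsr cond_a cond_b \<Omega> coeff u] wm LL that])
  show *: "WF_beurling LL \<Omega> u \<subseteq> WF_beurling LL \<Omega> (apply_op a m u) \<union> Char \<Omega> a m"
    using 1 by (auto simp: WF_beurling_def Char_def)
  show "WF_beurling LL \<Omega> u = WF_beurling LL \<Omega> (apply_op a m u)" if "elliptic \<Omega> a m"
  proof
    show "WF_beurling LL \<Omega> u \<subseteq> WF_beurling LL \<Omega> (apply_op a m u)" using * that by (simp add: elliptic_def)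
    show "WF_beurling LL \<Omega> (apply_op a m u) \<subseteq> WF_beurling LL \<Omega> u" using 2 by (auto simp: WF_beurling_def)
  qed
qed

end
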